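(* Let $G$ be a real Lie group. For $X$ a $G$-manifold, the functor $\mathrm U:\mathrm{Vect}_{TG}^{\mathrm{aff}}(X)\to\mathrm{Vect}_G(X)$ induces a group isomorphism $$K(\mathrm U):K_{TG}^{\mathrm{aff}}(X)\to KO_G(X).$$ Its inverse is $$K(\sigma):KO_G(X)\to K_{TG}^{\mathrm{aff}}(X).$$ These isomorphisms are natural in $X$, and thus define an isomorphism of (contravariant) functors $K_{TG}^{\mathrm{aff}}(-)\xrightarrow{\cong}KO_G(-)$ from the category $G\text{-Man}$ of $G$-manifolds and $G$-equivariant smooth maps to the category $\mathrm{Ab}$ of abelian groups.
   Context: All manifolds are smooth, finite-dimensional and real, and vector bundles are real of finite rank. A $G$-manifold is a manifold $X$ with a smooth left action $t:G\times X\to X$. $\mathrm{Vect}_G(X)$ is the category of $G$-equivariant vector bundles over $X$ (fibrewise linear left $G$-action on $E$ covering $t$) and $G$-equivariant vector bundle morphisms over $X$. $TG$ is a Lie group with multiplication $v_g\bullet w_h=(L_g)_*w_h+(R_h)_*v_g$. An affine action of $TG$ on a vector bundle $E\to X$ is a left action $\mu:TG\times E\to E$ of the Lie group $TG$ that is a vector bundle morphism covering $t$ (with $TG\times E$ a vector bundle over $G\times X$). Morphisms are $TG$-equivariant morphisms of vector bundles over $X$; the category is $\mathrm{Vect}_{TG}^{\mathrm{aff}}(X)$. It has finite products: the product of $E$ and $E'$ is $E\oplus E'$ with $v_g\cdot(e,e')=(v_g\cdot e,v_g\cdot e')$. $\mathrm U:\mathrm{Vect}_{TG}^{\mathrm{aff}}(X)\to\mathrm{Vect}_G(X)$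 sends an affine action on $E$ to $E$ with $G$-action $g\cdot e=0_g\cdot e$ (restriction along the zero section $G\to TG$), and is the identity on underlying bundle maps. $\sigma:\mathrm{Vect}_G(X)\to\mathrm{Vect}_{TG}^{\mathrm{aff}}(X)$ sends $E$ to $E$ with $v_g\cdot e=g\cdot e$, and is the identity on underlying bundle maps. Both preserve finite products. For an essentially small category $\mathscr C$ with finite products, $K(\mathscr C)$ is the Grothendieck group (group completion) of the commutative monoid of isomorphism classes of objects with $[E]+[E']=[E\times E']$; a product-preserving functor $\mathcal F$ induces $K(\mathcal F):[E]-[E']\mapsto[\mathcal F(E)]-[\mathcal F(E')]$. Set $K_{TG}^{\mathrm{aff}}(X)=K(\mathrm{Vect}_{TG}^{\mathrm{aff}}(X))$ and $KO_G(X)=K(\mathrm{Vect}_G(X))$. A $G$-map $f:X\to Y$ acts on $KO_G$ via pullback $f^*$ of $G$-vector bundles and on $K_{TG}^{\mathrm{aff}}$ via pullback of affine actions: $f^*E$ with $v_g\cdot(x,e)=(g\cdot x,v_g\cdot e)$. *)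

theory Defs
  imports "HOL-Analysis.Analysis" "HOL-Algebra.Group"
begin

section \<open>Smooth manifolds\<close>

text \<open>
  Ranks of vector bundles vary inside one category, so \<open>\<real>\<^sup>n\<close> has to be available for \<open>n\<close> a term:
  it is \<^term>\<open>Euclidean_space n\<close>, the space of sequences vanishing from index \<open>n\<close> on.
  \<open>Ck_on k n W f\<close> says that \<open>f\<close> is of class \<open>C\<^sup>k\<close> on the open subset \<open>W\<close> of \<open>\<real>\<^sup>n\<close>: it is continuous and,
  for \<open>k > 0\<close>, is partially differentiable on \<open>W\<close> with partial derivatives of one class less.
\<close>

primrec Ck_on :: "nat \<Rightarrow> nat \<Rightarrow> (nat \<Rightarrow> real) set \<Rightarrow> ((nat \<Rightarrow> real) \<Rightarrow> real) \<Rightarrow> bool" where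
  "Ck_on 0 n W f \<longleftrightarrow> continuous_map (subtopology (Euclidean_space n) W) euclideanreal f"
| "Ck_on (Suc k) n W f \<longleftrightarrow>
     continuous_map (subtopology (Euclidean_space n) W) euclideanreal f \<and>
     (\<forall>i<n. \<exists>f'. (\<forall>x\<in>W. ((\<lambda>s. f (x(i := s))) has_real_derivative f' x) (at (x i))) \<and> Ck_on k n W f')"

definition smooth_on :: "nat \<Rightarrow> nat \<Rightarrow> (nat \<Rightarrow> real) set \<Rightarrow> ((nat \<Rightarrow> real) \<Rightarrow> (nat \<Rightarrow> real)) \<Rightarrow> bool" where
  "smooth_on n m W f \<longleftrightarrow>
     f ` W \<subseteq> topspace (Euclidean_space m) \<and> (\<forall>j<m. \<forall>k. Ck_on k n W (\<lambda>x. f x j))"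

text \<open>
  A chart \<open>(U, n, \<phi>)\<close> has domain \<open>U\<close> and coordinate map \<open>\<phi> : U \<rightarrow> \<real>\<^sup>n\<close>.  A manifold is given by an atlas
  (not necessarily maximal) on the union of the chart domains; its topology is the one induced by the atlas,
  i.e. the one for which the charts are homeomorphisms onto open subsets of Euclidean spaces.
  The dimension of a manifold is only required to be locally constant.
\<close>

type_synonym 'a chart = "'a set \<times> nat \<times> ('a \<Rightarrow> nat \<Rightarrow> real)"
type_synonym 'a atlas = "'a chart set"

definition mcarrier :: "'a atlas \<Rightarrow> 'a set" where
  "mcarrier M = (\<Union>(U, n, \<phi>)\<in>M. U)"

definition smooth_atlas :: "'a atlas \<Rightarrow> bool" where
  "smooth_atlas M \<longleftrightarrow>
     (\<forall>(U, n, \<phi>)\<in>M. inj_on \<phi> U \<and> \<phi> ` U \<subseteq> topspace (Euclidean_space n)) \<and>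
     (\<forall>(U, n, \<phi>)\<in>M. \<forall>(V, m, \<psi>)\<in>M.
        openin (Euclidean_space n) (\<phi> ` (U \<inter> V)) \<and>
        smooth_on n m (\<phi> ` (U \<inter> V)) (\<psi> \<circ> inv_into U \<phi>))"

definition atlas_topology :: "'a atlas \<Rightarrow> 'a topology" where
  "atlas_topology M = topology (\<lambda>W. W \<subseteq> mcarrier M \<and>
     (\<forall>(U, n, \<phi>)\<in>M. openin (Euclidean_space n) (\<phi> ` (U \<inter> W))))"

definition manifold :: "'a atlas \<Rightarrow> bool" where
  "manifold M \<longleftrightarrow> smooth_atlas M \<and>
     Hausdorff_space (atlas_topology M) \<and> second_countable (atlas_topology M)"

definition smooth_map :: "'a atlas \<Rightarrow> 'b atlas \<Rightarrow> ('a \<Rightarrow> 'b) \<Rightarrow> bool" where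
  "smooth_map M N f \<longleftrightarrow>
     continuous_map (atlas_topology M) (atlas_topology N) f \<and>
     (\<forall>(U, n, \<phi>)\<in>M. \<forall>(V, m, \<psi>)\<in>N.
        smooth_on n m (\<phi> ` (U \<inter> f -` V)) (\<psi> \<circ> f \<circ> inv_into U \<phi>))"

text \<open>The identification of \<open>\<real>\<^sup>n \<times> \<real>\<^sup>m\<close> with \<open>Euclidean_space (n + m)\<close>.\<close>

definition join :: "nat \<Rightarrow> (nat \<Rightarrow> real) \<Rightarrow> (nat \<Rightarrow> real) \<Rightarrow> (nat \<Rightarrow> real)" where
  "join n x y = (\<lambda>i. if i < n then x i else y (i - n))"

definition prod_atlas :: "'a atlas \<Rightarrow> 'b atlas \<Rightarrow> ('a \<times> 'b) atlas" where
  "prod_atlas M N =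
     {(U \<times> V, n + m, \<lambda>(a, b). join n (\<phi> a) (\<psi> b)) | U n \<phi> V m \<psi>. (U, n, \<phi>) \<in> M \<and> (V, m, \<psi>) \<in> N}"


section \<open>Vector bundles\<close>

text \<open>
  A local trivialization \<open>(U, n, \<phi>)\<close> is given by an open set \<open>U\<close> of the base and the fibre component \<open>\<phi>\<close> of the
  trivialization, restricting to a linear isomorphism from each fibre over \<open>U\<close> to \<open>\<real>\<^sup>n\<close>.
\<close>

record ('e, 'x) vbundle =
  vcarrier :: "'e set"
  vproj :: "'e \<Rightarrow> 'x"
  vadd :: "'e \<Rightarrow> 'e \<Rightarrow> 'e"
  vscale :: "real \<Rightarrow> 'e \<Rightarrow> 'e"
  vtriv :: "('x set \<times> nat \<times> ('e \<Rightarrow> nat \<Rightarrow> real)) set"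

definition fibre :: "('e, 'x) vbundle \<Rightarrow> 'x \<Rightarrow> 'e set" where
  "fibre E x = {e \<in> vcarrier E. vproj E e = x}"

definition total_space :: "'x atlas \<Rightarrow> ('e, 'x) vbundle \<Rightarrow> 'e atlas" where
  "total_space X E =
     {({e \<in> vcarrier E. vproj E e \<in> W \<inter> U}, k + n, \<lambda>e. join k (\<xi> (vproj E e)) (\<phi> e)) | W k \<xi> U n \<phi>.
        (W, k, \<xi>) \<in> X \<and> (U, n, \<phi>) \<in> vtriv E}"

text \<open>
  The vector space axioms for the fibres are not listed: they are inherited from \<open>\<real>\<^sup>n\<close> through the bijections
  compatible with addition and scaling.  Smoothness of the transition functions is the smooth compatibility of
  the induced charts of the total space.  The total space over a manifold is then automatically Hausdorff and second
  countable, and the trivializations are diffeomorphisms by construction.  The rank is locally constant.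
\<close>

definition vector_bundle :: "'x atlas \<Rightarrow> ('e, 'x) vbundle \<Rightarrow> bool" where
  "vector_bundle X E \<longleftrightarrow>
     vproj E ` vcarrier E \<subseteq> mcarrier X \<and>
     (\<Union>(U, n, \<phi>)\<in>vtriv E. U) = mcarrier X \<and>
     (\<forall>(U, n, \<phi>)\<in>vtriv E. openin (atlas_topology X) U \<and>
        (\<forall>x\<in>U. bij_betw \<phi> (fibre E x) (topspace (Euclidean_space n)) \<and>
          (\<forall>e\<in>fibre E x. \<forall>e'\<in>fibre E x.
             vadd E e e' \<in> fibre E x \<and> \<phi> (vadd E e e') = (\<lambda>i. \<phi> e i + \<phi> e' i)) \<and>
          (\<forall>c. \<forall>e\<in>fibre E x.
             vscale E c e \<in> fibre E x \<and> \<phi> (vscale E c e) = (\<lambda>i. c * \<phi> e i)))) \<and>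
     smooth_atlas (total_space X E)"

definition fibrewise_linear :: "('e, 'x) vbundle \<Rightarrow> ('f, 'y) vbundle \<Rightarrow> ('x \<Rightarrow> 'y) \<Rightarrow> ('e \<Rightarrow> 'f) \<Rightarrow> bool" where
  "fibrewise_linear E F f h \<longleftrightarrow>
     (\<forall>e\<in>vcarrier E. h e \<in> fibre F (f (vproj E e))) \<and>
     (\<forall>e\<in>vcarrier E. \<forall>e'\<in>vcarrier E. vproj E e = vproj E e' \<longrightarrow> h (vadd E e e') = vadd F (h e) (h e')) \<and>
     (\<forall>c. \<forall>e\<in>vcarrier E. h (vscale E c e) = vscale F c (h e))"

definition vb_morphism ::
    "'x atlas \<Rightarrow> ('e, 'x) vbundle \<Rightarrow> 'y atlas \<Rightarrow> ('f, 'y) vbundle \<Rightarrow> ('x \<Rightarrow> 'y) \<Rightarrow> ('e \<Rightarrow> 'f) \<Rightarrow> bool" where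
  "vb_morphism X E Y F f h \<longleftrightarrow>
     smooth_map (total_space X E) (total_space Y F) h \<and> fibrewise_linear E F f h"

definition zero_bundle :: "'x atlas \<Rightarrow> ('x \<times> (nat \<Rightarrow> real), 'x) vbundle" where
  "zero_bundle X = \<lparr>
     vcarrier = mcarrier X \<times> {\<lambda>_. 0},
     vproj = fst,
     vadd = (\<lambda>e e'. e),
     vscale = (\<lambda>c e. e),
     vtriv = {(mcarrier X, 0, \<lambda>_ _. 0)}\<rparr>"

definition whitney_sum :: "('e, 'x) vbundle \<Rightarrow> ('f, 'x) vbundle \<Rightarrow> ('e \<times> 'f, 'x) vbundle" where
  "whitney_sum E F = \<lparr>
     vcarrier = {(e, e'). e \<in> vcarrier E \<and> e' \<in> vcarrier F \<and> vproj E e = vproj F e'},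
     vproj = (\<lambda>(e, e'). vproj E e),
     vadd = (\<lambda>(e, e') (d, d'). (vadd E e d, vadd F e' d')),
     vscale = (\<lambda>c (e, e'). (vscale E c e, vscale F c e')),
     vtriv = {(U \<inter> V, n + m, \<lambda>(e, e'). join n (\<phi> e) (\<psi> e')) | U n \<phi> V m \<psi>.
                (U, n, \<phi>) \<in> vtriv E \<and> (V, m, \<psi>) \<in> vtriv F}\<rparr>"

definition external_product :: "('e, 'x) vbundle \<Rightarrow> ('f, 'y) vbundle \<Rightarrow> ('e \<times> 'f, 'x \<times> 'y) vbundle" where
  "external_product E F = \<lparr>
     vcarrier = vcarrier E \<times> vcarrier F,
     vproj = (\<lambda>(e, e'). (vproj E e, vproj F e')),
     vadd = (\<lambda>(e, e') (d, d'). (vadd E e d, vadd F e' d')),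
     vscale = (\<lambda>c (e, e'). (vscale E c e, vscale F c e')),
     vtriv = {(U \<times> V, n + m, \<lambda>(e, e'). join n (\<phi> e) (\<psi> e')) | U n \<phi> V m \<psi>.
                (U, n, \<phi>) \<in> vtriv E \<and> (V, m, \<psi>) \<in> vtriv F}\<rparr>"

definition pullback_bundle :: "'x atlas \<Rightarrow> ('x \<Rightarrow> 'y) \<Rightarrow> ('e, 'y) vbundle \<Rightarrow> ('x \<times> 'e, 'x) vbundle" where
  "pullback_bundle X f E = \<lparr>
     vcarrier = {(x, e). x \<in> mcarrier X \<and> e \<in> vcarrier E \<and> f x = vproj E e},
     vproj = fst,
     vadd = (\<lambda>(x, e) (x', e'). (x, vadd E e e')),
     vscale = (\<lambda>c (x, e). (x, vscale E c e)),
     vtriv = {(mcarrier X \<inter> f -` U, n, \<phi> \<circ> snd) | U n \<phi>. (U, n, \<phi>) \<in> vtriv E}\<rparr>"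


section \<open>Tangent bundles\<close>

text \<open>
  A tangent vector at \<open>p\<close> is a family of coordinate vectors, one for each chart around \<open>p\<close>, that transforms by the
  derivatives of the coordinate changes; the family is set to \<open>0\<close> on all other charts.
\<close>

type_synonym 'a tvec = "'a \<times> ('a chart \<Rightarrow> nat \<Rightarrow> real)"

definition directional_deriv ::
    "((nat \<Rightarrow> real) \<Rightarrow> (nat \<Rightarrow> real)) \<Rightarrow> (nat \<Rightarrow> real) \<Rightarrow> (nat \<Rightarrow> real) \<Rightarrow> (nat \<Rightarrow> real)" where
  "directional_deriv f x v = (\<lambda>j. deriv (\<lambda>s. f (\<lambda>i. x i + s * v i) j) 0)"

definition charts_at :: "'a atlas \<Rightarrow> 'a \<Rightarrow> 'a chart set" where
  "charts_at M p = {(U, n, \<phi>) \<in> M. p \<in> U}"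

definition tangent_space :: "'a atlas \<Rightarrow> 'a \<Rightarrow> 'a tvec set" where
  "tangent_space M p = {(p, v) | v.
     (\<forall>c. c \<notin> charts_at M p \<longrightarrow> v c = (\<lambda>_. 0)) \<and>
     (\<forall>(U, n, \<phi>)\<in>charts_at M p. v (U, n, \<phi>) \<in> topspace (Euclidean_space n) \<and>
        (\<forall>(V, m, \<psi>)\<in>charts_at M p.
           v (V, m, \<psi>) = directional_deriv (\<psi> \<circ> inv_into U \<phi>) (\<phi> p) (v (U, n, \<phi>))))}"

definition tangent_add :: "'a tvec \<Rightarrow> 'a tvec \<Rightarrow> 'a tvec" where
  "tangent_add v w = (fst v, \<lambda>c i. snd v c i + snd w c i)"

definition tangent_zero :: "'a \<Rightarrow> 'a tvec" where
  "tangent_zero p = (p, \<lambda>_ _. 0)"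

definition tangent_bundle :: "'a atlas \<Rightarrow> ('a tvec, 'a) vbundle" where
  "tangent_bundle M = \<lparr>
     vcarrier = (\<Union>p\<in>mcarrier M. tangent_space M p),
     vproj = fst,
     vadd = tangent_add,
     vscale = (\<lambda>a v. (fst v, \<lambda>c i. a * snd v c i)),
     vtriv = {(U, n, \<lambda>v. snd v (U, n, \<phi>)) | U n \<phi>. (U, n, \<phi>) \<in> M}\<rparr>"

text \<open>The pushforward, computed in an arbitrarily chosen chart around the base point.\<close>

definition pushforward :: "'a atlas \<Rightarrow> 'b atlas \<Rightarrow> ('a \<Rightarrow> 'b) \<Rightarrow> 'a tvec \<Rightarrow> 'b tvec" where
  "pushforward M N f = (\<lambda>(p, v). (f p, \<lambda>(V, m, \<psi>).
     if (V, m, \<psi>) \<in> charts_at N (f p)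
     then (let (U, n, \<phi>) = (SOME c. c \<in> charts_at M p)
           in directional_deriv (\<psi> \<circ> f \<circ> inv_into U \<phi>) (\<phi> p) (v (U, n, \<phi>)))
     else (\<lambda>_. 0)))"


section \<open>Lie groups and equivariant bundles\<close>

record 'g lie_grp = "'g monoid" +
  atlas :: "'g atlas"

definition lie_group :: "'g lie_grp \<Rightarrow> bool" where
  "lie_group G \<longleftrightarrow> group G \<and> manifold (atlas G) \<and> carrier G = mcarrier (atlas G) \<and>
     smooth_map (prod_atlas (atlas G) (atlas G)) (atlas G) (\<lambda>(g, h). g \<otimes>\<^bsub>G\<^esub> h) \<and>
     smooth_map (atlas G) (atlas G) (\<lambda>g. inv\<^bsub>G\<^esub> g)"

text \<open>The group \<open>TG\<close>, with \<open>v\<^sub>g \<bullet> w\<^sub>h = (L\<^sub>g)\<^sub>* w\<^sub>h + (R\<^sub>h)\<^sub>* v\<^sub>g\<close>.\<close>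

definition tangent_group :: "'g lie_grp \<Rightarrow> 'g tvec monoid" where
  "tangent_group G = \<lparr>
     carrier = vcarrier (tangent_bundle (atlas G)),
     mult = (\<lambda>v w. tangent_add
        (pushforward (atlas G) (atlas G) (\<lambda>h. fst v \<otimes>\<^bsub>G\<^esub> h) w)
        (pushforward (atlas G) (atlas G) (\<lambda>g. g \<otimes>\<^bsub>G\<^esub> fst w) v)),
     one = tangent_zero \<one>\<^bsub>G\<^esub>\<rparr>"

definition left_action :: "('k, 'm) monoid_scheme \<Rightarrow> 'x set \<Rightarrow> ('k \<Rightarrow> 'x \<Rightarrow> 'x) \<Rightarrow> bool" where
  "left_action K S a \<longleftrightarrow>
     (\<forall>k\<in>carrier K. \<forall>x\<in>S. a k x \<in> S) \<and>
     (\<forall>x\<in>S. a \<one>\<^bsub>K\<^esub> x = x) \<and>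
     (\<forall>k\<in>carrier K. \<forall>l\<in>carrier K. \<forall>x\<in>S. a (k \<otimes>\<^bsub>K\<^esub> l) x = a k (a l x))"

type_synonym ('g, 'x) gspace = "'x atlas \<times> ('g \<Rightarrow> 'x \<Rightarrow> 'x)"

definition G_manifold :: "'g lie_grp \<Rightarrow> ('g, 'x) gspace \<Rightarrow> bool" where
  "G_manifold G = (\<lambda>(X, t). manifold X \<and> left_action G (mcarrier X) t \<and>
     smooth_map (prod_atlas (atlas G) X) X (\<lambda>(g, x). t g x))"

definition G_map :: "'g lie_grp \<Rightarrow> ('g, 'x) gspace \<Rightarrow> ('g, 'y) gspace \<Rightarrow> ('x \<Rightarrow> 'y) \<Rightarrow> bool" where
  "G_map G = (\<lambda>(X, t) (Y, s) f. smooth_map X Y f \<and>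
     (\<forall>g\<in>carrier G. \<forall>x\<in>mcarrier X. f (t g x) = s g (f x)))"

text \<open>
  Objects of both categories are pairs of a vector bundle and a map giving the action, where the acting type \<open>'k\<close> is
  \<open>'g\<close> or \<open>'g tvec\<close>.
\<close>

type_synonym ('k, 'e, 'x) abundle = "('e, 'x) vbundle \<times> ('k \<Rightarrow> 'e \<Rightarrow> 'e)"

definition Vect_G :: "'g lie_grp \<Rightarrow> ('g, 'x) gspace \<Rightarrow> ('g, 'e, 'x) abundle set" where
  "Vect_G G = (\<lambda>(X, t). {(E, \<rho>).
     vector_bundle X E \<and> left_action G (vcarrier E) \<rho> \<and>
     smooth_map (prod_atlas (atlas G) (total_space X E)) (total_space X E) (\<lambda>(g, e). \<rho> g e) \<and>
     (\<forall>g\<in>carrier G. fibrewise_linear E E (t g) (\<rho> g))})"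

definition Vect_aff :: "'g lie_grp \<Rightarrow> ('g, 'x) gspace \<Rightarrow> ('g tvec, 'e, 'x) abundle set" where
  "Vect_aff G = (\<lambda>(X, t). {(E, \<mu>).
     vector_bundle X E \<and> left_action (tangent_group G) (vcarrier E) \<mu> \<and>
     vb_morphism (prod_atlas (atlas G) X) (external_product (tangent_bundle (atlas G)) E) X E
       (\<lambda>(g, x). t g x) (\<lambda>(v, e). \<mu> v e)})"

text \<open>Equivariant morphisms over the identity of \<open>X\<close>; \<open>K\<close> is \<open>G\<close> or \<open>TG\<close>.\<close>

definition equivariant_morphism ::
    "('k, 'm) monoid_scheme \<Rightarrow> 'x atlas \<Rightarrow> ('k, 'e, 'x) abundle \<Rightarrow> ('k, 'f, 'x) abundle \<Rightarrow> ('e \<Rightarrow> 'f) \<Rightarrow> bool" where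
  "equivariant_morphism K X = (\<lambda>(E, a) (F, b) h. vb_morphism X E X F (\<lambda>x. x) h \<and>
     (\<forall>k\<in>carrier K. \<forall>e\<in>vcarrier E. h (a k e) = b k (h e)))"

definition isomorphic ::
    "('k, 'm) monoid_scheme \<Rightarrow> 'x atlas \<Rightarrow> ('k, 'e, 'x) abundle \<Rightarrow> ('k, 'f, 'x) abundle \<Rightarrow> bool" where
  "isomorphic K X E F \<longleftrightarrow> (\<exists>h h'. equivariant_morphism K X E F h \<and> equivariant_morphism K X F E h' \<and>
     (\<forall>e\<in>vcarrier (fst E). h' (h e) = e) \<and> (\<forall>e\<in>vcarrier (fst F). h (h' e) = e))"

text \<open>\<open>k \<cdot> (e, e') = (k \<cdot> e, k \<cdot> e')\<close>\<close>

definition abundle_sum :: "('k, 'e, 'x) abundle \<Rightarrow> ('k, 'f, 'x) abundle \<Rightarrow> ('k, 'e \<times> 'f, 'x) abundle" where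
  "abundle_sum = (\<lambda>(E, a) (F, b). (whitney_sum E F, \<lambda>k (e, e'). (a k e, b k e')))"

text \<open>In the next two definitions \<open>s\<close> is the action on the base: \<open>t\<close> for \<open>G\<close>, and \<open>t\<close> after the projection for \<open>TG\<close>.\<close>

definition abundle_zero :: "'x atlas \<Rightarrow> ('k \<Rightarrow> 'x \<Rightarrow> 'x) \<Rightarrow> ('k, 'x \<times> (nat \<Rightarrow> real), 'x) abundle" where
  "abundle_zero X s = (zero_bundle X, \<lambda>k (x, z). (s k x, z))"

definition abundle_pullback ::
    "'x atlas \<Rightarrow> ('k \<Rightarrow> 'x \<Rightarrow> 'x) \<Rightarrow> ('x \<Rightarrow> 'y) \<Rightarrow> ('k, 'e, 'y) abundle \<Rightarrow> ('k, 'x \<times> 'e, 'x) abundle" where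
  "abundle_pullback X s f = (\<lambda>(E, a). (pullback_bundle X f E, \<lambda>k (x, e). (s k x, a k e)))"

definition U_fun :: "('g tvec, 'e, 'x) abundle \<Rightarrow> ('g, 'e, 'x) abundle" where
  "U_fun = (\<lambda>(E, \<mu>). (E, \<lambda>g. \<mu> (tangent_zero g)))"

definition sigma_fun :: "('g, 'e, 'x) abundle \<Rightarrow> ('g tvec, 'e, 'x) abundle" where
  "sigma_fun = (\<lambda>(E, \<rho>). (E, \<lambda>v. \<rho> (fst v)))"


section \<open>Grothendieck groups\<close>

definition gc_rel :: "('a, 'm) monoid_scheme \<Rightarrow> (('a \<times> 'a) \<times> ('a \<times> 'a)) set" where
  "gc_rel A = {((a, b), (a', b')) | a b a' b'.
     a \<in> carrier A \<and> b \<in> carrier A \<and> a' \<in> carrier A \<and> b' \<in> carrier A \<and>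
     (\<exists>c\<in>carrier A. a \<otimes>\<^bsub>A\<^esub> b' \<otimes>\<^bsub>A\<^esub> c = a' \<otimes>\<^bsub>A\<^esub> b \<otimes>\<^bsub>A\<^esub> c)}"

text \<open>The formal difference \<open>a - b\<close>\<close>

definition gc_diff :: "('a, 'm) monoid_scheme \<Rightarrow> 'a \<Rightarrow> 'a \<Rightarrow> ('a \<times> 'a) set" where
  "gc_diff A a b = gc_rel A `` {(a, b)}"

text \<open>In the following definitions by unions over representatives, all sets in the union coincide.\<close>

definition group_completion :: "('a, 'm) monoid_scheme \<Rightarrow> ('a \<times> 'a) set monoid" where
  "group_completion A = \<lparr>
     carrier = (carrier A \<times> carrier A) // gc_rel A,
     mult = (\<lambda>z w. \<Union>(a, b)\<in>z. \<Union>(a', b')\<in>w. gc_diff A (a \<otimes>\<^bsub>A\<^esub> a') (b \<otimes>\<^bsub>A\<^esub> b')),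
     one = gc_diff A \<one>\<^bsub>A\<^esub> \<one>\<^bsub>A\<^esub>\<rparr>"

text \<open>
  Isomorphism classes are formed in a small category equivalent to the category of all bundles: total spaces are subsets
  of the type \<open>'x \<times> (nat \<Rightarrow> real)\<close>, to which the total space of every vector bundle over a subset of \<open>'x\<close> can be
  transported.  As \<open>isomorphic\<close> compares bundles on different types, \<open>iso_class\<close> also gives the class of a bundle
  with total space of any other type, such as a sum or a pullback.
\<close>

type_synonym ('k, 'x) ubundle = "('k, 'x \<times> (nat \<Rightarrow> real), 'x) abundle"

definition iso_class ::
    "('k, 'm) monoid_scheme \<Rightarrow> 'x atlas \<Rightarrow> ('k, 'x) ubundle set \<Rightarrow> ('k, 'e, 'x) abundle \<Rightarrow> ('k, 'x) ubundle set" where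
  "iso_class K X C E = {F \<in> C. isomorphic K X E F}"

definition iso_monoid ::
    "('k, 'm) monoid_scheme \<Rightarrow> 'x atlas \<Rightarrow> ('k \<Rightarrow> 'x \<Rightarrow> 'x) \<Rightarrow> ('k, 'x) ubundle set \<Rightarrow> ('k, 'x) ubundle set monoid" where
  "iso_monoid K X s C = \<lparr>
     carrier = iso_class K X C ` C,
     mult = (\<lambda>a b. \<Union>E\<in>a. \<Union>F\<in>b. iso_class K X C (abundle_sum E F)),
     one = iso_class K X C (abundle_zero X s)\<rparr>"

abbreviation class_G ::
    "'g lie_grp \<Rightarrow> ('g, 'x) gspace \<Rightarrow> ('g, 'e, 'x) abundle \<Rightarrow> ('g, 'x) ubundle set" where
  "class_G G X \<equiv> iso_class G (fst X) (Vect_G G X)"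

abbreviation class_aff ::
    "'g lie_grp \<Rightarrow> ('g, 'x) gspace \<Rightarrow> ('g tvec, 'e, 'x) abundle \<Rightarrow> ('g tvec, 'x) ubundle set" where
  "class_aff G X \<equiv> iso_class (tangent_group G) (fst X) (Vect_aff G X)"

definition monoid_G :: "'g lie_grp \<Rightarrow> ('g, 'x) gspace \<Rightarrow> ('g, 'x) ubundle set monoid" where
  "monoid_G G X = iso_monoid G (fst X) (snd X) (Vect_G G X)"

definition monoid_aff :: "'g lie_grp \<Rightarrow> ('g, 'x) gspace \<Rightarrow> ('g tvec, 'x) ubundle set monoid" where
  "monoid_aff G X = iso_monoid (tangent_group G) (fst X) (\<lambda>v. snd X (fst v)) (Vect_aff G X)"

definition KO :: "'g lie_grp \<Rightarrow> ('g, 'x) gspace \<Rightarrow> (('g, 'x) ubundle set \<times> ('g, 'x) ubundle set) set monoid" where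
  "KO G X = group_completion (monoid_G G X)"

definition K_aff ::
    "'g lie_grp \<Rightarrow> ('g, 'x) gspace \<Rightarrow> (('g tvec, 'x) ubundle set \<times> ('g tvec, 'x) ubundle set) set monoid" where
  "K_aff G X = group_completion (monoid_aff G X)"

text \<open>
  The map \<open>[E] - [E'] \<mapsto> [F E] - [F E']\<close> induced by a functor \<open>F\<close>, where \<open>cl\<close> and \<open>B\<close> are the class map and
  the monoid of isomorphism classes of the target category.
\<close>

definition K_map ::
    "('b set, 'm) monoid_scheme \<Rightarrow> ('f \<Rightarrow> 'b set) \<Rightarrow> ('a \<Rightarrow> 'f) \<Rightarrow> ('a set \<times> 'a set) set \<Rightarrow> ('b set \<times> 'b set) set" where
  "K_map B cl F z = (\<Union>(a, a')\<in>z. gc_diff B (\<Union>E\<in>a. cl (F E)) (\<Union>E\<in>a'. cl (F E)))"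

definition K_U where
  "K_U G X = K_map (monoid_G G X) (class_G G X) U_fun"

definition K_sigma where
  "K_sigma G X = K_map (monoid_aff G X) (class_aff G X) sigma_fun"

definition KO_pullback where
  "KO_pullback G X f = K_map (monoid_G G X) (class_G G X) (abundle_pullback (fst X) (snd X) f)"

definition K_aff_pullback where
  "K_aff_pullback G X f =
     K_map (monoid_aff G X) (class_aff G X) (abundle_pullback (fst X) (\<lambda>v. snd X (fst v)) f)"

end

(*
  Joint linearity of an affine action gives v e' = v e + 0_g (e' - e) for v in T_g G, so the shear
  (e, e') |-> (e, e' - e) is an isomorphism from the affine bundle E + E to E + sigma U E.  Hence
  [E] = [sigma U E] in K although E and sigma U E need not be isomorphic; the other composite U sigma
  is the identity.

  Vector bundles are handled through their transition matrices: a family of local trivializations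
  with smooth transition matrices is a vector bundle and conversely, so that sums, pullbacks,
  products and the tangent bundle reduce to matrix computations over the base.
*)

theory Submission
  imports Defs
begin

section \<open>Calculus in Euclidean spaces\<close>

text \<open>The pairs (v, e) and (0_g, e' - e) lie over the same point (g, x) and add up to (v, e'),
  which is where the formula for v e' comes from. The translation v 0 depends on v and the base
  point only, so it cancels in a difference of two vectors of one fibre. A single copy of E has no
  second vector to subtract, hence the extra summand, and hence a result that holds only after
  stabilization. Two obstacles shape the rest. Smoothness is given by iterated partial derivatives
  with existential witnesses and without a total derivative, so the chain rule is derived from
  continuity of the partials, and witnesses found at different places or orders have to be unified.
  Moreover sums and pullbacks have total spaces of new types while classes are formed at one fixed
  type, so each bundle is carried to this type by an injection that need not be continuous, and
  formulas for classes are then extended to bundles of arbitrary type.\<close>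

abbreviation Eu :: "nat \<Rightarrow> (nat \<Rightarrow> real) set" where
  "Eu n \<equiv> topspace (Euclidean_space n)"

text \<open>Both \<open>Euclidean_space n\<close> and the type class topology on
  \<open>nat \<Rightarrow> real\<close> come from the product topology, so \<open>open\<close>,
  \<open>continuous_on\<close> and limits become available for coordinate spaces.\<close>

lemma Euclidean_space_eq: "Euclidean_space n = top_of_set (Eu n)"
  by (simp add: Euclidean_space_def euclidean_product_topology)

lemma openin_Euclidean_space_iff:
  "openin (Euclidean_space n) W \<longleftrightarrow> (\<exists>T. open T \<and> W = Eu n \<inter> T)"
  by (subst Euclidean_space_eq) (simp add: openin_open)

lemma continuous_map_Eu_subset:
  assumes "W \<subseteq> Eu n"
  shows "continuous_map (subtopology (Euclidean_space n) W) euclideanreal f \<longleftrightarrow> continuous_on W f"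
proof -
  have "subtopology (Euclidean_space n) W = top_of_set W"
    using assms by (subst Euclidean_space_eq) (simp add: subtopology_subtopology Int_absorb1)
  then show ?thesis by simp
qed

lemma tendsto_fun_iff:
  fixes f :: "'a \<Rightarrow> 'i \<Rightarrow> real"
  shows "(f \<longlongrightarrow> l) F \<longleftrightarrow> (\<forall>i. ((\<lambda>x. f x i) \<longlongrightarrow> l i) F)"
proof -
  have "(f \<longlongrightarrow> l) F \<longleftrightarrow> limitin (product_topology (\<lambda>i. euclideanreal) UNIV) f l F"
    by (simp add: euclidean_product_topology)
  also have "\<dots> \<longleftrightarrow> (\<forall>i. ((\<lambda>x. f x i) \<longlongrightarrow> l i) F)"
    by (simp add: limitin_componentwise)
  finally show ?thesis .
qed

lemma continuous_on_fun_upd_pair: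
  "continuous_on UNIV (\<lambda>(s::real, y::nat \<Rightarrow> real). y(i := s))"
proof -
  have "continuous_on UNIV (\<lambda>p::real \<times> (nat \<Rightarrow> real). ((snd p)(i := fst p)) j)" for j
  proof (cases "j = i")
    case False
    have "continuous_on UNIV (\<lambda>p::real \<times> (nat \<Rightarrow> real). snd p j)"
      by (rule continuous_on_compose2[OF continuous_on_product_coordinates continuous_on_snd[OF continuous_on_id]]) auto
    with False show ?thesis by simp
  qed (simp add: continuous_on_fst)
  then have "continuous_on UNIV (\<lambda>p::real \<times> (nat \<Rightarrow> real). ((snd p)(i := fst p)))"
    by (rule continuous_on_coordinatewise_then_product)
  then show ?thesis by (simp add: case_prod_unfold)
qed

text \<open>Joint continuity of \<open>(s, y) \<mapsto> y(i := s)\<close> yields a radius for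
  \<open>s\<close> and a neighbourhood for \<open>y\<close> that work together. This uniformity is
  what a mean value argument with a moving base point needs.\<close>

lemma fun_upd_nbhd:
  fixes p :: "nat \<Rightarrow> real"
  assumes "open T" "p \<in> T"
  obtains \<delta> N where "\<delta> > 0" "open N" "p \<in> N" "\<And>s y. \<bar>s - p i\<bar> < \<delta> \<Longrightarrow> y \<in> N \<Longrightarrow> y(i := s) \<in> T"
proof -
  have "open ((\<lambda>(s::real, y::nat \<Rightarrow> real). y(i := s)) -` T)"
    using continuous_on_fun_upd_pair assms(1) by (metis open_vimage)
  moreover have "(p i, p) \<in> ((\<lambda>(s::real, y::nat \<Rightarrow> real). y(i := s)) -` T)" using assms by simp
  ultimately obtain A N where AN: "open A" "open N" "(p i, p) \<in> A \<times> N"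
      "A \<times> N \<subseteq> ((\<lambda>(s::real, y::nat \<Rightarrow> real). y(i := s)) -` T)"
    by (elim open_prod_elim) auto
  then have "open A" "p i \<in> A" by auto
  then obtain \<delta> where \<delta>: "\<delta> > 0" "ball (p i) \<delta> \<subseteq> A"
    unfolding open_contains_ball by blast
  show ?thesis
  proof (rule that[OF \<delta>(1) AN(2)])
    show "p \<in> N" using AN(3) by simp
    fix s y assume "\<bar>s - p i\<bar> < \<delta>" "y \<in> N"
    then have "s \<in> A" using \<delta>(2) by (auto simp: dist_real_def abs_minus_commute)
    with \<open>y \<in> N\<close> have "(s, y) \<in> A \<times> N" by simp
    with AN(4) have "(s, y) \<in> (\<lambda>(s::real, y::nat \<Rightarrow> real). y(i := s)) -` T" by (rule subsetD)
    then show "y(i := s) \<in> T" by simp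
  qed
qed

lemma fun_upd_Eu: "y \<in> Eu n \<Longrightarrow> i < n \<Longrightarrow> y(i := s) \<in> Eu n"
  by (auto simp: topspace_Euclidean_space)

lemma eventually_fun_upd:
  assumes "openin (Euclidean_space n) W" "x \<in> W" "i < n"
  shows "\<forall>\<^sub>F s in nhds (x i). x(i := s) \<in> W"
proof -
  obtain T where T: "open T" "W = Eu n \<inter> T" using assms(1) openin_Euclidean_space_iff by blast
  with assms obtain \<delta> N where \<delta>: "\<delta> > 0" "x \<in> N" "\<And>s y. \<bar>s - x i\<bar> < \<delta> \<Longrightarrow> y \<in> N \<Longrightarrow> y(i := s) \<in> T"
    by (metis IntD2 fun_upd_nbhd)
  show ?thesis
    unfolding eventually_nhds_metric
  proof (intro exI conjI allI impI)
    fix s assume "dist s (x i) < \<delta>"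
    then have "x(i := s) \<in> T" using \<delta> by (simp add: dist_real_def)
    moreover have "x(i := s) \<in> Eu n" using T assms fun_upd_Eu by blast
    ultimately show "x(i := s) \<in> W" using T by blast
  qed (use \<delta> in simp)
qed

section \<open>Partial derivatives and functions of class C^k\<close>

definition has_partial_on :: "((nat \<Rightarrow> real) \<Rightarrow> real) \<Rightarrow> nat \<Rightarrow> ((nat \<Rightarrow> real) \<Rightarrow> real) \<Rightarrow> (nat \<Rightarrow> real) set \<Rightarrow> bool" where
  "has_partial_on f i f' W \<longleftrightarrow> (\<forall>x\<in>W. ((\<lambda>s. f (x(i := s))) has_real_derivative f' x) (at (x i)))"

lemma Ck_on_Suc_iff: "Ck_on (Suc k) n W f \<longleftrightarrow> Ck_on 0 n W f \<and> (\<forall>i<n. \<exists>f'. has_partial_on f i f' W \<and> Ck_on k n W f')"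
  by (simp add: has_partial_on_def)

text \<open>Since \<open>W\<close> is open, the coordinate line through a point of \<open>W\<close>
  stays in \<open>W\<close> for small changes, so the derivative sees only values on
  \<open>W\<close>.\<close>

lemma has_partial_on_cong:
  assumes "openin (Euclidean_space n) W" "i < n" "\<And>x. x \<in> W \<Longrightarrow> f x = g x" "has_partial_on f i f' W"
  shows "has_partial_on g i f' W"
  unfolding has_partial_on_def
proof
  fix x assume x: "x \<in> W"
  have "\<forall>\<^sub>F s in nhds (x i). f (x(i := s)) = g (x(i := s))"
    using eventually_fun_upd[OF assms(1) x assms(2)] by eventually_elim (use assms(3) in auto)
  moreover have "((\<lambda>s. f (x(i := s))) has_real_derivative f' x) (at (x i))"
    using assms(4) x by (simp add: has_partial_on_def)
  ultimately show "((\<lambda>s. g (x(i := s))) has_real_derivative f' x) (at (x i))"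
    by (rule iffD1[OF DERIV_cong_ev[OF refl _ refl]])
qed

lemma Ck_on_0: "openin (Euclidean_space n) W \<Longrightarrow> Ck_on 0 n W f \<longleftrightarrow> continuous_on W f"
  by (simp add: continuous_map_Eu_subset openin_subset)

lemma Ck_on_imp_0: "Ck_on k n W f \<Longrightarrow> Ck_on 0 n W f"
  by (cases k) auto

lemma Ck_on_imp_continuous: "openin (Euclidean_space n) W \<Longrightarrow> Ck_on k n W f \<Longrightarrow> continuous_on W f"
  using Ck_on_imp_0 Ck_on_0 by blast

text \<open>One layer of the definition suffices: the partial derivatives of \<open>f\<close> serve
  unchanged as those of \<open>g\<close>, so no induction on \<open>k\<close> is made.\<close>

lemma Ck_on_cong:
  assumes W: "openin (Euclidean_space n) W" and "\<And>x. x \<in> W \<Longrightarrow> f x = g x" "Ck_on k n W f"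
  shows "Ck_on k n W g"
proof -
  have 0: "Ck_on 0 n W g"
    using assms Ck_on_imp_0 Ck_on_0 continuous_on_cong by metis
  show ?thesis
  proof (cases k)
    case (Suc l)
    then show ?thesis
      using 0 assms has_partial_on_cong[OF W] unfolding Suc Ck_on_Suc_iff by metis
  qed (use 0 in simp)
qed

lemma Ck_on_mono:
  assumes "openin (Euclidean_space n) V" "V \<subseteq> W" "openin (Euclidean_space n) W" "Ck_on k n W f"
  shows "Ck_on k n V f"
  using assms(4)
proof (induction k arbitrary: f)
  case 0
  then show ?case using assms Ck_on_0 continuous_on_subset by metis
next
  case (Suc k)
  have "Ck_on 0 n V f" using Suc.prems assms by (metis Ck_on_0 Ck_on_imp_0 continuous_on_subset)
  moreover have "has_partial_on f i f' V" if "has_partial_on f i f' W" for i f'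
    using that assms(2) by (auto simp: has_partial_on_def)
  ultimately show ?case using Suc unfolding Ck_on_Suc_iff by metis
qed

lemma Ck_on_Suc_D: "Ck_on (Suc k) n W f \<Longrightarrow> Ck_on k n W f"
proof (induction k arbitrary: f)
  case (Suc k)
  then show ?case using Ck_on_Suc_iff by metis
qed auto

lemma has_partial_on_partial:
  assumes "has_partial_on f i f' W"
  shows "x \<in> W \<Longrightarrow> deriv (\<lambda>s. f (x(i := s))) (x i) = f' x"
  using assms DERIV_imp_deriv by (auto simp: has_partial_on_def)

text \<open>Partial derivatives are existential witnesses at every level of \<open>Ck_on\<close>.
  Uniqueness of derivatives identifies any two of them on \<open>W\<close>, so regularity passes
  from one to the other.\<close>

lemma Ck_on_partial:
  assumes "openin (Euclidean_space n) W" "has_partial_on f i f' W"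
    and "has_partial_on f i f'' W" "Ck_on k n W f'"
  shows "Ck_on k n W f''"
  using Ck_on_cong[OF assms(1) _ assms(4)] has_partial_on_partial assms(2,3) by metis

lemma Ck_on_locally:
  assumes W: "openin (Euclidean_space n) W"
    and loc: "\<And>x. x \<in> W \<Longrightarrow> \<exists>V. openin (Euclidean_space n) V \<and> x \<in> V \<and> V \<subseteq> W \<and> Ck_on k n V f"
  shows "Ck_on k n W f"
  using loc
proof (induction k arbitrary: f)
  case 0
  have "(f \<longlongrightarrow> f x) (at x within W)" if x: "x \<in> W" for x
  proof -
    obtain V where V: "openin (Euclidean_space n) V" "x \<in> V" "V \<subseteq> W" "Ck_on 0 n V f"
      using 0 x by blast
    then obtain T where T: "open T" "V = Eu n \<inter> T" by (auto simp: openin_Euclidean_space_iff)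
    have "(f \<longlongrightarrow> f x) (at x within V)"
      using V by (metis Ck_on_0 continuous_on_def)
    moreover have "at x within V = at x within W"
      using T V W by (intro at_within_nhd[of _ T]) (auto dest: openin_subset)
    ultimately show ?thesis by simp
  qed
  then show ?case using W Ck_on_0 by (metis continuous_on_def)
next
  case (Suc k)
  have 0: "Ck_on k n W f"
    using Suc.prems Ck_on_Suc_D by (intro Suc.IH) metis
  have "\<exists>f'. has_partial_on f i f' W \<and> Ck_on k n W f'" if i: "i < n" for i
  proof -
    \<comment> \<open>The local partial derivatives come from unrelated witnesses.
      \<open>deriv\<close> names one global function that agrees with each of them on its
      neighbourhood, so they need not be glued by hand.\<close>
    define f' where "f' = (\<lambda>x. deriv (\<lambda>s. f (x(i := s))) (x i))"
    have *: "has_partial_on f i f' V \<and> Ck_on k n V f'"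
      if V: "openin (Euclidean_space n) V" "Ck_on (Suc k) n V f" for V
    proof -
      obtain g where g: "has_partial_on f i g V" "Ck_on k n V g"
        using V(2) i unfolding Ck_on_Suc_iff by blast
      then have "has_partial_on f i f' V"
        using has_partial_on_partial[OF g(1)] by (simp add: has_partial_on_def f'_def)
      then show ?thesis using Ck_on_partial V(1) g by blast
    qed
    have "has_partial_on f i f' W"
      unfolding has_partial_on_def
    proof
      fix x assume "x \<in> W"
      then obtain V where V: "openin (Euclidean_space n) V" "x \<in> V" "Ck_on (Suc k) n V f"
        using Suc.prems by blast
      then show "((\<lambda>s. f (x(i := s))) has_real_derivative f' x) (at (x i))"
        using * unfolding has_partial_on_def by blast
    qed
    moreover have "Ck_on k n W f'"
      using Suc.prems * by (intro Suc.IH) metis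
    ultimately show ?thesis by blast
  qed
  then show ?case
    using 0 Ck_on_imp_0 unfolding Ck_on_Suc_iff by blast
qed

lemma Ck_on_const:
  assumes W: "openin (Euclidean_space n) W"
  shows "Ck_on k n W (\<lambda>x. c)"
proof (induction k arbitrary: c)
  case (Suc k)
  have "has_partial_on (\<lambda>x. c) i (\<lambda>x. 0) W" for i
    by (simp add: has_partial_on_def)
  then show ?case unfolding Ck_on_Suc_iff using Suc Ck_on_0[OF W] by (metis continuous_on_const)
qed (use Ck_on_0[OF W] in auto)

lemma Ck_on_coord:
  assumes W: "openin (Euclidean_space n) W"
  shows "Ck_on k n W (\<lambda>x. x j)"
proof -
  have 0: "Ck_on 0 n W (\<lambda>x. x j)"
    unfolding Ck_on_0[OF W] by (rule continuous_on_subset[OF continuous_on_product_coordinates]) simp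
  show ?thesis
  proof (cases k)
    case (Suc l)
    have "has_partial_on (\<lambda>x. x j) i (\<lambda>x. if i = j then 1 else 0) W" for i
      by (auto simp: has_partial_on_def)
    then show ?thesis unfolding Suc Ck_on_Suc_iff using 0 Ck_on_const[OF W] by blast
  qed (use 0 in simp)
qed

lemma Ck_on_add:
  assumes W: "openin (Euclidean_space n) W" and "Ck_on k n W f" "Ck_on k n W g"
  shows "Ck_on k n W (\<lambda>x. f x + g x)"
  using assms(2,3)
proof (induction k arbitrary: f g)
  case 0
  then show ?case using Ck_on_0[OF W] continuous_on_add by blast
next
  case (Suc k)
  have "Ck_on 0 n W (\<lambda>x. f x + g x)"
    using Suc.prems Ck_on_imp_0 Ck_on_0[OF W] continuous_on_add by blast
  moreover have "has_partial_on (\<lambda>x. f x + g x) i (\<lambda>x. f' x + g' x) W"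
    if "has_partial_on f i f' W" "has_partial_on g i g' W" for i f' g'
    using that by (auto simp: has_partial_on_def intro!: DERIV_add)
  ultimately show ?case using Suc unfolding Ck_on_Suc_iff by meson
qed

lemma Ck_on_mult:
  assumes W: "openin (Euclidean_space n) W" and "Ck_on k n W f" "Ck_on k n W g"
  shows "Ck_on k n W (\<lambda>x. f x * g x)"
  using assms(2,3)
proof (induction k arbitrary: f g)
  case 0
  then show ?case using Ck_on_0[OF W] continuous_on_mult by blast
next
  case (Suc k)
  have 0: "Ck_on 0 n W (\<lambda>x. f x * g x)"
    using Suc.prems Ck_on_imp_0 Ck_on_0[OF W] continuous_on_mult by blast
  have "\<exists>h. has_partial_on (\<lambda>x. f x * g x) i h W \<and> Ck_on k n W h" if "i < n" for i
  proof -
    have "\<exists>f'. has_partial_on f i f' W \<and> Ck_on k n W f'" "\<exists>g'. has_partial_on g i g' W \<and> Ck_on k n W g'"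
      using Suc.prems that unfolding Ck_on_Suc_iff by simp_all
    then obtain f' g' where fg: "has_partial_on f i f' W" "has_partial_on g i g' W" "Ck_on k n W f'" "Ck_on k n W g'"
      by blast
    have "has_partial_on (\<lambda>x. f x * g x) i (\<lambda>x. f' x * g x + g' x * f x) W"
      using fg(1,2) unfolding has_partial_on_def by (auto intro!: derivative_eq_intros)
    \<comment> \<open>The product rule keeps the undifferentiated factors, which are of class
      \<open>Suc k\<close>; they are lowered to class \<open>k\<close> so that the induction
      hypothesis applies to them.\<close>
    moreover have "Ck_on k n W (\<lambda>x. f' x * g x + g' x * f x)"
      using fg Suc.prems[THEN Ck_on_Suc_D] by (intro Ck_on_add[OF W] Suc.IH)
    ultimately show ?thesis by blast
  qed
  then show ?case using 0 unfolding Ck_on_Suc_iff by blast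
qed

lemma Ck_on_sum:
  assumes W: "openin (Euclidean_space n) W" and "\<And>i. i \<in> I \<Longrightarrow> Ck_on k n W (f i)"
  shows "Ck_on k n W (\<lambda>x. \<Sum>i\<in>I. f i x)"
  using assms(2)
proof (induction I rule: infinite_finite_induct)
  case (insert i I)
  then show ?case using Ck_on_add[OF W] by simp
qed (use Ck_on_const[OF W] in auto)

text \<open>The mean value theorem along the \<open>i\<close>-th coordinate writes the increment as
  \<open>c t - p i\<close> times a value of \<open>f'\<close> at an intermediate point. The base
  point \<open>q t\<close> of the segment moves with \<open>t\<close>, so it takes continuity of
  \<open>f'\<close> at \<open>p\<close>, and not just its value there, to pass to the limit.\<close>

lemma partial_increment:
  assumes W: "openin (Euclidean_space n) W" and p: "p \<in> W" and i: "i < n"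
    and f': "has_partial_on f i f' W" and cont: "continuous_on W f'"
    and q: "(q \<longlongrightarrow> p) (at t0)" and q0: "q t0 = p" and qE: "\<And>t. q t \<in> Eu n" and qi: "\<And>t. q t i = p i"
    and c: "(c has_real_derivative d) (at t0)" and c0: "c t0 = p i"
  shows "((\<lambda>t. f ((q t)(i := c t)) - f (q t)) has_real_derivative f' p * d) (at t0)"
proof -
  \<comment> \<open>The difference quotient in the \<open>i\<close>-th coordinate, completed by its
    expected limit where the denominator vanishes. Multiplied by the quotient of \<open>c\<close> it
    is the quotient of the increment for every \<open>t\<close>.\<close>
  define D where "D = (\<lambda>t. if c t = p i then f' p else (f ((q t)(i := c t)) - f (q t)) / (c t - p i))"
  have "(D \<longlongrightarrow> f' p) (at t0)"
  proof (rule tendstoI)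
    fix e :: real assume e: "e > 0"
    have "\<exists>T. open T \<and> p \<in> T \<and> (\<forall>y\<in>Eu n \<inter> T. y \<in> W \<and> dist (f' y) (f' p) < e)"
    proof -
      obtain A where A: "open A" "A \<inter> W = f' -` ball (f' p) e \<inter> W"
        using cont unfolding continuous_on_open_invariant by blast
      obtain T where T: "open T" "W = Eu n \<inter> T" using W by (auto simp: openin_Euclidean_space_iff)
      have "p \<in> A" using A(2) p e by auto
      then show ?thesis
      proof (intro exI[of _ "A \<inter> T"] conjI ballI)
        fix y assume y: "y \<in> Eu n \<inter> (A \<inter> T)"
        then show "y \<in> W" using T by blast
        with y have "y \<in> f' -` ball (f' p) e \<inter> W" unfolding A(2)[symmetric] by blast
        then show "dist (f' y) (f' p) < e" by (simp add: dist_commute)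
      qed (use A T p in auto)
    qed
    then obtain T where T: "open T" "p \<in> T" "\<And>y. y \<in> Eu n \<inter> T \<Longrightarrow> y \<in> W \<and> dist (f' y) (f' p) < e"
      by blast
    obtain \<delta> N where N: "\<delta> > 0" "open N" "p \<in> N" "\<And>s y. \<bar>s - p i\<bar> < \<delta> \<Longrightarrow> y \<in> N \<Longrightarrow> y(i := s) \<in> T"
      using fun_upd_nbhd[OF T(1,2)] by metis
    have "\<forall>\<^sub>F t in at t0. q t \<in> N" using topological_tendstoD[OF q] N by blast
    moreover have "\<forall>\<^sub>F t in at t0. dist (c t) (p i) < \<delta>"
      using DERIV_isCont[OF c] N(1) c0 unfolding isCont_def by (metis tendstoD)
    ultimately show "\<forall>\<^sub>F t in at t0. dist (D t) (f' p) < e"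
    proof eventually_elim
      case (elim t)
      show ?case
      proof (cases "c t = p i")
        case False
        have der: "((\<lambda>s. f ((q t)(i := s))) has_real_derivative f' ((q t)(i := s))) (at s)"
          if "\<bar>s - p i\<bar> < \<delta>" for s
        proof -
          have "(q t)(i := s) \<in> W"
            using N(4)[OF that elim(1)] T(3) fun_upd_Eu[OF qE i] by blast
          then show ?thesis using f' unfolding has_partial_on_def by force
        qed
        have "\<exists>z. \<bar>z - p i\<bar> < \<delta> \<and> f ((q t)(i := c t)) - f (q t) = (c t - p i) * f' ((q t)(i := z))"
        \<comment> \<open>The mean value theorem is stated for ordered endpoints, so the two
          possible orders are treated apart; equality was split off before.\<close>
        proof (cases "p i < c t")
          case True
          have "\<exists>z>p i. z < c t \<and> f ((q t)(i := c t)) - f ((q t)(i := p i)) = (c t - p i) * f' ((q t)(i := z))"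
            using True elim(2) by (intro MVT2 der) (auto simp: dist_real_def)
          then obtain z where "p i < z" "z < c t" "f ((q t)(i := c t)) - f ((q t)(i := p i)) = (c t - p i) * f' ((q t)(i := z))"
            by blast
          moreover have "(q t)(i := p i) = q t" using qi by auto
          ultimately show ?thesis using elim(2) by (intro exI[of _ z]) (auto simp: dist_real_def)
        next
          case False
          have "\<exists>z>c t. z < p i \<and> f ((q t)(i := p i)) - f ((q t)(i := c t)) = (p i - c t) * f' ((q t)(i := z))"
            using False \<open>c t \<noteq> p i\<close> elim(2) by (intro MVT2 der) (auto simp: dist_real_def)
          then obtain z where "c t < z" "z < p i" "f ((q t)(i := p i)) - f ((q t)(i := c t)) = (p i - c t) * f' ((q t)(i := z))"
            by blast
          moreover have "(q t)(i := p i) = q t" using qi by auto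
          ultimately show ?thesis using elim(2) by (intro exI[of _ z]) (auto simp: dist_real_def algebra_simps)
        qed
        then obtain z where z: "\<bar>z - p i\<bar> < \<delta>" "D t = f' ((q t)(i := z))"
          using False by (auto simp: D_def)
        have "(q t)(i := z) \<in> Eu n \<inter> T" using N(4)[OF z(1) elim(1)] fun_upd_Eu[OF qE i] by blast
        then show ?thesis using T(3) z by auto
      qed (use e in \<open>simp add: D_def\<close>)
    qed
  qed
  moreover have "((\<lambda>t. (c t - c t0) / (t - t0)) \<longlongrightarrow> d) (at t0)"
    using c by (simp add: has_field_derivative_iff)
  ultimately have "((\<lambda>t. D t * ((c t - c t0) / (t - t0))) \<longlongrightarrow> f' p * d) (at t0)"
    by (rule tendsto_mult)
  moreover have "D t * ((c t - c t0) / (t - t0)) =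
      (f ((q t)(i := c t)) - f (q t) - (f ((q t0)(i := c t0)) - f (q t0))) / (t - t0)" for t
  proof (cases "c t = p i")
    case True
    then have "(q t)(i := c t) = q t" using qi by auto
    then show ?thesis using c0 q0 True by (auto simp: fun_upd_idem)
  next
    case False
    then show ?thesis using c0 q0 by (simp add: D_def fun_upd_idem)
  qed
  ultimately show ?thesis unfolding has_field_derivative_iff by (simp only:)
qed

text \<open>A telescoping sum over the coordinates: \<open>z k\<close> follows
  \<open>\<gamma>\<close> in the coordinates below \<open>k\<close> and rests at
  \<open>\<gamma> t0\<close> in the others, so consecutive terms differ in one coordinate and
  \<open>partial_increment\<close> gives the derivative of their difference.\<close>

lemma chain_rule_partial:
  assumes W: "openin (Euclidean_space n) W" and p: "\<gamma> t0 \<in> W"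
    and f': "\<And>i. i < n \<Longrightarrow> has_partial_on f i (f' i) W" and cont: "\<And>i. i < n \<Longrightarrow> continuous_on W (f' i)"
    and \<gamma>E: "\<And>t. \<gamma> t \<in> Eu n"
    and \<gamma>': "\<And>i. i < n \<Longrightarrow> ((\<lambda>t. \<gamma> t i) has_real_derivative d i) (at t0)"
  shows "((\<lambda>t. f (\<gamma> t)) has_real_derivative (\<Sum>i<n. f' i (\<gamma> t0) * d i)) (at t0)"
proof -
  define z where "z = (\<lambda>k t i. if i < k then \<gamma> t i else \<gamma> t0 i)"
  have "((\<lambda>t. f (z k t)) has_real_derivative (\<Sum>i<k. f' i (\<gamma> t0) * d i)) (at t0)" if "k \<le> n" for k
    using that
  proof (induction k)
    case 0
    then show ?case by (simp add: z_def)
  next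
    case (Suc k)
    have lim: "(z k \<longlongrightarrow> \<gamma> t0) (at t0)"
      unfolding tendsto_fun_iff
    proof
      fix i
      show "((\<lambda>t. z k t i) \<longlongrightarrow> \<gamma> t0 i) (at t0)"
      proof (cases "i < k")
        case True
        then have "isCont (\<lambda>t. \<gamma> t i) t0" using DERIV_isCont[OF \<gamma>', of i] Suc.prems by simp
        then show ?thesis using True by (simp add: z_def isCont_def)
      qed (simp add: z_def)
    qed
    have "((\<lambda>t. f ((z k t)(k := \<gamma> t k)) - f (z k t)) has_real_derivative f' k (\<gamma> t0) * d k) (at t0)"
    proof (rule partial_increment[OF W p _ f' cont lim _ _ _ \<gamma>'])
      fix t show "z k t \<in> Eu n" using \<gamma>E[of t] \<gamma>E[of t0] by (auto simp: z_def topspace_Euclidean_space)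
    qed (use Suc.prems in \<open>auto simp: z_def\<close>)
    moreover have "(z k t)(k := \<gamma> t k) = z (Suc k) t" for t
      by (auto simp: z_def less_Suc_eq)
    ultimately have "((\<lambda>t. f (z k t) + (f (z (Suc k) t) - f (z k t))) has_real_derivative
        (\<Sum>i<k. f' i (\<gamma> t0) * d i) + f' k (\<gamma> t0) * d k) (at t0)"
      using Suc by (intro DERIV_add) auto
    then show ?case by simp
  qed
  \<comment> \<open>Points of \<open>Eu n\<close> vanish from index \<open>n\<close> on, so
    following \<open>\<gamma>\<close> below \<open>n\<close> already means following it
    everywhere.\<close>
  moreover have "z n t = \<gamma> t" for t
    using \<gamma>E[of t] \<gamma>E[of t0] by (auto simp: z_def topspace_Euclidean_space)
  ultimately show ?thesis by fastforce
qed

text \<open>The coordinates of \<open>g\<close> from index \<open>n\<close> on vanish, so they need not be assumed to be differentiable.\<close>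

lemma Ck_on_compose:
  assumes W: "openin (Euclidean_space n) W" and V: "openin (Euclidean_space m) V"
    and g: "\<And>x. x \<in> V \<Longrightarrow> g x \<in> W" "\<And>i. i < n \<Longrightarrow> Ck_on k m V (\<lambda>x. g x i)"
    and f: "Ck_on k n W f"
  shows "Ck_on k m V (\<lambda>x. f (g x))"
  using g(2) f
proof (induction k arbitrary: f)
  case 0
  have "continuous_on V (\<lambda>x. g x i)" for i
  proof (cases "i < n")
    case False
    then have "g x i = 0" if "x \<in> V" for x
      using g(1)[OF that] openin_subset[OF W] by (auto simp: topspace_Euclidean_space)
    then show ?thesis by (metis continuous_on_cong continuous_on_const)
  qed (use 0 Ck_on_0[OF V] in auto)
  then have "continuous_on V g" by (rule continuous_on_coordinatewise_then_product)
  then show ?case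
    using 0 g(1) Ck_on_0[OF V] Ck_on_0[OF W] by (metis continuous_on_compose2 image_subsetI)
next
  case (Suc k)
  have IH: "Ck_on k m V (\<lambda>x. h (g x))" if "Ck_on k n W h" for h
    using Suc.IH[OF _ that] Suc.prems(1) Ck_on_Suc_D by metis
  have 0: "Ck_on 0 m V (\<lambda>x. f (g x))"
    using IH Suc.prems(2) Ck_on_Suc_D Ck_on_imp_0 by metis
  obtain f' where f': "\<And>i. i < n \<Longrightarrow> has_partial_on f i (f' i) W" "\<And>i. i < n \<Longrightarrow> Ck_on k n W (f' i)"
    using Suc.prems(2) unfolding Ck_on_Suc_iff by metis
  have ex: "\<forall>i\<in>{..<n}. \<forall>j\<in>{..<m}. \<exists>g'. has_partial_on (\<lambda>x. g x i) j g' V \<and> Ck_on k m V g'"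
    using Suc.prems(1) unfolding Ck_on_Suc_iff by blast
  have "\<exists>h. has_partial_on (\<lambda>x. f (g x)) j h V \<and> Ck_on k m V h" if j: "j < m" for j
  proof -
    have "\<forall>i\<in>{..<n}. \<exists>g'. has_partial_on (\<lambda>x. g x i) j g' V \<and> Ck_on k m V g'"
      using ex j by blast
    then obtain g' where "\<forall>i\<in>{..<n}. has_partial_on (\<lambda>x. g x i) j (g' i) V \<and> Ck_on k m V (g' i)"
      by (rule bchoice[THEN exE])
    then have g': "\<And>i. i < n \<Longrightarrow> has_partial_on (\<lambda>x. g x i) j (g' i) V" "\<And>i. i < n \<Longrightarrow> Ck_on k m V (g' i)"
      by auto
    have "has_partial_on (\<lambda>x. f (g x)) j (\<lambda>x. \<Sum>i<n. f' i (g x) * g' i x) V"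
      unfolding has_partial_on_def
    proof
      fix x assume x: "x \<in> V"
      \<comment> \<open>Off \<open>V\<close> nothing is known about \<open>g\<close>. The constant
        value there keeps the curve in \<open>Eu n\<close> for all parameters, as the chain rule
        asks, without changing its germ at \<open>x j\<close>.\<close>
      define \<gamma> where "\<gamma> = (\<lambda>s. if x(j := s) \<in> V then g (x(j := s)) else g x)"
      have ev: "\<forall>\<^sub>F s in nhds (x j). \<gamma> s = g (x(j := s))"
        using eventually_fun_upd[OF V x j] by eventually_elim (auto simp: \<gamma>_def)
      have "((\<lambda>s. f (\<gamma> s)) has_real_derivative (\<Sum>i<n. f' i (\<gamma> (x j)) * g' i x)) (at (x j))"
      proof (rule chain_rule_partial[OF W _ f'(1)])
        show "continuous_on W (f' i)" if "i < n" for i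
          using f'(2)[OF that] Ck_on_imp_continuous[OF W] by blast
        show "\<gamma> (x j) \<in> W" using g(1) x by (simp add: \<gamma>_def)
        show "\<gamma> s \<in> Eu n" for s using g(1) x openin_subset[OF W] by (auto simp: \<gamma>_def)
        show "((\<lambda>s. \<gamma> s i) has_real_derivative g' i x) (at (x j))" if i: "i < n" for i
        proof -
          have "\<forall>\<^sub>F s in nhds (x j). \<gamma> s i = g (x(j := s)) i"
            using ev by eventually_elim simp
          from DERIV_cong_ev[OF refl this refl] show ?thesis
            by (rule iffD2) (use g'(1)[OF i] x in \<open>simp add: has_partial_on_def\<close>)
        qed
      qed auto
      moreover have "\<gamma> (x j) = g x" using x by (simp add: \<gamma>_def)
      moreover have "\<forall>\<^sub>F s in nhds (x j). f (\<gamma> s) = f (g (x(j := s)))"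
        using ev by eventually_elim simp
      ultimately show "((\<lambda>s. f (g (x(j := s)))) has_real_derivative (\<Sum>i<n. f' i (g x) * g' i x)) (at (x j))"
        using DERIV_cong_ev[OF refl _ refl] by fastforce
    qed
    moreover have "Ck_on k m V (\<lambda>x. \<Sum>i<n. f' i (g x) * g' i x)"
      using IH f'(2) g'(2) by (intro Ck_on_sum Ck_on_mult V) auto
    ultimately show ?thesis by blast
  qed
  then show ?case using 0 unfolding Ck_on_Suc_iff by blast
qed

section \<open>Smooth real functions on open sets of coordinate spaces\<close>

definition smooth_fun :: "nat \<Rightarrow> (nat \<Rightarrow> real) set \<Rightarrow> ((nat \<Rightarrow> real) \<Rightarrow> real) \<Rightarrow> bool" where
  "smooth_fun n W f \<longleftrightarrow> (\<forall>k. Ck_on k n W f)"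

lemma smooth_fun_compose:
  assumes "openin (Euclidean_space n) W" "openin (Euclidean_space m) V"
    and "\<And>x. x \<in> V \<Longrightarrow> g x \<in> W" "\<And>i. i < n \<Longrightarrow> smooth_fun m V (\<lambda>x. g x i)" "smooth_fun n W f"
  shows "smooth_fun m V (\<lambda>x. f (g x))"
  using assms unfolding smooth_fun_def by (blast intro: Ck_on_compose)

lemma smooth_fun_cong:
  "openin (Euclidean_space n) W \<Longrightarrow> (\<And>x. x \<in> W \<Longrightarrow> f x = g x) \<Longrightarrow> smooth_fun n W f \<longleftrightarrow> smooth_fun n W g"
  unfolding smooth_fun_def using Ck_on_cong by metis

lemma smooth_fun_mono:
  "openin (Euclidean_space n) V \<Longrightarrow> V \<subseteq> W \<Longrightarrow> openin (Euclidean_space n) W \<Longrightarrow> smooth_fun n W f \<Longrightarrow> smooth_fun n V f"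
  unfolding smooth_fun_def using Ck_on_mono by blast

lemma smooth_fun_locally:
  assumes "openin (Euclidean_space n) W"
    and "\<And>x. x \<in> W \<Longrightarrow> \<exists>V. openin (Euclidean_space n) V \<and> x \<in> V \<and> V \<subseteq> W \<and> smooth_fun n V f"
  shows "smooth_fun n W f"
  unfolding smooth_fun_def
proof (intro allI Ck_on_locally assms(1))
  fix k x assume "x \<in> W"
  from assms(2)[OF this] show "\<exists>V. openin (Euclidean_space n) V \<and> x \<in> V \<and> V \<subseteq> W \<and> Ck_on k n V f"
    unfolding smooth_fun_def by blast
qed

lemma smooth_fun_const: "openin (Euclidean_space n) W \<Longrightarrow> smooth_fun n W (\<lambda>x. c)"
  and smooth_fun_coord: "openin (Euclidean_space n) W \<Longrightarrow> smooth_fun n W (\<lambda>x. x j)"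
  by (simp_all add: smooth_fun_def Ck_on_const Ck_on_coord)

lemma smooth_fun_add: "openin (Euclidean_space n) W \<Longrightarrow> smooth_fun n W f \<Longrightarrow> smooth_fun n W g \<Longrightarrow> smooth_fun n W (\<lambda>x. f x + g x)"
  and smooth_fun_mult: "openin (Euclidean_space n) W \<Longrightarrow> smooth_fun n W f \<Longrightarrow> smooth_fun n W g \<Longrightarrow> smooth_fun n W (\<lambda>x. f x * g x)"
  by (simp_all add: smooth_fun_def Ck_on_add Ck_on_mult)

lemma smooth_fun_sum:
  "openin (Euclidean_space n) W \<Longrightarrow> (\<And>i. i \<in> I \<Longrightarrow> smooth_fun n W (f i)) \<Longrightarrow> smooth_fun n W (\<lambda>x. \<Sum>i\<in>I. f i x)"
  by (simp add: smooth_fun_def Ck_on_sum)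

lemma smooth_fun_continuous: "openin (Euclidean_space n) W \<Longrightarrow> smooth_fun n W f \<Longrightarrow> continuous_on W f"
  using Ck_on_imp_continuous unfolding smooth_fun_def by blast

lemma smooth_on_iff:
  "smooth_on n m W f \<longleftrightarrow> f ` W \<subseteq> Eu m \<and> (\<forall>j<m. smooth_fun n W (\<lambda>x. f x j))"
  by (auto simp: smooth_on_def smooth_fun_def)

section \<open>Manifolds and smooth maps\<close>

lemma mcarrier_iff: "p \<in> mcarrier M \<longleftrightarrow> (\<exists>U n \<phi>. (U, n, \<phi>) \<in> M \<and> p \<in> U)"
  by (force simp: mcarrier_def)

lemma chart_subset: "(U, n, \<phi>) \<in> M \<Longrightarrow> U \<subseteq> mcarrier M"
  by (subst subset_iff) (metis mcarrier_iff)

text \<open>The range condition inside \<open>smooth_on\<close> follows from the first conjunct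
  applied to the target chart, so only smoothness of the coordinates of the transitions
  remains.\<close>

lemma smooth_atlas_iff:
  "smooth_atlas M \<longleftrightarrow>
     (\<forall>U n \<phi>. (U, n, \<phi>) \<in> M \<longrightarrow> inj_on \<phi> U \<and> \<phi> ` U \<subseteq> Eu n) \<and>
     (\<forall>U n \<phi> V m \<psi>. (U, n, \<phi>) \<in> M \<longrightarrow> (V, m, \<psi>) \<in> M \<longrightarrow> openin (Euclidean_space n) (\<phi> ` (U \<inter> V)) \<and>
        (\<forall>j<m. smooth_fun n (\<phi> ` (U \<inter> V)) (\<lambda>x. \<psi> (inv_into U \<phi> x) j)))"
proof -
  have eq: "smooth_atlas M \<longleftrightarrow>
     (\<forall>U n \<phi>. (U, n, \<phi>) \<in> M \<longrightarrow> inj_on \<phi> U \<and> \<phi> ` U \<subseteq> Eu n) \<and>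
     (\<forall>U n \<phi>. (U, n, \<phi>) \<in> M \<longrightarrow> (\<forall>V m \<psi>. (V, m, \<psi>) \<in> M \<longrightarrow> openin (Euclidean_space n) (\<phi> ` (U \<inter> V)) \<and>
        (\<psi> \<circ> inv_into U \<phi>) ` \<phi> ` (U \<inter> V) \<subseteq> Eu m \<and>
        (\<forall>j<m. smooth_fun n (\<phi> ` (U \<inter> V)) (\<lambda>x. \<psi> (inv_into U \<phi> x) j))))"
    by (simp add: smooth_atlas_def smooth_on_iff Ball_def o_def)
  have rng: "(\<psi> \<circ> inv_into U \<phi>) ` \<phi> ` (U \<inter> V) \<subseteq> Eu m" if "inj_on \<phi> U" "\<psi> ` V \<subseteq> Eu m" for U \<phi> V m and \<psi> :: "'a \<Rightarrow> nat \<Rightarrow> real"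
    using that by auto
  show ?thesis
    unfolding eq
  proof (intro conj_cong refl iffI allI impI)
    fix U n \<phi> V m \<psi>
    assume "\<forall>U n \<phi>. (U, n, \<phi>) \<in> M \<longrightarrow> inj_on \<phi> U \<and> \<phi> ` U \<subseteq> Eu n" and "(U, n, \<phi>) \<in> M" "(V, m, \<psi>) \<in> M"
    then have "inj_on \<phi> U" "\<psi> ` V \<subseteq> Eu m" by simp_all
    note * = rng[OF this]
    {
      assume "\<forall>U n \<phi>. (U, n, \<phi>) \<in> M \<longrightarrow> (\<forall>V m \<psi>. (V, m, \<psi>) \<in> M \<longrightarrow> openin (Euclidean_space n) (\<phi> ` (U \<inter> V)) \<and>
          (\<psi> \<circ> inv_into U \<phi>) ` \<phi> ` (U \<inter> V) \<subseteq> Eu m \<and>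
          (\<forall>j<m. smooth_fun n (\<phi> ` (U \<inter> V)) (\<lambda>x. \<psi> (inv_into U \<phi> x) j)))"
      with \<open>(U, n, \<phi>) \<in> M\<close> \<open>(V, m, \<psi>) \<in> M\<close> show "openin (Euclidean_space n) (\<phi> ` (U \<inter> V)) \<and>
          (\<forall>j<m. smooth_fun n (\<phi> ` (U \<inter> V)) (\<lambda>x. \<psi> (inv_into U \<phi> x) j))"
        by presburger
    next
      assume "\<forall>U n \<phi> V m \<psi>. (U, n, \<phi>) \<in> M \<longrightarrow> (V, m, \<psi>) \<in> M \<longrightarrow> openin (Euclidean_space n) (\<phi> ` (U \<inter> V)) \<and>
          (\<forall>j<m. smooth_fun n (\<phi> ` (U \<inter> V)) (\<lambda>x. \<psi> (inv_into U \<phi> x) j))"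
      with \<open>(U, n, \<phi>) \<in> M\<close> \<open>(V, m, \<psi>) \<in> M\<close> * show "openin (Euclidean_space n) (\<phi> ` (U \<inter> V)) \<and>
          (\<psi> \<circ> inv_into U \<phi>) ` \<phi> ` (U \<inter> V) \<subseteq> Eu m \<and>
          (\<forall>j<m. smooth_fun n (\<phi> ` (U \<inter> V)) (\<lambda>x. \<psi> (inv_into U \<phi> x) j))"
        by presburger
    }
  qed
qed

lemma chart_inj: "smooth_atlas M \<Longrightarrow> (U, n, \<phi>) \<in> M \<Longrightarrow> inj_on \<phi> U"
  and chart_Eu: "smooth_atlas M \<Longrightarrow> (U, n, \<phi>) \<in> M \<Longrightarrow> p \<in> U \<Longrightarrow> \<phi> p \<in> Eu n"
  unfolding smooth_atlas_iff by blast+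

text \<open>\<open>topology\<close> returns the given predicate only after it is shown to be a
  topology. Closure under intersections rests on injectivity of the charts, by which images of
  intersections are intersections of images.\<close>

lemma openin_atlas_iff:
  assumes M: "smooth_atlas M"
  shows "openin (atlas_topology M) W \<longleftrightarrow>
    W \<subseteq> mcarrier M \<and> (\<forall>U n \<phi>. (U, n, \<phi>) \<in> M \<longrightarrow> openin (Euclidean_space n) (\<phi> ` (U \<inter> W)))"
proof -
  let ?L = "\<lambda>W. W \<subseteq> mcarrier M \<and> (\<forall>(U, n, \<phi>)\<in>M. openin (Euclidean_space n) (\<phi> ` (U \<inter> W)))"
  have "istopology ?L"
    unfolding istopology_def
  proof (intro conjI allI impI; (elim conjE)?)
    fix S T assume ST: "S \<subseteq> mcarrier M" "\<forall>(U, n, \<phi>)\<in>M. openin (Euclidean_space n) (\<phi> ` (U \<inter> S))"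
      "T \<subseteq> mcarrier M" "\<forall>(U, n, \<phi>)\<in>M. openin (Euclidean_space n) (\<phi> ` (U \<inter> T))"
    show "\<forall>(U, n, \<phi>)\<in>M. openin (Euclidean_space n) (\<phi> ` (U \<inter> (S \<inter> T)))"
    proof clarify
      fix U n \<phi> assume c: "(U, n, \<phi>) \<in> M"
      have "\<phi> ` (U \<inter> (S \<inter> T)) = \<phi> ` (U \<inter> S) \<inter> \<phi> ` (U \<inter> T)"
        using chart_inj[OF M c] by (auto dest: inj_onD)
      then show "openin (Euclidean_space n) (\<phi> ` (U \<inter> (S \<inter> T)))"
        using ST c by fastforce
    qed
  next
    fix \<K> assume K: "\<forall>K\<in>\<K>. ?L K"
    show "\<forall>(U, n, \<phi>)\<in>M. openin (Euclidean_space n) (\<phi> ` (U \<inter> \<Union>\<K>))"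
    proof clarify
      fix U n \<phi> assume c: "(U, n, \<phi>) \<in> M"
      have "\<phi> ` (U \<inter> \<Union>\<K>) = (\<Union>K\<in>\<K>. \<phi> ` (U \<inter> K))" by blast
      then show "openin (Euclidean_space n) (\<phi> ` (U \<inter> \<Union>\<K>))" using K c by fastforce
    qed
  qed auto
  then have "openin (atlas_topology M) = ?L"
    unfolding atlas_topology_def by (rule topology_inverse')
  then show ?thesis by fastforce
qed

lemma openin_chart_image:
  "smooth_atlas M \<Longrightarrow> openin (atlas_topology M) A \<Longrightarrow> (U, n, \<phi>) \<in> M \<Longrightarrow> openin (Euclidean_space n) (\<phi> ` (U \<inter> A))"
  by (simp add: openin_atlas_iff)

lemma openin_chart: "smooth_atlas M \<Longrightarrow> (U, n, \<phi>) \<in> M \<Longrightarrow> openin (atlas_topology M) U"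
  using smooth_atlas_iff[of M] by (simp add: openin_atlas_iff chart_subset)

lemma topspace_atlas: assumes M: "smooth_atlas M" shows "topspace (atlas_topology M) = mcarrier M"
proof
  show "topspace (atlas_topology M) \<subseteq> mcarrier M"
    using openin_topspace openin_atlas_iff[OF M] by blast
  show "mcarrier M \<subseteq> topspace (atlas_topology M)"
    using openin_chart[OF M] openin_subset by (metis mcarrier_iff subsetD subsetI)
qed

text \<open>Smooth maps, transition matrices and sections are all handled through such real
  functions on open sets. Openness of the domain is built in, so a smooth function carries the
  topological information needed to restrict or glue it.\<close>

definition smooth_real :: "'a atlas \<Rightarrow> 'a set \<Rightarrow> ('a \<Rightarrow> real) \<Rightarrow> bool" where
  "smooth_real M A u \<longleftrightarrow> openin (atlas_topology M) A \<and>
     (\<forall>U n \<phi>. (U, n, \<phi>) \<in> M \<longrightarrow> smooth_fun n (\<phi> ` (U \<inter> A)) (\<lambda>x. u (inv_into U \<phi> x)))"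

lemma smooth_real_open: "smooth_real M A u \<Longrightarrow> openin (atlas_topology M) A"
  by (simp add: smooth_real_def)

context
  fixes M :: "'a atlas"
  assumes M: "smooth_atlas M"
begin

lemma chart_inv: "(U, n, \<phi>) \<in> M \<Longrightarrow> p \<in> U \<Longrightarrow> inv_into U \<phi> (\<phi> p) = p"
  by (simp add: chart_inj[OF M] inv_into_f_f)

lemma smooth_real_const: "openin (atlas_topology M) A \<Longrightarrow> smooth_real M A (\<lambda>p. c)"
  by (simp add: smooth_real_def smooth_fun_const openin_chart_image[OF M])

lemma smooth_real_add: "smooth_real M A u \<Longrightarrow> smooth_real M A v \<Longrightarrow> smooth_real M A (\<lambda>p. u p + v p)"
  by (simp add: smooth_real_def smooth_fun_add openin_chart_image[OF M])

lemma smooth_real_mult: "smooth_real M A u \<Longrightarrow> smooth_real M A v \<Longrightarrow> smooth_real M A (\<lambda>p. u p * v p)"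
  by (simp add: smooth_real_def smooth_fun_mult openin_chart_image[OF M])

lemma smooth_real_mono:
  assumes "openin (atlas_topology M) B" "B \<subseteq> A" "smooth_real M A u"
  shows "smooth_real M B u"
proof -
  have "smooth_fun n (\<phi> ` (U \<inter> B)) (\<lambda>x. u (inv_into U \<phi> x))" if c: "(U, n, \<phi>) \<in> M" for U n \<phi>
    by (rule smooth_fun_mono[of _ _ "\<phi> ` (U \<inter> A)"])
       (use assms c in \<open>auto simp: smooth_real_def openin_chart_image[OF M]\<close>)
  then show ?thesis using assms by (simp add: smooth_real_def)
qed

lemma smooth_real_cong:
  assumes "\<And>p. p \<in> A \<Longrightarrow> u p = v p"
  shows "smooth_real M A u \<longleftrightarrow> smooth_real M A v"
proof -
  have "smooth_fun n (\<phi> ` (U \<inter> A)) (\<lambda>x. u (inv_into U \<phi> x)) \<longleftrightarrow>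
        smooth_fun n (\<phi> ` (U \<inter> A)) (\<lambda>x. v (inv_into U \<phi> x))"
    if c: "(U, n, \<phi>) \<in> M" and A: "openin (atlas_topology M) A" for U n \<phi>
    by (rule smooth_fun_cong) (use openin_chart_image[OF M A c] chart_inv[OF c] assms in auto)
  then show ?thesis unfolding smooth_real_def by blast
qed

text \<open>Stated for every index \<open>j\<close>: from \<open>n\<close> on the coordinate is
  constantly zero, which spares later uses a bound on the index.\<close>

lemma smooth_real_chart:
  assumes c: "(U, n, \<phi>) \<in> M"
  shows "smooth_real M U (\<lambda>p. \<phi> p j)"
proof (cases "j < n")
  case True
  then show ?thesis
    using M c openin_chart[OF M c] unfolding smooth_real_def smooth_atlas_iff by (metis Int_commute)
next
  case False
  then have "\<phi> p j = 0" if "p \<in> U" for p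
    using chart_Eu[OF M c that] by (simp add: topspace_Euclidean_space)
  then show ?thesis
    using smooth_real_const[OF openin_chart[OF M c], of 0] smooth_real_cong by metis
qed

end

text \<open>In coordinates \<open>u \<circ> f\<close> factors as \<open>u\<close> read in the chart
  \<open>\<psi>\<close> after the coordinate expression of \<open>f\<close>, both of which are
  smooth. A single chart of the target containing the image of \<open>A\<close> is used.\<close>

lemma smooth_real_compose_chart:
  assumes M: "smooth_atlas M" and N: "smooth_atlas N"
    and c: "(V, m, \<psi>) \<in> N" and f: "f ` A \<subseteq> V" and sm: "\<And>j. j < m \<Longrightarrow> smooth_real M A (\<lambda>p. \<psi> (f p) j)"
    and u: "smooth_real N B u" and A': "openin (atlas_topology M) A'" "A' \<subseteq> A" "f ` A' \<subseteq> B"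
  shows "smooth_real M A' (\<lambda>p. u (f p))"
proof -
  have "smooth_fun n (\<phi> ` (U \<inter> A')) (\<lambda>x. u (f (inv_into U \<phi> x)))" if d: "(U, n, \<phi>) \<in> M" for U n \<phi>
  proof -
    have o: "openin (Euclidean_space n) (\<phi> ` (U \<inter> A'))" using openin_chart_image[OF M A'(1) d] .
    have o2: "openin (Euclidean_space m) (\<psi> ` (V \<inter> B))" using openin_chart_image[OF N smooth_real_open[OF u] c] .
    have fV: "f p \<in> V \<inter> B" if "p \<in> A'" for p using that f A' by blast
    have "smooth_fun n (\<phi> ` (U \<inter> A')) (\<lambda>x. u (inv_into V \<psi> (\<psi> (f (inv_into U \<phi> x)))))"
    proof (rule smooth_fun_compose[OF o2 o, where g = "\<lambda>x. \<psi> (f (inv_into U \<phi> x))" and f = "\<lambda>y. u (inv_into V \<psi> y)"])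
      show "\<psi> (f (inv_into U \<phi> x)) \<in> \<psi> ` (V \<inter> B)" if "x \<in> \<phi> ` (U \<inter> A')" for x
        using that fV by (auto simp: chart_inv[OF M d])
      show "smooth_fun n (\<phi> ` (U \<inter> A')) (\<lambda>x. \<psi> (f (inv_into U \<phi> x)) j)" if "j < m" for j
        using smooth_real_mono[OF M A'(1,2) sm[OF that]] d unfolding smooth_real_def by blast
      show "smooth_fun m (\<psi> ` (V \<inter> B)) (\<lambda>y. u (inv_into V \<psi> y))"
        using u c unfolding smooth_real_def by blast
    qed
    moreover have "u (inv_into V \<psi> (\<psi> (f (inv_into U \<phi> x)))) = u (f (inv_into U \<phi> x))" if "x \<in> \<phi> ` (U \<inter> A')" for x
      using that fV by (auto simp: chart_inv[OF M d] chart_inv[OF N c])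
    ultimately show ?thesis
      using smooth_fun_cong[OF o, of "\<lambda>x. u (inv_into V \<psi> (\<psi> (f (inv_into U \<phi> x))))"
          "\<lambda>x. u (f (inv_into U \<phi> x))"] by simp
  qed
  then show ?thesis using A' by (simp add: smooth_real_def)
qed

lemma smooth_real_locally:
  assumes M: "smooth_atlas M" and A: "openin (atlas_topology M) A"
    and loc: "\<And>p. p \<in> A \<Longrightarrow> \<exists>B. p \<in> B \<and> B \<subseteq> A \<and> smooth_real M B u"
  shows "smooth_real M A u"
proof -
  have "smooth_fun n (\<phi> ` (U \<inter> A)) (\<lambda>x. u (inv_into U \<phi> x))" if c: "(U, n, \<phi>) \<in> M" for U n \<phi>
  proof (rule smooth_fun_locally)
    show "openin (Euclidean_space n) (\<phi> ` (U \<inter> A))" using openin_chart_image[OF M A c] .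
    fix x assume "x \<in> \<phi> ` (U \<inter> A)"
    then obtain p where p: "p \<in> U" "p \<in> A" "x = \<phi> p" by blast
    then obtain B where B: "p \<in> B" "B \<subseteq> A" "smooth_real M B u" using loc by blast
    have "openin (Euclidean_space n) (\<phi> ` (U \<inter> B))" "smooth_fun n (\<phi> ` (U \<inter> B)) (\<lambda>x. u (inv_into U \<phi> x))"
      using B(3) c by (auto simp: smooth_real_def openin_chart_image[OF M])
    then show "\<exists>V. openin (Euclidean_space n) V \<and> x \<in> V \<and> V \<subseteq> \<phi> ` (U \<inter> A) \<and> smooth_fun n V (\<lambda>x. u (inv_into U \<phi> x))"
      using p B by (intro exI[of _ "\<phi> ` (U \<inter> B)"]) auto
  qed
  then show ?thesis using A by (simp add: smooth_real_def)
qed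

text \<open>Continuity of \<open>f\<close> is obtained rather than assumed: smooth coordinates are
  continuous, and membership of \<open>f p\<close> in \<open>B\<close> can be read off in the chart
  \<open>\<psi>\<close>, which is injective.\<close>

lemma openin_chart_vimage:
  assumes M: "smooth_atlas M" and N: "smooth_atlas N" and A: "openin (atlas_topology M) A"
    and c: "(V, m, \<psi>) \<in> N" and f: "f ` A \<subseteq> V" and sm: "\<And>j. j < m \<Longrightarrow> smooth_real M A (\<lambda>p. \<psi> (f p) j)"
    and B: "openin (atlas_topology N) B"
  shows "openin (atlas_topology M) (A \<inter> f -` B)"
proof -
  have "openin (Euclidean_space n) (\<phi> ` (U \<inter> (A \<inter> f -` B)))" if d: "(U, n, \<phi>) \<in> M" for U n \<phi>
  proof -
    define g where "g = (\<lambda>x. \<psi> (f (inv_into U \<phi> x)))"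
    have o: "openin (Euclidean_space n) (\<phi> ` (U \<inter> A))" using openin_chart_image[OF M A d] .
    have gE: "g x \<in> Eu m" if "x \<in> \<phi> ` (U \<inter> A)" for x
      using that f chart_Eu[OF N c] by (auto simp: g_def chart_inv[OF M d])
    have "continuous_on (\<phi> ` (U \<inter> A)) (\<lambda>x. g x j)" for j
    proof (cases "j < m")
      case True
      then show ?thesis
        using sm[OF True] d smooth_fun_continuous[OF o] unfolding smooth_real_def g_def by blast
    next
      case False
      have "g x j = 0" if "x \<in> \<phi> ` (U \<inter> A)" for x
        using gE[OF that] False by (simp add: topspace_Euclidean_space)
      then show ?thesis by (metis continuous_on_cong continuous_on_const)
    qed
    then have cont: "continuous_on (\<phi> ` (U \<inter> A)) g" by (rule continuous_on_coordinatewise_then_product)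
    obtain T where T: "open T" "\<psi> ` (V \<inter> B) = Eu m \<inter> T"
      using openin_chart_image[OF N B c] by (auto simp: openin_Euclidean_space_iff)
    obtain S where S: "open S" "S \<inter> \<phi> ` (U \<inter> A) = g -` T \<inter> \<phi> ` (U \<inter> A)"
      using cont T(1) unfolding continuous_on_open_invariant by blast
    have "\<phi> ` (U \<inter> (A \<inter> f -` B)) = \<phi> ` (U \<inter> A) \<inter> S"
    proof -
      have "f p \<in> B \<longleftrightarrow> g (\<phi> p) \<in> T" if "p \<in> U" "p \<in> A" for p
      proof -
        have "f p \<in> V" using f that by blast
        then have "f p \<in> B \<longleftrightarrow> \<psi> (f p) \<in> \<psi> ` (V \<inter> B)"
          using chart_inj[OF N c] by (auto dest: inj_onD)
        also have "\<dots> \<longleftrightarrow> g (\<phi> p) \<in> T"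
          using T(2) chart_Eu[OF N c \<open>f p \<in> V\<close>] by (simp add: g_def chart_inv[OF M d that(1)])
        finally show ?thesis .
      qed
      then show ?thesis using S(2) by blast
    qed
    moreover obtain T' where "open T'" "\<phi> ` (U \<inter> A) = Eu n \<inter> T'"
      using o by (auto simp: openin_Euclidean_space_iff)
    ultimately have "\<phi> ` (U \<inter> (A \<inter> f -` B)) = Eu n \<inter> (T' \<inter> S)" "open (T' \<inter> S)" using S(1) by auto
    then show ?thesis unfolding openin_Euclidean_space_iff by blast
  qed
  then show ?thesis using A openin_atlas_iff[OF M] by auto
qed

text \<open>\<open>smooth_map\<close> asks for continuity and for all pairs of charts. Around each
  point one chart of the target is enough, because the coordinates of every other chart are smooth
  functions to be composed with it.\<close>

lemma smooth_mapI:
  assumes M: "smooth_atlas M" and N: "smooth_atlas N"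
    and loc: "\<And>p. p \<in> mcarrier M \<Longrightarrow> \<exists>A V m \<psi>. openin (atlas_topology M) A \<and> p \<in> A \<and> (V, m, \<psi>) \<in> N \<and> f ` A \<subseteq> V \<and>
      (\<forall>j<m. smooth_real M A (\<lambda>p. \<psi> (f p) j))"
  shows "smooth_map M N f"
  unfolding smooth_map_def
proof (intro conjI)
  have pre: "openin (atlas_topology M) {p \<in> mcarrier M. f p \<in> B}" if B: "openin (atlas_topology N) B" for B
  proof (subst openin_subopen, clarify)
    fix p assume p: "p \<in> mcarrier M" "f p \<in> B"
    from loc[OF p(1)] obtain A V m \<psi> where A: "openin (atlas_topology M) A" "p \<in> A" "(V, m, \<psi>) \<in> N" "f ` A \<subseteq> V"
      "\<forall>j<m. smooth_real M A (\<lambda>p. \<psi> (f p) j)" by blast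
    have "openin (atlas_topology M) (A \<inter> f -` B)"
      using openin_chart_vimage[OF M N A(1,3,4) _ B] A(5) by blast
    moreover have "A \<subseteq> mcarrier M" using A(1) openin_atlas_iff[OF M] by blast
    ultimately show "\<exists>T. openin (atlas_topology M) T \<and> p \<in> T \<and> T \<subseteq> {p \<in> mcarrier M. f p \<in> B}"
      using A p by (intro exI[of _ "A \<inter> f -` B"]) auto
  qed
  have fc: "f p \<in> mcarrier N" if "p \<in> mcarrier M" for p
    using loc[OF that] chart_subset by blast
  then show "continuous_map (atlas_topology M) (atlas_topology N) f"
    using pre by (auto simp: continuous_map_def topspace_atlas[OF M] topspace_atlas[OF N])
  show "\<forall>(U, n, \<phi>)\<in>M. \<forall>(V, m, \<psi>)\<in>N. smooth_on n m (\<phi> ` (U \<inter> f -` V)) (\<psi> \<circ> f \<circ> inv_into U \<phi>)"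
  proof clarify
    fix U n \<phi> V m \<psi> assume c: "(U, n, \<phi>) \<in> M" and d: "(V, m, \<psi>) \<in> N"
    have V: "openin (atlas_topology M) {p \<in> mcarrier M. f p \<in> V}" using pre openin_chart[OF N d] by blast
    have eq: "U \<inter> f -` V = U \<inter> {p \<in> mcarrier M. f p \<in> V}" using chart_subset[OF c] by blast
    have "smooth_real M {p \<in> mcarrier M. f p \<in> V} (\<lambda>p. \<psi> (f p) j)" for j
    proof (rule smooth_real_locally[OF M V])
      fix p assume p: "p \<in> {p \<in> mcarrier M. f p \<in> V}"
      then have "p \<in> mcarrier M" by simp
      from loc[OF this] obtain A V' m' \<psi>' where A: "openin (atlas_topology M) A" "p \<in> A" "(V', m', \<psi>') \<in> N" "f ` A \<subseteq> V'"
        "\<forall>j<m'. smooth_real M A (\<lambda>p. \<psi>' (f p) j)" by blast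
      have o: "openin (atlas_topology M) (A \<inter> {p \<in> mcarrier M. f p \<in> V})" using A V by blast
      have "smooth_real M (A \<inter> {p \<in> mcarrier M. f p \<in> V}) (\<lambda>p. \<psi> (f p) j)"
        by (rule smooth_real_compose_chart[OF M N A(3,4) _ smooth_real_chart[OF N d] o]) (use A in auto)
      then show "\<exists>B. p \<in> B \<and> B \<subseteq> {p \<in> mcarrier M. f p \<in> V} \<and> smooth_real M B (\<lambda>p. \<psi> (f p) j)"
        using A p by (intro exI[of _ "A \<inter> {p \<in> mcarrier M. f p \<in> V}"]) auto
    qed
    then show "smooth_on n m (\<phi> ` (U \<inter> f -` V)) (\<psi> \<circ> f \<circ> inv_into U \<phi>)"
      using c chart_Eu[OF N d] chart_inv[OF M c] unfolding smooth_on_iff eq smooth_real_def by auto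
  qed
qed

section \<open>Calculus of smooth maps between manifolds\<close>

lemma smooth_map_carrier: "smooth_atlas M \<Longrightarrow> smooth_atlas N \<Longrightarrow> smooth_map M N f \<Longrightarrow> p \<in> mcarrier M \<Longrightarrow> f p \<in> mcarrier N"
  unfolding smooth_map_def continuous_map_def by (auto simp: topspace_atlas)

lemma smooth_map_vimage:
  "smooth_atlas M \<Longrightarrow> smooth_map M N f \<Longrightarrow> openin (atlas_topology N) B \<Longrightarrow> openin (atlas_topology M) {p \<in> mcarrier M. f p \<in> B}"
  unfolding smooth_map_def continuous_map_def by (auto simp: topspace_atlas)

lemma smooth_mapD:
  assumes M: "smooth_atlas M" and N: "smooth_atlas N" and f: "smooth_map M N f" and d: "(V, m, \<psi>) \<in> N"
  shows "smooth_real M {p \<in> mcarrier M. f p \<in> V} (\<lambda>p. \<psi> (f p) j)"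
proof (cases "j < m")
  case True
  have "smooth_fun n (\<phi> ` (U \<inter> {p \<in> mcarrier M. f p \<in> V})) (\<lambda>x. \<psi> (f (inv_into U \<phi> x)) j)" if c: "(U, n, \<phi>) \<in> M" for U n \<phi>
  proof -
    have "U \<inter> f -` V = U \<inter> {p \<in> mcarrier M. f p \<in> V}" using chart_subset[OF c] by blast
    moreover have "smooth_on n m (\<phi> ` (U \<inter> f -` V)) (\<psi> \<circ> f \<circ> inv_into U \<phi>)"
      using f c d unfolding smooth_map_def by auto
    ultimately show ?thesis using True unfolding smooth_on_iff by simp
  qed
  then show ?thesis using smooth_map_vimage[OF M f openin_chart[OF N d]] by (simp add: smooth_real_def)
next
  case False
  have "\<psi> (f p) j = 0" if "p \<in> {p \<in> mcarrier M. f p \<in> V}" for p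
    using chart_Eu[OF N d] that False by (auto simp: topspace_Euclidean_space)
  then show ?thesis
    using smooth_real_const[OF M smooth_map_vimage[OF M f openin_chart[OF N d]], of 0] smooth_real_cong[OF M] by (metis (no_types, lifting))
qed

lemma smooth_real_pullback:
  assumes M: "smooth_atlas M" and N: "smooth_atlas N" and f: "smooth_map M N f" and u: "smooth_real N B u"
    and A: "openin (atlas_topology M) A" "\<And>p. p \<in> A \<Longrightarrow> f p \<in> B"
  shows "smooth_real M A (\<lambda>p. u (f p))"
proof (rule smooth_real_locally[OF M A(1)])
  fix p assume p: "p \<in> A"
  have AM: "A \<subseteq> mcarrier M" using A(1) openin_atlas_iff[OF M] by blast
  then have "f p \<in> mcarrier N" using smooth_map_carrier[OF M N f] p by blast
  then obtain V m \<psi> where d: "(V, m, \<psi>) \<in> N" "f p \<in> V" by (auto simp: mcarrier_iff)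
  define A' where "A' = A \<inter> {p \<in> mcarrier M. f p \<in> V}"
  have o: "openin (atlas_topology M) A'"
    using A(1) smooth_map_vimage[OF M f openin_chart[OF N d(1)]] by (auto simp: A'_def)
  have "smooth_real M A' (\<lambda>p. u (f p))"
    by (rule smooth_real_compose_chart[OF M N d(1) _ smooth_mapD[OF M N f d(1)] u o]) (use A in \<open>auto simp: A'_def\<close>)
  then show "\<exists>B. p \<in> B \<and> B \<subseteq> A \<and> smooth_real M B (\<lambda>p. u (f p))"
    using p d AM by (intro exI[of _ A']) (auto simp: A'_def)
qed

lemma smooth_map_compose:
  assumes M: "smooth_atlas M" and N: "smooth_atlas N" and P: "smooth_atlas P"
    and f: "smooth_map M N f" and g: "smooth_map N P g"
  shows "smooth_map M P (\<lambda>p. g (f p))"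
proof (rule smooth_mapI[OF M P])
  fix p assume p: "p \<in> mcarrier M"
  then have "g (f p) \<in> mcarrier P" using smooth_map_carrier M N P f g by metis
  then obtain V m \<psi> where d: "(V, m, \<psi>) \<in> P" "g (f p) \<in> V" by (auto simp: mcarrier_iff)
  define B where "B = {q \<in> mcarrier N. g q \<in> V}"
  define A where "A = {p \<in> mcarrier M. f p \<in> B}"
  have A: "openin (atlas_topology M) A"
    unfolding A_def B_def by (intro smooth_map_vimage[OF M f] smooth_map_vimage[OF N g] openin_chart[OF P d(1)])
  have "smooth_real M A (\<lambda>p. \<psi> (g (f p)) j)" for j
    using smooth_real_pullback[OF M N f smooth_mapD[OF N P g d(1)] A] by (auto simp: A_def B_def)
  moreover have "p \<in> A" using p d smooth_map_carrier[OF M N f p] by (auto simp: A_def B_def)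
  ultimately show "\<exists>A V m \<psi>. openin (atlas_topology M) A \<and> p \<in> A \<and> (V, m, \<psi>) \<in> P \<and> (\<lambda>p. g (f p)) ` A \<subseteq> V \<and>
      (\<forall>j<m. smooth_real M A (\<lambda>p. \<psi> (g (f p)) j))"
    using A d(1) by (intro exI[of _ A] exI[of _ V] exI[of _ m] exI[of _ \<psi>]) (auto simp: A_def B_def)
qed

lemma smooth_map_ident: assumes M: "smooth_atlas M" shows "smooth_map M M (\<lambda>p. p)"
proof (rule smooth_mapI[OF M M])
  fix p assume "p \<in> mcarrier M"
  then obtain U n \<phi> where "(U, n, \<phi>) \<in> M" "p \<in> U" by (auto simp: mcarrier_iff)
  then show "\<exists>A V m \<psi>. openin (atlas_topology M) A \<and> p \<in> A \<and> (V, m, \<psi>) \<in> M \<and> (\<lambda>p. p) ` A \<subseteq> V \<and>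
      (\<forall>j<m. smooth_real M A (\<lambda>p. \<psi> p j))"
    using openin_chart[OF M] smooth_real_chart[OF M] by (intro exI[of _ U] exI[of _ n] exI[of _ \<phi>]) auto
qed

lemma smooth_map_cong:
  assumes M: "smooth_atlas M" and N: "smooth_atlas N" and f: "smooth_map M N f" and eq: "\<And>p. p \<in> mcarrier M \<Longrightarrow> f p = g p"
  shows "smooth_map M N g"
proof (rule smooth_mapI[OF M N])
  fix p assume p: "p \<in> mcarrier M"
  then have "f p \<in> mcarrier N" using smooth_map_carrier[OF M N f] by blast
  then obtain V m \<psi> where d: "(V, m, \<psi>) \<in> N" "f p \<in> V" by (auto simp: mcarrier_iff)
  define A where "A = {p \<in> mcarrier M. f p \<in> V}"
  have "smooth_real M A (\<lambda>p. \<psi> (g p) j)" for j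
    using smooth_mapD[OF M N f d(1)] smooth_real_cong[OF M, of A "\<lambda>p. \<psi> (f p) j" "\<lambda>p. \<psi> (g p) j"] eq
    by (simp add: A_def)
  then show "\<exists>A V m \<psi>. openin (atlas_topology M) A \<and> p \<in> A \<and> (V, m, \<psi>) \<in> N \<and> g ` A \<subseteq> V \<and>
      (\<forall>j<m. smooth_real M A (\<lambda>p. \<psi> (g p) j))"
    using d p eq smooth_map_vimage[OF M f openin_chart[OF N d(1)]]
    by (intro exI[of _ A] exI[of _ V] exI[of _ m] exI[of _ \<psi>]) (auto simp: A_def)
qed

text \<open>Repackages the existential premise of \<open>smooth_mapI\<close>, so that the open set
  and the chart are found by resolution.\<close>

lemma smooth_at_witness:
  "openin (atlas_topology M) A \<Longrightarrow> p \<in> A \<Longrightarrow> (V, m, \<psi>) \<in> N \<Longrightarrow> (\<And>q. q \<in> A \<Longrightarrow> f q \<in> V) \<Longrightarrow>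
    (\<And>j. j < m \<Longrightarrow> smooth_real M A (\<lambda>p. \<psi> (f p) j)) \<Longrightarrow>
    \<exists>A V m \<psi>. openin (atlas_topology M) A \<and> p \<in> A \<and> (V, m, \<psi>) \<in> N \<and> f ` A \<subseteq> V \<and>
      (\<forall>j<m. smooth_real M A (\<lambda>p. \<psi> (f p) j))"
  by (intro exI[of _ A] exI[of _ V] exI[of _ m] exI[of _ \<psi>]) auto

section \<open>Products\<close>

text \<open>Together with \<open>sndj\<close> the inverse of \<open>join\<close>. The first half is
  padded with zeros so as to land in \<open>Eu n\<close>.\<close>

definition fstj :: "nat \<Rightarrow> (nat \<Rightarrow> real) \<Rightarrow> nat \<Rightarrow> real" where
  "fstj n z = (\<lambda>i. if i < n then z i else 0)"

definition sndj :: "nat \<Rightarrow> (nat \<Rightarrow> real) \<Rightarrow> nat \<Rightarrow> real" where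
  "sndj n z = (\<lambda>i. z (n + i))"

definition jprod :: "nat \<Rightarrow> (nat \<Rightarrow> real) set \<Rightarrow> (nat \<Rightarrow> real) set \<Rightarrow> (nat \<Rightarrow> real) set" where
  "jprod n A B = (\<lambda>(x, y). join n x y) ` (A \<times> B)"

lemma fstj_join: "x \<in> Eu n \<Longrightarrow> fstj n (join n x y) = x"
  by (auto simp: fstj_def join_def topspace_Euclidean_space)

lemma sndj_join [simp]: "sndj n (join n x y) = y"
  by (auto simp: sndj_def join_def)

lemma join_fstj_sndj: "join n (fstj n z) (sndj n z) = z"
  by (auto simp: fstj_def sndj_def join_def)

lemma join_Eu: "x \<in> Eu n \<Longrightarrow> y \<in> Eu m \<Longrightarrow> join n x y \<in> Eu (n + m)"
  by (auto simp: join_def topspace_Euclidean_space)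

lemma fstj_Eu: "fstj n z \<in> Eu n"
  and sndj_Eu: "z \<in> Eu (n + m) \<Longrightarrow> sndj n z \<in> Eu m"
  by (auto simp: fstj_def sndj_def topspace_Euclidean_space)

lemma join_eq_iff: "x \<in> Eu n \<Longrightarrow> x' \<in> Eu n \<Longrightarrow> join n x y = join n x' y' \<longleftrightarrow> x = x' \<and> y = y'"
  by (metis fstj_join sndj_join)

lemma bij_betw_join:
  assumes "bij_betw \<phi> A (Eu n)" "bij_betw \<psi> B (Eu m)"
  shows "bij_betw (\<lambda>(e, e'). join n (\<phi> e) (\<psi> e')) (A \<times> B) (Eu (n + m))"
proof (rule bij_betw_imageI)
  show "inj_on (\<lambda>(e, e'). join n (\<phi> e) (\<psi> e')) (A \<times> B)"
  proof (rule inj_onI, clarify)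
    fix a b a' b' assume ab: "a \<in> A" "b \<in> B" "a' \<in> A" "b' \<in> B" "join n (\<phi> a) (\<psi> b) = join n (\<phi> a') (\<psi> b')"
    then have "\<phi> a \<in> Eu n" "\<phi> a' \<in> Eu n" using assms(1) by (auto dest: bij_betwE)
    with ab(5) have "\<phi> a = \<phi> a'" "\<psi> b = \<psi> b'" by (auto simp: join_eq_iff)
    then show "a = a' \<and> b = b'" using assms ab(1-4) by (auto simp: bij_betw_def dest: inj_onD)
  qed
  show "(\<lambda>(e, e'). join n (\<phi> e) (\<psi> e')) ` (A \<times> B) = Eu (n + m)"
  proof
    show "(\<lambda>(e, e'). join n (\<phi> e) (\<psi> e')) ` (A \<times> B) \<subseteq> Eu (n + m)"
      using assms by (auto intro!: join_Eu simp: bij_betw_def)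
    show "Eu (n + m) \<subseteq> (\<lambda>(e, e'). join n (\<phi> e) (\<psi> e')) ` (A \<times> B)"
    proof
      fix z assume "z \<in> Eu (n + m)"
      then have "fstj n z \<in> \<phi> ` A" "sndj n z \<in> \<psi> ` B"
        using assms fstj_Eu sndj_Eu by (auto simp: bij_betw_def)
      then obtain a b where "a \<in> A" "b \<in> B" "fstj n z = \<phi> a" "sndj n z = \<psi> b" by blast
      then have "z = (\<lambda>(e, e'). join n (\<phi> e) (\<psi> e')) (a, b)" using join_fstj_sndj[of n z] by simp
      with \<open>a \<in> A\<close> \<open>b \<in> B\<close> show "z \<in> (\<lambda>(e, e'). join n (\<phi> e) (\<psi> e')) ` (A \<times> B)" by blast
    qed
  qed
qed

text \<open>Inside \<open>Eu (n + m)\<close> the set is cut out by preimages under the two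
  continuous maps \<open>fstj n\<close> and \<open>sndj n\<close>.\<close>

lemma openin_jprod:
  assumes A: "openin (Euclidean_space n) A" and B: "openin (Euclidean_space m) B"
  shows "openin (Euclidean_space (n + m)) (jprod n A B)"
proof -
  obtain S T where S: "open S" "A = Eu n \<inter> S" and T: "open T" "B = Eu m \<inter> T"
    using A B by (auto simp: openin_Euclidean_space_iff)
  have "continuous_on UNIV (\<lambda>z. fstj n z i)" "continuous_on UNIV (\<lambda>z. sndj n z i)" for i
    by (cases "i < n"; simp add: fstj_def sndj_def)+
  then have "continuous_on UNIV (fstj n)" "continuous_on UNIV (sndj n)"
    by (simp_all add: continuous_on_coordinatewise_then_product)
  then have "open (fstj n -` S \<inter> sndj n -` T)"
    using S T by (intro open_Int) (metis open_vimage)+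
  moreover have "jprod n A B = Eu (n + m) \<inter> (fstj n -` S \<inter> sndj n -` T)"
  proof
    show "jprod n A B \<subseteq> Eu (n + m) \<inter> (fstj n -` S \<inter> sndj n -` T)"
      using S T by (auto simp: jprod_def join_Eu fstj_join)
    show "Eu (n + m) \<inter> (fstj n -` S \<inter> sndj n -` T) \<subseteq> jprod n A B"
    proof
      fix z assume z: "z \<in> Eu (n + m) \<inter> (fstj n -` S \<inter> sndj n -` T)"
      then have "(fstj n z, sndj n z) \<in> A \<times> B" using S T fstj_Eu sndj_Eu by auto
      then show "z \<in> jprod n A B" unfolding jprod_def using join_fstj_sndj[of n z] by force
    qed
  qed
  ultimately show ?thesis by (auto simp: openin_Euclidean_space_iff)
qed

lemma smooth_fun_fstj:
  assumes A: "openin (Euclidean_space n) A" and B: "openin (Euclidean_space m) B" and f: "smooth_fun n A f"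
  shows "smooth_fun (n + m) (jprod n A B) (\<lambda>z. f (fstj n z))"
proof (rule smooth_fun_compose[OF A openin_jprod[OF A B] _ _ f])
  show "fstj n z \<in> A" if "z \<in> jprod n A B" for z
    using that openin_subset[OF A] by (auto simp: jprod_def fstj_join)
  show "smooth_fun (n + m) (jprod n A B) (\<lambda>z. fstj n z i)" if "i < n" for i
    using that smooth_fun_coord[OF openin_jprod[OF A B]] by (simp add: fstj_def)
qed

lemma smooth_fun_sndj:
  assumes A: "openin (Euclidean_space n) A" and B: "openin (Euclidean_space m) B" and f: "smooth_fun m B f"
  shows "smooth_fun (n + m) (jprod n A B) (\<lambda>z. f (sndj n z))"
proof (rule smooth_fun_compose[OF B openin_jprod[OF A B] _ _ f])
  show "sndj n z \<in> B" if "z \<in> jprod n A B" for z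
    using that by (auto simp: jprod_def)
  show "smooth_fun (n + m) (jprod n A B) (\<lambda>z. sndj n z i)" for i
    using smooth_fun_coord[OF openin_jprod[OF A B]] by (simp add: sndj_def)
qed

lemma smooth_real_join:
  assumes "\<And>i. i < n \<Longrightarrow> smooth_real M A (\<lambda>p. a p i)" "\<And>i. i < m \<Longrightarrow> smooth_real M A (\<lambda>p. b p i)" "j < n + m"
  shows "smooth_real M A (\<lambda>p. join n (a p) (b p) j)"
  using assms by (cases "j < n") (auto simp: join_def)

lemma smooth_real_join_chart:
  assumes M: "smooth_atlas M" and c: "(C, k, \<kappa>) \<in> M" and eq: "\<And>q. q \<in> C \<Longrightarrow> \<kappa> q = join n (a q) (b q)"
  shows "i < n \<Longrightarrow> smooth_real M C (\<lambda>q. a q i)" "smooth_real M C (\<lambda>q. b q j)"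
proof -
  assume i: "i < n"
  have "smooth_real M C (\<lambda>q. \<kappa> q i) \<longleftrightarrow> smooth_real M C (\<lambda>q. a q i)"
    by (rule smooth_real_cong[OF M]) (use eq i in \<open>simp add: join_def\<close>)
  then show "smooth_real M C (\<lambda>q. a q i)" using smooth_real_chart[OF M c] by simp
next
  have "smooth_real M C (\<lambda>q. \<kappa> q (n + j)) \<longleftrightarrow> smooth_real M C (\<lambda>q. b q j)"
    by (rule smooth_real_cong[OF M]) (use eq in \<open>simp add: join_def\<close>)
  then show "smooth_real M C (\<lambda>q. b q j)" using smooth_real_chart[OF M c] by simp
qed

section \<open>Products of manifolds\<close>

lemma mem_prod_atlas:
  "(C, k, \<kappa>) \<in> prod_atlas M N \<longleftrightarrow> (\<exists>U n \<phi> V m \<psi>. (U, n, \<phi>) \<in> M \<and> (V, m, \<psi>) \<in> N \<and>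
     C = U \<times> V \<and> k = n + m \<and> \<kappa> = (\<lambda>(a, b). join n (\<phi> a) (\<psi> b)))"
  unfolding prod_atlas_def by blast

lemma mcarrier_prod_atlas: "mcarrier (prod_atlas M N) = mcarrier M \<times> mcarrier N"
proof (rule Set.set_eqI)
  fix p
  show "p \<in> mcarrier (prod_atlas M N) \<longleftrightarrow> p \<in> mcarrier M \<times> mcarrier N"
    unfolding mcarrier_iff mem_prod_atlas mem_Times_iff by (cases p) (simp, blast)
qed

lemma smooth_atlas_prod:
  assumes M: "smooth_atlas M" and N: "smooth_atlas N"
  shows "smooth_atlas (prod_atlas M N)"
  unfolding smooth_atlas_iff
proof (intro conjI allI impI)
  fix C k \<kappa> assume "(C, k, \<kappa>) \<in> prod_atlas M N"
  then obtain U n \<phi> V m \<psi> where c: "(U, n, \<phi>) \<in> M" "(V, m, \<psi>) \<in> N"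
    "C = U \<times> V" "k = n + m" "\<kappa> = (\<lambda>(a, b). join n (\<phi> a) (\<psi> b))"
    unfolding mem_prod_atlas by blast
  show "inj_on \<kappa> C"
    unfolding inj_on_def c(3,5)
    using join_eq_iff chart_Eu[OF M c(1)] inj_onD[OF chart_inj[OF M c(1)]] inj_onD[OF chart_inj[OF N c(2)]] by auto
  show "\<kappa> ` C \<subseteq> Eu k"
    unfolding c(3-5) using chart_Eu[OF M c(1)] chart_Eu[OF N c(2)] by (auto intro: join_Eu)
next
  fix C k \<kappa> C' k' \<kappa>' assume "(C, k, \<kappa>) \<in> prod_atlas M N" "(C', k', \<kappa>') \<in> prod_atlas M N"
  then obtain U n \<phi> V m \<psi> U' n' \<phi>' V' m' \<psi>' where c: "(U, n, \<phi>) \<in> M" "(V, m, \<psi>) \<in> N"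
    "C = U \<times> V" "k = n + m" "\<kappa> = (\<lambda>(a, b). join n (\<phi> a) (\<psi> b))"
    and c': "(U', n', \<phi>') \<in> M" "(V', m', \<psi>') \<in> N"
    "C' = U' \<times> V'" "k' = n' + m'" "\<kappa>' = (\<lambda>(a, b). join n' (\<phi>' a) (\<psi>' b))"
    unfolding mem_prod_atlas by blast
  define A where "A = \<phi> ` (U \<inter> U')"
  define B where "B = \<psi> ` (V \<inter> V')"
  have A: "openin (Euclidean_space n) A" and B: "openin (Euclidean_space m) B"
    unfolding A_def B_def
    using openin_chart_image[OF M openin_chart[OF M c'(1)] c(1)] openin_chart_image[OF N openin_chart[OF N c'(2)] c(2)] by simp_all
  have im: "\<kappa> ` (C \<inter> C') = jprod n A B"
    unfolding c c' jprod_def A_def B_def by force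
  show "openin (Euclidean_space k) (\<kappa> ` (C \<inter> C'))"
    unfolding im c(4) using openin_jprod[OF A B] .
  fix j assume j: "j < k'"
  \<comment> \<open>The inverse of a product chart is computed on the two halves of \<open>z\<close>
    separately; this turns the transition function into a \<open>join\<close> of the two given
    transitions.\<close>
  have inv: "inv_into C \<kappa> z = (inv_into U \<phi> (fstj n z), inv_into V \<psi> (sndj n z))" if z: "z \<in> jprod n A B" for z
  proof -
    from z obtain a b where ab: "a \<in> U" "b \<in> V" "z = join n (\<phi> a) (\<psi> b)"
      by (auto simp: jprod_def A_def B_def)
    have "inj_on \<kappa> C"
      unfolding inj_on_def c(3,5)
      using join_eq_iff chart_Eu[OF M c(1)] inj_onD[OF chart_inj[OF M c(1)]] inj_onD[OF chart_inj[OF N c(2)]] by auto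
    moreover have "z = \<kappa> (a, b)" "(a, b) \<in> C" using ab c by auto
    ultimately have "inv_into C \<kappa> z = (a, b)" by simp
    then show ?thesis using ab chart_Eu[OF M c(1)] chart_inv[OF M c(1)] chart_inv[OF N c(2)] by (simp add: fstj_join)
  qed
  have s1: "smooth_fun n A (\<lambda>x. \<phi>' (inv_into U \<phi> x) i)" for i
    using smooth_real_chart[OF M c'(1)] c(1) by (simp add: A_def smooth_real_def)
  have s2: "smooth_fun m B (\<lambda>x. \<psi>' (inv_into V \<psi> x) i)" for i
    using smooth_real_chart[OF N c'(2)] c(2) by (simp add: B_def smooth_real_def)
  have "smooth_fun (n + m) (jprod n A B) (\<lambda>z. join n' (\<phi>' (inv_into U \<phi> (fstj n z))) (\<psi>' (inv_into V \<psi> (sndj n z))) j)"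
    unfolding join_def using smooth_fun_fstj[OF A B s1] smooth_fun_sndj[OF A B s2] by (cases "j < n'") simp_all
  then show "smooth_fun k (\<kappa> ` (C \<inter> C')) (\<lambda>x. \<kappa>' (inv_into C \<kappa> x) j)"
    unfolding im c(4) by (subst smooth_fun_cong[OF openin_jprod[OF A B]]) (auto simp: inv c')
qed

lemma smooth_map_fst:
  assumes M: "smooth_atlas M" and N: "smooth_atlas N"
  shows "smooth_map (prod_atlas M N) M fst"
proof (rule smooth_mapI[OF smooth_atlas_prod[OF M N] M])
  fix p assume "p \<in> mcarrier (prod_atlas M N)"
  then obtain U n \<phi> V m \<psi> where c: "(U, n, \<phi>) \<in> M" "(V, m, \<psi>) \<in> N" "p \<in> U \<times> V"
    unfolding mcarrier_prod_atlas mem_Times_iff mcarrier_iff by blast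
  then have d: "(U \<times> V, n + m, \<lambda>(a, b). join n (\<phi> a) (\<psi> b)) \<in> prod_atlas M N"
    unfolding mem_prod_atlas by blast
  show "\<exists>A V m \<psi>. openin (atlas_topology (prod_atlas M N)) A \<and> p \<in> A \<and> (V, m, \<psi>) \<in> M \<and> fst ` A \<subseteq> V \<and>
      (\<forall>j<m. smooth_real (prod_atlas M N) A (\<lambda>p. \<psi> (fst p) j))"
    by (rule smooth_at_witness[OF openin_chart[OF smooth_atlas_prod[OF M N] d] c(3) c(1)])
       (auto intro!: smooth_real_join_chart(1)[OF smooth_atlas_prod[OF M N] d, where b = "\<lambda>q. \<psi> (snd q)" and n = n])
qed

lemma smooth_map_snd:
  assumes M: "smooth_atlas M" and N: "smooth_atlas N"
  shows "smooth_map (prod_atlas M N) N snd"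
proof (rule smooth_mapI[OF smooth_atlas_prod[OF M N] N])
  fix p assume "p \<in> mcarrier (prod_atlas M N)"
  then obtain U n \<phi> V m \<psi> where c: "(U, n, \<phi>) \<in> M" "(V, m, \<psi>) \<in> N" "p \<in> U \<times> V"
    unfolding mcarrier_prod_atlas mem_Times_iff mcarrier_iff by blast
  then have d: "(U \<times> V, n + m, \<lambda>(a, b). join n (\<phi> a) (\<psi> b)) \<in> prod_atlas M N"
    unfolding mem_prod_atlas by blast
  show "\<exists>A V m \<psi>. openin (atlas_topology (prod_atlas M N)) A \<and> p \<in> A \<and> (V, m, \<psi>) \<in> N \<and> snd ` A \<subseteq> V \<and>
      (\<forall>j<m. smooth_real (prod_atlas M N) A (\<lambda>p. \<psi> (snd p) j))"
    by (rule smooth_at_witness[OF openin_chart[OF smooth_atlas_prod[OF M N] d] c(3) c(2)])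
       (auto intro!: smooth_real_join_chart(2)[OF smooth_atlas_prod[OF M N] d, where a = "\<lambda>q. \<phi> (fst q)" and n = n])
qed

lemma smooth_map_pair:
  assumes L: "smooth_atlas L" and M: "smooth_atlas M" and N: "smooth_atlas N"
    and f: "smooth_map L M f" and g: "smooth_map L N g"
  shows "smooth_map L (prod_atlas M N) (\<lambda>p. (f p, g p))"
proof (rule smooth_mapI[OF L smooth_atlas_prod[OF M N]])
  fix p assume p: "p \<in> mcarrier L"
  have "f p \<in> mcarrier M" "g p \<in> mcarrier N"
    using smooth_map_carrier[OF L M f p] smooth_map_carrier[OF L N g p] by auto
  then obtain U n \<phi> V m \<psi> where c: "(U, n, \<phi>) \<in> M" "(V, m, \<psi>) \<in> N" "f p \<in> U" "g p \<in> V"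
    unfolding mcarrier_iff by blast
  then have d: "(U \<times> V, n + m, \<lambda>(a, b). join n (\<phi> a) (\<psi> b)) \<in> prod_atlas M N"
    unfolding mem_prod_atlas by blast
  define A where "A = {p \<in> mcarrier L. f p \<in> U} \<inter> {p \<in> mcarrier L. g p \<in> V}"
  have A: "openin (atlas_topology L) A"
    unfolding A_def
    by (intro openin_Int smooth_map_vimage[OF L f] smooth_map_vimage[OF L g] openin_chart[OF M c(1)] openin_chart[OF N c(2)])
  have "smooth_real L A (\<lambda>p. \<phi> (f p) i)" for i
    by (rule smooth_real_mono[OF L A _ smooth_mapD[OF L M f c(1)]]) (auto simp: A_def)
  moreover have "smooth_real L A (\<lambda>p. \<psi> (g p) i)" for i
    by (rule smooth_real_mono[OF L A _ smooth_mapD[OF L N g c(2)]]) (auto simp: A_def)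
  ultimately have "smooth_real L A (\<lambda>p. join n (\<phi> (f p)) (\<psi> (g p)) j)" if "j < n + m" for j
    using that by (rule smooth_real_join)
  then show "\<exists>A V m \<psi>. openin (atlas_topology L) A \<and> p \<in> A \<and> (V, m, \<psi>) \<in> prod_atlas M N \<and> (\<lambda>p. (f p, g p)) ` A \<subseteq> V \<and>
      (\<forall>j<m. smooth_real L A (\<lambda>p. \<psi> (f p, g p) j))"
    using p c by (intro smooth_at_witness[OF A _ d]) (auto simp: A_def)
qed

lemma openin_prod_atlas:
  assumes M: "smooth_atlas M" and N: "smooth_atlas N"
    and A: "openin (atlas_topology M) A" and B: "openin (atlas_topology N) B"
  shows "openin (atlas_topology (prod_atlas M N)) (A \<times> B)"
proof -
  have "A \<subseteq> mcarrier M" "B \<subseteq> mcarrier N" using A B openin_atlas_iff M N by blast+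
  then have "A \<times> B = {p \<in> mcarrier (prod_atlas M N). fst p \<in> A} \<inter> {p \<in> mcarrier (prod_atlas M N). snd p \<in> B}"
    by (auto simp: mcarrier_prod_atlas)
  then show ?thesis
    using smooth_map_vimage[OF smooth_atlas_prod[OF M N] smooth_map_fst[OF M N] A]
      smooth_map_vimage[OF smooth_atlas_prod[OF M N] smooth_map_snd[OF M N] B] by (simp add: openin_Int)
qed

section \<open>Vector bundles\<close>

definition trivialization :: "('e, 'x) vbundle \<Rightarrow> 'x set \<Rightarrow> nat \<Rightarrow> ('e \<Rightarrow> nat \<Rightarrow> real) \<Rightarrow> bool" where
  "trivialization E U n \<phi> \<longleftrightarrow>
     (\<forall>x\<in>U. bij_betw \<phi> (fibre E x) (Eu n) \<and>
       (\<forall>e\<in>fibre E x. \<forall>e'\<in>fibre E x. vadd E e e' \<in> fibre E x \<and> \<phi> (vadd E e e') = (\<lambda>i. \<phi> e i + \<phi> e' i)) \<and>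
       (\<forall>c. \<forall>e\<in>fibre E x. vscale E c e \<in> fibre E x \<and> \<phi> (vscale E c e) = (\<lambda>i. c * \<phi> e i)))"

text \<open>The conditions of \<open>vector_bundle\<close> that can be checked fibre by fibre or in
  the topology of the base; what remains is the smooth compatibility of the charts of the total
  space.\<close>

definition prebundle :: "'x atlas \<Rightarrow> ('e, 'x) vbundle \<Rightarrow> bool" where
  "prebundle X E \<longleftrightarrow>
     vproj E ` vcarrier E \<subseteq> mcarrier X \<and>
     (\<forall>x\<in>mcarrier X. \<exists>U n \<phi>. (U, n, \<phi>) \<in> vtriv E \<and> x \<in> U) \<and>
     (\<forall>U n \<phi>. (U, n, \<phi>) \<in> vtriv E \<longrightarrow> openin (atlas_topology X) U \<and> trivialization E U n \<phi>)"

lemma vector_bundle_iff_prebundle: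
  assumes X: "smooth_atlas X"
  shows "vector_bundle X E \<longleftrightarrow> prebundle X E \<and> smooth_atlas (total_space X E)"
proof -
  have *: "(\<Union>(U, n, \<phi>)\<in>vtriv E. U) = mcarrier X \<longleftrightarrow> (\<forall>x\<in>mcarrier X. \<exists>U n \<phi>. (U, n, \<phi>) \<in> vtriv E \<and> x \<in> U)"
    if "\<forall>(U, n, \<phi>)\<in>vtriv E. openin (atlas_topology X) U"
  proof
    assume "(\<Union>(U, n, \<phi>)\<in>vtriv E. U) = mcarrier X"
    then show "\<forall>x\<in>mcarrier X. \<exists>U n \<phi>. (U, n, \<phi>) \<in> vtriv E \<and> x \<in> U"
      by (fastforce simp only: UN_iff Bex_def split_paired_Ex prod.case)
  next
    assume "\<forall>x\<in>mcarrier X. \<exists>U n \<phi>. (U, n, \<phi>) \<in> vtriv E \<and> x \<in> U"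
    then have "mcarrier X \<subseteq> (\<Union>(U, n, \<phi>)\<in>vtriv E. U)" by fastforce
    moreover have "(\<Union>(U, n, \<phi>)\<in>vtriv E. U) \<subseteq> mcarrier X"
      using that openin_atlas_iff[OF X] by fastforce
    ultimately show "(\<Union>(U, n, \<phi>)\<in>vtriv E. U) = mcarrier X" by blast
  qed
  have "vector_bundle X E \<longleftrightarrow> vproj E ` vcarrier E \<subseteq> mcarrier X \<and> (\<Union>(U, n, \<phi>)\<in>vtriv E. U) = mcarrier X \<and>
      (\<forall>(U, n, \<phi>)\<in>vtriv E. openin (atlas_topology X) U \<and> trivialization E U n \<phi>) \<and> smooth_atlas (total_space X E)"
    unfolding vector_bundle_def trivialization_def ..
  also have "\<dots> \<longleftrightarrow> vproj E ` vcarrier E \<subseteq> mcarrier X \<and> (\<forall>x\<in>mcarrier X. \<exists>U n \<phi>. (U, n, \<phi>) \<in> vtriv E \<and> x \<in> U) \<and>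
      (\<forall>(U, n, \<phi>)\<in>vtriv E. openin (atlas_topology X) U \<and> trivialization E U n \<phi>) \<and> smooth_atlas (total_space X E)"
  proof -
    have "\<forall>(U, n, \<phi>)\<in>vtriv E. openin (atlas_topology X) U"
      if "\<forall>(U, n, \<phi>)\<in>vtriv E. openin (atlas_topology X) U \<and> trivialization E U n \<phi>"
      using that by auto
    with * show ?thesis by argo
  qed
  also have "\<dots> \<longleftrightarrow> prebundle X E \<and> smooth_atlas (total_space X E)"
    by (simp add: prebundle_def Ball_def)
  finally show ?thesis .
qed

lemma fibre_iff: "e \<in> fibre E x \<longleftrightarrow> e \<in> vcarrier E \<and> vproj E e = x"
  by (simp add: fibre_def)

context
  fixes E :: "('e, 'x) vbundle" and U n \<phi> x
  assumes triv: "trivialization E U n \<phi>" and x: "x \<in> U"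
begin

lemma triv_bij: "bij_betw \<phi> (fibre E x) (Eu n)"
  and triv_add: "e \<in> fibre E x \<Longrightarrow> e' \<in> fibre E x \<Longrightarrow> \<phi> (vadd E e e') = (\<lambda>i. \<phi> e i + \<phi> e' i)"
  and triv_scale: "e \<in> fibre E x \<Longrightarrow> \<phi> (vscale E c e) = (\<lambda>i. c * \<phi> e i)"
  and fibre_add: "e \<in> fibre E x \<Longrightarrow> e' \<in> fibre E x \<Longrightarrow> vadd E e e' \<in> fibre E x"
  and fibre_scale: "e \<in> fibre E x \<Longrightarrow> vscale E c e \<in> fibre E x"
  using triv x unfolding trivialization_def by blast+

lemma triv_Eu: "e \<in> fibre E x \<Longrightarrow> \<phi> e \<in> Eu n"
  using triv_bij by (auto dest: bij_betwE)

lemma triv_inj: "e \<in> fibre E x \<Longrightarrow> e' \<in> fibre E x \<Longrightarrow> \<phi> e = \<phi> e' \<Longrightarrow> e = e'"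
  using triv_bij by (auto simp: bij_betw_def dest: inj_onD)

lemma triv_inv: "v \<in> Eu n \<Longrightarrow> inv_into (fibre E x) \<phi> v \<in> fibre E x"
  "v \<in> Eu n \<Longrightarrow> \<phi> (inv_into (fibre E x) \<phi> v) = v"
  using triv_bij by (auto simp: bij_betw_def inv_into_into f_inv_into_f)

end

definition uvec :: "nat \<Rightarrow> nat \<Rightarrow> real" where
  "uvec i = (\<lambda>k. if k = i then 1 else 0)"

lemma uvec_Eu: "i < n \<Longrightarrow> uvec i \<in> Eu n"
  by (auto simp: uvec_def topspace_Euclidean_space)

text \<open>The columns of the matrix are the \<psi>-coordinates of the basis vectors that
  \<open>\<phi>\<close> identifies with the \<open>uvec i\<close>. As fibres come with
  \<open>vadd\<close> and \<open>vscale\<close> only, no linear combination is formed inside the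
  fibre; the coordinates of \<open>e\<close> are cleared one at a time, starting from the
  last.\<close>

lemma triv_change:
  assumes \<phi>: "trivialization E U n \<phi>" "x \<in> U" and \<psi>: "trivialization E V m \<psi>" "x \<in> V" and e: "e \<in> fibre E x"
  shows "\<psi> e j = (\<Sum>i<n. \<psi> (inv_into (fibre E x) \<phi> (uvec i)) j * \<phi> e i)"
proof -
  define b where "b = (\<lambda>i. inv_into (fibre E x) \<phi> (uvec i))"
  have b: "b i \<in> fibre E x" "\<phi> (b i) = uvec i" if "i < n" for i
    unfolding b_def using triv_inv[OF \<phi> uvec_Eu[OF that]] by auto
  have "\<psi> e j = (\<Sum>i<k. \<psi> (b i) j * \<phi> e i)" if "k \<le> n" "e \<in> fibre E x" "\<And>i. i \<ge> k \<Longrightarrow> \<phi> e i = 0" for k e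
    using that
  proof (induction k arbitrary: e)
    case 0
    \<comment> \<open>A vector without nonzero coordinates equals its own multiple by 0, and every
      trivialization sends that multiple to 0. This avoids naming a zero vector of the
      fibre.\<close>
    have "\<phi> (vscale E 0 e) = \<phi> e" using 0 by (simp add: triv_scale[OF \<phi>] fun_eq_iff)
    then have "vscale E 0 e = e" using triv_inj[OF \<phi>] fibre_scale[OF \<phi>] 0 by blast
    then show ?case using triv_scale[OF \<psi> 0(2), of 0] by simp
  next
    case (Suc k)
    \<comment> \<open>Subtracts the \<open>k\<close>-th component, so that \<open>e'\<close> has
      coordinates below \<open>k\<close> only and falls under the induction hypothesis.\<close>
    define e' where "e' = vadd E e (vscale E (- \<phi> e k) (b k))"
    have bk: "b k \<in> fibre E x" "\<phi> (b k) = uvec k" using b Suc.prems(1) by auto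
    have e': "e' \<in> fibre E x"
      unfolding e'_def by (intro fibre_add[OF \<phi>] fibre_scale[OF \<phi>] Suc.prems bk)
    have \<phi>e': "\<phi> e' i = \<phi> e i - \<phi> e k * uvec k i" for i
      unfolding e'_def using Suc.prems(2) bk by (simp add: triv_add[OF \<phi>] triv_scale[OF \<phi>] fibre_scale[OF \<phi>])
    have \<psi>e': "\<psi> e' j = \<psi> e j - \<phi> e k * \<psi> (b k) j"
      unfolding e'_def using Suc.prems(2) bk by (simp add: triv_add[OF \<psi>] triv_scale[OF \<psi>] fibre_scale[OF \<phi>])
    have "\<psi> e' j = (\<Sum>i<k. \<psi> (b i) j * \<phi> e' i)"
      by (rule Suc.IH) (use Suc.prems e' in \<open>auto simp: \<phi>e' uvec_def Suc_le_eq\<close>)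
    also have "\<dots> = (\<Sum>i<k. \<psi> (b i) j * \<phi> e i)"
      by (rule sum.cong) (auto simp: \<phi>e' uvec_def)
    finally show ?case using \<psi>e' by (simp add: algebra_simps)
  qed
  moreover have "\<phi> e i = 0" if "i \<ge> n" for i
    using triv_Eu[OF \<phi> e] that by (simp add: topspace_Euclidean_space)
  ultimately show ?thesis using e unfolding b_def by blast
qed

section \<open>Charts of the total space and transition matrices\<close>

lemma mem_total_space:
  "(C, l, \<kappa>) \<in> total_space X E \<longleftrightarrow> (\<exists>W k \<xi> U n \<phi>. (W, k, \<xi>) \<in> X \<and> (U, n, \<phi>) \<in> vtriv E \<and>
     C = {e \<in> vcarrier E. vproj E e \<in> W \<inter> U} \<and> l = k + n \<and> \<kappa> = (\<lambda>e. join k (\<xi> (vproj E e)) (\<phi> e)))"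
  unfolding total_space_def by blast

text \<open>In the charts of the total space a coordinate change is a base transition joined with a
  matrix applied to the fibre coordinates. The second part is linear in these coordinates with
  smooth coefficients, hence smooth.\<close>

lemma vector_bundleI:
  assumes X: "smooth_atlas X" and E: "prebundle X E"
    and trans: "\<And>U n \<phi> V m \<psi>. (U, n, \<phi>) \<in> vtriv E \<Longrightarrow> (V, m, \<psi>) \<in> vtriv E \<Longrightarrow>
      \<exists>a. (\<forall>j<m. \<forall>i<n. smooth_real X (U \<inter> V) (a j i)) \<and>
        (\<forall>e\<in>vcarrier E. vproj E e \<in> U \<inter> V \<longrightarrow> (\<forall>j<m. \<psi> e j = (\<Sum>i<n. a j i (vproj E e) * \<phi> e i)))"
  shows "vector_bundle X E"
  unfolding vector_bundle_iff_prebundle[OF X]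
proof (intro conjI E)
  have triv: "trivialization E U n \<phi>" "openin (atlas_topology X) U" if "(U, n, \<phi>) \<in> vtriv E" for U n \<phi>
    using that E unfolding prebundle_def by auto
  have inj: "inj_on (\<lambda>e. join k (\<xi> (vproj E e)) (\<phi> e)) {e \<in> vcarrier E. vproj E e \<in> W \<inter> U}"
    if W: "(W, k, \<xi>) \<in> X" and U: "(U, n, \<phi>) \<in> vtriv E" for W k \<xi> U n \<phi>
  proof (rule inj_onI, clarify)
    fix e e' assume e: "e \<in> vcarrier E" "vproj E e \<in> W" "vproj E e \<in> U" and e': "e' \<in> vcarrier E" "vproj E e' \<in> W" "vproj E e' \<in> U"
      and eq: "join k (\<xi> (vproj E e)) (\<phi> e) = join k (\<xi> (vproj E e')) (\<phi> e')"
    from eq have eq: "\<xi> (vproj E e) = \<xi> (vproj E e')" "\<phi> e = \<phi> e'"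
      using join_eq_iff chart_Eu[OF X W e(2)] chart_Eu[OF X W e'(2)] by auto
    from eq(1) have "vproj E e = vproj E e'" using inj_onD[OF chart_inj[OF X W]] e e' by blast
    then show "e = e'" using triv_inj[OF triv(1)[OF U] e(3)] e e' eq(2) by (simp add: fibre_iff)
  qed
  show "smooth_atlas (total_space X E)"
    unfolding smooth_atlas_iff
  proof (intro conjI allI impI)
    fix C l \<kappa> assume "(C, l, \<kappa>) \<in> total_space X E"
    then obtain W k \<xi> U n \<phi> where c: "(W, k, \<xi>) \<in> X" "(U, n, \<phi>) \<in> vtriv E"
      "C = {e \<in> vcarrier E. vproj E e \<in> W \<inter> U}" "l = k + n" "\<kappa> = (\<lambda>e. join k (\<xi> (vproj E e)) (\<phi> e))"
      unfolding mem_total_space by blast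
    show "inj_on \<kappa> C" unfolding c(3,5) by (rule inj[OF c(1,2)])
    show "\<kappa> ` C \<subseteq> Eu l"
      unfolding c(3-5) using chart_Eu[OF X c(1)] triv_Eu[OF triv(1)[OF c(2)]] by (auto intro!: join_Eu simp: fibre_iff)
  next
    fix C l \<kappa> C' l' \<kappa>' assume "(C, l, \<kappa>) \<in> total_space X E" "(C', l', \<kappa>') \<in> total_space X E"
    then obtain W k \<xi> U n \<phi> W' k' \<xi>' V m \<psi> where c: "(W, k, \<xi>) \<in> X" "(U, n, \<phi>) \<in> vtriv E"
      "C = {e \<in> vcarrier E. vproj E e \<in> W \<inter> U}" "l = k + n" "\<kappa> = (\<lambda>e. join k (\<xi> (vproj E e)) (\<phi> e))"
      and c': "(W', k', \<xi>') \<in> X" "(V, m, \<psi>) \<in> vtriv E"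
      "C' = {e \<in> vcarrier E. vproj E e \<in> W' \<inter> V}" "l' = k' + m" "\<kappa>' = (\<lambda>e. join k' (\<xi>' (vproj E e)) (\<psi> e))"
      unfolding mem_total_space by blast
    define O' where "O' = W' \<inter> (U \<inter> V)"
    have O': "openin (atlas_topology X) O'"
      unfolding O'_def using openin_chart[OF X c'(1)] triv(2)[OF c(2)] triv(2)[OF c'(2)] by blast
    define A where "A = \<xi> ` (W \<inter> O')"
    have A: "openin (Euclidean_space k) A" unfolding A_def by (rule openin_chart_image[OF X O' c(1)])
    have En: "openin (Euclidean_space n) (Eu n)" by simp
    \<comment> \<open>The overlap of two charts contains whole fibres, so its image is an open set
      of the base times all of \<real>^n; surjectivity in the fibre direction comes from the
      fibrewise bijection.\<close>
    have im: "\<kappa> ` (C \<inter> C') = jprod k A (Eu n)"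
    proof
      show "\<kappa> ` (C \<inter> C') \<subseteq> jprod k A (Eu n)"
        unfolding c c' jprod_def A_def O'_def using triv_Eu[OF triv(1)[OF c(2)]] by (auto simp: fibre_iff)
      show "jprod k A (Eu n) \<subseteq> \<kappa> ` (C \<inter> C')"
      proof
        fix z assume "z \<in> jprod k A (Eu n)"
        then obtain p v where p: "p \<in> W" "p \<in> O'" "v \<in> Eu n" "z = join k (\<xi> p) v"
          by (auto simp: jprod_def A_def)
        then have pU: "p \<in> U" by (simp add: O'_def)
        define e where "e = inv_into (fibre E p) \<phi> v"
        have "e \<in> fibre E p" "\<phi> e = v" unfolding e_def using triv_inv[OF triv(1)[OF c(2)] pU p(3)] by auto
        then show "z \<in> \<kappa> ` (C \<inter> C')"
          using p unfolding c c' O'_def by (auto simp: fibre_iff image_iff)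
      qed
    qed
    show "openin (Euclidean_space l) (\<kappa> ` (C \<inter> C'))"
      unfolding im c(4) by (rule openin_jprod[OF A En])
    fix j assume j: "j < l'"
    obtain a where a: "\<And>j i. j < m \<Longrightarrow> i < n \<Longrightarrow> smooth_real X (U \<inter> V) (a j i)"
      "\<And>e j. e \<in> vcarrier E \<Longrightarrow> vproj E e \<in> U \<inter> V \<Longrightarrow> j < m \<Longrightarrow> \<psi> e j = (\<Sum>i<n. a j i (vproj E e) * \<phi> e i)"
    proof -
      from trans[OF c(2) c'(2)] obtain a where "(\<forall>j<m. \<forall>i<n. smooth_real X (U \<inter> V) (a j i)) \<and>
        (\<forall>e\<in>vcarrier E. vproj E e \<in> U \<inter> V \<longrightarrow> (\<forall>j<m. \<psi> e j = (\<Sum>i<n. a j i (vproj E e) * \<phi> e i)))" ..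
      then show thesis by (intro that[of a]) simp_all
    qed
    \<comment> \<open>The \<open>j\<close>-th coordinate of the transition as an explicit formula:
      the first half of \<open>z\<close> determines the base point, the second half is the vector to
      which the matrix is applied.\<close>
    define h where "h = (\<lambda>z. join k' (\<xi>' (inv_into W \<xi> (fstj k z))) (\<lambda>j. \<Sum>i<n. a j i (inv_into W \<xi> (fstj k z)) * sndj k z i) j)"
    have O1: "openin (Euclidean_space (k + n)) (jprod k A (Eu n))" by (rule openin_jprod[OF A En])
    have "smooth_fun (k + n) (jprod k A (Eu n)) h"
    proof (cases "j < k'")
      case True
      have "smooth_real X O' (\<lambda>p. \<xi>' p j)"
        by (rule smooth_real_mono[OF X O' _ smooth_real_chart[OF X c'(1)]]) (auto simp: O'_def)
      then have "smooth_fun k A (\<lambda>x. \<xi>' (inv_into W \<xi> x) j)" using c(1) by (simp add: smooth_real_def A_def)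
      from smooth_fun_fstj[OF A En this] show ?thesis using True by (simp add: h_def join_def)
    next
      case False
      have "smooth_fun (k + n) (jprod k A (Eu n)) (\<lambda>z. a (j - k') i (inv_into W \<xi> (fstj k z)))" if "i < n" for i
      proof -
        have "j - k' < m" using j False c'(4) by auto
        then have "smooth_real X O' (a (j - k') i)"
          by (intro smooth_real_mono[OF X O' _ a(1)[OF _ that]]) (auto simp: O'_def)
        then have "smooth_fun k A (\<lambda>x. a (j - k') i (inv_into W \<xi> x))" using c(1) by (simp add: smooth_real_def A_def)
        from smooth_fun_fstj[OF A En this] show ?thesis .
      qed
      moreover have "smooth_fun (k + n) (jprod k A (Eu n)) (\<lambda>z. sndj k z i)" for i
        using smooth_fun_coord[OF O1] by (simp add: sndj_def)
      ultimately have "smooth_fun (k + n) (jprod k A (Eu n)) (\<lambda>z. \<Sum>i<n. a (j - k') i (inv_into W \<xi> (fstj k z)) * sndj k z i)"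
        by (intro smooth_fun_sum[OF O1] smooth_fun_mult[OF O1]) auto
      then show ?thesis using False by (simp add: h_def join_def)
    qed
    moreover have "\<kappa>' (inv_into C \<kappa> z) j = h z" if z: "z \<in> jprod k A (Eu n)" for z
    proof -
      from z obtain e where e: "e \<in> C" "e \<in> C'" "z = \<kappa> e" using im by blast
      have "inj_on \<kappa> C" unfolding c(3,5) by (rule inj[OF c(1,2)])
      then have 1: "inv_into C \<kappa> z = e" using e by simp
      have W: "vproj E e \<in> W" using e(1) by (simp add: c)
      have 2: "inv_into W \<xi> (fstj k z) = vproj E e" "sndj k z = \<phi> e"
        using chart_Eu[OF X c(1) W] chart_inv[OF X c(1) W] by (simp_all add: e(3) c(5) fstj_join)
      have "\<psi> e i = (\<Sum>i'<n. a i i' (vproj E e) * \<phi> e i')" if "i < m" for i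
        using e that by (intro a(2)) (auto simp: c c')
      then show ?thesis unfolding 1 h_def 2 c'(5) using j c'(4) by (auto simp: join_def)
    qed
    ultimately show "smooth_fun l (\<kappa> ` (C \<inter> C')) (\<lambda>x. \<kappa>' (inv_into C \<kappa> x) j)"
      unfolding im c(4) by (subst smooth_fun_cong[OF O1]) auto
  qed
qed

locale vec_bundle =
  fixes X :: "'x atlas" and E :: "('e, 'x) vbundle"
  assumes X: "smooth_atlas X" and E: "vector_bundle X E"
begin

abbreviation "TS \<equiv> total_space X E"

lemma pre: "prebundle X E" and TS: "smooth_atlas TS"
  using E vector_bundle_iff_prebundle[OF X] by auto

lemma vproj_in: "e \<in> vcarrier E \<Longrightarrow> vproj E e \<in> mcarrier X"
  using pre by (auto simp: prebundle_def)

lemma triv_cover: "x \<in> mcarrier X \<Longrightarrow> \<exists>U n \<phi>. (U, n, \<phi>) \<in> vtriv E \<and> x \<in> U"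
  using pre by (auto simp: prebundle_def)

lemma triv_open: "(U, n, \<phi>) \<in> vtriv E \<Longrightarrow> openin (atlas_topology X) U"
  and triv_triv: "(U, n, \<phi>) \<in> vtriv E \<Longrightarrow> trivialization E U n \<phi>"
  using pre by (auto simp: prebundle_def)

lemma triv_subset: "(U, n, \<phi>) \<in> vtriv E \<Longrightarrow> U \<subseteq> mcarrier X"
  using triv_open openin_atlas_iff[OF X] by blast

lemma mcarrier_TS: "mcarrier TS = vcarrier E"
proof (rule Set.set_eqI)
  fix e
  show "e \<in> mcarrier TS \<longleftrightarrow> e \<in> vcarrier E"
  proof
    assume "e \<in> mcarrier TS"
    then show "e \<in> vcarrier E" unfolding mcarrier_iff mem_total_space by blast
  next
    assume e: "e \<in> vcarrier E"
    from vproj_in[OF e] obtain W k \<xi> where W: "(W, k, \<xi>) \<in> X" "vproj E e \<in> W" unfolding mcarrier_iff by blast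
    from triv_cover[OF vproj_in[OF e]] obtain U n \<phi> where U: "(U, n, \<phi>) \<in> vtriv E" "vproj E e \<in> U" by blast
    show "e \<in> mcarrier TS" unfolding mcarrier_iff mem_total_space using e W U by blast
  qed
qed

lemma TS_chart:
  "(W, k, \<xi>) \<in> X \<Longrightarrow> (U, n, \<phi>) \<in> vtriv E \<Longrightarrow>
    ({e \<in> vcarrier E. vproj E e \<in> W \<inter> U}, k + n, \<lambda>e. join k (\<xi> (vproj E e)) (\<phi> e)) \<in> TS"
  unfolding mem_total_space by blast

lemma smooth_vproj: "smooth_map TS X (vproj E)"
proof (rule smooth_mapI[OF TS X])
  fix e assume "e \<in> mcarrier TS"
  then have e: "e \<in> vcarrier E" by (simp add: mcarrier_TS)
  from vproj_in[OF e] obtain W k \<xi> where W: "(W, k, \<xi>) \<in> X" "vproj E e \<in> W" unfolding mcarrier_iff by blast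
  from triv_cover[OF vproj_in[OF e]] obtain U n \<phi> where U: "(U, n, \<phi>) \<in> vtriv E" "vproj E e \<in> U" by blast
  note c = TS_chart[OF W(1) U(1)]
  show "\<exists>A V m \<psi>. openin (atlas_topology TS) A \<and> e \<in> A \<and> (V, m, \<psi>) \<in> X \<and> vproj E ` A \<subseteq> V \<and>
      (\<forall>j<m. smooth_real TS A (\<lambda>p. \<psi> (vproj E p) j))"
  proof (rule smooth_at_witness[OF openin_chart[OF TS c] _ W(1)])
    show "smooth_real TS {e \<in> vcarrier E. vproj E e \<in> W \<inter> U} (\<lambda>e. \<xi> (vproj E e) j)" if "j < k" for j
      by (rule smooth_real_join_chart(1)[OF TS c refl that])
  qed (use e W U in auto)
qed

lemma openin_TS_over:
  assumes "openin (atlas_topology X) A"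
  shows "openin (atlas_topology TS) {e \<in> vcarrier E. vproj E e \<in> A}"
  using smooth_map_vimage[OF TS smooth_vproj assms] by (simp add: mcarrier_TS)

lemma smooth_triv:
  assumes U: "(U, n, \<phi>) \<in> vtriv E"
  shows "smooth_real TS {e \<in> vcarrier E. vproj E e \<in> U} (\<lambda>e. \<phi> e i)"
proof (rule smooth_real_locally[OF TS openin_TS_over[OF triv_open[OF U]]])
  fix e assume e: "e \<in> {e \<in> vcarrier E. vproj E e \<in> U}"
  then have "vproj E e \<in> mcarrier X" using vproj_in by blast
  then obtain W k \<xi> where W: "(W, k, \<xi>) \<in> X" "vproj E e \<in> W" unfolding mcarrier_iff by blast
  note c = TS_chart[OF W(1) U]
  show "\<exists>B. e \<in> B \<and> B \<subseteq> {e \<in> vcarrier E. vproj E e \<in> U} \<and> smooth_real TS B (\<lambda>e. \<phi> e i)"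
  proof (intro exI conjI)
    show "smooth_real TS {e \<in> vcarrier E. vproj E e \<in> W \<inter> U} (\<lambda>e. \<phi> e i)"
      by (rule smooth_real_join_chart(2)[OF TS c refl])
  qed (use e W in auto)
qed

text \<open>A chart of the total space joins base coordinates with fibre coordinates, so smoothness
  splits into that of the map to the base and that of the fibre coordinates in one trivialization
  near each point.\<close>

lemma smooth_map_totalI:
  assumes L: "smooth_atlas L" and base: "smooth_map L X (\<lambda>p. vproj E (f p))"
    and f: "\<And>p. p \<in> mcarrier L \<Longrightarrow> f p \<in> vcarrier E"
    and loc: "\<And>p. p \<in> mcarrier L \<Longrightarrow> \<exists>A U n \<phi>. openin (atlas_topology L) A \<and> p \<in> A \<and> (U, n, \<phi>) \<in> vtriv E \<and>
       (\<forall>q\<in>A. vproj E (f q) \<in> U) \<and> (\<forall>i<n. smooth_real L A (\<lambda>q. \<phi> (f q) i))"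
  shows "smooth_map L TS f"
proof (rule smooth_mapI[OF L TS])
  fix p assume p: "p \<in> mcarrier L"
  from loc[OF p] obtain A U n \<phi> where A: "openin (atlas_topology L) A" "p \<in> A" "(U, n, \<phi>) \<in> vtriv E"
    "\<forall>q\<in>A. vproj E (f q) \<in> U" "\<forall>i<n. smooth_real L A (\<lambda>q. \<phi> (f q) i)" by blast
  from vproj_in[OF f[OF p]] obtain W k \<xi> where W: "(W, k, \<xi>) \<in> X" "vproj E (f p) \<in> W" unfolding mcarrier_iff by blast
  define B where "B = A \<inter> {p \<in> mcarrier L. vproj E (f p) \<in> W}"
  have B: "openin (atlas_topology L) B"
    unfolding B_def by (intro openin_Int A(1) smooth_map_vimage[OF L base] openin_chart[OF X W(1)])
  have "smooth_real L B (\<lambda>q. \<xi> (vproj E (f q)) i)" for i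
    by (rule smooth_real_mono[OF L B _ smooth_mapD[OF L X base W(1)]]) (auto simp: B_def)
  moreover have "smooth_real L B (\<lambda>q. \<phi> (f q) i)" if "i < n" for i
    by (rule smooth_real_mono[OF L B]) (use A(5) that in \<open>auto simp: B_def\<close>)
  ultimately have sm: "smooth_real L B (\<lambda>q. join k (\<xi> (vproj E (f q))) (\<phi> (f q)) j)" if "j < k + n" for j
    using that by (rule smooth_real_join)
  show "\<exists>A V m \<psi>. openin (atlas_topology L) A \<and> p \<in> A \<and> (V, m, \<psi>) \<in> TS \<and> f ` A \<subseteq> V \<and>
      (\<forall>j<m. smooth_real L A (\<lambda>p. \<psi> (f p) j))"
    by (rule smooth_at_witness[OF B _ TS_chart[OF W(1) A(3)]]) (use p A f W sm in \<open>auto simp: B_def\<close>)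
qed

text \<open>The converse of \<open>vector_bundleI\<close>. The matrix entries are the
  \<psi>-coordinates of the frame \<open>b i\<close> dual to \<open>\<phi>\<close>, so the point is
  that this frame varies smoothly with the base point.\<close>

lemma smooth_transition:
  assumes U: "(U, n, \<phi>) \<in> vtriv E" and V: "(V, m, \<psi>) \<in> vtriv E"
  shows "\<exists>a. (\<forall>j<m. \<forall>i<n. smooth_real X (U \<inter> V) (a j i)) \<and>
        (\<forall>e\<in>vcarrier E. vproj E e \<in> U \<inter> V \<longrightarrow> (\<forall>j<m. \<psi> e j = (\<Sum>i<n. a j i (vproj E e) * \<phi> e i)))"
proof -
  define b where "b = (\<lambda>i x. inv_into (fibre E x) \<phi> (uvec i))"
  have UV: "openin (atlas_topology X) (U \<inter> V)" using triv_open U V by blast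
  have b: "b i x \<in> fibre E x" "\<phi> (b i x) = uvec i" if "i < n" "x \<in> U" for i x
    unfolding b_def using triv_inv[OF triv_triv[OF U] that(2) uvec_Eu[OF that(1)]] by auto
  have "smooth_real X (U \<inter> V) (\<lambda>x. \<psi> (b i x) j)" if i: "i < n" for i j
  proof (rule smooth_real_locally[OF X UV])
    fix x assume x: "x \<in> U \<inter> V"
    then have "x \<in> mcarrier X" using triv_subset[OF U] by blast
    then obtain W k \<xi> where W: "(W, k, \<xi>) \<in> X" "x \<in> W" unfolding mcarrier_iff by blast
    have o: "openin (atlas_topology X) (W \<inter> (U \<inter> V))" using UV openin_chart[OF X W(1)] by blast
    note c = TS_chart[OF W(1) U]
    \<comment> \<open>In the chart of the total space built from \<open>\<phi>\<close> the frame has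
      constant fibre coordinates \<open>uvec i\<close>, hence is smooth; the \<psi>-coordinates are
      smooth functions on the total space and can be composed with it.\<close>
    have "smooth_real X (W \<inter> (U \<inter> V)) (\<lambda>x. join k (\<xi> (vproj E (b i x))) (\<phi> (b i x)) l)" for l
    proof -
      have "smooth_real X (W \<inter> (U \<inter> V)) (\<lambda>x. join k (\<xi> x) (uvec i) l)"
      proof (cases "l < k")
        case True
        then show ?thesis
          using smooth_real_mono[OF X o _ smooth_real_chart[OF X W(1), of l]] by (simp add: join_def)
      next
        case False
        then show ?thesis using smooth_real_const[OF X o] by (simp add: join_def)
      qed
      then show ?thesis
        by (rule smooth_real_cong[OF X, THEN iffD1, rotated]) (use b i in \<open>auto simp: fibre_iff\<close>)
    qed
    then have "smooth_real X (W \<inter> (U \<inter> V)) (\<lambda>x. \<psi> (b i x) j)"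
      by (intro smooth_real_compose_chart[OF X TS c _ _ smooth_triv[OF V] o, where f = "b i" and A = "W \<inter> (U \<inter> V)"])
        (use b i in \<open>auto simp: fibre_iff\<close>)
    then show "\<exists>B. x \<in> B \<and> B \<subseteq> U \<inter> V \<and> smooth_real X B (\<lambda>x. \<psi> (b i x) j)"
      using x W by (intro exI[of _ "W \<inter> (U \<inter> V)"]) auto
  qed
  moreover have "\<psi> e j = (\<Sum>i<n. \<psi> (b i (vproj E e)) j * \<phi> e i)" if "e \<in> vcarrier E" "vproj E e \<in> U \<inter> V" for e j
    unfolding b_def by (rule triv_change[OF triv_triv[OF U] _ triv_triv[OF V]]) (use that in \<open>auto simp: fibre_iff\<close>)
  ultimately show ?thesis by (intro exI[of _ "\<lambda>j i x. \<psi> (b i x) j"]) auto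
qed

end

section \<open>Constructions of vector bundles\<close>

lemma join_add: "join n (\<lambda>i. x i + x' i) (\<lambda>i. y i + y' i) = (\<lambda>i. join n x y i + join n x' y' i)"
  and join_scale: "join n (\<lambda>i. c * x i) (\<lambda>i. c * y i) = (\<lambda>i. c * join n x y i)"
  by (auto simp: join_def)

lemma sum_lessThan_add: "(\<Sum>i<n + m. f i) = (\<Sum>i<n. f i) + (\<Sum>i<m. f (n + i :: nat) :: real)"
  by (induction m) auto

text \<open>A direct sum has block diagonal transition matrix, with zero off-diagonal blocks. The
  vectors are arbitrary, so no bundle has to be mentioned yet.\<close>

lemma block_matrix:
  assumes M: "smooth_atlas M" and A: "openin (atlas_topology M) A"
    and a: "\<And>j i. j < n' \<Longrightarrow> i < n \<Longrightarrow> smooth_real M A (a j i)"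
    and b: "\<And>j i. j < m' \<Longrightarrow> i < m \<Longrightarrow> smooth_real M A (b j i)"
  shows "\<exists>c. (\<forall>j<n' + m'. \<forall>i<n + m. smooth_real M A (c j i)) \<and>
    (\<forall>x u v u' v'. (\<forall>j<n'. u' j = (\<Sum>i<n. a j i x * u i)) \<longrightarrow> (\<forall>j<m'. v' j = (\<Sum>i<m. b j i x * v i)) \<longrightarrow>
       (\<forall>j<n' + m'. join n' u' v' j = (\<Sum>i<n + m. c j i x * join n u v i)))"
proof -
  define c where "c = (\<lambda>j i x. if j < n' then (if i < n then a j i x else 0) else (if i < n then 0 else b (j - n') (i - n) x))"
  have "smooth_real M A (c j i)" if "j < n' + m'" "i < n + m" for j i
  proof -
    have "j < n' \<or> j - n' < m'" "i < n \<or> i - n < m" using that by auto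
    then show ?thesis
      using a[of j i] b[of "j - n'" "i - n"] smooth_real_const[OF M A, of 0]
      by (cases "j < n'"; cases "i < n") (simp_all add: c_def)
  qed
  moreover have "join n' u' v' j = (\<Sum>i<n + m. c j i x * join n u v i)"
    if "\<forall>j<n'. u' j = (\<Sum>i<n. a j i x * u i)" "\<forall>j<m'. v' j = (\<Sum>i<m. b j i x * v i)" "j < n' + m'" for x u v u' v' j
  proof (cases "j < n'")
    case True
    then show ?thesis using that by (simp add: sum_lessThan_add c_def join_def)
  next
    case False
    then have "j - n' < m'" using that(3) by auto
    then show ?thesis using that False by (simp add: sum_lessThan_add c_def join_def)
  qed
  ultimately show ?thesis by (intro exI[of _ c]) blast
qed

text \<open>Here \<open>S\<close> stands for the part of a total space over the overlap and
  \<open>r\<close> for its projection. Taking the coordinates after the projections to the two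
  factors covers Whitney sums and external products alike.\<close>

lemma vec_bundle_block:
  assumes X: "smooth_atlas X" and A: "openin (atlas_topology X) A"
    and ex: "\<exists>a. (\<forall>j<n'. \<forall>i<n. smooth_real X A (a j i)) \<and> (\<forall>e\<in>S. \<forall>j<n'. \<phi>' e j = (\<Sum>i<n. a j i (r e) * \<phi> e i))"
      "\<exists>b. (\<forall>j<m'. \<forall>i<m. smooth_real X A (b j i)) \<and> (\<forall>e\<in>S. \<forall>j<m'. \<psi>' e j = (\<Sum>i<m. b j i (r e) * \<psi> e i))"
  shows "\<exists>c. (\<forall>j<n' + m'. \<forall>i<n + m. smooth_real X A (c j i)) \<and>
    (\<forall>e\<in>S. \<forall>j<n' + m'. join n' (\<phi>' e) (\<psi>' e) j = (\<Sum>i<n + m. c j i (r e) * join n (\<phi> e) (\<psi> e) i))"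
proof -
  obtain a where a: "\<forall>j<n'. \<forall>i<n. smooth_real X A (a j i)" "\<forall>e\<in>S. \<forall>j<n'. \<phi>' e j = (\<Sum>i<n. a j i (r e) * \<phi> e i)"
    using ex(1) by (elim exE conjE)
  obtain b where b: "\<forall>j<m'. \<forall>i<m. smooth_real X A (b j i)" "\<forall>e\<in>S. \<forall>j<m'. \<psi>' e j = (\<Sum>i<m. b j i (r e) * \<psi> e i)"
    using ex(2) by (elim exE conjE)
  from a(1) b(1) have "\<exists>c. (\<forall>j<n' + m'. \<forall>i<n + m. smooth_real X A (c j i)) \<and>
    (\<forall>x u v u' v'. (\<forall>j<n'. u' j = (\<Sum>i<n. a j i x * u i)) \<longrightarrow> (\<forall>j<m'. v' j = (\<Sum>i<m. b j i x * v i)) \<longrightarrow>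
       (\<forall>j<n' + m'. join n' u' v' j = (\<Sum>i<n + m. c j i x * join n u v i)))"
    by (intro block_matrix[OF X A]) auto
  then obtain c where c: "\<forall>j<n' + m'. \<forall>i<n + m. smooth_real X A (c j i)"
    "\<forall>x u v u' v'. (\<forall>j<n'. u' j = (\<Sum>i<n. a j i x * u i)) \<longrightarrow> (\<forall>j<m'. v' j = (\<Sum>i<m. b j i x * v i)) \<longrightarrow>
       (\<forall>j<n' + m'. join n' u' v' j = (\<Sum>i<n + m. c j i x * join n u v i))" by (elim exE conjE)
  then show ?thesis using a(2) b(2) by (intro exI[of _ c] conjI ballI c(1)) simp
qed

text \<open>\<open>p\<close> and \<open>q\<close> lead to the bases of the two bundles: both are the
  identity for a Whitney sum, and the two projections for an external product.\<close>

lemma trivialization_join: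
  assumes E: "trivialization E U n \<phi>" and F: "trivialization F V m \<psi>"
    and H: "\<And>z. z \<in> W \<Longrightarrow> p z \<in> U \<and> q z \<in> V \<and> fibre H z = fibre E (p z) \<times> fibre F (q z)"
    and add: "vadd H = (\<lambda>(e, e') (d, d'). (vadd E e d, vadd F e' d'))"
    and scale: "vscale H = (\<lambda>c (e, e'). (vscale E c e, vscale F c e'))"
  shows "trivialization H W (n + m) (\<lambda>(e, e'). join n (\<phi> e) (\<psi> e'))"
  unfolding trivialization_def
proof (intro ballI conjI allI)
  fix z assume "z \<in> W"
  then have z: "p z \<in> U" "q z \<in> V" and fib: "fibre H z = fibre E (p z) \<times> fibre F (q z)" using H by auto
  show "bij_betw (\<lambda>(e, e'). join n (\<phi> e) (\<psi> e')) (fibre H z) (Eu (n + m))"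
    unfolding fib by (rule bij_betw_join[OF triv_bij[OF E z(1)] triv_bij[OF F z(2)]])
  {
    fix e d assume e: "e \<in> fibre H z" and d: "d \<in> fibre H z"
    from e d show "vadd H e d \<in> fibre H z"
      unfolding fib add by (auto intro: fibre_add[OF E z(1)] fibre_add[OF F z(2)])
    from e d show "(\<lambda>(e, e'). join n (\<phi> e) (\<psi> e')) (vadd H e d) =
        (\<lambda>i. (\<lambda>(e, e'). join n (\<phi> e) (\<psi> e')) e i + (\<lambda>(e, e'). join n (\<phi> e) (\<psi> e')) d i)"
      unfolding fib add by (auto simp: triv_add[OF E z(1)] triv_add[OF F z(2)] join_add)
  }
  fix c e assume e: "e \<in> fibre H z"
  from e show "vscale H c e \<in> fibre H z"
    unfolding fib scale by (auto intro: fibre_scale[OF E z(1)] fibre_scale[OF F z(2)])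
  from e show "(\<lambda>(e, e'). join n (\<phi> e) (\<psi> e')) (vscale H c e) = (\<lambda>i. c * (\<lambda>(e, e'). join n (\<phi> e) (\<psi> e')) e i)"
    unfolding fib scale by (auto simp: triv_scale[OF E z(1)] triv_scale[OF F z(2)] join_scale)
qed

section \<open>Whitney sums, external products and pullbacks\<close>

lemma whitney_simps [simp]:
  "vproj (whitney_sum E F) (e, e') = vproj E e"
  "vadd (whitney_sum E F) (e, e') (d, d') = (vadd E e d, vadd F e' d')"
  "vscale (whitney_sum E F) c (e, e') = (vscale E c e, vscale F c e')"
  by (simp_all add: whitney_sum_def)

lemma whitney_carrier: "p \<in> vcarrier (whitney_sum E F) \<longleftrightarrow>
    fst p \<in> vcarrier E \<and> snd p \<in> vcarrier F \<and> vproj E (fst p) = vproj F (snd p)"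
  by (auto simp: whitney_sum_def)

lemma whitney_proj: "vproj (whitney_sum E F) p = vproj E (fst p)"
  by (cases p) simp

lemma whitney_fibre: "fibre (whitney_sum E F) x = fibre E x \<times> fibre F x"
  by (auto simp: fibre_iff whitney_carrier whitney_proj)

lemma whitney_vtriv: "(W, k, \<kappa>) \<in> vtriv (whitney_sum E F) \<longleftrightarrow>
    (\<exists>U n \<phi> V m \<psi>. (U, n, \<phi>) \<in> vtriv E \<and> (V, m, \<psi>) \<in> vtriv F \<and>
      W = U \<inter> V \<and> k = n + m \<and> \<kappa> = (\<lambda>(e, e'). join n (\<phi> e) (\<psi> e')))"
  unfolding whitney_sum_def by (simp, blast)

lemma ext_simps [simp]:
  "vproj (external_product E F) (e, e') = (vproj E e, vproj F e')"
  "vadd (external_product E F) (e, e') (d, d') = (vadd E e d, vadd F e' d')"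
  "vscale (external_product E F) c (e, e') = (vscale E c e, vscale F c e')"
  "vcarrier (external_product E F) = vcarrier E \<times> vcarrier F"
  by (simp_all add: external_product_def)

lemma ext_proj: "vproj (external_product E F) p = (vproj E (fst p), vproj F (snd p))"
  by (cases p) simp

lemma ext_fibre: "fibre (external_product E F) z = fibre E (fst z) \<times> fibre F (snd z)"
  by (cases z) (auto simp: fibre_iff)

lemma ext_vtriv: "(W, k, \<kappa>) \<in> vtriv (external_product E F) \<longleftrightarrow>
    (\<exists>U n \<phi> V m \<psi>. (U, n, \<phi>) \<in> vtriv E \<and> (V, m, \<psi>) \<in> vtriv F \<and>
      W = U \<times> V \<and> k = n + m \<and> \<kappa> = (\<lambda>(e, e'). join n (\<phi> e) (\<psi> e')))"
  unfolding external_product_def by (simp, blast)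

lemma pullback_simps [simp]:
  "vproj (pullback_bundle X f E) = fst"
  "vadd (pullback_bundle X f E) (x, e) (x', e') = (x, vadd E e e')"
  "vscale (pullback_bundle X f E) c (x, e) = (x, vscale E c e)"
  by (simp_all add: pullback_bundle_def)

lemma pullback_carrier: "p \<in> vcarrier (pullback_bundle X f E) \<longleftrightarrow>
    fst p \<in> mcarrier X \<and> snd p \<in> vcarrier E \<and> f (fst p) = vproj E (snd p)"
  by (auto simp: pullback_bundle_def)

lemma pullback_fibre: "x \<in> mcarrier X \<Longrightarrow> fibre (pullback_bundle X f E) x = Pair x ` fibre E (f x)"
  by (auto simp: fibre_iff pullback_carrier)

lemma pullback_vtriv: "(W, k, \<kappa>) \<in> vtriv (pullback_bundle X f E) \<longleftrightarrow>
    (\<exists>U \<phi>. (U, k, \<phi>) \<in> vtriv E \<and> W = mcarrier X \<inter> f -` U \<and> \<kappa> = \<phi> \<circ> snd)"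
  unfolding pullback_bundle_def by (simp, blast)

lemma whitney_bundle:
  assumes "vec_bundle X E" "vec_bundle X F"
  shows "vec_bundle X (whitney_sum E F)"
proof -
  interpret E: vec_bundle X E by fact
  interpret F: vec_bundle X F by fact
  show ?thesis
  proof (unfold_locales, rule E.X, rule vector_bundleI[OF E.X])
    show "prebundle X (whitney_sum E F)"
      unfolding prebundle_def
    proof (intro conjI ballI allI impI)
      show "vproj (whitney_sum E F) ` vcarrier (whitney_sum E F) \<subseteq> mcarrier X"
        using E.vproj_in by (force simp: whitney_carrier whitney_proj)
      show "\<exists>U n \<phi>. (U, n, \<phi>) \<in> vtriv (whitney_sum E F) \<and> x \<in> U" if x: "x \<in> mcarrier X" for x
      proof -
        from E.triv_cover[OF x] F.triv_cover[OF x] obtain U n \<phi> V m \<psi>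
          where "(U, n, \<phi>) \<in> vtriv E" "x \<in> U" "(V, m, \<psi>) \<in> vtriv F" "x \<in> V" by blast
        then show ?thesis unfolding whitney_vtriv by (intro exI[of _ "U \<inter> V"]) blast
      qed
      fix W k \<kappa> assume "(W, k, \<kappa>) \<in> vtriv (whitney_sum E F)"
      then obtain U n \<phi> V m \<psi> where U: "(U, n, \<phi>) \<in> vtriv E" and V: "(V, m, \<psi>) \<in> vtriv F"
        and W: "W = U \<inter> V" "k = n + m" "\<kappa> = (\<lambda>(e, e'). join n (\<phi> e) (\<psi> e'))"
        unfolding whitney_vtriv by blast
      show "openin (atlas_topology X) W" using E.triv_open[OF U] F.triv_open[OF V] W by blast
      show "trivialization (whitney_sum E F) W k \<kappa>"
        unfolding W
        by (rule trivialization_join[OF E.triv_triv[OF U] F.triv_triv[OF V], where p = "\<lambda>x. x" and q = "\<lambda>x. x"])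
           (auto simp: whitney_fibre, simp_all add: whitney_sum_def)
    qed
    fix W k \<kappa> W' k' \<kappa>' assume "(W, k, \<kappa>) \<in> vtriv (whitney_sum E F)" "(W', k', \<kappa>') \<in> vtriv (whitney_sum E F)"
    then obtain U n \<phi> V m \<psi> U' n' \<phi>' V' m' \<psi>' where U: "(U, n, \<phi>) \<in> vtriv E" and V: "(V, m, \<psi>) \<in> vtriv F"
      and W: "W = U \<inter> V" "k = n + m" "\<kappa> = (\<lambda>(e, e'). join n (\<phi> e) (\<psi> e'))"
      and U': "(U', n', \<phi>') \<in> vtriv E" and V': "(V', m', \<psi>') \<in> vtriv F"
      and W': "W' = U' \<inter> V'" "k' = n' + m'" "\<kappa>' = (\<lambda>(e, e'). join n' (\<phi>' e) (\<psi>' e'))"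
      unfolding whitney_vtriv by blast
    define S where "S = {p \<in> vcarrier (whitney_sum E F). vproj (whitney_sum E F) p \<in> W \<inter> W'}"
    have o: "openin (atlas_topology X) (W \<inter> W')"
      unfolding W W' using E.triv_open[OF U] E.triv_open[OF U'] F.triv_open[OF V] F.triv_open[OF V'] by blast
    have 1: "\<exists>a. (\<forall>j<n'. \<forall>i<n. smooth_real X (W \<inter> W') (a j i)) \<and>
        (\<forall>p\<in>S. \<forall>j<n'. \<phi>' (fst p) j = (\<Sum>i<n. a j i (vproj (whitney_sum E F) p) * \<phi> (fst p) i))"
    proof -
      from E.smooth_transition[OF U U'] obtain a where a: "\<forall>j<n'. \<forall>i<n. smooth_real X (U \<inter> U') (a j i)"
        "\<forall>e\<in>vcarrier E. vproj E e \<in> U \<inter> U' \<longrightarrow> (\<forall>j<n'. \<phi>' e j = (\<Sum>i<n. a j i (vproj E e) * \<phi> e i))"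
        by (elim exE conjE)
      have "smooth_real X (W \<inter> W') (a j i)" if "j < n'" "i < n" for i j
        using smooth_real_mono[OF E.X o _ a(1)[rule_format, OF that]] unfolding W W' by blast
      then show ?thesis
        using a(2) by (intro exI[of _ a]) (auto simp: S_def whitney_carrier whitney_proj W W')
    qed
    have 2: "\<exists>b. (\<forall>j<m'. \<forall>i<m. smooth_real X (W \<inter> W') (b j i)) \<and>
        (\<forall>p\<in>S. \<forall>j<m'. \<psi>' (snd p) j = (\<Sum>i<m. b j i (vproj (whitney_sum E F) p) * \<psi> (snd p) i))"
    proof -
      from F.smooth_transition[OF V V'] obtain b where b: "\<forall>j<m'. \<forall>i<m. smooth_real X (V \<inter> V') (b j i)"
        "\<forall>e\<in>vcarrier F. vproj F e \<in> V \<inter> V' \<longrightarrow> (\<forall>j<m'. \<psi>' e j = (\<Sum>i<m. b j i (vproj F e) * \<psi> e i))"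
        by (elim exE conjE)
      have "smooth_real X (W \<inter> W') (b j i)" if "j < m'" "i < m" for i j
        using smooth_real_mono[OF E.X o _ b(1)[rule_format, OF that]] unfolding W W' by blast
      then show ?thesis
        using b(2) by (intro exI[of _ b]) (auto simp: S_def whitney_carrier whitney_proj W W')
    qed
    from vec_bundle_block[OF E.X o 1 2]
    show "\<exists>a. (\<forall>j<k'. \<forall>i<k. smooth_real X (W \<inter> W') (a j i)) \<and>
        (\<forall>e\<in>vcarrier (whitney_sum E F). vproj (whitney_sum E F) e \<in> W \<inter> W' \<longrightarrow>
          (\<forall>j<k'. \<kappa>' e j = (\<Sum>i<k. a j i (vproj (whitney_sum E F) e) * \<kappa> e i)))"
      unfolding W(2,3) W'(2,3) S_def case_prod_unfold Ball_def mem_Collect_eq imp_conjL .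
  qed
qed

lemma external_bundle:
  assumes "vec_bundle X E" "vec_bundle Y F"
  shows "vec_bundle (prod_atlas X Y) (external_product E F)"
proof -
  interpret E: vec_bundle X E by fact
  interpret F: vec_bundle Y F by fact
  note XY = smooth_atlas_prod[OF E.X F.X]
  show ?thesis
  proof (unfold_locales, rule XY, rule vector_bundleI[OF XY])
    show "prebundle (prod_atlas X Y) (external_product E F)"
      unfolding prebundle_def
    proof (intro conjI ballI allI impI)
      show "vproj (external_product E F) ` vcarrier (external_product E F) \<subseteq> mcarrier (prod_atlas X Y)"
        using E.vproj_in F.vproj_in by (auto simp: mcarrier_prod_atlas)
      show "\<exists>U n \<phi>. (U, n, \<phi>) \<in> vtriv (external_product E F) \<and> z \<in> U" if "z \<in> mcarrier (prod_atlas X Y)" for z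
      proof -
        from that have "fst z \<in> mcarrier X" "snd z \<in> mcarrier Y" by (auto simp: mcarrier_prod_atlas)
        from E.triv_cover[OF this(1)] F.triv_cover[OF this(2)] obtain U n \<phi> V m \<psi>
          where "(U, n, \<phi>) \<in> vtriv E" "fst z \<in> U" "(V, m, \<psi>) \<in> vtriv F" "snd z \<in> V" by blast
        then show ?thesis unfolding ext_vtriv mem_Times_iff by (intro exI[of _ "U \<times> V"]) (simp add: mem_Times_iff, blast)
      qed
      fix W k \<kappa> assume "(W, k, \<kappa>) \<in> vtriv (external_product E F)"
      then obtain U n \<phi> V m \<psi> where U: "(U, n, \<phi>) \<in> vtriv E" and V: "(V, m, \<psi>) \<in> vtriv F"
        and W: "W = U \<times> V" "k = n + m" "\<kappa> = (\<lambda>(e, e'). join n (\<phi> e) (\<psi> e'))"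
        unfolding ext_vtriv by blast
      show "openin (atlas_topology (prod_atlas X Y)) W"
        unfolding W by (rule openin_prod_atlas[OF E.X F.X E.triv_open[OF U] F.triv_open[OF V]])
      show "trivialization (external_product E F) W k \<kappa>"
        unfolding W
        by (rule trivialization_join[OF E.triv_triv[OF U] F.triv_triv[OF V], where p = fst and q = snd])
           (auto simp: ext_fibre, simp_all add: external_product_def)
    qed
    fix W k \<kappa> W' k' \<kappa>' assume "(W, k, \<kappa>) \<in> vtriv (external_product E F)" "(W', k', \<kappa>') \<in> vtriv (external_product E F)"
    then obtain U n \<phi> V m \<psi> U' n' \<phi>' V' m' \<psi>' where U: "(U, n, \<phi>) \<in> vtriv E" and V: "(V, m, \<psi>) \<in> vtriv F"
      and W: "W = U \<times> V" "k = n + m" "\<kappa> = (\<lambda>(e, e'). join n (\<phi> e) (\<psi> e'))"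
      and U': "(U', n', \<phi>') \<in> vtriv E" and V': "(V', m', \<psi>') \<in> vtriv F"
      and W': "W' = U' \<times> V'" "k' = n' + m'" "\<kappa>' = (\<lambda>(e, e'). join n' (\<phi>' e) (\<psi>' e'))"
      unfolding ext_vtriv by blast
    define S where "S = {p \<in> vcarrier (external_product E F). vproj (external_product E F) p \<in> W \<inter> W'}"
    have o: "openin (atlas_topology (prod_atlas X Y)) (W \<inter> W')"
      unfolding W W' by (intro openin_Int openin_prod_atlas E.X F.X E.triv_open[OF U] F.triv_open[OF V] E.triv_open[OF U'] F.triv_open[OF V'])
    have 1: "\<exists>a. (\<forall>j<n'. \<forall>i<n. smooth_real (prod_atlas X Y) (W \<inter> W') (a j i)) \<and>
        (\<forall>p\<in>S. \<forall>j<n'. \<phi>' (fst p) j = (\<Sum>i<n. a j i (vproj (external_product E F) p) * \<phi> (fst p) i))"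
    proof -
      from E.smooth_transition[OF U U'] obtain a where a: "\<forall>j<n'. \<forall>i<n. smooth_real X (U \<inter> U') (a j i)"
        "\<forall>e\<in>vcarrier E. vproj E e \<in> U \<inter> U' \<longrightarrow> (\<forall>j<n'. \<phi>' e j = (\<Sum>i<n. a j i (vproj E e) * \<phi> e i))"
        by (elim exE conjE)
      have "smooth_real (prod_atlas X Y) (W \<inter> W') (\<lambda>z. a j i (fst z))" if "j < n'" "i < n" for i j
        by (rule smooth_real_pullback[OF XY E.X smooth_map_fst[OF E.X F.X] a(1)[rule_format, OF that] o]) (auto simp: W W')
      then show ?thesis
        using a(2) by (intro exI[of _ "\<lambda>j i z. a j i (fst z)"]) (auto simp: S_def W W')
    qed
    have 2: "\<exists>b. (\<forall>j<m'. \<forall>i<m. smooth_real (prod_atlas X Y) (W \<inter> W') (b j i)) \<and>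
        (\<forall>p\<in>S. \<forall>j<m'. \<psi>' (snd p) j = (\<Sum>i<m. b j i (vproj (external_product E F) p) * \<psi> (snd p) i))"
    proof -
      from F.smooth_transition[OF V V'] obtain b where b: "\<forall>j<m'. \<forall>i<m. smooth_real Y (V \<inter> V') (b j i)"
        "\<forall>e\<in>vcarrier F. vproj F e \<in> V \<inter> V' \<longrightarrow> (\<forall>j<m'. \<psi>' e j = (\<Sum>i<m. b j i (vproj F e) * \<psi> e i))"
        by (elim exE conjE)
      have "smooth_real (prod_atlas X Y) (W \<inter> W') (\<lambda>z. b j i (snd z))" if "j < m'" "i < m" for i j
        by (rule smooth_real_pullback[OF XY F.X smooth_map_snd[OF E.X F.X] b(1)[rule_format, OF that] o]) (auto simp: W W')
      then show ?thesis
        using b(2) by (intro exI[of _ "\<lambda>j i z. b j i (snd z)"]) (auto simp: S_def W W')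
    qed
    from vec_bundle_block[OF XY o 1 2]
    show "\<exists>a. (\<forall>j<k'. \<forall>i<k. smooth_real (prod_atlas X Y) (W \<inter> W') (a j i)) \<and>
        (\<forall>e\<in>vcarrier (external_product E F). vproj (external_product E F) e \<in> W \<inter> W' \<longrightarrow>
          (\<forall>j<k'. \<kappa>' e j = (\<Sum>i<k. a j i (vproj (external_product E F) e) * \<kappa> e i)))"
      unfolding W(2,3) W'(2,3) S_def case_prod_unfold Ball_def mem_Collect_eq imp_conjL .
  qed
qed

lemma pullback_vec_bundle:
  assumes X: "smooth_atlas X" and "vec_bundle Y E" and f: "smooth_map X Y f"
  shows "vec_bundle X (pullback_bundle X f E)"
proof -
  interpret E: vec_bundle Y E by fact
  have open_pre: "openin (atlas_topology X) (mcarrier X \<inter> f -` U)" if "openin (atlas_topology Y) U" for U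
  proof -
    have "mcarrier X \<inter> f -` U = {x \<in> mcarrier X. f x \<in> U}" by blast
    then show ?thesis using smooth_map_vimage[OF X f that] by simp
  qed
  show ?thesis
  proof (unfold_locales, rule X, rule vector_bundleI[OF X])
    show "prebundle X (pullback_bundle X f E)"
      unfolding prebundle_def
    proof (intro conjI ballI allI impI)
      show "vproj (pullback_bundle X f E) ` vcarrier (pullback_bundle X f E) \<subseteq> mcarrier X"
        by (auto simp: pullback_carrier)
      show "\<exists>U n \<phi>. (U, n, \<phi>) \<in> vtriv (pullback_bundle X f E) \<and> x \<in> U" if x: "x \<in> mcarrier X" for x
      proof -
        from E.triv_cover[OF smooth_map_carrier[OF X E.X f x]] obtain U n \<phi>
          where "(U, n, \<phi>) \<in> vtriv E" "f x \<in> U" by blast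
        then show ?thesis unfolding pullback_vtriv using x by (intro exI[of _ "mcarrier X \<inter> f -` U"]) blast
      qed
      fix W k \<kappa> assume "(W, k, \<kappa>) \<in> vtriv (pullback_bundle X f E)"
      then obtain U \<phi> where U: "(U, k, \<phi>) \<in> vtriv E" and W: "W = mcarrier X \<inter> f -` U" "\<kappa> = \<phi> \<circ> snd"
        unfolding pullback_vtriv by blast
      show "openin (atlas_topology X) W" unfolding W by (rule open_pre[OF E.triv_open[OF U]])
      show "trivialization (pullback_bundle X f E) W k \<kappa>"
        unfolding trivialization_def
      proof (intro ballI conjI allI)
        fix x assume "x \<in> W"
        then have x: "x \<in> mcarrier X" "f x \<in> U" by (auto simp: W)
        note fib = pullback_fibre[OF x(1)]
        note T = E.triv_triv[OF U] x(2)
        show "bij_betw \<kappa> (fibre (pullback_bundle X f E) x) (Eu k)"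
          unfolding fib W(2) using triv_bij[OF T] by (auto simp: bij_betw_def inj_on_def image_image)
        {
          fix e e' assume "e \<in> fibre (pullback_bundle X f E) x" "e' \<in> fibre (pullback_bundle X f E) x"
          then show "vadd (pullback_bundle X f E) e e' \<in> fibre (pullback_bundle X f E) x"
            "\<kappa> (vadd (pullback_bundle X f E) e e') = (\<lambda>i. \<kappa> e i + \<kappa> e' i)"
            unfolding fib W(2) using fibre_add[OF T] triv_add[OF T] by auto
        }
        fix c e assume "e \<in> fibre (pullback_bundle X f E) x"
        then show "vscale (pullback_bundle X f E) c e \<in> fibre (pullback_bundle X f E) x"
            "\<kappa> (vscale (pullback_bundle X f E) c e) = (\<lambda>i. c * \<kappa> e i)"
          unfolding fib W(2) using fibre_scale[OF T] triv_scale[OF T] by auto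
      qed
    qed
    fix W k \<kappa> W' k' \<kappa>' assume "(W, k, \<kappa>) \<in> vtriv (pullback_bundle X f E)" "(W', k', \<kappa>') \<in> vtriv (pullback_bundle X f E)"
    then obtain U \<phi> U' \<phi>' where U: "(U, k, \<phi>) \<in> vtriv E" and W: "W = mcarrier X \<inter> f -` U" "\<kappa> = \<phi> \<circ> snd"
      and U': "(U', k', \<phi>') \<in> vtriv E" and W': "W' = mcarrier X \<inter> f -` U'" "\<kappa>' = \<phi>' \<circ> snd"
      unfolding pullback_vtriv by blast
    from E.smooth_transition[OF U U'] obtain a where a: "\<forall>j<k'. \<forall>i<k. smooth_real Y (U \<inter> U') (a j i)"
      "\<forall>e\<in>vcarrier E. vproj E e \<in> U \<inter> U' \<longrightarrow> (\<forall>j<k'. \<phi>' e j = (\<Sum>i<k. a j i (vproj E e) * \<phi> e i))"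
      by (elim exE conjE)
    have o: "openin (atlas_topology X) (W \<inter> W')"
      unfolding W W' using open_pre[OF E.triv_open[OF U]] open_pre[OF E.triv_open[OF U']] by blast
    have "smooth_real X (W \<inter> W') (\<lambda>x. a j i (f x))" if "j < k'" "i < k" for i j
      by (rule smooth_real_pullback[OF X E.X f a(1)[rule_format, OF that] o]) (auto simp: W W')
    then show "\<exists>a. (\<forall>j<k'. \<forall>i<k. smooth_real X (W \<inter> W') (a j i)) \<and>
        (\<forall>e\<in>vcarrier (pullback_bundle X f E). vproj (pullback_bundle X f E) e \<in> W \<inter> W' \<longrightarrow>
          (\<forall>j<k'. \<kappa>' e j = (\<Sum>i<k. a j i (vproj (pullback_bundle X f E) e) * \<kappa> e i)))"
      using a(2) by (intro exI[of _ "\<lambda>j i x. a j i (f x)"]) (auto simp: W W' pullback_carrier)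
  qed
qed

section \<open>The zero bundle and transport of structure\<close>

lemma zero_bundle_simps [simp]:
  "vcarrier (zero_bundle X) = mcarrier X \<times> {\<lambda>_. 0}"
  "vproj (zero_bundle X) = fst"
  "vadd (zero_bundle X) = (\<lambda>e e'. e)"
  "vscale (zero_bundle X) = (\<lambda>c e. e)"
  "vtriv (zero_bundle X) = {(mcarrier X, 0, \<lambda>_ _. 0)}"
  by (simp_all add: zero_bundle_def)

lemma zero_vec_bundle:
  assumes X: "smooth_atlas X"
  shows "vec_bundle X (zero_bundle X)"
proof (unfold_locales, rule X, rule vector_bundleI[OF X])
  have E0: "Eu 0 = {\<lambda>_. 0}" by (auto simp: topspace_Euclidean_space)
  have fib: "fibre (zero_bundle X) x = {(x, \<lambda>_. 0)}" if "x \<in> mcarrier X" for x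
    using that by (auto simp: fibre_iff)
  have "openin (atlas_topology X) (mcarrier X)"
    using topspace_atlas[OF X] openin_topspace[of "atlas_topology X"] by simp
  then show "prebundle X (zero_bundle X)"
    by (auto simp: prebundle_def trivialization_def fib E0)
qed auto

text \<open>Transport of structure along an injection \<open>\<tau>\<close> of the total space into
  another type: every operation passes through the inverse of \<open>\<tau>\<close>. Base and cover
  stay as they are, and so do the transition matrices.\<close>

definition transport_bundle :: "('e \<Rightarrow> 'f) \<Rightarrow> ('e, 'x) vbundle \<Rightarrow> ('f, 'x) vbundle" where
  "transport_bundle \<tau> E = (let \<tau>' = inv_into (vcarrier E) \<tau> in \<lparr>
     vcarrier = \<tau> ` vcarrier E,
     vproj = vproj E \<circ> \<tau>',
     vadd = (\<lambda>e e'. \<tau> (vadd E (\<tau>' e) (\<tau>' e'))),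
     vscale = (\<lambda>c e. \<tau> (vscale E c (\<tau>' e))),
     vtriv = {(U, n, \<phi> \<circ> \<tau>') | U n \<phi>. (U, n, \<phi>) \<in> vtriv E}\<rparr>)"

context
  fixes \<tau> :: "'e \<Rightarrow> 'f" and E :: "('e, 'x) vbundle"
  assumes \<tau>: "inj_on \<tau> (vcarrier E)"
begin

lemma transport_simps [simp]:
  "vcarrier (transport_bundle \<tau> E) = \<tau> ` vcarrier E"
  "e \<in> vcarrier E \<Longrightarrow> vproj (transport_bundle \<tau> E) (\<tau> e) = vproj E e"
  "e \<in> vcarrier E \<Longrightarrow> e' \<in> vcarrier E \<Longrightarrow> vadd (transport_bundle \<tau> E) (\<tau> e) (\<tau> e') = \<tau> (vadd E e e')"
  "e \<in> vcarrier E \<Longrightarrow> vscale (transport_bundle \<tau> E) c (\<tau> e) = \<tau> (vscale E c e)"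
  using \<tau> by (simp_all add: transport_bundle_def Let_def)

lemma transport_vtriv: "(U, n, \<kappa>) \<in> vtriv (transport_bundle \<tau> E) \<longleftrightarrow>
    (\<exists>\<phi>. (U, n, \<phi>) \<in> vtriv E \<and> \<kappa> = \<phi> \<circ> inv_into (vcarrier E) \<tau>)"
  unfolding transport_bundle_def Let_def by (simp, blast)

lemma transport_fibre: "fibre (transport_bundle \<tau> E) x = \<tau> ` fibre E x"
  by (auto simp: fibre_iff)

lemma transport_vec_bundle:
  assumes "vec_bundle X E"
  shows "vec_bundle X (transport_bundle \<tau> E)"
proof -
  interpret E: vec_bundle X E by fact
  have sub: "fibre E x \<subseteq> vcarrier E" for x by (auto simp: fibre_iff)
  show ?thesis
  proof (unfold_locales, rule E.X, rule vector_bundleI[OF E.X])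
    show "prebundle X (transport_bundle \<tau> E)"
      unfolding prebundle_def
    proof (intro conjI ballI allI impI)
      show "vproj (transport_bundle \<tau> E) ` vcarrier (transport_bundle \<tau> E) \<subseteq> mcarrier X"
        using E.vproj_in by auto
      show "\<exists>U n \<phi>. (U, n, \<phi>) \<in> vtriv (transport_bundle \<tau> E) \<and> x \<in> U" if x: "x \<in> mcarrier X" for x
        using E.triv_cover[OF x] unfolding transport_vtriv by blast
      fix U n \<kappa> assume "(U, n, \<kappa>) \<in> vtriv (transport_bundle \<tau> E)"
      then obtain \<phi> where U: "(U, n, \<phi>) \<in> vtriv E" and \<kappa>: "\<kappa> = \<phi> \<circ> inv_into (vcarrier E) \<tau>"
        unfolding transport_vtriv by blast
      show "openin (atlas_topology X) U" by (rule E.triv_open[OF U])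
      have \<kappa>\<tau>: "\<kappa> (\<tau> e) = \<phi> e" if "e \<in> vcarrier E" for e using that \<tau> by (simp add: \<kappa>)
      show "trivialization (transport_bundle \<tau> E) U n \<kappa>"
        unfolding trivialization_def
      proof (intro ballI conjI allI)
        fix x assume "x \<in> U"
        note T = E.triv_triv[OF U] this
        have "bij_betw (\<kappa> \<circ> \<tau>) (fibre E x) (Eu n) = bij_betw \<phi> (fibre E x) (Eu n)"
          by (rule bij_betw_cong) (use \<kappa>\<tau> sub in auto)
        moreover have "bij_betw \<tau> (fibre E x) (fibre (transport_bundle \<tau> E) x)"
          unfolding transport_fibre using \<tau> sub by (metis inj_on_imp_bij_betw inj_on_subset)
        ultimately show "bij_betw \<kappa> (fibre (transport_bundle \<tau> E) x) (Eu n)"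
          using triv_bij[OF T] bij_betw_comp_iff by metis
        {
          fix e e' assume "e \<in> fibre (transport_bundle \<tau> E) x" "e' \<in> fibre (transport_bundle \<tau> E) x"
          then obtain d d' where d: "e = \<tau> d" "e' = \<tau> d'" "d \<in> fibre E x" "d' \<in> fibre E x"
            unfolding transport_fibre by blast
          moreover from d have "d \<in> vcarrier E" "d' \<in> vcarrier E" "vadd E d d' \<in> vcarrier E"
            using sub fibre_add[OF T] by blast+
          ultimately show "vadd (transport_bundle \<tau> E) e e' \<in> fibre (transport_bundle \<tau> E) x"
            "\<kappa> (vadd (transport_bundle \<tau> E) e e') = (\<lambda>i. \<kappa> e i + \<kappa> e' i)"
            using fibre_add[OF T] triv_add[OF T] by (simp_all add: transport_fibre \<kappa>\<tau>)
        }
        fix c e assume "e \<in> fibre (transport_bundle \<tau> E) x"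
        then obtain d where d: "e = \<tau> d" "d \<in> fibre E x" unfolding transport_fibre by blast
        moreover from d have "d \<in> vcarrier E" "vscale E c d \<in> vcarrier E" using sub fibre_scale[OF T] by blast+
        ultimately show "vscale (transport_bundle \<tau> E) c e \<in> fibre (transport_bundle \<tau> E) x"
            "\<kappa> (vscale (transport_bundle \<tau> E) c e) = (\<lambda>i. c * \<kappa> e i)"
          using fibre_scale[OF T] triv_scale[OF T] by (simp_all add: transport_fibre \<kappa>\<tau>)
      qed
    qed
    fix U n \<kappa> V m \<kappa>' assume "(U, n, \<kappa>) \<in> vtriv (transport_bundle \<tau> E)" "(V, m, \<kappa>') \<in> vtriv (transport_bundle \<tau> E)"
    then obtain \<phi> \<psi> where U: "(U, n, \<phi>) \<in> vtriv E" and \<kappa>: "\<kappa> = \<phi> \<circ> inv_into (vcarrier E) \<tau>"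
      and V: "(V, m, \<psi>) \<in> vtriv E" and \<kappa>': "\<kappa>' = \<psi> \<circ> inv_into (vcarrier E) \<tau>"
      unfolding transport_vtriv by blast
    from E.smooth_transition[OF U V] obtain a where a: "\<forall>j<m. \<forall>i<n. smooth_real X (U \<inter> V) (a j i)"
      "\<forall>e\<in>vcarrier E. vproj E e \<in> U \<inter> V \<longrightarrow> (\<forall>j<m. \<psi> e j = (\<Sum>i<n. a j i (vproj E e) * \<phi> e i))"
      by (elim exE conjE)
    show "\<exists>a. (\<forall>j<m. \<forall>i<n. smooth_real X (U \<inter> V) (a j i)) \<and>
        (\<forall>e\<in>vcarrier (transport_bundle \<tau> E). vproj (transport_bundle \<tau> E) e \<in> U \<inter> V \<longrightarrow>
          (\<forall>j<m. \<kappa>' e j = (\<Sum>i<n. a j i (vproj (transport_bundle \<tau> E) e) * \<kappa> e i)))"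
      using a \<tau> by (intro exI[of _ a]) (auto simp: \<kappa> \<kappa>')
  qed
qed

end

section \<open>The tangent bundle\<close>

text \<open>Each class C^k provides a partial derivative of its own. \<open>deriv\<close> picks one
  function that coincides with all of them on \<open>W\<close> and is therefore of every
  class.\<close>

lemma smooth_fun_partial:
  assumes W: "openin (Euclidean_space n) W" and f: "smooth_fun n W f" and i: "i < n"
  defines "g \<equiv> \<lambda>x. deriv (\<lambda>s. f (x(i := s))) (x i)"
  shows "has_partial_on f i g W" "smooth_fun n W g"
proof -
  have ex: "\<exists>f'. has_partial_on f i f' W \<and> Ck_on k n W f'" for k
  proof -
    have "Ck_on (Suc k) n W f" using f unfolding smooth_fun_def ..
    with i show ?thesis unfolding Ck_on_Suc_iff by blast
  qed
  from ex[of 0] obtain f' where f': "has_partial_on f i f' W" by blast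
  then show g: "has_partial_on f i g W"
    using has_partial_on_partial[OF f'] by (simp add: has_partial_on_def g_def)
  show "smooth_fun n W g"
    unfolding smooth_fun_def using ex g Ck_on_partial[OF W] by blast
qed

lemma smooth_fun_curve:
  assumes W: "openin (Euclidean_space n) W" and f: "smooth_fun n W f"
    and \<gamma>: "\<gamma> t0 \<in> W" "\<And>t. \<gamma> t \<in> Eu n" "\<And>i. i < n \<Longrightarrow> ((\<lambda>t. \<gamma> t i) has_real_derivative d i) (at t0)"
  shows "((\<lambda>t. f (\<gamma> t)) has_real_derivative
    (\<Sum>i<n. deriv (\<lambda>s. f ((\<gamma> t0)(i := s))) (\<gamma> t0 i) * d i)) (at t0)"
  using smooth_fun_partial[OF W f] smooth_fun_continuous[OF W] \<gamma>
  by (intro chain_rule_partial[OF W, where f' = "\<lambda>i x. deriv (\<lambda>s. f (x(i := s))) (x i)"]) auto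

lemma line_Eu: "x \<in> Eu n \<Longrightarrow> w \<in> Eu n \<Longrightarrow> (\<lambda>i. x i + s * w i) \<in> Eu n"
  by (auto simp: topspace_Euclidean_space)

lemma eventually_line:
  assumes W: "openin (Euclidean_space n) W" and x: "x \<in> W" and w: "w \<in> Eu n"
  shows "\<forall>\<^sub>F s in nhds 0. (\<lambda>i. x i + s * w i) \<in> W"
proof -
  obtain T where T: "open T" "W = Eu n \<inter> T" using W by (auto simp: openin_Euclidean_space_iff)
  have "continuous_on UNIV (\<lambda>s. \<lambda>i. x i + s * w i)"
    by (rule continuous_on_coordinatewise_then_product) (intro continuous_intros)
  then have "open ((\<lambda>s. \<lambda>i. x i + s * w i) -` T)" by (rule open_vimage[OF T(1)])
  moreover have "0 \<in> (\<lambda>s. \<lambda>i. x i + s * w i) -` T" using x T by simp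
  ultimately have "\<forall>\<^sub>F s in nhds 0. s \<in> (\<lambda>s. \<lambda>i. x i + s * w i) -` T" by (rule eventually_nhds_in_open)
  then show ?thesis
    by eventually_elim (use T x w line_Eu in auto)
qed

text \<open>An entry of the Jacobian matrix of the coordinate change from the first chart to the
  second, as a function of the point of the manifold. These matrices become the transition matrices
  of the tangent bundle.\<close>

definition jac :: "'a chart \<Rightarrow> 'a chart \<Rightarrow> nat \<Rightarrow> nat \<Rightarrow> 'a \<Rightarrow> real" where
  "jac = (\<lambda>(U, n, \<phi>) (V, m, \<psi>) j i p. deriv (\<lambda>s. \<psi> (inv_into U \<phi> ((\<phi> p)(i := s))) j) (\<phi> p i))"

context
  fixes M :: "'a atlas"
  assumes M: "smooth_atlas M"
begin

lemma transition_smooth_fun: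
  assumes "(U, n, \<phi>) \<in> M" "(V, m, \<psi>) \<in> M"
  shows "openin (Euclidean_space n) (\<phi> ` (U \<inter> V))" "smooth_fun n (\<phi> ` (U \<inter> V)) (\<lambda>x. \<psi> (inv_into U \<phi> x) j)"
  using smooth_real_chart[OF M assms(2)] openin_chart_image[OF M openin_chart[OF M assms(2)] assms(1)] assms(1)
  by (auto simp: smooth_real_def)

text \<open>Smoothness in one chart whose domain contains \<open>B\<close> is enough, as the
  expressions in the other charts arise by composition with transition functions.\<close>

lemma smooth_real_of_chart:
  assumes c: "(U, n, \<phi>) \<in> M" and B: "openin (atlas_topology M) B" "B \<subseteq> U" and g: "smooth_fun n (\<phi> ` B) g"
  shows "smooth_real M B (\<lambda>p. g (\<phi> p))"
proof -
  have UB: "U \<inter> B = B" using B by blast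
  have "smooth_fun k (\<xi> ` (W \<inter> B)) (\<lambda>x. g (\<phi> (inv_into W \<xi> x)))" if d: "(W, k, \<xi>) \<in> M" for W k \<xi>
  proof (rule smooth_fun_compose[where g = "\<lambda>x. \<phi> (inv_into W \<xi> x)", OF _ _ _ _ g])
    show "openin (Euclidean_space n) (\<phi> ` B)" using openin_chart_image[OF M B(1) c] by (simp add: UB)
    show o: "openin (Euclidean_space k) (\<xi> ` (W \<inter> B))" by (rule openin_chart_image[OF M B(1) d])
    show "\<phi> (inv_into W \<xi> x) \<in> \<phi> ` B" if "x \<in> \<xi> ` (W \<inter> B)" for x
      using that chart_inv[OF M d] by auto
    show "smooth_fun k (\<xi> ` (W \<inter> B)) (\<lambda>x. \<phi> (inv_into W \<xi> x) i)" for i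
      by (rule smooth_fun_mono[OF o _ transition_smooth_fun[OF d c]]) (use B in auto)
  qed
  then show ?thesis using B by (simp add: smooth_real_def)
qed

lemma smooth_real_jac:
  assumes c: "(U, n, \<phi>) \<in> M" and d: "(V, m, \<psi>) \<in> M" and i: "i < n"
  shows "smooth_real M (U \<inter> V) (jac (U, n, \<phi>) (V, m, \<psi>) j i)"
  unfolding jac_def prod.case
  by (rule smooth_real_of_chart[OF c _ _ smooth_fun_partial(2)[OF transition_smooth_fun[OF c d] i]])
     (use openin_chart[OF M c] openin_chart[OF M d] in auto)

section \<open>Derivatives of coordinate changes\<close>

context
  fixes U n \<phi> V m \<psi> p w
  assumes c: "(U, n, \<phi>) \<in> M" and d: "(V, m, \<psi>) \<in> M" and p: "p \<in> U" "p \<in> V" and w: "w \<in> Eu n"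
begin

text \<open>Besides a value this records that the derivative exists, which
  \<open>directional_deriv\<close>, being built on \<open>deriv\<close>, does not convey by
  itself.\<close>

lemma has_directional_deriv:
  "((\<lambda>s. \<psi> (inv_into U \<phi> (\<lambda>i. \<phi> p i + s * w i)) j) has_real_derivative
     (\<Sum>i<n. jac (U, n, \<phi>) (V, m, \<psi>) j i p * w i)) (at 0)"
proof -
  have 0: "(\<lambda>i. \<phi> p i + 0 * w i) = \<phi> p" by simp
  have "((\<lambda>s. \<psi> (inv_into U \<phi> (\<lambda>i. \<phi> p i + s * w i)) j) has_real_derivative
    (\<Sum>i<n. deriv (\<lambda>s. \<psi> (inv_into U \<phi> ((\<lambda>i. \<phi> p i + 0 * w i)(i := s))) j) (\<phi> p i + 0 * w i) * w i)) (at 0)"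
  proof (rule smooth_fun_curve[OF transition_smooth_fun[OF c d], where \<gamma> = "\<lambda>s i. \<phi> p i + s * w i"])
    show "(\<lambda>i. \<phi> p i + 0 * w i) \<in> \<phi> ` (U \<inter> V)" unfolding 0 using p by blast
    show "(\<lambda>i. \<phi> p i + t * w i) \<in> Eu n" for t by (rule line_Eu[OF chart_Eu[OF M c p(1)] w])
    show "((\<lambda>t. \<phi> p i + t * w i) has_real_derivative w i) (at 0)" for i
      by (auto intro!: derivative_eq_intros)
  qed
  then show ?thesis unfolding 0 by (simp add: jac_def)
qed

lemma directional_deriv_chart:
  "directional_deriv (\<psi> \<circ> inv_into U \<phi>) (\<phi> p) w = (\<lambda>j. \<Sum>i<n. jac (U, n, \<phi>) (V, m, \<psi>) j i p * w i)"
  unfolding directional_deriv_def o_def using DERIV_imp_deriv[OF has_directional_deriv] by (intro ext)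

lemma eventually_line_chart: "\<forall>\<^sub>F s in nhds 0. (\<lambda>i. \<phi> p i + s * w i) \<in> \<phi> ` (U \<inter> V)"
  by (rule eventually_line[OF transition_smooth_fun(1)[OF c d] _ w]) (use p in blast)

text \<open>The line leaves the image of the chart for large parameters, where
  \<open>inv_into\<close> is arbitrary. Near 0 it stays inside, so the coordinates from
  \<open>m\<close> on vanish near 0 and their derivatives are zero.\<close>

lemma directional_deriv_Eu: "directional_deriv (\<psi> \<circ> inv_into U \<phi>) (\<phi> p) w \<in> Eu m"
  unfolding topspace_Euclidean_space
proof (clarify)
  fix j assume j: "m \<le> j"
  have "\<forall>\<^sub>F s in nhds 0. \<psi> (inv_into U \<phi> (\<lambda>i. \<phi> p i + s * w i)) j = 0"
    using eventually_line_chart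
  proof eventually_elim
    case (elim s)
    then have "\<psi> (inv_into U \<phi> (\<lambda>i. \<phi> p i + s * w i)) \<in> Eu m"
      using chart_Eu[OF M d] chart_inv[OF M c] by auto
    then show ?case using j by (simp add: topspace_Euclidean_space)
  qed
  then have "deriv (\<lambda>s. \<psi> (inv_into U \<phi> (\<lambda>i. \<phi> p i + s * w i)) j) 0 = deriv (\<lambda>s. 0) (0::real)"
    by (rule deriv_cong_ev) simp
  then show "directional_deriv (\<psi> \<circ> inv_into U \<phi>) (\<phi> p) w j = 0"
    by (simp add: directional_deriv_def)
qed

text \<open>The chain rule for \<open>\<psi>' \<circ> inv_into U \<phi>\<close> as the composite of
  the transitions through \<open>V\<close>. It is what makes the coordinates of a tangent vector in
  different charts consistent.\<close>

lemma directional_deriv_cocycle: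
  assumes e: "(V', m', \<psi>') \<in> M" and p': "p \<in> V'"
  shows "directional_deriv (\<psi>' \<circ> inv_into V \<psi>) (\<psi> p) (directional_deriv (\<psi> \<circ> inv_into U \<phi>) (\<phi> p) w) =
    directional_deriv (\<psi>' \<circ> inv_into U \<phi>) (\<phi> p) w"
proof
  fix j
  define l where "l = (\<lambda>s i. \<phi> p i + s * w i)"
  define v where "v = directional_deriv (\<psi> \<circ> inv_into U \<phi>) (\<phi> p) w"
  \<comment> \<open>The line of direction \<open>w\<close>, seen in the chart \<open>\<psi>\<close>.
    Where it leaves the overlap it is replaced by the constant \<open>\<psi> p\<close>, because
    \<open>smooth_fun_curve\<close> requires a curve in \<open>Eu m\<close> at all times; the germ
    at 0 is unaffected.\<close>
  define \<gamma> where "\<gamma> = (\<lambda>s. if l s \<in> \<phi> ` (U \<inter> V) then \<psi> (inv_into U \<phi> (l s)) else \<psi> p)"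
  have l0: "l 0 = \<phi> p" by (simp add: l_def)
  have \<gamma>0: "\<gamma> 0 = \<psi> p" using p by (auto simp: \<gamma>_def l0 chart_inv[OF M c])
  have ev: "\<forall>\<^sub>F s in nhds 0. l s \<in> \<phi> ` (U \<inter> V)" using eventually_line_chart by (simp add: l_def)
  have "((\<lambda>s. \<psi>' (inv_into V \<psi> (\<gamma> s)) j) has_real_derivative
    (\<Sum>i<m. deriv (\<lambda>s. \<psi>' (inv_into V \<psi> ((\<gamma> 0)(i := s))) j) (\<gamma> 0 i) * v i)) (at 0)"
  proof (rule smooth_fun_curve[OF transition_smooth_fun[OF d e]])
    show "\<gamma> 0 \<in> \<psi> ` (V \<inter> V')" using p p' by (auto simp: \<gamma>0)
    show "\<gamma> s \<in> Eu m" for s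
      using chart_Eu[OF M d] p by (auto simp: \<gamma>_def chart_inv[OF M c])
    fix i
    have "((\<lambda>s. \<psi> (inv_into U \<phi> (l s)) i) has_real_derivative v i) (at 0)"
      unfolding l_def v_def directional_deriv_chart by (rule has_directional_deriv)
    moreover have "\<forall>\<^sub>F s in nhds 0. \<psi> (inv_into U \<phi> (l s)) i = \<gamma> s i"
      using ev by eventually_elim (simp add: \<gamma>_def)
    ultimately show "((\<lambda>s. \<gamma> s i) has_real_derivative v i) (at 0)"
      by (rule iffD1[OF DERIV_cong_ev[OF refl _ refl], rotated])
  qed
  then have "deriv (\<lambda>s. \<psi>' (inv_into V \<psi> (\<gamma> s)) j) 0 = (\<Sum>i<m. jac (V, m, \<psi>) (V', m', \<psi>') j i p * v i)"
    using DERIV_imp_deriv by (fastforce simp: \<gamma>0 jac_def)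
  moreover have "\<forall>\<^sub>F s in nhds 0. \<psi>' (inv_into V \<psi> (\<gamma> s)) j = \<psi>' (inv_into U \<phi> (l s)) j"
    using ev by eventually_elim (auto simp: \<gamma>_def chart_inv[OF M c] chart_inv[OF M d])
  then have "deriv (\<lambda>s. \<psi>' (inv_into V \<psi> (\<gamma> s)) j) 0 = deriv (\<lambda>s. \<psi>' (inv_into U \<phi> (l s)) j) 0"
    by (rule deriv_cong_ev) simp
  \<comment> \<open>The straight line with velocity \<open>v\<close> and the curve
    \<open>\<gamma>\<close> have the same velocity at 0, so the Jacobian formula gives both the same
    derivative under the second transition.\<close>
  moreover have "(\<Sum>i<m. jac (V, m, \<psi>) (V', m', \<psi>') j i p * v i) = directional_deriv (\<psi>' \<circ> inv_into V \<psi>) (\<psi> p) v j"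
  proof -
    have "directional_deriv (\<psi>' \<circ> inv_into V \<psi>) (\<psi> p) v j = deriv (\<lambda>s. \<psi>' (inv_into V \<psi> (\<lambda>i. \<psi> p i + s * v i)) j) 0"
      by (simp add: directional_deriv_def)
    also have "((\<lambda>s. \<psi>' (inv_into V \<psi> (\<lambda>i. \<psi> p i + s * v i)) j) has_real_derivative
        (\<Sum>i<m. deriv (\<lambda>s. \<psi>' (inv_into V \<psi> ((\<lambda>i. \<psi> p i + 0 * v i)(i := s))) j) (\<psi> p i + 0 * v i) * v i)) (at 0)"
    proof (rule smooth_fun_curve[OF transition_smooth_fun[OF d e], where \<gamma> = "\<lambda>s i. \<psi> p i + s * v i"])
      show "(\<lambda>i. \<psi> p i + 0 * v i) \<in> \<psi> ` (V \<inter> V')" using p p' by simp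
      show "(\<lambda>i. \<psi> p i + t * v i) \<in> Eu m" for t
        unfolding v_def by (rule line_Eu[OF chart_Eu[OF M d p(2)] directional_deriv_Eu])
      show "((\<lambda>t. \<psi> p i + t * v i) has_real_derivative v i) (at 0)" for i
        by (auto intro!: derivative_eq_intros)
    qed
    note DERIV_imp_deriv[OF this]
    finally show ?thesis by (simp add: jac_def)
  qed
  ultimately show "directional_deriv (\<psi>' \<circ> inv_into V \<psi>) (\<psi> p) (directional_deriv (\<psi> \<circ> inv_into U \<phi>) (\<phi> p) w) j =
    directional_deriv (\<psi>' \<circ> inv_into U \<phi>) (\<phi> p) w j"
    unfolding v_def[symmetric] by (simp add: directional_deriv_def l_def)
qed

end

lemma directional_deriv_self:
  assumes c: "(U, n, \<phi>) \<in> M" and p: "p \<in> U" and w: "w \<in> Eu n"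
  shows "directional_deriv (\<phi> \<circ> inv_into U \<phi>) (\<phi> p) w = w"
proof
  fix j
  have "\<forall>\<^sub>F s in nhds 0. \<phi> (inv_into U \<phi> (\<lambda>i. \<phi> p i + s * w i)) j = \<phi> p j + s * w j"
    using eventually_line_chart[OF c c p p w]
  proof eventually_elim
    case (elim s)
    then have "\<phi> (inv_into U \<phi> (\<lambda>i. \<phi> p i + s * w i)) = (\<lambda>i. \<phi> p i + s * w i)"
      by (intro f_inv_into_f) auto
    then show ?case by simp
  qed
  then have "deriv (\<lambda>s. \<phi> (inv_into U \<phi> (\<lambda>i. \<phi> p i + s * w i)) j) 0 = deriv (\<lambda>s. \<phi> p j + s * w j) 0"
    by (rule deriv_cong_ev) simp
  also have "\<dots> = w j" by (rule DERIV_imp_deriv) (auto intro!: derivative_eq_intros)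
  finally show "directional_deriv (\<phi> \<circ> inv_into U \<phi>) (\<phi> p) w j = w j"
    by (simp add: directional_deriv_def)
qed

section \<open>The bundle structure on tangent vectors\<close>

lemma tangent_bundle_simps [simp]:
  "vcarrier (tangent_bundle M) = (\<Union>p\<in>mcarrier M. tangent_space M p)"
  "vproj (tangent_bundle M) = fst"
  "vadd (tangent_bundle M) = tangent_add"
  "vscale (tangent_bundle M) = (\<lambda>a v. (fst v, \<lambda>c i. a * snd v c i))"
  by (simp_all add: tangent_bundle_def)

lemma tangent_vtriv: "(W, k, \<kappa>) \<in> vtriv (tangent_bundle M) \<longleftrightarrow>
    (\<exists>\<phi>. (W, k, \<phi>) \<in> M \<and> \<kappa> = (\<lambda>v. snd v (W, k, \<phi>)))"
  unfolding tangent_bundle_def by (simp, blast)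

lemma tangent_space_iff:
  "v \<in> tangent_space M p \<longleftrightarrow> fst v = p \<and> (\<forall>c. c \<notin> charts_at M p \<longrightarrow> snd v c = (\<lambda>_. 0)) \<and>
     (\<forall>U n \<phi>. (U, n, \<phi>) \<in> M \<longrightarrow> p \<in> U \<longrightarrow> snd v (U, n, \<phi>) \<in> Eu n \<and>
        (\<forall>V m \<psi>. (V, m, \<psi>) \<in> M \<longrightarrow> p \<in> V \<longrightarrow>
           snd v (V, m, \<psi>) = directional_deriv (\<psi> \<circ> inv_into U \<phi>) (\<phi> p) (snd v (U, n, \<phi>))))"
proof (cases v)
  case (Pair q u)
  have "v \<in> tangent_space M p \<longleftrightarrow> q = p \<and> (\<forall>c. c \<notin> charts_at M p \<longrightarrow> u c = (\<lambda>_. 0)) \<and>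
     (\<forall>(U, n, \<phi>)\<in>charts_at M p. u (U, n, \<phi>) \<in> Eu n \<and>
        (\<forall>(V, m, \<psi>)\<in>charts_at M p. u (V, m, \<psi>) = directional_deriv (\<psi> \<circ> inv_into U \<phi>) (\<phi> p) (u (U, n, \<phi>))))"
    unfolding Pair tangent_space_def by blast
  then show ?thesis
    unfolding Pair fst_conv snd_conv charts_at_def Ball_def split_paired_All mem_Collect_eq prod.case imp_conjL .
qed

lemma tangent_space_fst: "v \<in> tangent_space M p \<Longrightarrow> fst v = p"
  by (auto simp: tangent_space_def)

lemma tangent_fibre: "p \<in> mcarrier M \<Longrightarrow> fibre (tangent_bundle M) p = tangent_space M p"
proof (rule Set.set_eqI)
  fix v assume p: "p \<in> mcarrier M"
  have "v \<in> fibre (tangent_bundle M) p \<longleftrightarrow> (\<exists>q\<in>mcarrier M. v \<in> tangent_space M q) \<and> fst v = p"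
    by (simp add: fibre_iff)
  then show "v \<in> fibre (tangent_bundle M) p \<longleftrightarrow> v \<in> tangent_space M p"
    using p tangent_space_fst by metis
qed

lemma tangent_space_off: "v \<in> tangent_space M p \<Longrightarrow> c \<notin> charts_at M p \<Longrightarrow> snd v c = (\<lambda>_. 0)"
  unfolding tangent_space_iff by blast

lemma tangent_space_Eu: "v \<in> tangent_space M p \<Longrightarrow> (U, n, \<phi>) \<in> M \<Longrightarrow> p \<in> U \<Longrightarrow> snd v (U, n, \<phi>) \<in> Eu n"
  unfolding tangent_space_iff by blast

lemma tangent_space_jac:
  assumes v: "v \<in> tangent_space M p" and c: "(U, n, \<phi>) \<in> M" "p \<in> U" and d: "(V, m, \<psi>) \<in> M" "p \<in> V"
  shows "snd v (V, m, \<psi>) j = (\<Sum>i<n. jac (U, n, \<phi>) (V, m, \<psi>) j i p * snd v (U, n, \<phi>) i)"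
proof -
  have "snd v (U, n, \<phi>) \<in> Eu n" "snd v (V, m, \<psi>) = directional_deriv (\<psi> \<circ> inv_into U \<phi>) (\<phi> p) (snd v (U, n, \<phi>))"
    using v c d unfolding tangent_space_iff by blast+
  then show ?thesis using directional_deriv_chart[OF c(1) d(1) c(2) d(2)] by simp
qed

text \<open>A tangent vector at \<open>p\<close> is determined by its coordinates in one chart, by
  the Jacobians for charts around \<open>p\<close> and by the value 0 for all others. Conversely any
  vector of coordinates extends to a compatible family by the cocycle identity, and linearity of the
  Jacobians makes sums and multiples of families compatible again.\<close>

lemma tangent_trivialization:
  assumes c: "(U, n, \<phi>) \<in> M"
  shows "trivialization (tangent_bundle M) U n (\<lambda>v. snd v (U, n, \<phi>))"
  unfolding trivialization_def
proof (intro ballI conjI allI)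
  fix p assume p: "p \<in> U"
  then have pM: "p \<in> mcarrier M" using chart_subset[OF c] by blast
  note fib = tangent_fibre[OF pM]
  show "bij_betw (\<lambda>v. snd v (U, n, \<phi>)) (fibre (tangent_bundle M) p) (Eu n)"
    unfolding fib
  proof (rule bij_betw_imageI)
    show "inj_on (\<lambda>v. snd v (U, n, \<phi>)) (tangent_space M p)"
    proof (rule inj_onI)
      fix v v' assume v: "v \<in> tangent_space M p" "v' \<in> tangent_space M p" and eq: "snd v (U, n, \<phi>) = snd v' (U, n, \<phi>)"
      have "snd v (V, m, \<psi>) = snd v' (V, m, \<psi>)" for V m \<psi>
      proof (cases "(V, m, \<psi>) \<in> charts_at M p")
        case True
        then have d: "(V, m, \<psi>) \<in> M" "p \<in> V" by (auto simp: charts_at_def)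
        then show ?thesis
          using tangent_space_jac[OF v(1) c p d] tangent_space_jac[OF v(2) c p d] eq by (intro ext) simp
      next
        case False
        then show ?thesis using tangent_space_off[OF v(1)] tangent_space_off[OF v(2)] by simp
      qed
      then have "snd v c' = snd v' c'" for c' by (cases c') simp
      then have "snd v = snd v'" ..
      then show "v = v'" using v by (simp add: tangent_space_fst prod_eq_iff)
    qed
    show "(\<lambda>v. snd v (U, n, \<phi>)) ` tangent_space M p = Eu n"
    proof
      show "(\<lambda>v. snd v (U, n, \<phi>)) ` tangent_space M p \<subseteq> Eu n"
        using tangent_space_Eu[OF _ c p] by blast
      show "Eu n \<subseteq> (\<lambda>v. snd v (U, n, \<phi>)) ` tangent_space M p"
      proof
        fix w assume w: "w \<in> Eu n"
        \<comment> \<open>The family generated by prescribing \<open>w\<close> in the chart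
          \<open>\<phi>\<close> and applying the derivative of the coordinate change to every other
          chart around \<open>p\<close>.\<close>
        define u where "u = (\<lambda>(V, m, \<psi>). if (V, m, \<psi>) \<in> charts_at M p
          then directional_deriv (\<psi> \<circ> inv_into U \<phi>) (\<phi> p) w else (\<lambda>_. 0))"
        have u: "u (V, m, \<psi>) = directional_deriv (\<psi> \<circ> inv_into U \<phi>) (\<phi> p) w" if "(V, m, \<psi>) \<in> M" "p \<in> V" for V m \<psi>
          using that by (simp add: u_def charts_at_def)
        have "(p, u) \<in> tangent_space M p"
          unfolding tangent_space_iff fst_conv snd_conv
        proof (intro conjI allI impI)
          show "u d = (\<lambda>_. 0)" if "d \<notin> charts_at M p" for d
            using that by (cases d) (simp add: u_def)
          fix V m \<psi> assume d: "(V, m, \<psi>) \<in> M" "p \<in> V"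
          show "u (V, m, \<psi>) \<in> Eu m"
            unfolding u[OF d] by (rule directional_deriv_Eu[OF c d(1) p d(2) w])
          fix V' m' \<psi>' assume e: "(V', m', \<psi>') \<in> M" "p \<in> V'"
          show "u (V', m', \<psi>') = directional_deriv (\<psi>' \<circ> inv_into V \<psi>) (\<psi> p) (u (V, m, \<psi>))"
            unfolding u[OF d] u[OF e] by (rule directional_deriv_cocycle[OF c d(1) p d(2) w e, symmetric])
        qed simp
        moreover have "u (U, n, \<phi>) = w"
          unfolding u[OF c p] by (rule directional_deriv_self[OF c p w])
        ultimately show "w \<in> (\<lambda>v. snd v (U, n, \<phi>)) ` tangent_space M p" by force
      qed
    qed
  qed
  {
    fix v v' assume v: "v \<in> fibre (tangent_bundle M) p" "v' \<in> fibre (tangent_bundle M) p"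
    then have v: "v \<in> tangent_space M p" "v' \<in> tangent_space M p" by (simp_all add: fib)
    show "snd (vadd (tangent_bundle M) v v') (U, n, \<phi>) = (\<lambda>i. snd v (U, n, \<phi>) i + snd v' (U, n, \<phi>) i)"
      by (simp add: tangent_add_def)
    have "tangent_add v v' \<in> tangent_space M p"
      unfolding tangent_space_iff
    proof (intro conjI allI impI)
      fix V m \<psi> V' m' \<psi>' assume d: "(V, m, \<psi>) \<in> M" "p \<in> V" and e: "(V', m', \<psi>') \<in> M" "p \<in> V'"
      have E: "(\<lambda>i. snd v (V, m, \<psi>) i + snd v' (V, m, \<psi>) i) \<in> Eu m"
        using v[THEN tangent_space_Eu[OF _ d]] by (simp add: topspace_Euclidean_space)
      show "snd (tangent_add v v') (V', m', \<psi>') =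
          directional_deriv (\<psi>' \<circ> inv_into V \<psi>) (\<psi> p) (snd (tangent_add v v') (V, m, \<psi>))"
        unfolding tangent_add_def snd_conv directional_deriv_chart[OF d(1) e(1) d(2) e(2) E]
        by (simp add: tangent_space_jac[OF v(1) d e] tangent_space_jac[OF v(2) d e] distrib_left sum.distrib)
    next
      fix V m \<psi> assume d: "(V, m, \<psi>) \<in> M" "p \<in> V"
      show "snd (tangent_add v v') (V, m, \<psi>) \<in> Eu m"
        using v[THEN tangent_space_Eu[OF _ d]] by (simp add: tangent_add_def topspace_Euclidean_space)
    qed (use v[THEN tangent_space_fst] v[THEN tangent_space_off] in \<open>simp_all add: tangent_add_def\<close>)
    then show "vadd (tangent_bundle M) v v' \<in> fibre (tangent_bundle M) p" by (simp add: fib)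
  }
  fix a v assume "v \<in> fibre (tangent_bundle M) p"
  then have v: "v \<in> tangent_space M p" by (simp add: fib)
  show "snd (vscale (tangent_bundle M) a v) (U, n, \<phi>) = (\<lambda>i. a * snd v (U, n, \<phi>) i)" by simp
  have "(fst v, \<lambda>c i. a * snd v c i) \<in> tangent_space M p"
    unfolding tangent_space_iff fst_conv snd_conv
  proof (intro conjI allI impI)
    fix V m \<psi> V' m' \<psi>' assume d: "(V, m, \<psi>) \<in> M" "p \<in> V" and e: "(V', m', \<psi>') \<in> M" "p \<in> V'"
    have E: "(\<lambda>i. a * snd v (V, m, \<psi>) i) \<in> Eu m"
      using tangent_space_Eu[OF v d] by (simp add: topspace_Euclidean_space)
    show "(\<lambda>i. a * snd v (V', m', \<psi>') i) = directional_deriv (\<psi>' \<circ> inv_into V \<psi>) (\<psi> p) (\<lambda>i. a * snd v (V, m, \<psi>) i)"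
      unfolding directional_deriv_chart[OF d(1) e(1) d(2) e(2) E]
      by (simp add: tangent_space_jac[OF v d e] sum_distrib_left algebra_simps)
  next
    fix V m \<psi> assume d: "(V, m, \<psi>) \<in> M" "p \<in> V"
    show "(\<lambda>i. a * snd v (V, m, \<psi>) i) \<in> Eu m"
      using tangent_space_Eu[OF v d] by (simp add: topspace_Euclidean_space)
  qed (use tangent_space_fst[OF v] tangent_space_off[OF v] in simp_all)
  then show "vscale (tangent_bundle M) a v \<in> fibre (tangent_bundle M) p" by (simp add: fib)
qed

lemma tangent_vec_bundle: "vec_bundle M (tangent_bundle M)"
proof (unfold_locales, rule M, rule vector_bundleI[OF M])
  show "prebundle M (tangent_bundle M)"
    unfolding prebundle_def
  proof (intro conjI ballI allI impI)
    show "vproj (tangent_bundle M) ` vcarrier (tangent_bundle M) \<subseteq> mcarrier M"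
      using tangent_space_fst by (simp add: image_subset_iff)
    show "\<exists>U n \<phi>. (U, n, \<phi>) \<in> vtriv (tangent_bundle M) \<and> x \<in> U" if "x \<in> mcarrier M" for x
      using that unfolding mcarrier_iff tangent_vtriv by blast
    fix U n \<kappa> assume "(U, n, \<kappa>) \<in> vtriv (tangent_bundle M)"
    then obtain \<phi> where c: "(U, n, \<phi>) \<in> M" and \<kappa>: "\<kappa> = (\<lambda>v. snd v (U, n, \<phi>))" unfolding tangent_vtriv by blast
    show "openin (atlas_topology M) U" by (rule openin_chart[OF M c])
    show "trivialization (tangent_bundle M) U n \<kappa>" unfolding \<kappa> by (rule tangent_trivialization[OF c])
  qed
  fix U n \<kappa> V m \<kappa>' assume "(U, n, \<kappa>) \<in> vtriv (tangent_bundle M)" "(V, m, \<kappa>') \<in> vtriv (tangent_bundle M)"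
  then obtain \<phi> \<psi> where c: "(U, n, \<phi>) \<in> M" and \<kappa>: "\<kappa> = (\<lambda>v. snd v (U, n, \<phi>))"
    and d: "(V, m, \<psi>) \<in> M" and \<kappa>': "\<kappa>' = (\<lambda>v. snd v (V, m, \<psi>))" unfolding tangent_vtriv by blast
  have "snd v (V, m, \<psi>) j = (\<Sum>i<n. jac (U, n, \<phi>) (V, m, \<psi>) j i (fst v) * snd v (U, n, \<phi>) i)"
    if v: "v \<in> vcarrier (tangent_bundle M)" "fst v \<in> U \<inter> V" for v j
  proof -
    obtain q where "v \<in> tangent_space M q" using v(1) by auto
    then have "v \<in> tangent_space M (fst v)" using tangent_space_fst by metis
    from tangent_space_jac[OF this c _ d] that(2) show ?thesis by simp
  qed
  then show "\<exists>a. (\<forall>j<m. \<forall>i<n. smooth_real M (U \<inter> V) (a j i)) \<and>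
      (\<forall>e\<in>vcarrier (tangent_bundle M). vproj (tangent_bundle M) e \<in> U \<inter> V \<longrightarrow>
        (\<forall>j<m. \<kappa>' e j = (\<Sum>i<n. a j i (vproj (tangent_bundle M) e) * \<kappa> e i)))"
    by (intro exI[of _ "jac (U, n, \<phi>) (V, m, \<psi>)"]) (auto simp: \<kappa> \<kappa>' intro: smooth_real_jac[OF c d])
qed

lemma tangent_zero_space: "p \<in> mcarrier M \<Longrightarrow> tangent_zero p \<in> tangent_space M p"
  by (auto simp: tangent_space_iff tangent_zero_def directional_deriv_def topspace_Euclidean_space)

lemma tangent_zero_carrier: "p \<in> mcarrier M \<Longrightarrow> tangent_zero p \<in> vcarrier (tangent_bundle M)"
  using tangent_zero_space by auto

text \<open>All fibre coordinates of the zero section vanish. Its smoothness ensures that an affine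
  action of \<open>TG\<close> restricts to a smooth action of \<open>G\<close>.\<close>

lemma smooth_tangent_zero: "smooth_map M (total_space M (tangent_bundle M)) tangent_zero"
proof (rule vec_bundle.smooth_map_totalI[OF tangent_vec_bundle M])
  show "smooth_map M M (\<lambda>p. vproj (tangent_bundle M) (tangent_zero p))"
    using smooth_map_ident[OF M] by (simp add: tangent_zero_def)
  show "tangent_zero p \<in> vcarrier (tangent_bundle M)" if "p \<in> mcarrier M" for p
    by (rule tangent_zero_carrier[OF that])
  fix p assume "p \<in> mcarrier M"
  then obtain U n \<phi> where c: "(U, n, \<phi>) \<in> M" "p \<in> U" unfolding mcarrier_iff by blast
  then have d: "(U, n, \<lambda>v. snd v (U, n, \<phi>)) \<in> vtriv (tangent_bundle M)" unfolding tangent_vtriv by blast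
  show "\<exists>A U n \<phi>. openin (atlas_topology M) A \<and> p \<in> A \<and> (U, n, \<phi>) \<in> vtriv (tangent_bundle M) \<and>
       (\<forall>q\<in>A. vproj (tangent_bundle M) (tangent_zero q) \<in> U) \<and> (\<forall>i<n. smooth_real M A (\<lambda>q. \<phi> (tangent_zero q) i))"
    using openin_chart[OF M c(1)] c(2) d smooth_real_const[OF M openin_chart[OF M c(1)]]
    by (intro exI[of _ U] exI[of _ n] exI[of _ "\<lambda>v. snd v (U, n, \<phi>)"]) (simp add: tangent_zero_def)
qed

end

section \<open>Smooth maps between total spaces\<close>

context vec_bundle
begin

lemma vadd_closed:
  assumes "e \<in> vcarrier E" "e' \<in> vcarrier E" "vproj E e = vproj E e'"
  shows "vadd E e e' \<in> vcarrier E" "vproj E (vadd E e e') = vproj E e"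
proof -
  obtain U n \<phi> where U: "(U, n, \<phi>) \<in> vtriv E" "vproj E e \<in> U" using triv_cover[OF vproj_in[OF assms(1)]] by blast
  have "vadd E e e' \<in> fibre E (vproj E e)"
    using fibre_add[OF triv_triv[OF U(1)] U(2)] assms by (simp add: fibre_iff)
  then show "vadd E e e' \<in> vcarrier E" "vproj E (vadd E e e') = vproj E e" by (auto simp: fibre_iff)
qed

lemma vscale_closed:
  assumes "e \<in> vcarrier E"
  shows "vscale E c e \<in> vcarrier E" "vproj E (vscale E c e) = vproj E e"
proof -
  obtain U n \<phi> where U: "(U, n, \<phi>) \<in> vtriv E" "vproj E e \<in> U" using triv_cover[OF vproj_in[OF assms(1)]] by blast
  have "vscale E c e \<in> fibre E (vproj E e)"
    using fibre_scale[OF triv_triv[OF U(1)] U(2)] assms by (simp add: fibre_iff)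
  then show "vscale E c e \<in> vcarrier E" "vproj E (vscale E c e) = vproj E e" by (auto simp: fibre_iff)
qed

lemma TS_carrier_iff [simp]: "e \<in> mcarrier TS \<longleftrightarrow> e \<in> vcarrier E"
  by (simp add: mcarrier_TS)

lemma smooth_map_base: "smooth_atlas L \<Longrightarrow> smooth_map L TS f \<Longrightarrow> smooth_map L X (\<lambda>p. vproj E (f p))"
  using smooth_map_compose[OF _ TS X _ smooth_vproj] .

lemma smooth_map_triv:
  assumes L: "smooth_atlas L" and f: "smooth_map L TS f" and U: "(U, n, \<phi>) \<in> vtriv E"
  shows "smooth_real L {p \<in> mcarrier L. vproj E (f p) \<in> U} (\<lambda>p. \<phi> (f p) i)"
  using smooth_map_vimage[OF L smooth_map_base[OF L f] triv_open[OF U]] smooth_map_carrier[OF L TS f]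
  by (intro smooth_real_pullback[OF L TS f smooth_triv[OF U]]) auto

text \<open>The combination with a scalar \<open>c\<close> is the form in which the shear
  (\<open>c = -1\<close>) and its inverse (\<open>c = 1\<close>) change the second summand.\<close>

lemma smooth_map_linear:
  assumes L: "smooth_atlas L" and f: "smooth_map L TS f" and g: "smooth_map L TS g"
    and eq: "\<And>p. p \<in> mcarrier L \<Longrightarrow> vproj E (f p) = vproj E (g p)"
  shows "smooth_map L TS (\<lambda>p. vadd E (f p) (vscale E c (g p)))"
proof (rule smooth_map_totalI[OF L])
  have fE: "f p \<in> vcarrier E" and gE: "g p \<in> vcarrier E" if "p \<in> mcarrier L" for p
    using smooth_map_carrier[OF L TS f that] smooth_map_carrier[OF L TS g that] by simp_all
  have S: "vscale E c (g p) \<in> vcarrier E" "vproj E (vscale E c (g p)) = vproj E (f p)" if "p \<in> mcarrier L" for p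
    using vscale_closed[OF gE[OF that]] eq[OF that] by auto
  have A: "vadd E (f p) (vscale E c (g p)) \<in> vcarrier E" "vproj E (vadd E (f p) (vscale E c (g p))) = vproj E (f p)"
    if "p \<in> mcarrier L" for p
    using vadd_closed[OF fE[OF that] S(1)[OF that]] S(2)[OF that] by auto
  show "smooth_map L X (\<lambda>p. vproj E (vadd E (f p) (vscale E c (g p))))"
    by (rule smooth_map_cong[OF L X smooth_map_base[OF L f]]) (simp add: A)
  show "vadd E (f p) (vscale E c (g p)) \<in> vcarrier E" if "p \<in> mcarrier L" for p by (rule A(1)[OF that])
  fix p assume p: "p \<in> mcarrier L"
  obtain U n \<phi> where U: "(U, n, \<phi>) \<in> vtriv E" "vproj E (f p) \<in> U" using triv_cover[OF vproj_in[OF fE[OF p]]] by blast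
  define B where "B = {p \<in> mcarrier L. vproj E (f p) \<in> U}"
  have B: "smooth_real L B (\<lambda>p. \<phi> (f p) i)" for i
    unfolding B_def by (rule smooth_map_triv[OF L f U(1)])
  have "{p \<in> mcarrier L. vproj E (g p) \<in> U} = B" unfolding B_def using eq by auto
  then have B': "smooth_real L B (\<lambda>p. \<phi> (g p) i)" for i
    using smooth_map_triv[OF L g U(1)] by simp
  have *: "\<phi> (vadd E (f q) (vscale E c (g q))) i = \<phi> (f q) i + c * \<phi> (g q) i" if "q \<in> B" for q i
  proof -
    have q: "q \<in> mcarrier L" "vproj E (f q) \<in> U" using that by (auto simp: B_def)
    note T = triv_triv[OF U(1)] q(2)
    show ?thesis
      using triv_add[OF T, of "f q" "vscale E c (g q)"] triv_scale[OF T, of "g q" c] S[OF q(1)] fE[OF q(1)] gE[OF q(1)] eq[OF q(1)]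
      by (simp add: fibre_iff)
  qed
  have "smooth_real L B (\<lambda>p. \<phi> (f p) i + c * \<phi> (g p) i)" for i
    using B B' smooth_real_const[OF L smooth_real_open[OF B]] by (intro smooth_real_add[OF L] smooth_real_mult[OF L])
  then have "smooth_real L B (\<lambda>p. \<phi> (vadd E (f p) (vscale E c (g p))) i)" for i
    using smooth_real_cong[OF L, of B "\<lambda>p. \<phi> (f p) i + c * \<phi> (g p) i" "\<lambda>p. \<phi> (vadd E (f p) (vscale E c (g p))) i"] * by simp
  moreover have "\<forall>q\<in>B. vproj E (vadd E (f q) (vscale E c (g q))) \<in> U"
    by (simp add: B_def A)
  moreover have "p \<in> B" using p U by (simp add: B_def)
  ultimately show "\<exists>A U n \<phi>. openin (atlas_topology L) A \<and> p \<in> A \<and> (U, n, \<phi>) \<in> vtriv E \<and>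
       (\<forall>q\<in>A. vproj E (vadd E (f q) (vscale E c (g q))) \<in> U) \<and>
       (\<forall>i<n. smooth_real L A (\<lambda>q. \<phi> (vadd E (f q) (vscale E c (g q))) i))"
    using smooth_real_open[OF B] U(1) by (intro exI[of _ B] exI[of _ U] exI[of _ n] exI[of _ \<phi>]) blast
qed

end

text \<open>The variant of \<open>smooth_map_totalI\<close> for maps whose fibre coordinates can be
  controlled in every trivialization, on the whole preimage of its domain.\<close>

lemma smooth_map_total_chartI:
  assumes "vec_bundle X E" and L: "smooth_atlas L" and base: "smooth_map L X (\<lambda>p. vproj E (f p))"
    and f: "\<And>p. p \<in> mcarrier L \<Longrightarrow> f p \<in> vcarrier E"
    and loc: "\<And>U n \<phi> i. (U, n, \<phi>) \<in> vtriv E \<Longrightarrow> i < n \<Longrightarrow> smooth_real L {p \<in> mcarrier L. vproj E (f p) \<in> U} (\<lambda>p. \<phi> (f p) i)"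
  shows "smooth_map L (total_space X E) f"
proof -
  interpret vec_bundle X E by fact
  show ?thesis
  proof (rule smooth_map_totalI[OF L base f])
    fix p assume p: "p \<in> mcarrier L"
    obtain U n \<phi> where U: "(U, n, \<phi>) \<in> vtriv E" "vproj E (f p) \<in> U" using triv_cover[OF vproj_in[OF f[OF p]]] by blast
    show "\<exists>A U n \<phi>. openin (atlas_topology L) A \<and> p \<in> A \<and> (U, n, \<phi>) \<in> vtriv E \<and>
       (\<forall>q\<in>A. vproj E (f q) \<in> U) \<and> (\<forall>i<n. smooth_real L A (\<lambda>q. \<phi> (f q) i))"
      using loc[OF U(1)] U p smooth_map_vimage[OF L base triv_open[OF U(1)]]
      by (intro exI[of _ "{p \<in> mcarrier L. vproj E (f p) \<in> U}"] exI[of _ U] exI[of _ n] exI[of _ \<phi>]) auto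
  qed
qed

section \<open>Projections from and maps into a Whitney sum\<close>

context
  fixes X :: "'x atlas" and E :: "('e, 'x) vbundle" and F :: "('f, 'x) vbundle"
  assumes EE: "vec_bundle X E" and FF: "vec_bundle X F"
begin

interpretation E: vec_bundle X E by (rule EE)
interpretation F: vec_bundle X F by (rule FF)
interpretation W: vec_bundle X "whitney_sum E F" by (rule whitney_bundle[OF EE FF])

lemma smooth_whitney_fst: "smooth_map (total_space X (whitney_sum E F)) (total_space X E) fst"
proof (rule E.smooth_map_totalI[OF W.TS])
  show "smooth_map W.TS X (\<lambda>p. vproj E (fst p))" 
    by (rule smooth_map_cong[OF W.TS E.X W.smooth_vproj]) (simp add: whitney_proj)
  show "fst p \<in> vcarrier E" if "p \<in> mcarrier W.TS" for p using that by (simp add: whitney_carrier)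
  fix p assume "p \<in> mcarrier W.TS"
  then have p: "fst p \<in> vcarrier E" "snd p \<in> vcarrier F" "vproj E (fst p) = vproj F (snd p)" by (auto simp: whitney_carrier)
  obtain U n \<phi> where U: "(U, n, \<phi>) \<in> vtriv E" "vproj E (fst p) \<in> U" using E.triv_cover[OF E.vproj_in[OF p(1)]] by blast
  obtain V m \<psi> where V: "(V, m, \<psi>) \<in> vtriv F" "vproj F (snd p) \<in> V" using F.triv_cover[OF F.vproj_in[OF p(2)]] by blast
  have W: "(U \<inter> V, n + m, \<lambda>(e, e'). join n (\<phi> e) (\<psi> e')) \<in> vtriv (whitney_sum E F)"
    unfolding whitney_vtriv using U V by blast
  define A where "A = {e \<in> vcarrier (whitney_sum E F). vproj (whitney_sum E F) e \<in> U \<inter> V}"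
  have "smooth_real W.TS A (\<lambda>q. \<phi> (fst q) i)" if "i < n" for i
    using W.smooth_triv[OF W, of i] that by (simp add: A_def join_def case_prod_unfold)
  then show "\<exists>A U n \<phi>. openin (atlas_topology W.TS) A \<and> p \<in> A \<and> (U, n, \<phi>) \<in> vtriv E \<and>
       (\<forall>q\<in>A. vproj E (fst q) \<in> U) \<and> (\<forall>i<n. smooth_real W.TS A (\<lambda>q. \<phi> (fst q) i))"
    using W.openin_TS_over[OF W.triv_open[OF W]] p U V
    by (intro exI[of _ A] exI[of _ U] exI[of _ n] exI[of _ \<phi>]) (auto simp: A_def whitney_carrier whitney_proj)
qed

lemma smooth_whitney_snd: "smooth_map (total_space X (whitney_sum E F)) (total_space X F) snd"
proof (rule F.smooth_map_totalI[OF W.TS])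
  show "smooth_map W.TS X (\<lambda>p. vproj F (snd p))"
    by (rule smooth_map_cong[OF W.TS E.X W.smooth_vproj]) (simp add: whitney_carrier whitney_proj)
  show "snd p \<in> vcarrier F" if "p \<in> mcarrier W.TS" for p using that by (simp add: whitney_carrier)
  fix p assume "p \<in> mcarrier W.TS"
  then have p: "fst p \<in> vcarrier E" "snd p \<in> vcarrier F" "vproj E (fst p) = vproj F (snd p)" by (auto simp: whitney_carrier)
  obtain U n \<phi> where U: "(U, n, \<phi>) \<in> vtriv E" "vproj E (fst p) \<in> U" using E.triv_cover[OF E.vproj_in[OF p(1)]] by blast
  obtain V m \<psi> where V: "(V, m, \<psi>) \<in> vtriv F" "vproj F (snd p) \<in> V" using F.triv_cover[OF F.vproj_in[OF p(2)]] by blast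
  have W: "(U \<inter> V, n + m, \<lambda>(e, e'). join n (\<phi> e) (\<psi> e')) \<in> vtriv (whitney_sum E F)"
    unfolding whitney_vtriv using U V by blast
  define A where "A = {e \<in> vcarrier (whitney_sum E F). vproj (whitney_sum E F) e \<in> U \<inter> V}"
  have "smooth_real W.TS A (\<lambda>q. \<psi> (snd q) i)" for i
    using W.smooth_triv[OF W, of "n + i"] by (simp add: A_def join_def case_prod_unfold)
  then show "\<exists>A V m \<psi>. openin (atlas_topology W.TS) A \<and> p \<in> A \<and> (V, m, \<psi>) \<in> vtriv F \<and>
       (\<forall>q\<in>A. vproj F (snd q) \<in> V) \<and> (\<forall>i<m. smooth_real W.TS A (\<lambda>q. \<psi> (snd q) i))"
    using W.openin_TS_over[OF W.triv_open[OF W]] p U V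
    by (intro exI[of _ A] exI[of _ V] exI[of _ m] exI[of _ \<psi>]) (auto simp: A_def whitney_carrier whitney_proj)
qed

text \<open>The universal property of the sum on the level of total spaces: the fibre coordinates of
  the pair are a \<open>join\<close> of those of \<open>f\<close> and \<open>g\<close>. With the
  projections it yields all structural isomorphisms of sums by composition, without further
  charts.\<close>

lemma smooth_whitney_pair:
  assumes L: "smooth_atlas L" and f: "smooth_map L (total_space X E) f" and g: "smooth_map L (total_space X F) g"
    and eq: "\<And>p. p \<in> mcarrier L \<Longrightarrow> vproj E (f p) = vproj F (g p)"
  shows "smooth_map L (total_space X (whitney_sum E F)) (\<lambda>p. (f p, g p))"
proof (rule smooth_map_total_chartI[OF W.vec_bundle_axioms L])
  show "smooth_map L X (\<lambda>p. vproj (whitney_sum E F) (f p, g p))" using E.smooth_map_base[OF L f] by simp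
  show "(f p, g p) \<in> vcarrier (whitney_sum E F)" if "p \<in> mcarrier L" for p
    using smooth_map_carrier[OF L E.TS f that] smooth_map_carrier[OF L F.TS g that] eq[OF that] by (simp add: whitney_carrier)
  fix W k \<kappa> i assume "(W, k, \<kappa>) \<in> vtriv (whitney_sum E F)" and i: "i < k"
  then obtain U n \<phi> V m \<psi> where U: "(U, n, \<phi>) \<in> vtriv E" and V: "(V, m, \<psi>) \<in> vtriv F"
    and W: "W = U \<inter> V" "k = n + m" "\<kappa> = (\<lambda>(e, e'). join n (\<phi> e) (\<psi> e'))"
    unfolding whitney_vtriv by blast
  define A where "A = {p \<in> mcarrier L. vproj E (f p) \<in> U \<inter> V}"
  have A: "openin (atlas_topology L) A"
    unfolding A_def using smooth_map_vimage[OF L E.smooth_map_base[OF L f] W.triv_open[of "U \<inter> V" k \<kappa>]] \<open>(W, k, \<kappa>) \<in> _\<close> W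
    by simp
  have "smooth_real L A (\<lambda>p. \<phi> (f p) j)" for j
    by (rule smooth_real_mono[OF L A _ E.smooth_map_triv[OF L f U]]) (auto simp: A_def)
  moreover have "smooth_real L A (\<lambda>p. \<psi> (g p) j)" for j
    by (rule smooth_real_mono[OF L A _ F.smooth_map_triv[OF L g V]]) (auto simp: A_def eq)
  ultimately have "smooth_real L A (\<lambda>p. join n (\<phi> (f p)) (\<psi> (g p)) i)"
    using i W by (intro smooth_real_join) auto
  then show "smooth_real L {p \<in> mcarrier L. vproj (whitney_sum E F) (f p, g p) \<in> W} (\<lambda>p. \<kappa> (f p, g p) i)"
    by (simp add: W A_def)
qed

end

section \<open>The total space of an external product\<close>

context
  fixes X :: "'x atlas" and E :: "('e, 'x) vbundle" and Y :: "'y atlas" and F :: "('f, 'y) vbundle"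
  assumes EE: "vec_bundle X E" and FF: "vec_bundle Y F"
begin

interpretation E: vec_bundle X E by (rule EE)
interpretation F: vec_bundle Y F by (rule FF)
interpretation W: vec_bundle "prod_atlas X Y" "external_product E F" by (rule external_bundle[OF EE FF])

text \<open>Both atlases have the same underlying set but order the coordinates differently: the
  external product lists both base parts before both fibre parts, the product of total spaces lists
  base and fibre of each factor together. Since the identity is smooth in both directions,
  smoothness of an affine action can be tested on either.\<close>

lemma smooth_external_ident:
  "smooth_map (total_space (prod_atlas X Y) (external_product E F)) (prod_atlas (total_space X E) (total_space Y F)) (\<lambda>p. p)"
proof -
  have c: "fst p \<in> vcarrier E \<and> snd p \<in> vcarrier F" if "p \<in> mcarrier W.TS" for p
    using that by (cases p) simp
  have "smooth_map W.TS E.TS fst"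
  proof (rule E.smooth_map_totalI[OF W.TS])
    show "smooth_map W.TS X (\<lambda>p. vproj E (fst p))"
      using smooth_map_compose[OF W.TS W.X E.X W.smooth_vproj smooth_map_fst[OF E.X F.X]] by (simp add: ext_proj)
    show "fst p \<in> vcarrier E" if "p \<in> mcarrier W.TS" for p using c that by blast
    fix p assume "p \<in> mcarrier W.TS"
    then have p: "fst p \<in> vcarrier E" "snd p \<in> vcarrier F" using c by auto
    obtain U n \<phi> where U: "(U, n, \<phi>) \<in> vtriv E" "vproj E (fst p) \<in> U" using E.triv_cover[OF E.vproj_in[OF p(1)]] by blast
    obtain V m \<psi> where V: "(V, m, \<psi>) \<in> vtriv F" "vproj F (snd p) \<in> V" using F.triv_cover[OF F.vproj_in[OF p(2)]] by blast
    have W: "(U \<times> V, n + m, \<lambda>(e, e'). join n (\<phi> e) (\<psi> e')) \<in> vtriv (external_product E F)"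
      unfolding ext_vtriv using U V by blast
    define A where "A = {e \<in> vcarrier (external_product E F). vproj (external_product E F) e \<in> U \<times> V}"
    have "smooth_real W.TS A (\<lambda>q. \<phi> (fst q) i)" if "i < n" for i
      using W.smooth_triv[OF W, of i] that by (simp add: A_def join_def case_prod_unfold)
    then show "\<exists>A U n \<phi>. openin (atlas_topology W.TS) A \<and> p \<in> A \<and> (U, n, \<phi>) \<in> vtriv E \<and>
         (\<forall>q\<in>A. vproj E (fst q) \<in> U) \<and> (\<forall>i<n. smooth_real W.TS A (\<lambda>q. \<phi> (fst q) i))"
      using W.openin_TS_over[OF W.triv_open[OF W]] p U V
      by (intro exI[of _ A] exI[of _ U] exI[of _ n] exI[of _ \<phi>]) (auto simp: A_def ext_proj mem_Times_iff)
  qed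
  moreover have "smooth_map W.TS F.TS snd"
  proof (rule F.smooth_map_totalI[OF W.TS])
    show "smooth_map W.TS Y (\<lambda>p. vproj F (snd p))"
      using smooth_map_compose[OF W.TS W.X F.X W.smooth_vproj smooth_map_snd[OF E.X F.X]] by (simp add: ext_proj)
    show "snd p \<in> vcarrier F" if "p \<in> mcarrier W.TS" for p using c that by blast
    fix p assume "p \<in> mcarrier W.TS"
    then have p: "fst p \<in> vcarrier E" "snd p \<in> vcarrier F" using c by auto
    obtain U n \<phi> where U: "(U, n, \<phi>) \<in> vtriv E" "vproj E (fst p) \<in> U" using E.triv_cover[OF E.vproj_in[OF p(1)]] by blast
    obtain V m \<psi> where V: "(V, m, \<psi>) \<in> vtriv F" "vproj F (snd p) \<in> V" using F.triv_cover[OF F.vproj_in[OF p(2)]] by blast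
    have W: "(U \<times> V, n + m, \<lambda>(e, e'). join n (\<phi> e) (\<psi> e')) \<in> vtriv (external_product E F)"
      unfolding ext_vtriv using U V by blast
    define A where "A = {e \<in> vcarrier (external_product E F). vproj (external_product E F) e \<in> U \<times> V}"
    have "smooth_real W.TS A (\<lambda>q. \<psi> (snd q) i)" for i
      using W.smooth_triv[OF W, of "n + i"] by (simp add: A_def join_def case_prod_unfold)
    then show "\<exists>A V m \<psi>. openin (atlas_topology W.TS) A \<and> p \<in> A \<and> (V, m, \<psi>) \<in> vtriv F \<and>
         (\<forall>q\<in>A. vproj F (snd q) \<in> V) \<and> (\<forall>i<m. smooth_real W.TS A (\<lambda>q. \<psi> (snd q) i))"
      using W.openin_TS_over[OF W.triv_open[OF W]] p U V
      by (intro exI[of _ A] exI[of _ V] exI[of _ m] exI[of _ \<psi>]) (auto simp: A_def ext_proj mem_Times_iff)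
  qed
  ultimately show ?thesis using smooth_map_pair[OF W.TS E.TS F.TS] by fastforce
qed

lemma smooth_external_ident':
  "smooth_map (prod_atlas (total_space X E) (total_space Y F)) (total_space (prod_atlas X Y) (external_product E F)) (\<lambda>p. p)"
proof (rule smooth_map_total_chartI[OF W.vec_bundle_axioms])
  let ?P = "prod_atlas E.TS F.TS"
  show P: "smooth_atlas ?P" by (rule smooth_atlas_prod[OF E.TS F.TS])
  note f = smooth_map_fst[OF E.TS F.TS] and s = smooth_map_snd[OF E.TS F.TS]
  show "smooth_map ?P (prod_atlas X Y) (\<lambda>p. vproj (external_product E F) p)"
    using smooth_map_pair[OF P E.X F.X E.smooth_map_base[OF P f] F.smooth_map_base[OF P s]] by (simp add: ext_proj[abs_def])
  show "p \<in> vcarrier (external_product E F)" if "p \<in> mcarrier ?P" for p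
    using that by (cases p) (simp add: mcarrier_prod_atlas)
  fix W k \<kappa> i assume k: "(W, k, \<kappa>) \<in> vtriv (external_product E F)" and i: "i < k"
  then obtain U n \<phi> V m \<psi> where U: "(U, n, \<phi>) \<in> vtriv E" and V: "(V, m, \<psi>) \<in> vtriv F"
    and W: "W = U \<times> V" "k = n + m" "\<kappa> = (\<lambda>(e, e'). join n (\<phi> e) (\<psi> e'))"
    unfolding ext_vtriv by blast
  define A where "A = {p \<in> mcarrier ?P. vproj E (fst p) \<in> U} \<inter> {p \<in> mcarrier ?P. vproj F (snd p) \<in> V}"
  have A: "openin (atlas_topology ?P) A"
    unfolding A_def
    by (intro openin_Int smooth_map_vimage[OF P E.smooth_map_base[OF P f]] smooth_map_vimage[OF P F.smooth_map_base[OF P s]]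
        E.triv_open[OF U] F.triv_open[OF V])
  have "smooth_real ?P A (\<lambda>p. \<phi> (fst p) j)" for j
    by (rule smooth_real_mono[OF P A _ E.smooth_map_triv[OF P f U]]) (auto simp: A_def)
  moreover have "smooth_real ?P A (\<lambda>p. \<psi> (snd p) j)" for j
    by (rule smooth_real_mono[OF P A _ F.smooth_map_triv[OF P s V]]) (auto simp: A_def)
  ultimately have "smooth_real ?P A (\<lambda>p. join n (\<phi> (fst p)) (\<psi> (snd p)) i)"
    using i W by (intro smooth_real_join) auto
  moreover have "{p \<in> mcarrier ?P. vproj (external_product E F) p \<in> W} = A"
    by (auto simp: A_def W ext_proj)
  ultimately show "smooth_real ?P {p \<in> mcarrier ?P. vproj (external_product E F) p \<in> W} (\<lambda>p. \<kappa> p i)"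
    by (simp add: W case_prod_unfold)
qed

end

section \<open>Projections from and maps into a pullback\<close>

context
  fixes X :: "'x atlas" and Y :: "'y atlas" and E :: "('e, 'y) vbundle" and f :: "'x \<Rightarrow> 'y"
  assumes X: "smooth_atlas X" and EE: "vec_bundle Y E" and f: "smooth_map X Y f"
begin

interpretation E: vec_bundle Y E by (rule EE)
interpretation P: vec_bundle X "pullback_bundle X f E" by (rule pullback_vec_bundle[OF X EE f])

lemma smooth_pullback_fst: "smooth_map (total_space X (pullback_bundle X f E)) X fst"
  using P.smooth_vproj by simp

lemma smooth_pullback_snd: "smooth_map (total_space X (pullback_bundle X f E)) (total_space Y E) snd"
proof (rule smooth_map_total_chartI[OF EE P.TS])
  show "smooth_map P.TS Y (\<lambda>p. vproj E (snd p))"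
    by (rule smooth_map_cong[OF P.TS E.X smooth_map_compose[OF P.TS X E.X smooth_pullback_fst f]]) (simp add: pullback_carrier)
  show "snd p \<in> vcarrier E" if "p \<in> mcarrier P.TS" for p using that by (simp add: pullback_carrier)
  fix U n \<phi> i assume "(U, n, \<phi>) \<in> vtriv E"
  then have "(mcarrier X \<inter> f -` U, n, \<phi> \<circ> snd) \<in> vtriv (pullback_bundle X f E)" unfolding pullback_vtriv by blast
  note P.smooth_triv[OF this, of i]
  moreover have "{e \<in> vcarrier (pullback_bundle X f E). vproj (pullback_bundle X f E) e \<in> mcarrier X \<inter> f -` U} =
      {p \<in> mcarrier P.TS. vproj E (snd p) \<in> U}"
    by (auto simp: pullback_carrier)
  ultimately show "smooth_real P.TS {p \<in> mcarrier P.TS. vproj E (snd p) \<in> U} (\<lambda>p. \<phi> (snd p) i)" by simp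
qed

text \<open>The universal property of the pullback. The fibre coordinates of the pair are those of
  \<open>b\<close>, on a domain that the compatibility of \<open>a\<close> and \<open>b\<close>
  identifies with the preimage of the domain of the trivialization.\<close>

lemma smooth_pullback_pair:
  assumes L: "smooth_atlas L" and a: "smooth_map L X a" and b: "smooth_map L (total_space Y E) b"
    and eq: "\<And>p. p \<in> mcarrier L \<Longrightarrow> f (a p) = vproj E (b p)"
  shows "smooth_map L (total_space X (pullback_bundle X f E)) (\<lambda>p. (a p, b p))"
proof (rule smooth_map_total_chartI[OF P.vec_bundle_axioms L])
  show "smooth_map L X (\<lambda>p. vproj (pullback_bundle X f E) (a p, b p))" using a by simp
  show "(a p, b p) \<in> vcarrier (pullback_bundle X f E)" if "p \<in> mcarrier L" for p
    using smooth_map_carrier[OF L X a that] smooth_map_carrier[OF L E.TS b that] eq[OF that] by (simp add: pullback_carrier)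
  fix W k \<kappa> i assume "(W, k, \<kappa>) \<in> vtriv (pullback_bundle X f E)"
  then obtain U \<phi> where U: "(U, k, \<phi>) \<in> vtriv E" and W: "W = mcarrier X \<inter> f -` U" "\<kappa> = \<phi> \<circ> snd"
    unfolding pullback_vtriv by blast
  have "{p \<in> mcarrier L. vproj (pullback_bundle X f E) (a p, b p) \<in> W} = {p \<in> mcarrier L. vproj E (b p) \<in> U}"
    using smooth_map_carrier[OF L X a] eq by (auto simp: W)
  then show "smooth_real L {p \<in> mcarrier L. vproj (pullback_bundle X f E) (a p, b p) \<in> W} (\<lambda>p. \<kappa> (a p, b p) i)"
    using E.smooth_map_triv[OF L b U] by (simp add: W)
qed

end

lemma smooth_zero_pair:
  assumes X: "smooth_atlas X" and L: "smooth_atlas L" and a: "smooth_map L X a"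
  shows "smooth_map L (total_space X (zero_bundle X)) (\<lambda>p. (a p, \<lambda>_. 0))"
  by (rule smooth_map_total_chartI[OF zero_vec_bundle[OF X] L]) (use a smooth_map_carrier[OF L X a] in auto)

context
  fixes X :: "'x atlas" and E :: "('e, 'x) vbundle" and \<tau> :: "'e \<Rightarrow> 'f"
  assumes EE: "vec_bundle X E" and \<tau>: "inj_on \<tau> (vcarrier E)"
begin

interpretation E: vec_bundle X E by (rule EE)
interpretation T: vec_bundle X "transport_bundle \<tau> E" by (rule transport_vec_bundle[OF \<tau> EE])

lemma smooth_transport: "smooth_map (total_space X E) (total_space X (transport_bundle \<tau> E)) \<tau>"
proof (rule smooth_map_total_chartI[OF T.vec_bundle_axioms E.TS])
  show "smooth_map E.TS X (\<lambda>p. vproj (transport_bundle \<tau> E) (\<tau> p))"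
    by (rule smooth_map_cong[OF E.TS E.X E.smooth_vproj]) (simp add: transport_simps[OF \<tau>])
  show "\<tau> p \<in> vcarrier (transport_bundle \<tau> E)" if "p \<in> mcarrier E.TS" for p
    using that by (simp add: transport_simps[OF \<tau>])
  fix U n \<kappa> i assume "(U, n, \<kappa>) \<in> vtriv (transport_bundle \<tau> E)"
  then obtain \<phi> where U: "(U, n, \<phi>) \<in> vtriv E" and \<kappa>: "\<kappa> = \<phi> \<circ> inv_into (vcarrier E) \<tau>"
    unfolding transport_vtriv[OF \<tau>] by blast
  have *: "{p \<in> mcarrier E.TS. vproj (transport_bundle \<tau> E) (\<tau> p) \<in> U} = {e \<in> vcarrier E. vproj E e \<in> U}"
    by (auto simp: transport_simps[OF \<tau>])
  have "smooth_real E.TS {e \<in> vcarrier E. vproj E e \<in> U} (\<lambda>p. \<kappa> (\<tau> p) i)"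
    by (rule smooth_real_cong[OF E.TS, THEN iffD1, OF _ E.smooth_triv[OF U]]) (use \<tau> in \<open>simp add: \<kappa>\<close>)
  then show "smooth_real E.TS {p \<in> mcarrier E.TS. vproj (transport_bundle \<tau> E) (\<tau> p) \<in> U} (\<lambda>p. \<kappa> (\<tau> p) i)"
    unfolding * .
qed

lemma smooth_transport_inv: "smooth_map (total_space X (transport_bundle \<tau> E)) (total_space X E) (inv_into (vcarrier E) \<tau>)"
proof (rule smooth_map_total_chartI[OF EE T.TS])
  show "smooth_map T.TS X (\<lambda>p. vproj E (inv_into (vcarrier E) \<tau> p))"
    by (rule smooth_map_cong[OF T.TS E.X T.smooth_vproj]) (use \<tau> in \<open>auto simp: transport_simps[OF \<tau>]\<close>)
  show "inv_into (vcarrier E) \<tau> p \<in> vcarrier E" if "p \<in> mcarrier T.TS" for p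
    using that \<tau> by (auto simp: transport_simps[OF \<tau>])
  fix U n \<phi> i assume "(U, n, \<phi>) \<in> vtriv E"
  then have U: "(U, n, \<phi> \<circ> inv_into (vcarrier E) \<tau>) \<in> vtriv (transport_bundle \<tau> E)"
    unfolding transport_vtriv[OF \<tau>] by blast
  have "{p \<in> mcarrier T.TS. vproj E (inv_into (vcarrier E) \<tau> p) \<in> U} =
      {e \<in> vcarrier (transport_bundle \<tau> E). vproj (transport_bundle \<tau> E) e \<in> U}"
    using \<tau> by (auto simp: transport_simps[OF \<tau>])
  then show "smooth_real T.TS {p \<in> mcarrier T.TS. vproj E (inv_into (vcarrier E) \<tau> p) \<in> U} (\<lambda>p. \<phi> (inv_into (vcarrier E) \<tau> p) i)"
    using T.smooth_triv[OF U] by simp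
qed

end

section \<open>Bundles with an action\<close>

lemma abundle_sum_simp: "abundle_sum (E, a) (F, b) = (whitney_sum E F, \<lambda>k (e, e'). (a k e, b k e'))"
  by (simp add: abundle_sum_def)

lemma abundle_pullback_simp: "abundle_pullback X s f (E, a) = (pullback_bundle X f E, \<lambda>k (x, e). (s k x, a k e))"
  by (simp add: abundle_pullback_def)

lemma isomorphic_sym: "isomorphic K X A B \<Longrightarrow> isomorphic K X B A"
  unfolding isomorphic_def by blast

lemma fibrewise_linear_iff:
  "fibrewise_linear E F f h \<longleftrightarrow>
     (\<forall>e\<in>vcarrier E. h e \<in> vcarrier F \<and> vproj F (h e) = f (vproj E e)) \<and>
     (\<forall>e\<in>vcarrier E. \<forall>e'\<in>vcarrier E. vproj E e = vproj E e' \<longrightarrow> h (vadd E e e') = vadd F (h e) (h e')) \<and>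
     (\<forall>c. \<forall>e\<in>vcarrier E. h (vscale E c e) = vscale F c (h e))"
  by (simp add: fibrewise_linear_def fibre_iff)

text \<open>
  The group \<open>K\<close> is presented as a bundle \<open>KP\<close> over the group acting on the base: \<open>TG\<close> over \<open>G\<close>, or \<open>G\<close> over itself
  with rank \<open>0\<close>.  Joint linearity in the fibres of \<open>KP\<close> and of the bundle acted on then covers both kinds of action.
\<close>

locale acting =
  fixes K :: "('k, 'm) monoid_scheme" and KA :: "'k atlas" and KP :: "('k, 'h) vbundle"
  assumes KA: "smooth_atlas KA" and KA_carrier: "mcarrier KA = carrier K" and KP_carrier: "vcarrier KP = carrier K"
    and KP_add: "\<And>k k'. k \<in> carrier K \<Longrightarrow> k' \<in> carrier K \<Longrightarrow> vproj KP k = vproj KP k' \<Longrightarrow>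
      vadd KP k k' \<in> carrier K \<and> vproj KP (vadd KP k k') = vproj KP k"
    and KP_scale: "\<And>k c. k \<in> carrier K \<Longrightarrow> vscale KP c k \<in> carrier K \<and> vproj KP (vscale KP c k) = vproj KP k"
begin

definition base :: "('h \<Rightarrow> 'x \<Rightarrow> 'x) \<Rightarrow> 'k \<Rightarrow> 'x \<Rightarrow> 'x" where
  "base t k x = t (vproj KP k) x"

definition space :: "'x atlas \<Rightarrow> ('h \<Rightarrow> 'x \<Rightarrow> 'x) \<Rightarrow> bool" where
  "space X t \<longleftrightarrow> smooth_atlas X \<and> left_action K (mcarrier X) (base t) \<and>
     smooth_map (prod_atlas KA X) X (\<lambda>(k, x). base t k x)"

definition action_map :: "'x atlas \<Rightarrow> ('h \<Rightarrow> 'x \<Rightarrow> 'x) \<Rightarrow> 'y atlas \<Rightarrow> ('h \<Rightarrow> 'y \<Rightarrow> 'y) \<Rightarrow> ('x \<Rightarrow> 'y) \<Rightarrow> bool" where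
  "action_map X t Y s f \<longleftrightarrow> smooth_map X Y f \<and>
     (\<forall>k\<in>carrier K. \<forall>x\<in>mcarrier X. f (base t k x) = base s k (f x))"

definition bundles :: "'x atlas \<Rightarrow> ('h \<Rightarrow> 'x \<Rightarrow> 'x) \<Rightarrow> ('k, 'e, 'x) abundle set" where
  "bundles X t = {(E, a). vector_bundle X E \<and> left_action K (vcarrier E) a \<and>
     smooth_map (prod_atlas KA (total_space X E)) (total_space X E) (\<lambda>(k, e). a k e) \<and>
     fibrewise_linear (external_product KP E) E (\<lambda>(g, x). t g x) (\<lambda>(k, e). a k e)}"

lemma spaceD:
  assumes "space X t"
  shows "smooth_atlas X" "left_action K (mcarrier X) (base t)" "smooth_map (prod_atlas KA X) X (\<lambda>(k, x). base t k x)"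
  using assms by (auto simp: space_def)

text \<open>Joint linearity spelled out: sums are formed for pairs over the same point of the acting
  base and the same point of \<open>X\<close>, with the acting vector and the bundle vector added
  simultaneously.\<close>

lemma bundles_iff:
  assumes "space X t"
  shows "(E, a) \<in> bundles X t \<longleftrightarrow> vec_bundle X E \<and> left_action K (vcarrier E) a \<and>
     smooth_map (prod_atlas KA (total_space X E)) (total_space X E) (\<lambda>(k, e). a k e) \<and>
     (\<forall>k\<in>carrier K. \<forall>e\<in>vcarrier E. vproj E (a k e) = base t k (vproj E e)) \<and>
     (\<forall>k\<in>carrier K. \<forall>e\<in>vcarrier E. \<forall>k'\<in>carrier K. \<forall>e'\<in>vcarrier E. vproj KP k = vproj KP k' \<longrightarrow> vproj E e = vproj E e' \<longrightarrow>
        a (vadd KP k k') (vadd E e e') = vadd E (a k e) (a k' e')) \<and>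
     (\<forall>c. \<forall>k\<in>carrier K. \<forall>e\<in>vcarrier E. a (vscale KP c k) (vscale E c e) = vscale E c (a k e))"
proof -
  have *: "vec_bundle X E \<longleftrightarrow> vector_bundle X E" using spaceD(1)[OF assms] by (simp add: vec_bundle_def)
  show ?thesis
    unfolding * bundles_def fibrewise_linear_iff by (auto simp: KP_carrier base_def left_action_def)
qed

context
  fixes X :: "'x atlas" and t and E :: "('e, 'x) vbundle" and a
  assumes sp: "space X t" and Ea: "(E, a) \<in> bundles X t"
begin

lemma bundlesD:
  shows "vec_bundle X E"
    and "left_action K (vcarrier E) a"
    and "smooth_map (prod_atlas KA (total_space X E)) (total_space X E) (\<lambda>(k, e). a k e)"
    and "k \<in> carrier K \<Longrightarrow> e \<in> vcarrier E \<Longrightarrow> a k e \<in> vcarrier E"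
    and "k \<in> carrier K \<Longrightarrow> e \<in> vcarrier E \<Longrightarrow> vproj E (a k e) = base t k (vproj E e)"
    and "k \<in> carrier K \<Longrightarrow> e \<in> vcarrier E \<Longrightarrow> k' \<in> carrier K \<Longrightarrow> e' \<in> vcarrier E \<Longrightarrow> vproj KP k = vproj KP k' \<Longrightarrow>
        vproj E e = vproj E e' \<Longrightarrow> a (vadd KP k k') (vadd E e e') = vadd E (a k e) (a k' e')"
    and "k \<in> carrier K \<Longrightarrow> e \<in> vcarrier E \<Longrightarrow> a (vscale KP c k) (vscale E c e) = vscale E c (a k e)"
  using Ea unfolding bundles_iff[OF sp] left_action_def by blast+

lemma smooth_act:
  assumes L: "smooth_atlas L" and f: "smooth_map L KA f" and g: "smooth_map L (total_space X E) g"
  shows "smooth_map L (total_space X E) (\<lambda>p. a (f p) (g p))"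
proof -
  have TS: "smooth_atlas (total_space X E)" by (rule vec_bundle.TS[OF bundlesD(1)])
  show ?thesis
    using smooth_map_compose[OF L smooth_atlas_prod[OF KA TS] TS smooth_map_pair[OF L KA TS f g] bundlesD(3)] by simp
qed

end

lemma smooth_base:
  assumes "space X t" and L: "smooth_atlas L" and f: "smooth_map L KA f" and g: "smooth_map L X g"
  shows "smooth_map L X (\<lambda>p. base t (f p) (g p))"
  using smooth_map_compose[OF L smooth_atlas_prod[OF KA spaceD(1)] spaceD(1) smooth_map_pair[OF L KA spaceD(1) f g] spaceD(3)] assms(1)
  by simp

text \<open>Linearity and equivariance are checked in one direction only, since the inverse of a
  bijection inherits both. Smoothness has to be given in both directions.\<close>

lemma isomorphicI:
  assumes sp: "space X t" and Ea: "(E, a) \<in> bundles X t" and Fb: "(F, b) \<in> bundles X t"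
    and h: "smooth_map (total_space X E) (total_space X F) h" and h': "smooth_map (total_space X F) (total_space X E) h'"
    and proj: "\<And>e. e \<in> vcarrier E \<Longrightarrow> vproj F (h e) = vproj E e"
    and add: "\<And>e e'. e \<in> vcarrier E \<Longrightarrow> e' \<in> vcarrier E \<Longrightarrow> vproj E e = vproj E e' \<Longrightarrow> h (vadd E e e') = vadd F (h e) (h e')"
    and scale: "\<And>c e. e \<in> vcarrier E \<Longrightarrow> h (vscale E c e) = vscale F c (h e)"
    and equi: "\<And>k e. k \<in> carrier K \<Longrightarrow> e \<in> vcarrier E \<Longrightarrow> h (a k e) = b k (h e)"
    and inv: "\<And>e. e \<in> vcarrier E \<Longrightarrow> h' (h e) = e" "\<And>e. e \<in> vcarrier F \<Longrightarrow> h (h' e) = e"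
  shows "isomorphic K X (E, a) (F, b)"
proof -
  interpret E: vec_bundle X E by (rule bundlesD(1)[OF sp Ea])
  interpret F: vec_bundle X F by (rule bundlesD(1)[OF sp Fb])
  have hF: "h e \<in> vcarrier F" if "e \<in> vcarrier E" for e
    using smooth_map_carrier[OF E.TS F.TS h] that by simp
  have h'E: "h' e \<in> vcarrier E" if "e \<in> vcarrier F" for e
    using smooth_map_carrier[OF F.TS E.TS h'] that by simp
  have proj': "vproj E (h' e) = vproj F e" if "e \<in> vcarrier F" for e
    using proj[OF h'E[OF that]] inv(2)[OF that] by simp
  have "equivariant_morphism K X (E, a) (F, b) h"
    unfolding equivariant_morphism_def vb_morphism_def fibrewise_linear_iff
    using h hF proj add scale equi by auto
  moreover have "equivariant_morphism K X (F, b) (E, a) h'"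
    unfolding equivariant_morphism_def vb_morphism_def fibrewise_linear_iff prod.case
  proof (intro conjI ballI allI impI h' h'E proj')
    fix d d' assume d: "d \<in> vcarrier F" "d' \<in> vcarrier F" "vproj F d = vproj F d'"
    then have "h (vadd E (h' d) (h' d')) = vadd F d d'"
      using add[of "h' d" "h' d'"] h'E proj' inv(2) by simp
    moreover have "vadd E (h' d) (h' d') \<in> vcarrier E"
      using E.vadd_closed(1)[of "h' d" "h' d'"] d h'E proj' by simp
    ultimately show "h' (vadd F d d') = vadd E (h' d) (h' d')" using inv(1) by metis
  next
    fix c d assume d: "d \<in> vcarrier F"
    then have "h (vscale E c (h' d)) = vscale F c d"
      using scale[of "h' d"] h'E inv(2) by simp
    moreover have "vscale E c (h' d) \<in> vcarrier E" using E.vscale_closed(1)[OF h'E[OF d]] .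
    ultimately show "h' (vscale F c d) = vscale E c (h' d)" using inv(1) by metis
  next
    fix k d assume d: "k \<in> carrier K" "d \<in> vcarrier F"
    then have "h (a k (h' d)) = b k d" using equi h'E inv(2) by simp
    moreover have "a k (h' d) \<in> vcarrier E" using bundlesD(4)[OF sp Ea d(1) h'E[OF d(2)]] .
    ultimately show "h' (b k d) = a k (h' d)" using inv(1) by metis
  qed
  ultimately show ?thesis unfolding isomorphic_def using inv by auto
qed

lemma isomorphicE:
  assumes sp: "space X t" and "(E, a) \<in> bundles X t" "(F, b) \<in> bundles X t"
    and "isomorphic K X (E, a) (F, b)"
  obtains h h' where "smooth_map (total_space X E) (total_space X F) h" "smooth_map (total_space X F) (total_space X E) h'"
    "\<And>e. e \<in> vcarrier E \<Longrightarrow> h e \<in> vcarrier F" "\<And>e. e \<in> vcarrier F \<Longrightarrow> h' e \<in> vcarrier E"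
    "\<And>e. e \<in> vcarrier E \<Longrightarrow> vproj F (h e) = vproj E e" "\<And>e. e \<in> vcarrier F \<Longrightarrow> vproj E (h' e) = vproj F e"
    "\<And>e e'. e \<in> vcarrier E \<Longrightarrow> e' \<in> vcarrier E \<Longrightarrow> vproj E e = vproj E e' \<Longrightarrow> h (vadd E e e') = vadd F (h e) (h e')"
    "\<And>c e. e \<in> vcarrier E \<Longrightarrow> h (vscale E c e) = vscale F c (h e)"
    "\<And>k e. k \<in> carrier K \<Longrightarrow> e \<in> vcarrier E \<Longrightarrow> h (a k e) = b k (h e)"
    "\<And>e. e \<in> vcarrier E \<Longrightarrow> h' (h e) = e" "\<And>e. e \<in> vcarrier F \<Longrightarrow> h (h' e) = e"
proof -
  from assms(4) obtain h h' where "equivariant_morphism K X (E, a) (F, b) h" "equivariant_morphism K X (F, b) (E, a) h'"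
    "\<forall>e\<in>vcarrier E. h' (h e) = e" "\<forall>e\<in>vcarrier F. h (h' e) = e"
    unfolding isomorphic_def by auto
  then show thesis
    unfolding equivariant_morphism_def vb_morphism_def fibrewise_linear_iff prod.case
    by (intro that[of h h']) blast+
qed

lemma isomorphic_trans:
  assumes sp: "space X t" and A: "A \<in> bundles X t" and B: "B \<in> bundles X t" and C: "C \<in> bundles X t"
    and AB: "isomorphic K X A B" and BC: "isomorphic K X B C"
  shows "isomorphic K X A C"
proof -
  obtain E a F b H c where Ea: "A = (E, a)" "(E, a) \<in> bundles X t" and Fb: "B = (F, b)" "(F, b) \<in> bundles X t"
    and Hc: "C = (H, c)" "(H, c) \<in> bundles X t" using A B C by (cases A, cases B, cases C) auto
  have TE: "smooth_atlas (total_space X E)" by (rule vec_bundle.TS[OF bundlesD(1)[OF sp Ea(2)]])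
  have TF: "smooth_atlas (total_space X F)" by (rule vec_bundle.TS[OF bundlesD(1)[OF sp Fb(2)]])
  have TH: "smooth_atlas (total_space X H)" by (rule vec_bundle.TS[OF bundlesD(1)[OF sp Hc(2)]])
  obtain h h' where h: "smooth_map (total_space X E) (total_space X F) h" "smooth_map (total_space X F) (total_space X E) h'"
    "\<And>e. e \<in> vcarrier E \<Longrightarrow> h e \<in> vcarrier F" "\<And>e. e \<in> vcarrier F \<Longrightarrow> h' e \<in> vcarrier E"
    "\<And>e. e \<in> vcarrier E \<Longrightarrow> vproj F (h e) = vproj E e" "\<And>e. e \<in> vcarrier F \<Longrightarrow> vproj E (h' e) = vproj F e"
    "\<And>e e'. e \<in> vcarrier E \<Longrightarrow> e' \<in> vcarrier E \<Longrightarrow> vproj E e = vproj E e' \<Longrightarrow> h (vadd E e e') = vadd F (h e) (h e')"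
    "\<And>c e. e \<in> vcarrier E \<Longrightarrow> h (vscale E c e) = vscale F c (h e)"
    "\<And>k e. k \<in> carrier K \<Longrightarrow> e \<in> vcarrier E \<Longrightarrow> h (a k e) = b k (h e)"
    "\<And>e. e \<in> vcarrier E \<Longrightarrow> h' (h e) = e" "\<And>e. e \<in> vcarrier F \<Longrightarrow> h (h' e) = e"
    using isomorphicE[OF sp Ea(2) Fb(2) AB[unfolded Ea(1) Fb(1)]] by blast
  obtain g g' where g: "smooth_map (total_space X F) (total_space X H) g" "smooth_map (total_space X H) (total_space X F) g'"
    "\<And>e. e \<in> vcarrier F \<Longrightarrow> g e \<in> vcarrier H" "\<And>e. e \<in> vcarrier H \<Longrightarrow> g' e \<in> vcarrier F"
    "\<And>e. e \<in> vcarrier F \<Longrightarrow> vproj H (g e) = vproj F e" "\<And>e. e \<in> vcarrier H \<Longrightarrow> vproj F (g' e) = vproj H e"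
    "\<And>e e'. e \<in> vcarrier F \<Longrightarrow> e' \<in> vcarrier F \<Longrightarrow> vproj F e = vproj F e' \<Longrightarrow> g (vadd F e e') = vadd H (g e) (g e')"
    "\<And>c e. e \<in> vcarrier F \<Longrightarrow> g (vscale F c e) = vscale H c (g e)"
    "\<And>k e. k \<in> carrier K \<Longrightarrow> e \<in> vcarrier F \<Longrightarrow> g (b k e) = c k (g e)"
    "\<And>e. e \<in> vcarrier F \<Longrightarrow> g' (g e) = e" "\<And>e. e \<in> vcarrier H \<Longrightarrow> g (g' e) = e"
    using isomorphicE[OF sp Fb(2) Hc(2) BC[unfolded Hc(1) Fb(1)]] by blast
  show ?thesis unfolding Ea(1) Hc(1)
    by (rule isomorphicI[OF sp Ea(2) Hc(2) smooth_map_compose[OF TE TF TH h(1) g(1)] smooth_map_compose[OF TH TF TE g(2) h(2)]])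
       (simp_all add: h(3-) g(3-))
qed

section \<open>Zero bundles, sums and pullbacks with action\<close>

lemma zero_in_bundles:
  assumes sp: "space X t"
  shows "abundle_zero X (base t) \<in> bundles X t"
  unfolding abundle_zero_def bundles_iff[OF sp]
proof (intro conjI ballI allI impI)
  note X = spaceD(1)[OF sp]
  interpret Z: vec_bundle X "zero_bundle X" by (rule zero_vec_bundle[OF X])
  show "vec_bundle X (zero_bundle X)" ..
  show "left_action K (vcarrier (zero_bundle X)) (\<lambda>k (x, z). (base t k x, z))"
    using spaceD(2)[OF sp] by (auto simp: left_action_def)
  let ?L = "prod_atlas KA Z.TS"
  have L: "smooth_atlas ?L" by (rule smooth_atlas_prod[OF KA Z.TS])
  have "smooth_map ?L X (\<lambda>p. base t (fst p) (fst (snd p)))"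
    using Z.smooth_map_base[OF L smooth_map_snd[OF KA Z.TS]] by (intro smooth_base[OF sp L smooth_map_fst[OF KA Z.TS]]) simp
  from smooth_zero_pair[OF X L this] show "smooth_map ?L Z.TS (\<lambda>(k, e). (\<lambda>(x, z). (base t k x, z)) e)"
    by (rule smooth_map_cong[OF L Z.TS]) (auto simp: mcarrier_prod_atlas)
qed (auto simp: base_def KP_add KP_scale)

lemma sum_in_bundles:
  assumes sp: "space X t" and A: "A \<in> bundles X t" and B: "B \<in> bundles X t"
  shows "abundle_sum A B \<in> bundles X t"
proof -
  obtain E a F b where Ea: "A = (E, a)" "(E, a) \<in> bundles X t" and Fb: "B = (F, b)" "(F, b) \<in> bundles X t"
    using A B by (cases A, cases B) auto
  note E = bundlesD[OF sp Ea(2)] and F = bundlesD[OF sp Fb(2)]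
  interpret E: vec_bundle X E by (rule E(1))
  interpret F: vec_bundle X F by (rule F(1))
  interpret W: vec_bundle X "whitney_sum E F" by (rule whitney_bundle[OF E(1) F(1)])
  show ?thesis
    unfolding Ea(1) Fb(1) abundle_sum_simp bundles_iff[OF sp]
  proof (intro conjI ballI allI impI)
    show "vec_bundle X (whitney_sum E F)" ..
    show "left_action K (vcarrier (whitney_sum E F)) (\<lambda>k (e, e'). (a k e, b k e'))"
      using E(2,4,5) F(2,4,5) by (auto simp: left_action_def whitney_carrier)
    let ?L = "prod_atlas KA W.TS"
    have L: "smooth_atlas ?L" by (rule smooth_atlas_prod[OF KA W.TS])
    have s: "smooth_map ?L W.TS snd" by (rule smooth_map_snd[OF KA W.TS])
    have f: "smooth_map ?L KA fst" by (rule smooth_map_fst[OF KA W.TS])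
    have "smooth_map ?L W.TS (\<lambda>p. (a (fst p) (fst (snd p)), b (fst p) (snd (snd p))))"
    proof (rule smooth_whitney_pair[OF E(1) F(1) L])
      show "smooth_map ?L E.TS (\<lambda>p. a (fst p) (fst (snd p)))"
        by (rule smooth_act[OF sp Ea(2) L f smooth_map_compose[OF L W.TS E.TS s smooth_whitney_fst[OF E(1) F(1)]]])
      show "smooth_map ?L F.TS (\<lambda>p. b (fst p) (snd (snd p)))"
        by (rule smooth_act[OF sp Fb(2) L f smooth_map_compose[OF L W.TS F.TS s smooth_whitney_snd[OF E(1) F(1)]]])
    qed (auto simp: mcarrier_prod_atlas KA_carrier whitney_carrier E(5) F(5))
    then show "smooth_map ?L W.TS (\<lambda>(k, e). (\<lambda>(e, e'). (a k e, b k e')) e)"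
      by (simp add: case_prod_unfold)
  qed (auto simp: whitney_carrier E(5-7) F(5-7))
qed

lemma pullback_in_bundles:
  assumes spX: "space X t" and spY: "space Y s" and f: "action_map X t Y s f" and A: "A \<in> bundles Y s"
  shows "abundle_pullback X (base t) f A \<in> bundles X t"
proof -
  obtain E a where Ea: "A = (E, a)" "(E, a) \<in> bundles Y s" using A by (cases A) auto
  note E = bundlesD[OF spY Ea(2)]
  note X = spaceD(1)[OF spX]
  have fs: "smooth_map X Y f" and fe: "\<And>k x. k \<in> carrier K \<Longrightarrow> x \<in> mcarrier X \<Longrightarrow> f (base t k x) = base s k (f x)"
    using f by (auto simp: action_map_def)
  interpret E: vec_bundle Y E by (rule E(1))
  interpret P: vec_bundle X "pullback_bundle X f E" by (rule pullback_vec_bundle[OF X E(1) fs])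
  show ?thesis
    unfolding Ea(1) abundle_pullback_simp bundles_iff[OF spX]
  proof (intro conjI ballI allI impI)
    show "vec_bundle X (pullback_bundle X f E)" ..
    show "left_action K (vcarrier (pullback_bundle X f E)) (\<lambda>k (x, e). (base t k x, a k e))"
      using E(2,4,5) spaceD(2)[OF spX] by (auto simp: left_action_def pullback_carrier fe)
    let ?L = "prod_atlas KA P.TS"
    have L: "smooth_atlas ?L" by (rule smooth_atlas_prod[OF KA P.TS])
    have sn: "smooth_map ?L P.TS snd" by (rule smooth_map_snd[OF KA P.TS])
    have fi: "smooth_map ?L KA fst" by (rule smooth_map_fst[OF KA P.TS])
    have "smooth_map ?L P.TS (\<lambda>p. (base t (fst p) (fst (snd p)), a (fst p) (snd (snd p))))"
    proof (rule smooth_pullback_pair[OF X E(1) fs L])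
      show "smooth_map ?L X (\<lambda>p. base t (fst p) (fst (snd p)))"
        by (rule smooth_base[OF spX L fi smooth_map_compose[OF L P.TS X sn smooth_pullback_fst[OF X E(1) fs]]])
      show "smooth_map ?L E.TS (\<lambda>p. a (fst p) (snd (snd p)))"
        by (rule smooth_act[OF spY Ea(2) L fi smooth_map_compose[OF L P.TS E.TS sn smooth_pullback_snd[OF X E(1) fs]]])
    qed (auto simp: mcarrier_prod_atlas KA_carrier pullback_carrier E(5) fe)
    then show "smooth_map ?L P.TS (\<lambda>(k, e). (\<lambda>(x, e). (base t k x, a k e)) e)"
      by (simp add: case_prod_unfold)
  \<comment> \<open>The base component of the action depends on \<open>k\<close> through
    \<open>vproj KP k\<close> only, which the fibre operations of \<open>KP\<close> leave unchanged;
    so joint linearity concerns the second component alone.\<close>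
  qed (auto simp: pullback_carrier E(5-7) base_def KP_add KP_scale)
qed

text \<open>A point of the total space is encoded by its base point and its coordinates in a chosen trivialization.\<close>

lemma exists_rep:
  assumes sp: "space X t" and A: "A \<in> bundles X t"
  shows "\<exists>B \<in> (bundles X t :: ('k, 'x \<times> (nat \<Rightarrow> real), 'x) abundle set). isomorphic K X A B"
proof -
  obtain E a where Ea: "A = (E, a)" "(E, a) \<in> bundles X t" using A by (cases A) auto
  note E = bundlesD[OF sp Ea(2)]
  interpret E: vec_bundle X E by (rule E(1))
  define ch where "ch = (\<lambda>x. SOME \<phi>. \<exists>U n. (U, n, \<phi>) \<in> vtriv E \<and> x \<in> U)"
  have ch: "\<exists>U n. (U, n, ch x) \<in> vtriv E \<and> x \<in> U" if x: "x \<in> mcarrier X" for x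
  proof -
    have "\<exists>\<phi>. \<exists>U n. (U, n, \<phi>) \<in> vtriv E \<and> x \<in> U" using E.triv_cover[OF x] by blast
    then show ?thesis unfolding ch_def by (rule someI_ex)
  qed
  \<comment> \<open>The chosen trivialization may jump from one base point to the next, so
    \<open>\<tau>\<close> need not be continuous for any given structure on the target. Injectivity
    is all that transport of structure asks for, and fibre by fibre it holds because trivializations
    are bijective.\<close>
  define \<tau> where "\<tau> = (\<lambda>e. (vproj E e, ch (vproj E e) e))"
  have \<tau>: "inj_on \<tau> (vcarrier E)"
  proof (rule inj_onI)
    fix e e' assume e: "e \<in> vcarrier E" "e' \<in> vcarrier E" and eq: "\<tau> e = \<tau> e'"
    obtain U n where U: "(U, n, ch (vproj E e)) \<in> vtriv E" "vproj E e \<in> U" using ch[OF E.vproj_in[OF e(1)]] by blast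
    show "e = e'"
      by (rule triv_inj[OF E.triv_triv[OF U(1)] U(2)]) (use e eq in \<open>auto simp: \<tau>_def fibre_iff\<close>)
  qed
  let ?F = "transport_bundle \<tau> E" and ?\<tau>' = "inv_into (vcarrier E) \<tau>"
  \<comment> \<open>The action is conjugated by the encoding, so that \<open>\<tau>\<close> becomes
    an equivariant isomorphism.\<close>
  define b where "b = (\<lambda>k d. \<tau> (a k (?\<tau>' d)))"
  note simps = transport_simps[OF \<tau>]
  interpret F: vec_bundle X ?F by (rule transport_vec_bundle[OF \<tau> E(1)])
  have b: "b k (\<tau> e) = \<tau> (a k e)" if "e \<in> vcarrier E" for k e
    using that \<tau> by (simp add: b_def)
  have Fb: "(?F, b) \<in> bundles X t"
    unfolding bundles_iff[OF sp]
  proof (intro conjI ballI allI impI)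
    show "vec_bundle X ?F" ..
    show "left_action K (vcarrier ?F) b"
      using E(2,4) by (auto simp: left_action_def simps b)
    let ?L = "prod_atlas KA F.TS"
    have L: "smooth_atlas ?L" by (rule smooth_atlas_prod[OF KA F.TS])
    have "smooth_map ?L E.TS (\<lambda>p. a (fst p) (?\<tau>' (snd p)))"
      by (rule smooth_act[OF sp Ea(2) L smooth_map_fst[OF KA F.TS]
            smooth_map_compose[OF L F.TS E.TS smooth_map_snd[OF KA F.TS] smooth_transport_inv[OF E(1) \<tau>]]])
    from smooth_map_compose[OF L E.TS F.TS this smooth_transport[OF E(1) \<tau>]]
    show "smooth_map ?L F.TS (\<lambda>(k, e). b k e)" by (simp add: b_def case_prod_unfold)
  qed (auto simp: simps b E(4-7) E.vadd_closed E.vscale_closed)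
  have "isomorphic K X (E, a) (?F, b)"
    by (rule isomorphicI[OF sp Ea(2) Fb smooth_transport[OF E(1) \<tau>] smooth_transport_inv[OF E(1) \<tau>]])
       (use \<tau> in \<open>auto simp: simps b\<close>)
  then show ?thesis using Fb unfolding Ea(1) by blast
qed

end

section \<open>Sums and pullbacks up to isomorphism\<close>

context acting
begin

lemma isomorphic_sum:
  assumes sp: "space X t" and A: "A \<in> bundles X t" "A' \<in> bundles X t" and B: "B \<in> bundles X t" "B' \<in> bundles X t"
    and iso: "isomorphic K X A A'" "isomorphic K X B B'"
  shows "isomorphic K X (abundle_sum A B) (abundle_sum A' B')"
proof -
  obtain E a E' a' F b F' b' where Ea: "A = (E, a)" "(E, a) \<in> bundles X t" and Ea': "A' = (E', a')" "(E', a') \<in> bundles X t"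
    and Fb: "B = (F, b)" "(F, b) \<in> bundles X t" and Fb': "B' = (F', b')" "(F', b') \<in> bundles X t"
    using A B by (cases A, cases A', cases B, cases B') auto
  note E = bundlesD(1)[OF sp Ea(2)] and E' = bundlesD(1)[OF sp Ea'(2)]
    and F = bundlesD(1)[OF sp Fb(2)] and F' = bundlesD(1)[OF sp Fb'(2)]
  interpret E: vec_bundle X E by (rule E)
  interpret F: vec_bundle X F by (rule F)
  interpret E': vec_bundle X E' by (rule E')
  interpret F': vec_bundle X F' by (rule F')
  interpret W: vec_bundle X "whitney_sum E F" by (rule whitney_bundle[OF E F])
  interpret W': vec_bundle X "whitney_sum E' F'" by (rule whitney_bundle[OF E' F'])
  obtain h h' where h: "smooth_map E.TS E'.TS h" "smooth_map E'.TS E.TS h'"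
    "\<And>e. e \<in> vcarrier E \<Longrightarrow> h e \<in> vcarrier E'" "\<And>e. e \<in> vcarrier E' \<Longrightarrow> h' e \<in> vcarrier E"
    "\<And>e. e \<in> vcarrier E \<Longrightarrow> vproj E' (h e) = vproj E e" "\<And>e. e \<in> vcarrier E' \<Longrightarrow> vproj E (h' e) = vproj E' e"
    "\<And>e e'. e \<in> vcarrier E \<Longrightarrow> e' \<in> vcarrier E \<Longrightarrow> vproj E e = vproj E e' \<Longrightarrow> h (vadd E e e') = vadd E' (h e) (h e')"
    "\<And>c e. e \<in> vcarrier E \<Longrightarrow> h (vscale E c e) = vscale E' c (h e)"
    "\<And>k e. k \<in> carrier K \<Longrightarrow> e \<in> vcarrier E \<Longrightarrow> h (a k e) = a' k (h e)"
    "\<And>e. e \<in> vcarrier E \<Longrightarrow> h' (h e) = e" "\<And>e. e \<in> vcarrier E' \<Longrightarrow> h (h' e) = e"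
    using isomorphicE[OF sp Ea(2) Ea'(2) iso(1)[unfolded Ea(1) Ea'(1)]] by blast
  obtain g g' where g: "smooth_map F.TS F'.TS g" "smooth_map F'.TS F.TS g'"
    "\<And>e. e \<in> vcarrier F \<Longrightarrow> g e \<in> vcarrier F'" "\<And>e. e \<in> vcarrier F' \<Longrightarrow> g' e \<in> vcarrier F"
    "\<And>e. e \<in> vcarrier F \<Longrightarrow> vproj F' (g e) = vproj F e" "\<And>e. e \<in> vcarrier F' \<Longrightarrow> vproj F (g' e) = vproj F' e"
    "\<And>e e'. e \<in> vcarrier F \<Longrightarrow> e' \<in> vcarrier F \<Longrightarrow> vproj F e = vproj F e' \<Longrightarrow> g (vadd F e e') = vadd F' (g e) (g e')"
    "\<And>c e. e \<in> vcarrier F \<Longrightarrow> g (vscale F c e) = vscale F' c (g e)"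
    "\<And>k e. k \<in> carrier K \<Longrightarrow> e \<in> vcarrier F \<Longrightarrow> g (b k e) = b' k (g e)"
    "\<And>e. e \<in> vcarrier F \<Longrightarrow> g' (g e) = e" "\<And>e. e \<in> vcarrier F' \<Longrightarrow> g (g' e) = e"
    using isomorphicE[OF sp Fb(2) Fb'(2) iso(2)[unfolded Fb(1) Fb'(1)]] by blast
  have S: "(whitney_sum E F, \<lambda>k (e, e'). (a k e, b k e')) \<in> bundles X t"
    "(whitney_sum E' F', \<lambda>k (e, e'). (a' k e, b' k e')) \<in> bundles X t"
    using sum_in_bundles[OF sp Ea(2) Fb(2)] sum_in_bundles[OF sp Ea'(2) Fb'(2)] by (simp_all add: abundle_sum_simp)
  have "smooth_map W.TS W'.TS (\<lambda>p. (h (fst p), g (snd p)))"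
    by (rule smooth_whitney_pair[OF E' F' W.TS smooth_map_compose[OF W.TS E.TS E'.TS smooth_whitney_fst[OF E F] h(1)]
          smooth_map_compose[OF W.TS F.TS F'.TS smooth_whitney_snd[OF E F] g(1)]]) (simp add: whitney_carrier h(5) g(5))
  moreover have "smooth_map W'.TS W.TS (\<lambda>p. (h' (fst p), g' (snd p)))"
    by (rule smooth_whitney_pair[OF E F W'.TS smooth_map_compose[OF W'.TS E'.TS E.TS smooth_whitney_fst[OF E' F'] h(2)]
          smooth_map_compose[OF W'.TS F'.TS F.TS smooth_whitney_snd[OF E' F'] g(2)]]) (simp add: whitney_carrier h(6) g(6))
  ultimately show ?thesis
    unfolding Ea(1) Ea'(1) Fb(1) Fb'(1) abundle_sum_simp
    by (rule isomorphicI[OF sp S]) (auto simp: whitney_carrier h(3-) g(3-))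
qed

lemma isomorphic_sum_comm:
  assumes sp: "space X t" and A: "A \<in> bundles X t" and B: "B \<in> bundles X t"
  shows "isomorphic K X (abundle_sum A B) (abundle_sum B A)"
proof -
  obtain E a F b where Ea: "A = (E, a)" "(E, a) \<in> bundles X t" and Fb: "B = (F, b)" "(F, b) \<in> bundles X t"
    using A B by (cases A, cases B) auto
  note E = bundlesD(1)[OF sp Ea(2)] and F = bundlesD(1)[OF sp Fb(2)]
  have W: "smooth_atlas (total_space X (whitney_sum E F))" "smooth_atlas (total_space X (whitney_sum F E))"
    by (rule vec_bundle.TS, rule whitney_bundle; fact)+
  have m: "\<And>p. p \<in> mcarrier (total_space X (whitney_sum E F)) \<longleftrightarrow> p \<in> vcarrier (whitney_sum E F)"
    "\<And>p. p \<in> mcarrier (total_space X (whitney_sum F E)) \<longleftrightarrow> p \<in> vcarrier (whitney_sum F E)"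
    by (rule vec_bundle.TS_carrier_iff, rule whitney_bundle; fact)+
  have S: "(whitney_sum E F, \<lambda>k (e, e'). (a k e, b k e')) \<in> bundles X t"
    "(whitney_sum F E, \<lambda>k (e, e'). (b k e, a k e')) \<in> bundles X t"
    using sum_in_bundles[OF sp Ea(2) Fb(2)] sum_in_bundles[OF sp Fb(2) Ea(2)] by (simp_all add: abundle_sum_simp)
  have "smooth_map (total_space X (whitney_sum E F)) (total_space X (whitney_sum F E)) (\<lambda>p. (snd p, fst p))"
    by (rule smooth_whitney_pair[OF F E W(1) smooth_whitney_snd[OF E F] smooth_whitney_fst[OF E F]]) (simp add: m whitney_carrier)
  moreover have "smooth_map (total_space X (whitney_sum F E)) (total_space X (whitney_sum E F)) (\<lambda>p. (snd p, fst p))"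
    by (rule smooth_whitney_pair[OF E F W(2) smooth_whitney_snd[OF F E] smooth_whitney_fst[OF F E]]) (simp add: m whitney_carrier)
  ultimately show ?thesis
    unfolding Ea(1) Fb(1) abundle_sum_simp
    by (rule isomorphicI[OF sp S]) (auto simp: whitney_carrier)
qed

lemma isomorphic_sum_assoc:
  assumes sp: "space X t" and A: "A \<in> bundles X t" and B: "B \<in> bundles X t" and C: "C \<in> bundles X t"
  shows "isomorphic K X (abundle_sum (abundle_sum A B) C) (abundle_sum A (abundle_sum B C))"
proof -
  obtain E a F b H c where Ea: "A = (E, a)" "(E, a) \<in> bundles X t" and Fb: "B = (F, b)" "(F, b) \<in> bundles X t"
    and Hc: "C = (H, c)" "(H, c) \<in> bundles X t" using A B C by (cases A, cases B, cases C) auto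
  note E = bundlesD(1)[OF sp Ea(2)] and F = bundlesD(1)[OF sp Fb(2)] and H = bundlesD(1)[OF sp Hc(2)]
  interpret E: vec_bundle X E by (rule E)
  interpret F: vec_bundle X F by (rule F)
  interpret H: vec_bundle X H by (rule H)
  interpret EF: vec_bundle X "whitney_sum E F" by (rule whitney_bundle[OF E F])
  interpret FH: vec_bundle X "whitney_sum F H" by (rule whitney_bundle[OF F H])
  interpret L: vec_bundle X "whitney_sum (whitney_sum E F) H" by (rule whitney_bundle[OF EF.vec_bundle_axioms H])
  interpret R: vec_bundle X "whitney_sum E (whitney_sum F H)" by (rule whitney_bundle[OF E FH.vec_bundle_axioms])
  note l1 = smooth_whitney_fst[OF EF.vec_bundle_axioms H] and l2 = smooth_whitney_snd[OF EF.vec_bundle_axioms H]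
    and r1 = smooth_whitney_fst[OF E FH.vec_bundle_axioms] and r2 = smooth_whitney_snd[OF E FH.vec_bundle_axioms]
  have S: "abundle_sum (abundle_sum (E, a) (F, b)) (H, c) \<in> bundles X t" "abundle_sum (E, a) (abundle_sum (F, b) (H, c)) \<in> bundles X t"
    by (intro sum_in_bundles[OF sp] Ea(2) Fb(2) Hc(2))+
  have "smooth_map L.TS R.TS (\<lambda>p. (fst (fst p), (snd (fst p), snd p)))"
    by (intro smooth_whitney_pair[OF E FH.vec_bundle_axioms L.TS] smooth_whitney_pair[OF F H L.TS]
        smooth_map_compose[OF L.TS EF.TS E.TS l1 smooth_whitney_fst[OF E F]]
        smooth_map_compose[OF L.TS EF.TS F.TS l1 smooth_whitney_snd[OF E F]] l2)
      (auto simp: whitney_carrier whitney_proj)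
  moreover have "smooth_map R.TS L.TS (\<lambda>p. ((fst p, fst (snd p)), snd (snd p)))"
    by (intro smooth_whitney_pair[OF EF.vec_bundle_axioms H R.TS] smooth_whitney_pair[OF E F R.TS]
        smooth_map_compose[OF R.TS FH.TS F.TS r2 smooth_whitney_fst[OF F H]]
        smooth_map_compose[OF R.TS FH.TS H.TS r2 smooth_whitney_snd[OF F H]] r1)
      (auto simp: whitney_carrier whitney_proj)
  ultimately show ?thesis
    unfolding Ea(1) Fb(1) Hc(1) abundle_sum_simp
    by (rule isomorphicI[OF sp S[unfolded abundle_sum_simp]]) (auto simp: whitney_carrier whitney_proj)
qed

lemma isomorphic_zero_sum:
  assumes sp: "space X t" and A: "A \<in> bundles X t"
  shows "isomorphic K X (abundle_sum (abundle_zero X (base t)) A) A"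
proof -
  obtain E a where Ea: "A = (E, a)" "(E, a) \<in> bundles X t" using A by (cases A) auto
  note X = spaceD(1)[OF sp]
  note E = bundlesD(1)[OF sp Ea(2)] and Z = zero_vec_bundle[OF X]
  interpret E: vec_bundle X E by (rule E)
  interpret Z: vec_bundle X "zero_bundle X" by (rule Z)
  interpret W: vec_bundle X "whitney_sum (zero_bundle X) E" by (rule whitney_bundle[OF Z E])
  have S: "abundle_sum (abundle_zero X (base t)) (E, a) \<in> bundles X t"
    by (rule sum_in_bundles[OF sp zero_in_bundles[OF sp] Ea(2)])
  have "smooth_map E.TS W.TS (\<lambda>e. ((vproj E e, \<lambda>_. 0), e))"
    by (rule smooth_whitney_pair[OF Z E E.TS smooth_zero_pair[OF X E.TS E.smooth_vproj] smooth_map_ident[OF E.TS]]) simp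
  with smooth_whitney_snd[OF Z E] show ?thesis
    unfolding Ea(1) abundle_sum_simp abundle_zero_def
    by (rule isomorphicI[OF sp S[unfolded abundle_sum_simp abundle_zero_def] Ea(2)])
      (auto simp: whitney_carrier E.vproj_in)
qed

context
  fixes X :: "'x atlas" and t and Y :: "'y atlas" and s and f :: "'x \<Rightarrow> 'y"
  assumes spX: "space X t" and spY: "space Y s" and f: "action_map X t Y s f"
begin

lemma isomorphic_pullback:
  assumes A: "A \<in> bundles Y s" "A' \<in> bundles Y s" and iso: "isomorphic K Y A A'"
  shows "isomorphic K X (abundle_pullback X (base t) f A) (abundle_pullback X (base t) f A')"
proof -
  obtain E a E' a' where Ea: "A = (E, a)" "(E, a) \<in> bundles Y s" and Ea': "A' = (E', a')" "(E', a') \<in> bundles Y s"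
    using A by (cases A, cases A') auto
  note X = spaceD(1)[OF spX]
  have fs: "smooth_map X Y f" using f by (simp add: action_map_def)
  note E = bundlesD(1)[OF spY Ea(2)] and E' = bundlesD(1)[OF spY Ea'(2)]
  interpret E: vec_bundle Y E by (rule E)
  interpret E': vec_bundle Y E' by (rule E')
  interpret P: vec_bundle X "pullback_bundle X f E" by (rule pullback_vec_bundle[OF X E fs])
  interpret P': vec_bundle X "pullback_bundle X f E'" by (rule pullback_vec_bundle[OF X E' fs])
  obtain h h' where h: "smooth_map E.TS E'.TS h" "smooth_map E'.TS E.TS h'"
    "\<And>e. e \<in> vcarrier E \<Longrightarrow> h e \<in> vcarrier E'" "\<And>e. e \<in> vcarrier E' \<Longrightarrow> h' e \<in> vcarrier E"
    "\<And>e. e \<in> vcarrier E \<Longrightarrow> vproj E' (h e) = vproj E e" "\<And>e. e \<in> vcarrier E' \<Longrightarrow> vproj E (h' e) = vproj E' e"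
    "\<And>e e'. e \<in> vcarrier E \<Longrightarrow> e' \<in> vcarrier E \<Longrightarrow> vproj E e = vproj E e' \<Longrightarrow> h (vadd E e e') = vadd E' (h e) (h e')"
    "\<And>c e. e \<in> vcarrier E \<Longrightarrow> h (vscale E c e) = vscale E' c (h e)"
    "\<And>k e. k \<in> carrier K \<Longrightarrow> e \<in> vcarrier E \<Longrightarrow> h (a k e) = a' k (h e)"
    "\<And>e. e \<in> vcarrier E \<Longrightarrow> h' (h e) = e" "\<And>e. e \<in> vcarrier E' \<Longrightarrow> h (h' e) = e"
    using isomorphicE[OF spY Ea(2) Ea'(2) iso[unfolded Ea(1) Ea'(1)]] by blast
  note S = pullback_in_bundles[OF spX spY f Ea(2)] pullback_in_bundles[OF spX spY f Ea'(2)]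
  have "smooth_map P.TS P'.TS (\<lambda>p. (fst p, h (snd p)))"
    by (rule smooth_pullback_pair[OF X E' fs P.TS smooth_pullback_fst[OF X E fs]
          smooth_map_compose[OF P.TS E.TS E'.TS smooth_pullback_snd[OF X E fs] h(1)]]) (simp add: pullback_carrier h(5))
  moreover have "smooth_map P'.TS P.TS (\<lambda>p. (fst p, h' (snd p)))"
    by (rule smooth_pullback_pair[OF X E fs P'.TS smooth_pullback_fst[OF X E' fs]
          smooth_map_compose[OF P'.TS E'.TS E.TS smooth_pullback_snd[OF X E' fs] h(2)]]) (simp add: pullback_carrier h(6))
  ultimately show ?thesis
    unfolding Ea(1) Ea'(1) abundle_pullback_simp
    by (rule isomorphicI[OF spX S[unfolded abundle_pullback_simp]]) (auto simp: pullback_carrier h(3-))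
qed

lemma isomorphic_pullback_sum:
  assumes A: "A \<in> bundles Y s" and B: "B \<in> bundles Y s"
  shows "isomorphic K X (abundle_pullback X (base t) f (abundle_sum A B))
    (abundle_sum (abundle_pullback X (base t) f A) (abundle_pullback X (base t) f B))"
proof -
  obtain E a F b where Ea: "A = (E, a)" "(E, a) \<in> bundles Y s" and Fb: "B = (F, b)" "(F, b) \<in> bundles Y s"
    using A B by (cases A, cases B) auto
  note X = spaceD(1)[OF spX]
  have fs: "smooth_map X Y f" using f by (simp add: action_map_def)
  note E = bundlesD(1)[OF spY Ea(2)] and F = bundlesD(1)[OF spY Fb(2)]
  interpret E: vec_bundle Y E by (rule E)
  interpret F: vec_bundle Y F by (rule F)
  interpret W: vec_bundle Y "whitney_sum E F" by (rule whitney_bundle[OF E F])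
  interpret PE: vec_bundle X "pullback_bundle X f E" by (rule pullback_vec_bundle[OF X E fs])
  interpret PF: vec_bundle X "pullback_bundle X f F" by (rule pullback_vec_bundle[OF X F fs])
  interpret PW: vec_bundle X "pullback_bundle X f (whitney_sum E F)"
    by (rule pullback_vec_bundle[OF X W.vec_bundle_axioms fs])
  interpret WP: vec_bundle X "whitney_sum (pullback_bundle X f E) (pullback_bundle X f F)"
    by (rule whitney_bundle[OF PE.vec_bundle_axioms PF.vec_bundle_axioms])
  have S: "abundle_pullback X (base t) f (abundle_sum (E, a) (F, b)) \<in> bundles X t"
    "abundle_sum (abundle_pullback X (base t) f (E, a)) (abundle_pullback X (base t) f (F, b)) \<in> bundles X t"
    by (intro pullback_in_bundles[OF spX spY f] sum_in_bundles[OF spY] sum_in_bundles[OF spX] Ea(2) Fb(2))+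
  note p1 = smooth_pullback_fst[OF X W.vec_bundle_axioms fs] and p2 = smooth_pullback_snd[OF X W.vec_bundle_axioms fs]
  have "smooth_map PW.TS WP.TS (\<lambda>p. ((fst p, fst (snd p)), (fst p, snd (snd p))))"
    by (intro smooth_whitney_pair[OF PE.vec_bundle_axioms PF.vec_bundle_axioms PW.TS]
        smooth_pullback_pair[OF X E fs PW.TS p1] smooth_pullback_pair[OF X F fs PW.TS p1]
        smooth_map_compose[OF PW.TS W.TS E.TS p2 smooth_whitney_fst[OF E F]]
        smooth_map_compose[OF PW.TS W.TS F.TS p2 smooth_whitney_snd[OF E F]])
      (simp_all add: pullback_carrier whitney_carrier whitney_proj)
  moreover
  note w1 = smooth_whitney_fst[OF PE.vec_bundle_axioms PF.vec_bundle_axioms]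
    and w2 = smooth_whitney_snd[OF PE.vec_bundle_axioms PF.vec_bundle_axioms]
  have "smooth_map WP.TS PW.TS (\<lambda>p. (fst (fst p), (snd (fst p), snd (snd p))))"
    by (intro smooth_pullback_pair[OF X W.vec_bundle_axioms fs WP.TS] smooth_whitney_pair[OF E F WP.TS]
        smooth_map_compose[OF WP.TS PE.TS X w1 smooth_pullback_fst[OF X E fs]]
        smooth_map_compose[OF WP.TS PE.TS E.TS w1 smooth_pullback_snd[OF X E fs]]
        smooth_map_compose[OF WP.TS PF.TS F.TS w2 smooth_pullback_snd[OF X F fs]])
      (auto simp: pullback_carrier whitney_carrier whitney_proj)
  ultimately show ?thesis
    unfolding Ea(1) Fb(1) abundle_pullback_simp abundle_sum_simp
    by (rule isomorphicI[OF spX S[unfolded abundle_pullback_simp abundle_sum_simp]])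
      (auto simp: pullback_carrier whitney_carrier whitney_proj)
qed

text \<open>A point of the iterated pullback is \<open>(x, (f x, e))\<close>, where
  \<open>f x\<close> is redundant; dropping and reinserting it are the two isomorphisms.\<close>

lemma isomorphic_pullback_comp:
  assumes spZ: "space Z r" and h: "action_map Y s Z r h" and A: "A \<in> bundles Z r"
  shows "isomorphic K X (abundle_pullback X (base t) (h \<circ> f) A)
    (abundle_pullback X (base t) f (abundle_pullback Y (base s) h A))"
proof -
  obtain E a where Ea: "A = (E, a)" "(E, a) \<in> bundles Z r" using A by (cases A) auto
  note X = spaceD(1)[OF spX] and Y = spaceD(1)[OF spY] and Z = spaceD(1)[OF spZ]
  have fs: "smooth_map X Y f" and hs: "smooth_map Y Z h" using f h by (simp_all add: action_map_def)
  have fY: "f x \<in> mcarrier Y" if "x \<in> mcarrier X" for x using smooth_map_carrier[OF X Y fs that] .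
  have hfs: "smooth_map X Z (h \<circ> f)" using smooth_map_compose[OF X Y Z fs hs] by (simp add: o_def)
  have hf: "action_map X t Z r (h \<circ> f)" using f h hfs fY by (simp add: action_map_def)
  note E = bundlesD(1)[OF spZ Ea(2)]
  interpret E: vec_bundle Z E by (rule E)
  interpret H: vec_bundle Y "pullback_bundle Y h E" by (rule pullback_vec_bundle[OF Y E hs])
  interpret HF: vec_bundle X "pullback_bundle X (h \<circ> f) E" by (rule pullback_vec_bundle[OF X E hfs])
  interpret FH: vec_bundle X "pullback_bundle X f (pullback_bundle Y h E)"
    by (rule pullback_vec_bundle[OF X H.vec_bundle_axioms fs])
  note S = pullback_in_bundles[OF spX spZ hf Ea(2)] pullback_in_bundles[OF spX spY f pullback_in_bundles[OF spY spZ h Ea(2)]]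
  have fe: "\<And>k x. k \<in> carrier K \<Longrightarrow> x \<in> mcarrier X \<Longrightarrow> f (base t k x) = base s k (f x)"
    using f by (simp add: action_map_def)
  note p1 = smooth_pullback_fst[OF X E hfs] and p2 = smooth_pullback_snd[OF X E hfs]
  have "smooth_map HF.TS FH.TS (\<lambda>p. (fst p, (f (fst p), snd p)))"
    by (intro smooth_pullback_pair[OF X H.vec_bundle_axioms fs HF.TS p1]
        smooth_pullback_pair[OF Y E hs HF.TS smooth_map_compose[OF HF.TS X Y p1 fs] p2])
      (simp_all add: pullback_carrier)
  moreover
  note q1 = smooth_pullback_fst[OF X H.vec_bundle_axioms fs] and q2 = smooth_pullback_snd[OF X H.vec_bundle_axioms fs]
  have "smooth_map FH.TS HF.TS (\<lambda>p. (fst p, snd (snd p)))"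
    by (intro smooth_pullback_pair[OF X E hfs FH.TS q1] smooth_map_compose[OF FH.TS H.TS E.TS q2 smooth_pullback_snd[OF Y E hs]])
      (auto simp: pullback_carrier)
  ultimately show ?thesis
    unfolding Ea(1) abundle_pullback_simp
    by (rule isomorphicI[OF spX S[unfolded abundle_pullback_simp]]) (auto simp: pullback_carrier fe fY)
qed

end

lemma action_map_ident:
  assumes sp: "space X t"
  shows "action_map X t X t (\<lambda>x. x)"
  using smooth_map_ident[OF spaceD(1)[OF sp]] by (simp add: action_map_def)

lemma isomorphic_pullback_ident:
  assumes sp: "space X t" and A: "A \<in> bundles X t"
  shows "isomorphic K X A (abundle_pullback X (base t) (\<lambda>x. x) A)"
proof -
  obtain E a where Ea: "A = (E, a)" "(E, a) \<in> bundles X t" using A by (cases A) auto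
  note X = spaceD(1)[OF sp] and E = bundlesD[OF sp Ea(2)]
  note id = smooth_map_ident[OF X]
  interpret E: vec_bundle X E by (rule E(1))
  note S = pullback_in_bundles[OF sp sp action_map_ident[OF sp] Ea(2)]
  have "smooth_map E.TS (total_space X (pullback_bundle X (\<lambda>x. x) E)) (\<lambda>e. (vproj E e, e))"
    by (rule smooth_pullback_pair[OF X E(1) id E.TS E.smooth_vproj smooth_map_ident[OF E.TS]]) simp
  from this smooth_pullback_snd[OF X E(1) id] show ?thesis
    unfolding Ea(1) abundle_pullback_simp
    by (rule isomorphicI[OF sp Ea(2) S[unfolded abundle_pullback_simp]])
      (auto simp: pullback_carrier E.vadd_closed E.vscale_closed E(5))
qed

section \<open>The monoid of isomorphism classes\<close>

text \<open>The type constraint is the content: it restricts \<open>bundles\<close> to the fixed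
  type of total spaces on which isomorphism classes are formed.\<close>

abbreviation ubundles :: "'x atlas \<Rightarrow> ('h \<Rightarrow> 'x \<Rightarrow> 'x) \<Rightarrow> ('k, 'x) ubundle set" where
  "ubundles X t \<equiv> bundles X t"

abbreviation cl :: "'x atlas \<Rightarrow> ('h \<Rightarrow> 'x \<Rightarrow> 'x) \<Rightarrow> ('k, 'e, 'x) abundle \<Rightarrow> ('k, 'x) ubundle set" where
  "cl X t \<equiv> iso_class K X (ubundles X t)"

abbreviation monoid_of :: "'x atlas \<Rightarrow> ('h \<Rightarrow> 'x \<Rightarrow> 'x) \<Rightarrow> ('k, 'x) ubundle set monoid" where
  "monoid_of X t \<equiv> iso_monoid K X (base t) (ubundles X t)"

context
  fixes X :: "'x atlas" and t
  assumes sp: "space X t"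
begin

text \<open>\<open>A\<close> and \<open>B\<close> may have total spaces of different types;
  transitivity of isomorphism compares both with the candidates at the fixed type.\<close>

lemma cl_eqI:
  assumes A: "A \<in> bundles X t" and B: "B \<in> bundles X t" and AB: "isomorphic K X A B"
  shows "cl X t A = cl X t B"
proof -
  have "isomorphic K X A F \<longleftrightarrow> isomorphic K X B F" if F: "F \<in> ubundles X t" for F
    using isomorphic_trans[OF sp A B F AB] isomorphic_trans[OF sp B A F isomorphic_sym[OF AB]] by blast
  then show ?thesis unfolding iso_class_def by (intro Collect_cong conj_cong refl)
qed

lemma mem_cl: "F \<in> cl X t A \<longleftrightarrow> F \<in> ubundles X t \<and> isomorphic K X A F"
  by (simp add: iso_class_def)

lemma cl_nonempty: "A \<in> bundles X t \<Longrightarrow> \<exists>F. F \<in> cl X t A"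
  unfolding mem_cl using exists_rep[OF sp] by blast

text \<open>The carrier lists classes of bundles of the fixed type. By \<open>exists_rep\<close> the
  class of any other bundle is one of these.\<close>

lemma cl_carrier:
  assumes A: "A \<in> bundles X t"
  shows "cl X t A \<in> carrier (monoid_of X t)"
proof -
  obtain F where F: "F \<in> ubundles X t" "isomorphic K X A F" using exists_rep[OF sp A] by blast
  then have "cl X t A = cl X t F" by (intro cl_eqI A)
  then show ?thesis using F by (simp add: iso_monoid_def)
qed

lemma monoid_carrierE:
  assumes "a \<in> carrier (monoid_of X t)"
  obtains A where "A \<in> ubundles X t" "a = cl X t A"
  using assms by (auto simp: iso_monoid_def)

text \<open>Unions over representatives collapse to the common value because a class is never empty,
  which is again the existence of a representative at the fixed type.\<close>

lemma Union_cl: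
  assumes A: "A \<in> bundles X t" and eq: "\<And>F. F \<in> cl X t A \<Longrightarrow> g F = S"
  shows "(\<Union>F\<in>cl X t A. g F) = S"
proof -
  have "cl X t A \<noteq> {}" using cl_nonempty[OF A] by blast
  with eq show ?thesis by simp
qed

text \<open>The sum of representatives lives on a product type, so its class is formed across types,
  and independence of the representatives is \<open>isomorphic_sum\<close>.\<close>

lemma monoid_mult:
  assumes A: "A \<in> bundles X t" and B: "B \<in> bundles X t"
  shows "cl X t A \<otimes>\<^bsub>monoid_of X t\<^esub> cl X t B = cl X t (abundle_sum A B)"
proof -
  have "(\<Union>F\<in>cl X t B. cl X t (abundle_sum E F)) = cl X t (abundle_sum A B)" if E: "E \<in> cl X t A" for E
  proof (rule Union_cl[OF B])
    fix F assume F: "F \<in> cl X t B"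
    show "cl X t (abundle_sum E F) = cl X t (abundle_sum A B)"
      using E F A B by (intro cl_eqI sum_in_bundles[OF sp] isomorphic_sum[OF sp]) (auto simp: mem_cl intro: isomorphic_sym)
  qed
  from Union_cl[OF A this] show ?thesis by (simp add: iso_monoid_def)
qed

lemma monoid_one: "\<one>\<^bsub>monoid_of X t\<^esub> = cl X t (abundle_zero X (base t))"
  by (simp add: iso_monoid_def)

lemma comm_monoid_bundles: "comm_monoid (monoid_of X t)"
proof (rule comm_monoidI)
  note zero = zero_in_bundles[OF sp]
  fix x y assume "x \<in> carrier (monoid_of X t)" "y \<in> carrier (monoid_of X t)"
  then obtain A B where A: "A \<in> ubundles X t" "x = cl X t A" and B: "B \<in> ubundles X t" "y = cl X t B"
    by (meson monoid_carrierE)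
  show "x \<otimes>\<^bsub>monoid_of X t\<^esub> y \<in> carrier (monoid_of X t)"
    unfolding A(2) B(2) monoid_mult[OF A(1) B(1)] by (intro cl_carrier sum_in_bundles[OF sp] A B)
  show "x \<otimes>\<^bsub>monoid_of X t\<^esub> y = y \<otimes>\<^bsub>monoid_of X t\<^esub> x"
    unfolding A(2) B(2) monoid_mult[OF A(1) B(1)] monoid_mult[OF B(1) A(1)]
    by (intro cl_eqI sum_in_bundles[OF sp] A B isomorphic_sum_comm[OF sp])
next
  show "\<one>\<^bsub>monoid_of X t\<^esub> \<in> carrier (monoid_of X t)"
    unfolding monoid_one by (intro cl_carrier zero_in_bundles[OF sp])
next
  fix x y z assume "x \<in> carrier (monoid_of X t)" "y \<in> carrier (monoid_of X t)" "z \<in> carrier (monoid_of X t)"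
  then obtain A B C where A: "A \<in> ubundles X t" "x = cl X t A" and B: "B \<in> ubundles X t" "y = cl X t B"
    and C: "C \<in> ubundles X t" "z = cl X t C" by (meson monoid_carrierE)
  show "x \<otimes>\<^bsub>monoid_of X t\<^esub> y \<otimes>\<^bsub>monoid_of X t\<^esub> z = x \<otimes>\<^bsub>monoid_of X t\<^esub> (y \<otimes>\<^bsub>monoid_of X t\<^esub> z)"
    unfolding A(2) B(2) C(2) monoid_mult[OF A(1) B(1)] monoid_mult[OF B(1) C(1)]
      monoid_mult[OF sum_in_bundles[OF sp A(1) B(1)] C(1)] monoid_mult[OF A(1) sum_in_bundles[OF sp B(1) C(1)]]
    by (intro cl_eqI sum_in_bundles[OF sp] A B C isomorphic_sum_assoc[OF sp])
next
  fix x assume "x \<in> carrier (monoid_of X t)"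
  then obtain A where A: "A \<in> ubundles X t" "x = cl X t A" by (meson monoid_carrierE)
  show "\<one>\<^bsub>monoid_of X t\<^esub> \<otimes>\<^bsub>monoid_of X t\<^esub> x = x"
    unfolding A(2) monoid_one monoid_mult[OF zero_in_bundles[OF sp] A(1)]
    by (intro cl_eqI sum_in_bundles[OF sp] zero_in_bundles[OF sp] A isomorphic_zero_sum[OF sp])
qed

end

end

section \<open>Group completion\<close>

context comm_monoid
begin

lemma gc_rel_iff:
  "((a, b), (a', b')) \<in> gc_rel G \<longleftrightarrow> a \<in> carrier G \<and> b \<in> carrier G \<and> a' \<in> carrier G \<and> b' \<in> carrier G \<and>
     (\<exists>c\<in>carrier G. a \<otimes> b' \<otimes> c = a' \<otimes> b \<otimes> c)"
  by (simp add: gc_rel_def)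

text \<open>Without cancellation the stabilizers \<open>c\<close> and \<open>d\<close> have to be
  carried along. Multiplying the two equations leaves the middle term \<open>b'\<close> on both
  sides, and it is absorbed into the new stabilizer
  \<open>b' \<otimes> c \<otimes> d\<close>.\<close>

lemma gc_rel_trans:
  assumes "((a, b), (a', b')) \<in> gc_rel G" "((a', b'), (a'', b'')) \<in> gc_rel G"
  shows "((a, b), (a'', b'')) \<in> gc_rel G"
proof -
  from assms obtain c d where cd: "c \<in> carrier G" "d \<in> carrier G"
    and eq: "a \<otimes> b' \<otimes> c = a' \<otimes> b \<otimes> c" "a' \<otimes> b'' \<otimes> d = a'' \<otimes> b' \<otimes> d"
    by (auto simp: gc_rel_iff)
  from assms have cr: "a \<in> carrier G" "b \<in> carrier G" "a' \<in> carrier G" "b' \<in> carrier G" "a'' \<in> carrier G" "b'' \<in> carrier G"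
    by (auto simp: gc_rel_iff)
  have "a \<otimes> b'' \<otimes> (b' \<otimes> c \<otimes> d) = (a \<otimes> b' \<otimes> c) \<otimes> (b'' \<otimes> d)" using cr cd by (simp add: m_ac)
  also have "\<dots> = (a' \<otimes> b'' \<otimes> d) \<otimes> (b \<otimes> c)" unfolding eq(1) using cr cd by (simp add: m_ac)
  also have "\<dots> = a'' \<otimes> b \<otimes> (b' \<otimes> c \<otimes> d)" unfolding eq(2) using cr cd by (simp add: m_ac)
  finally have "\<exists>c\<in>carrier G. a \<otimes> b'' \<otimes> c = a'' \<otimes> b \<otimes> c" using cr cd by (intro bexI[of _ "b' \<otimes> c \<otimes> d"]) auto
  then show ?thesis using cr by (simp add: gc_rel_iff)
qed

lemma gc_rel_sym: "((a, b), (a', b')) \<in> gc_rel G \<Longrightarrow> ((a', b'), (a, b)) \<in> gc_rel G"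
  unfolding gc_rel_iff by (auto intro: sym)

lemma gc_rel_refl: "a \<in> carrier G \<Longrightarrow> b \<in> carrier G \<Longrightarrow> ((a, b), (a, b)) \<in> gc_rel G"
  unfolding gc_rel_iff by auto

lemma mem_gc_diff: "(a', b') \<in> gc_diff G a b \<longleftrightarrow> ((a, b), (a', b')) \<in> gc_rel G"
  by (simp add: gc_diff_def)

lemma gc_diff_eq_iff:
  assumes "a \<in> carrier G" "b \<in> carrier G" "a' \<in> carrier G" "b' \<in> carrier G"
  shows "gc_diff G a b = gc_diff G a' b' \<longleftrightarrow> (\<exists>c\<in>carrier G. a \<otimes> b' \<otimes> c = a' \<otimes> b \<otimes> c)"
proof
  assume "gc_diff G a b = gc_diff G a' b'"
  then have "((a, b), (a', b')) \<in> gc_rel G"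
    using mem_gc_diff[of a' b'] gc_rel_refl[OF assms(3,4)] by blast
  then show "\<exists>c\<in>carrier G. a \<otimes> b' \<otimes> c = a' \<otimes> b \<otimes> c" by (simp add: gc_rel_iff)
next
  assume "\<exists>c\<in>carrier G. a \<otimes> b' \<otimes> c = a' \<otimes> b \<otimes> c"
  then have r: "((a, b), (a', b')) \<in> gc_rel G" using assms by (simp add: gc_rel_iff)
  show "gc_diff G a b = gc_diff G a' b'"
  proof (rule Set.set_eqI)
    fix z
    show "z \<in> gc_diff G a b \<longleftrightarrow> z \<in> gc_diff G a' b'"
      using gc_rel_trans[OF r, of "fst z" "snd z"] gc_rel_trans[OF gc_rel_sym[OF r], of "fst z" "snd z"]
      by (cases z) (auto simp: mem_gc_diff)
  qed
qed

lemma gc_carrier_iff: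
  "z \<in> carrier (group_completion G) \<longleftrightarrow> (\<exists>a\<in>carrier G. \<exists>b\<in>carrier G. z = gc_diff G a b)"
  by (auto simp: group_completion_def quotient_def gc_diff_def)

lemma gc_diff_Union:
  assumes ab: "a \<in> carrier G" "b \<in> carrier G" and eq: "\<And>x y. ((a, b), (x, y)) \<in> gc_rel G \<Longrightarrow> f x y = S"
  shows "(\<Union>(x, y)\<in>gc_diff G a b. f x y) = S"
proof -
  have "(a, b) \<in> gc_diff G a b" using gc_rel_refl[OF ab] by (simp add: mem_gc_diff)
  moreover have "(case z of (x, y) \<Rightarrow> f x y) = S" if "z \<in> gc_diff G a b" for z
    using that eq by (cases z) (simp add: mem_gc_diff)
  ultimately show ?thesis by (intro SUP_eq_const) auto
qed

text \<open>The stabilizers of the two relations multiply to a stabilizer for the product, so the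
  formula is independent of the representatives.\<close>

lemma gc_mult:
  assumes ab: "a \<in> carrier G" "b \<in> carrier G" and cd: "c \<in> carrier G" "d \<in> carrier G"
  shows "gc_diff G a b \<otimes>\<^bsub>group_completion G\<^esub> gc_diff G c d = gc_diff G (a \<otimes> c) (b \<otimes> d)"
proof -
  have "gc_diff G (x \<otimes> z) (y \<otimes> w) = gc_diff G (a \<otimes> c) (b \<otimes> d)"
    if xy: "((a, b), (x, y)) \<in> gc_rel G" and zw: "((c, d), (z, w)) \<in> gc_rel G" for x y z w
  proof -
    obtain u v where u: "u \<in> carrier G" "a \<otimes> y \<otimes> u = x \<otimes> b \<otimes> u" and v: "v \<in> carrier G" "c \<otimes> w \<otimes> v = z \<otimes> d \<otimes> v"
      using xy zw by (auto simp: gc_rel_iff)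
    have cr: "x \<in> carrier G" "y \<in> carrier G" "z \<in> carrier G" "w \<in> carrier G" using xy zw by (auto simp: gc_rel_iff)
    have "(x \<otimes> z) \<otimes> (b \<otimes> d) \<otimes> (u \<otimes> v) = (x \<otimes> b \<otimes> u) \<otimes> (z \<otimes> d \<otimes> v)" using cr ab cd u(1) v(1) by (simp add: m_ac)
    also have "\<dots> = (a \<otimes> c) \<otimes> (y \<otimes> w) \<otimes> (u \<otimes> v)" unfolding u(2)[symmetric] v(2)[symmetric] using cr ab cd u(1) v(1) by (simp add: m_ac)
    finally show ?thesis using cr ab cd u(1) v(1) by (subst gc_diff_eq_iff) auto
  qed
  then have "(\<Union>(x, y)\<in>gc_diff G a b. \<Union>(z, w)\<in>gc_diff G c d. gc_diff G (x \<otimes> z) (y \<otimes> w)) = gc_diff G (a \<otimes> c) (b \<otimes> d)"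
    by (intro gc_diff_Union ab cd) blast
  then show ?thesis by (simp add: group_completion_def)
qed

lemma gc_one: "\<one>\<^bsub>group_completion G\<^esub> = gc_diff G \<one> \<one>"
  by (simp add: group_completion_def)

lemma comm_group_completion: "comm_group (group_completion G)"
proof (rule comm_groupI)
  show "\<one>\<^bsub>group_completion G\<^esub> \<in> carrier (group_completion G)"
    unfolding gc_one gc_carrier_iff by blast
next
  fix x y assume "x \<in> carrier (group_completion G)" "y \<in> carrier (group_completion G)"
  then obtain a b c d where ab: "a \<in> carrier G" "b \<in> carrier G" "x = gc_diff G a b"
    and cd: "c \<in> carrier G" "d \<in> carrier G" "y = gc_diff G c d" unfolding gc_carrier_iff by blast
  show "x \<otimes>\<^bsub>group_completion G\<^esub> y \<in> carrier (group_completion G)"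
    unfolding ab(3) cd(3) gc_mult[OF ab(1,2) cd(1,2)] gc_carrier_iff using ab cd by blast
  show "x \<otimes>\<^bsub>group_completion G\<^esub> y = y \<otimes>\<^bsub>group_completion G\<^esub> x"
    unfolding ab(3) cd(3) gc_mult[OF ab(1,2) cd(1,2)] gc_mult[OF cd(1,2) ab(1,2)] using ab cd by (simp add: m_comm)
next
  fix x y z assume "x \<in> carrier (group_completion G)" "y \<in> carrier (group_completion G)" "z \<in> carrier (group_completion G)"
  then obtain a b c d e f where ab: "a \<in> carrier G" "b \<in> carrier G" "x = gc_diff G a b"
    and cd: "c \<in> carrier G" "d \<in> carrier G" "y = gc_diff G c d"
    and ef: "e \<in> carrier G" "f \<in> carrier G" "z = gc_diff G e f" unfolding gc_carrier_iff by blast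
  show "x \<otimes>\<^bsub>group_completion G\<^esub> y \<otimes>\<^bsub>group_completion G\<^esub> z = x \<otimes>\<^bsub>group_completion G\<^esub> (y \<otimes>\<^bsub>group_completion G\<^esub> z)"
    unfolding ab(3) cd(3) ef(3) gc_mult[OF ab(1,2) cd(1,2)] gc_mult[OF cd(1,2) ef(1,2)]
      gc_mult[OF m_closed[OF ab(1) cd(1)] m_closed[OF ab(2) cd(2)] ef(1,2)]
      gc_mult[OF ab(1,2) m_closed[OF cd(1) ef(1)] m_closed[OF cd(2) ef(2)]]
    using ab(1,2) cd(1,2) ef(1,2) by (simp add: m_assoc)
next
  fix x assume "x \<in> carrier (group_completion G)"
  then obtain a b where ab: "a \<in> carrier G" "b \<in> carrier G" "x = gc_diff G a b" unfolding gc_carrier_iff by blast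
  show "\<one>\<^bsub>group_completion G\<^esub> \<otimes>\<^bsub>group_completion G\<^esub> x = x"
    using ab by (simp add: gc_one gc_mult)
  have "gc_diff G b a \<otimes>\<^bsub>group_completion G\<^esub> x = \<one>\<^bsub>group_completion G\<^esub>"
    unfolding ab(3) gc_one gc_mult[OF ab(2,1,1,2)]
    using ab by (subst gc_diff_eq_iff) (auto intro!: bexI[of _ \<one>] simp: m_comm)
  then show "\<exists>y\<in>carrier (group_completion G). y \<otimes>\<^bsub>group_completion G\<^esub> x = \<one>\<^bsub>group_completion G\<^esub>"
  proof (rule bexI)
    show "gc_diff G b a \<in> carrier (group_completion G)" unfolding gc_carrier_iff using ab(1,2) by blast
  qed
qed

end

text \<open>If \<open>u\<close> stabilizes the relation between two pairs, its image under the
  homomorphism stabilizes the relation between their images. Hence the union in \<open>K_map\<close>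
  has a single value.\<close>

lemma K_map_diff:
  assumes A: "comm_monoid A" and B: "comm_monoid B"
    and \<phi>: "(\<lambda>a. \<Union>E\<in>a. c (F E)) \<in> hom A B" and ab: "a \<in> carrier A" "b \<in> carrier A"
  shows "K_map B c F (gc_diff A a b) = gc_diff B (\<Union>E\<in>a. c (F E)) (\<Union>E\<in>b. c (F E))"
proof -
  interpret A: comm_monoid A by fact
  interpret B: comm_monoid B by fact
  define f where "f = (\<lambda>a. \<Union>E\<in>a. c (F E))"
  have f: "f a \<in> carrier B" "f (a \<otimes>\<^bsub>A\<^esub> a') = f a \<otimes>\<^bsub>B\<^esub> f a'" if "a \<in> carrier A" "a' \<in> carrier A" for a a'
    using \<phi> that unfolding f_def[symmetric] by (auto simp: hom_def)
  have "(\<Union>(x, y)\<in>gc_diff A a b. gc_diff B (f x) (f y)) = gc_diff B (f a) (f b)"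
  proof (rule A.gc_diff_Union[OF ab])
    fix x y assume xy: "((a, b), (x, y)) \<in> gc_rel A"
    then obtain u where u: "u \<in> carrier A" "a \<otimes>\<^bsub>A\<^esub> y \<otimes>\<^bsub>A\<^esub> u = x \<otimes>\<^bsub>A\<^esub> b \<otimes>\<^bsub>A\<^esub> u"
      and cr: "x \<in> carrier A" "y \<in> carrier A" by (auto simp: A.gc_rel_iff)
    have "f x \<otimes>\<^bsub>B\<^esub> f b \<otimes>\<^bsub>B\<^esub> f u = f (x \<otimes>\<^bsub>A\<^esub> b \<otimes>\<^bsub>A\<^esub> u)" using f ab cr u(1) by simp
    also have "\<dots> = f a \<otimes>\<^bsub>B\<^esub> f y \<otimes>\<^bsub>B\<^esub> f u" unfolding u(2)[symmetric] using f ab cr u(1) by simp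
    finally show "gc_diff B (f x) (f y) = gc_diff B (f a) (f b)"
      using f(1) ab cr u(1) by (subst B.gc_diff_eq_iff) blast+
  qed
  then show ?thesis by (simp add: K_map_def f_def)
qed

lemma K_map_hom:
  assumes A: "comm_monoid A" and B: "comm_monoid B" and \<phi>: "(\<lambda>a. \<Union>E\<in>a. c (F E)) \<in> hom A B"
  shows "K_map B c F \<in> hom (group_completion A) (group_completion B)"
proof -
  interpret A: comm_monoid A by fact
  interpret B: comm_monoid B by fact
  define f where "f = (\<lambda>a. \<Union>E\<in>a. c (F E))"
  have f: "f a \<in> carrier B" "f (a \<otimes>\<^bsub>A\<^esub> a') = f a \<otimes>\<^bsub>B\<^esub> f a'" if "a \<in> carrier A" "a' \<in> carrier A" for a a'
    using \<phi> that unfolding f_def[symmetric] by (auto simp: hom_def)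
  have K: "K_map B c F (gc_diff A a b) = gc_diff B (f a) (f b)" if "a \<in> carrier A" "b \<in> carrier A" for a b
    unfolding f_def by (rule K_map_diff[where c = c and F = F, OF A B \<phi> that])
  show ?thesis
  proof (rule homI)
    fix x assume "x \<in> carrier (group_completion A)"
    then obtain a b where ab: "a \<in> carrier A" "b \<in> carrier A" "x = gc_diff A a b" unfolding A.gc_carrier_iff by blast
    show "K_map B c F x \<in> carrier (group_completion B)"
      unfolding ab(3) K[OF ab(1,2)] B.gc_carrier_iff using f(1) ab by blast
  next
    fix x y assume "x \<in> carrier (group_completion A)" "y \<in> carrier (group_completion A)"
    then obtain a b c' d where ab: "a \<in> carrier A" "b \<in> carrier A" "x = gc_diff A a b"
      and cd: "c' \<in> carrier A" "d \<in> carrier A" "y = gc_diff A c' d" unfolding A.gc_carrier_iff by blast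
    show "K_map B c F (x \<otimes>\<^bsub>group_completion A\<^esub> y) = K_map B c F x \<otimes>\<^bsub>group_completion B\<^esub> K_map B c F y"
      using ab(1,2) cd(1,2) by (simp add: ab(3) cd(3) A.gc_mult K B.gc_mult f)
  qed
qed

section \<open>Functors that respect isomorphisms and sums\<close>

context
  fixes K :: "('k, 'm) monoid_scheme" and KA KP and K' :: "('l, 'n) monoid_scheme" and KA' KP'
    and X :: "'x atlas" and t and X' :: "'y atlas" and t'
    and F :: "('k, 'x) ubundle \<Rightarrow> ('l, 'f, 'y) abundle"
  assumes aK: "acting K KA KP" and aK': "acting K' KA' KP'"
    and sp: "acting.space K KA KP X t" and sp': "acting.space K' KA' KP' X' t'"
    and F_in: "\<And>A. A \<in> acting.bundles K KA KP X t \<Longrightarrow> F A \<in> acting.bundles K' KA' KP' X' t'"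
    and F_iso: "\<And>A B. isomorphic K X A B \<Longrightarrow> A \<in> acting.bundles K KA KP X t \<Longrightarrow> B \<in> acting.bundles K KA KP X t \<Longrightarrow>
      isomorphic K' X' (F A) (F B)"
    and F_sum: "\<And>A B C. A \<in> acting.bundles K KA KP X t \<Longrightarrow> B \<in> acting.bundles K KA KP X t \<Longrightarrow>
      C \<in> acting.bundles K KA KP X t \<Longrightarrow> isomorphic K X C (abundle_sum A B) \<Longrightarrow>
      isomorphic K' X' (F C) (abundle_sum (F A) (F B))"
begin

interpretation A: acting K KA KP by (rule aK)
interpretation B: acting K' KA' KP' by (rule aK')

lemma functor_cl:
  assumes A: "A \<in> A.bundles X t"
  shows "(\<Union>E\<in>A.cl X t A. B.cl X' t' (F E)) = B.cl X' t' (F A)"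
proof (rule A.Union_cl[OF sp A])
  fix E assume "E \<in> A.cl X t A"
  then have E: "E \<in> A.bundles X t" "isomorphic K X A E" by (auto simp: A.mem_cl[OF sp])
  show "B.cl X' t' (F E) = B.cl X' t' (F A)"
    by (intro B.cl_eqI[OF sp'] F_in A E(1) F_iso isomorphic_sym[OF E(2)])
qed

text \<open>\<open>F\<close> is a function on bundles of the fixed type, whereas
  \<open>abundle_sum A B\<close> has a product type. A representative \<open>C\<close> of the sum
  takes its place, which explains the form of the assumption \<open>F_sum\<close>.\<close>

lemma functor_hom: "(\<lambda>a. \<Union>E\<in>a. B.cl X' t' (F E)) \<in> hom (A.monoid_of X t) (B.monoid_of X' t')"
proof (rule homI)
  fix x assume "x \<in> carrier (A.monoid_of X t)"
  then obtain A where A: "A \<in> A.ubundles X t" "x = A.cl X t A" by (meson A.monoid_carrierE[OF sp])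
  show "(\<Union>E\<in>x. B.cl X' t' (F E)) \<in> carrier (B.monoid_of X' t')"
    unfolding A(2) functor_cl[OF A(1)] by (rule B.cl_carrier[OF sp' F_in[OF A(1)]])
next
  fix x y assume x: "x \<in> carrier (A.monoid_of X t)" and y: "y \<in> carrier (A.monoid_of X t)"
  obtain A where A: "A \<in> A.ubundles X t" "x = A.cl X t A" using x by (meson A.monoid_carrierE[OF sp])
  obtain B where B: "B \<in> A.ubundles X t" "y = A.cl X t B" using y by (meson A.monoid_carrierE[OF sp])
  have AB: "abundle_sum A B \<in> A.bundles X t" by (rule A.sum_in_bundles[OF sp A(1) B(1)])
  obtain C where C: "C \<in> A.ubundles X t" "isomorphic K X (abundle_sum A B) C" using A.exists_rep[OF sp AB] by blast
  have eq: "A.cl X t (abundle_sum A B) = A.cl X t C" by (rule A.cl_eqI[OF sp AB C])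
  show "(\<Union>E\<in>x \<otimes>\<^bsub>A.monoid_of X t\<^esub> y. B.cl X' t' (F E)) =
      (\<Union>E\<in>x. B.cl X' t' (F E)) \<otimes>\<^bsub>B.monoid_of X' t'\<^esub> (\<Union>E\<in>y. B.cl X' t' (F E))"
    unfolding A(2) B(2) A.monoid_mult[OF sp A(1) B(1)] eq functor_cl[OF A(1)] functor_cl[OF B(1)] functor_cl[OF C(1)]
      B.monoid_mult[OF sp' F_in[OF A(1)] F_in[OF B(1)]]
    by (intro B.cl_eqI[OF sp'] F_in C B.sum_in_bundles[OF sp'] A B F_sum isomorphic_sym[OF C(2)])
qed

lemma functor_K_map:
  assumes "A \<in> A.bundles X t" "B \<in> A.bundles X t"
  shows "K_map (B.monoid_of X' t') (B.cl X' t') F (gc_diff (A.monoid_of X t) (A.cl X t A) (A.cl X t B)) =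
    gc_diff (B.monoid_of X' t') (B.cl X' t' (F A)) (B.cl X' t' (F B))"
  using K_map_diff[where c = "B.cl X' t'" and F = F, OF A.comm_monoid_bundles[OF sp] B.comm_monoid_bundles[OF sp'] functor_hom A.cl_carrier[OF sp assms(1)] A.cl_carrier[OF sp assms(2)]]
  unfolding functor_cl[OF assms(1)] functor_cl[OF assms(2)] .

lemma functor_K_map_hom:
  "K_map (B.monoid_of X' t') (B.cl X' t') F \<in> hom (group_completion (A.monoid_of X t)) (group_completion (B.monoid_of X' t'))"
  by (rule K_map_hom[where c = "B.cl X' t'" and F = F, OF A.comm_monoid_bundles[OF sp] B.comm_monoid_bundles[OF sp'] functor_hom])

end

context acting
begin

lemma completion_carrierE:
  assumes sp: "space X t" and z: "z \<in> carrier (group_completion (monoid_of X t))"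
  obtains A B where "A \<in> ubundles X t" "B \<in> ubundles X t" "z = gc_diff (monoid_of X t) (cl X t A) (cl X t B)"
proof -
  interpret comm_monoid "monoid_of X t" by (rule comm_monoid_bundles[OF sp])
  from z obtain a b where "a \<in> carrier (monoid_of X t)" "b \<in> carrier (monoid_of X t)" "z = gc_diff (monoid_of X t) a b"
    unfolding gc_carrier_iff by blast
  then show thesis using that by (metis monoid_carrierE[OF sp])
qed

context
  fixes X :: "'x atlas" and t and Y :: "'y atlas" and s and f :: "'x \<Rightarrow> 'y"
  assumes spX: "space X t" and spY: "space Y s" and f: "action_map X t Y s f"
begin

lemma pullback_functor_sum:
  assumes "A \<in> bundles Y s" "B \<in> bundles Y s" "C \<in> bundles Y s" and C: "isomorphic K Y C (abundle_sum A B)"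
  shows "isomorphic K X (abundle_pullback X (base t) f C)
    (abundle_sum (abundle_pullback X (base t) f A) (abundle_pullback X (base t) f B))"
proof -
  note AB = sum_in_bundles[OF spY assms(1,2)]
  note p = pullback_in_bundles[OF spX spY f]
  show ?thesis
    by (rule isomorphic_trans[OF spX p[OF assms(3)] p[OF AB] sum_in_bundles[OF spX p[OF assms(1)] p[OF assms(2)]]
          isomorphic_pullback[OF spX spY f assms(3) AB C] isomorphic_pullback_sum[OF spX spY f assms(1,2)]])
qed

lemma pullback_K_map:
  assumes "A \<in> ubundles Y s" "B \<in> ubundles Y s"
  shows "K_map (monoid_of X t) (cl X t) (abundle_pullback X (base t) f) (gc_diff (monoid_of Y s) (cl Y s A) (cl Y s B)) =
    gc_diff (monoid_of X t) (cl X t (abundle_pullback X (base t) f A)) (cl X t (abundle_pullback X (base t) f B))"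
  by (rule functor_K_map[OF acting_axioms acting_axioms spY spX _ _ _ assms])
    (blast intro: pullback_in_bundles[OF spX spY f] isomorphic_pullback[OF spX spY f] pullback_functor_sum)+

lemma pullback_K_map_hom:
  "K_map (monoid_of X t) (cl X t) (abundle_pullback X (base t) f) \<in>
    hom (group_completion (monoid_of Y s)) (group_completion (monoid_of X t))"
  by (rule functor_K_map_hom[OF acting_axioms acting_axioms spY spX])
    (blast intro: pullback_in_bundles[OF spX spY f] isomorphic_pullback[OF spX spY f] pullback_functor_sum)+

end

end

section \<open>The tangent group and its affine actions\<close>

lemma fst_tangent_mult: "fst (v \<otimes>\<^bsub>tangent_group G\<^esub> w) = fst v \<otimes>\<^bsub>G\<^esub> fst w"
  by (cases v, cases w) (simp add: tangent_group_def tangent_add_def pushforward_def)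

lemma fst_tangent_zero [simp]: "fst (tangent_zero p) = p"
  by (simp add: tangent_zero_def)

text \<open>In direction zero the line is constant, so the derivative vanishes for an arbitrary map
  \<open>f\<close>, whichever chart the pushforward has chosen.\<close>

lemma pushforward_tangent_zero: "pushforward M N f (tangent_zero p) = tangent_zero (f p)"
  by (auto simp: pushforward_def tangent_zero_def directional_deriv_def Let_def fun_eq_iff split: prod.splits)

lemma tangent_add_zero: "tangent_add v (tangent_zero q) = v"
  by (simp add: tangent_add_def tangent_zero_def)

text \<open>Both translations push zero vectors to zero vectors, so the zero section is a
  homomorphism. Restriction along it therefore turns actions of \<open>TG\<close> into actions of
  \<open>G\<close>.\<close>

lemma tangent_zero_mult:
  "tangent_zero g \<otimes>\<^bsub>tangent_group G\<^esub> tangent_zero h = tangent_zero (g \<otimes>\<^bsub>G\<^esub> h)"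
  by (simp add: tangent_group_def pushforward_tangent_zero tangent_add_zero)

text \<open>\<open>G\<close> as a bundle over itself whose fibres are single points: addition and
  scaling have to be trivial, and joint linearity reduces to linearity in the bundle that is acted
  on.\<close>

definition rank_zero_bundle :: "('g, 'm) monoid_scheme \<Rightarrow> ('g, 'g) vbundle" where
  "rank_zero_bundle G = \<lparr>vcarrier = carrier G, vproj = (\<lambda>g. g), vadd = (\<lambda>g h. g), vscale = (\<lambda>c g. g), vtriv = {}\<rparr>"

lemma U_fun_sum: "U_fun (abundle_sum A B) = abundle_sum (U_fun A) (U_fun B)"
  by (cases A, cases B) (simp add: U_fun_def abundle_sum_def)

lemma sigma_fun_sum: "sigma_fun (abundle_sum A B) = abundle_sum (sigma_fun A) (sigma_fun B)"
  by (cases A, cases B) (simp add: sigma_fun_def abundle_sum_def)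

lemma U_fun_pullback: "U_fun (abundle_pullback X (\<lambda>v. t (fst v)) f A) = abundle_pullback X t f (U_fun A)"
  by (cases A) (simp add: U_fun_def abundle_pullback_def)

lemma sigma_fun_pullback: "sigma_fun (abundle_pullback X t f A) = abundle_pullback X (\<lambda>v. t (fst v)) f (sigma_fun A)"
  by (cases A) (simp add: sigma_fun_def abundle_pullback_def)

lemma U_sigma: "U_fun (sigma_fun A) = A"
  by (cases A) (simp add: U_fun_def sigma_fun_def)

text \<open>Vector identities in a fibre are checked in coordinates, where they become identities of
  real numbers. The computations with the shear rely on this.\<close>

lemma (in vec_bundle) fibre_eqI:
  assumes "e \<in> vcarrier E" "e' \<in> vcarrier E" "vproj E e' = vproj E e"
    and "\<And>U n \<phi>. (U, n, \<phi>) \<in> vtriv E \<Longrightarrow> vproj E e \<in> U \<Longrightarrow> \<phi> e = \<phi> e'"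
  shows "e = e'"
proof -
  obtain U n \<phi> where U: "(U, n, \<phi>) \<in> vtriv E" "vproj E e \<in> U" using triv_cover[OF vproj_in[OF assms(1)]] by blast
  show ?thesis
    by (rule triv_inj[OF triv_triv[OF U(1)] U(2)]) (use assms U in \<open>auto simp: fibre_iff\<close>)
qed

lemma (in vec_bundle) triv_combine:
  assumes "(U, n, \<phi>) \<in> vtriv E" "e \<in> vcarrier E" "e' \<in> vcarrier E" "vproj E e' = vproj E e" "vproj E e \<in> U"
  shows "\<phi> (vadd E e e') = (\<lambda>i. \<phi> e i + \<phi> e' i)" "\<phi> (vscale E c e) = (\<lambda>i. c * \<phi> e i)"
  using triv_add[OF triv_triv[OF assms(1)] assms(5)] triv_scale[OF triv_triv[OF assms(1)] assms(5)] assms by (auto simp: fibre_iff)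

section \<open>A Lie group and its tangent group as instances of \<open>acting\<close>\<close>

locale lie =
  fixes G :: "'g lie_grp"
  assumes lie: "lie_group G"
begin

lemma atlas_G: "smooth_atlas (atlas G)" and carrier_G: "carrier G = mcarrier (atlas G)" and group_G: "group G"
  using lie by (auto simp: lie_group_def manifold_def)

abbreviation "TG \<equiv> tangent_bundle (atlas G)"

sublocale T: vec_bundle "atlas G" TG
  by (rule tangent_vec_bundle[OF atlas_G])

lemma carrier_TG: "carrier (tangent_group G) = vcarrier TG"
  by (simp add: tangent_group_def)

lemma fst_carrier_TG: "v \<in> vcarrier TG \<Longrightarrow> fst v \<in> carrier G"
  using T.vproj_in by (simp add: carrier_G atlas_G tangent_bundle_simps(2))

sublocale GA: acting G "atlas G" "rank_zero_bundle G"
  by unfold_locales (auto simp: rank_zero_bundle_def atlas_G carrier_G)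

sublocale TA: acting "tangent_group G" T.TS TG
  by unfold_locales (auto simp del: tangent_bundle_simps simp: T.TS T.mcarrier_TS carrier_TG T.vadd_closed T.vscale_closed)

lemma GA_base: "GA.base t = t"
  by (intro ext) (simp only: GA.base_def, simp add: rank_zero_bundle_def)

lemma TA_base: "TA.base t = (\<lambda>v. t (fst v))"
  by (simp add: TA.base_def fun_eq_iff atlas_G tangent_bundle_simps(2))

lemma GA_space: "G_manifold G (X, t) \<Longrightarrow> GA.space X t"
  by (simp add: G_manifold_def GA.space_def GA_base manifold_def)

text \<open>\<open>TG\<close> acts on the base through the bundle projection onto \<open>G\<close>,
  which is a smooth homomorphism.\<close>

lemma TA_space:
  assumes "G_manifold G (X, t)"
  shows "TA.space X t"
proof -
  note sp = GA_space[OF assms]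
  note X = GA.spaceD(1)[OF sp]
  have la: "left_action G (mcarrier X) t" using GA.spaceD(2)[OF sp] by (simp add: GA_base)
  have "left_action (tangent_group G) (mcarrier X) (\<lambda>v. t (fst v))"
    unfolding left_action_def
  proof (intro conjI ballI)
    fix v w x assume vw: "v \<in> carrier (tangent_group G)" "w \<in> carrier (tangent_group G)" and x: "x \<in> mcarrier X"
    then show "t (fst (v \<otimes>\<^bsub>tangent_group G\<^esub> w)) x = t (fst v) (t (fst w) x)"
      using la fst_carrier_TG by (simp add: fst_tangent_mult left_action_def carrier_TG del: tangent_bundle_simps)
  next
    show "t (fst \<one>\<^bsub>tangent_group G\<^esub>) x = x" if "x \<in> mcarrier X" for x
      using la that by (simp add: tangent_group_def left_action_def)
    show "t (fst v) x \<in> mcarrier X" if "v \<in> carrier (tangent_group G)" "x \<in> mcarrier X" for v x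
      using la that fst_carrier_TG by (simp add: left_action_def carrier_TG del: tangent_bundle_simps)
  qed
  moreover have "smooth_map (prod_atlas T.TS X) X (\<lambda>(v, x). t (fst v) x)"
  proof -
    have L: "smooth_atlas (prod_atlas T.TS X)" by (rule smooth_atlas_prod[OF T.TS X])
    have "smooth_map (prod_atlas T.TS X) (atlas G) (\<lambda>p. fst (fst p))"
      using T.smooth_map_base[OF L smooth_map_fst[OF T.TS X]] by (simp add: atlas_G tangent_bundle_simps(2))
    from GA.smooth_base[OF sp L this smooth_map_snd[OF T.TS X]] show ?thesis by (simp add: GA_base case_prod_unfold)
  qed
  ultimately show ?thesis using X by (simp add: TA.space_def TA_base)
qed

lemma Vect_G_eq: "Vect_G G (X :: 'x atlas, t) = (GA.bundles X t :: ('g, 'e, 'x) abundle set)"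
proof -
  have "(\<forall>g\<in>carrier G. fibrewise_linear E E (t g) (\<rho> g)) \<longleftrightarrow>
      fibrewise_linear (external_product (rank_zero_bundle G) E) E (\<lambda>(g, x). t g x) (\<lambda>(g, e). \<rho> g e)"
    for E :: "('e, 'x) vbundle" and \<rho>
    unfolding fibrewise_linear_iff by (auto simp: rank_zero_bundle_def)
  then show ?thesis by (simp add: Vect_G_def GA.bundles_def)
qed

text \<open>The two descriptions differ in the source on which smoothness is tested: the total space
  of the external product, or the product of the total spaces. The identity is smooth both ways
  between them.\<close>

lemma Vect_aff_eq:
  fixes X :: "'x atlas"
  assumes sp: "TA.space X t"
  shows "Vect_aff G (X, t) = (TA.bundles X t :: ('g tvec, 'e, 'x) abundle set)"
proof -
  note X = TA.spaceD(1)[OF sp]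
  have "smooth_map (total_space (prod_atlas (atlas G) X) (external_product TG E)) (total_space X E) f \<longleftrightarrow>
      smooth_map (prod_atlas T.TS (total_space X E)) (total_space X E) f" if "vector_bundle X E"
    for E :: "('e, 'x) vbundle" and f
  proof -
    interpret E: vec_bundle X E using that X by unfold_locales
    interpret W: vec_bundle "prod_atlas (atlas G) X" "external_product TG E"
      by (rule external_bundle[OF T.vec_bundle_axioms E.vec_bundle_axioms])
    note P = smooth_atlas_prod[OF T.TS E.TS]
    show ?thesis
      using smooth_map_compose[OF P W.TS E.TS smooth_external_ident'[OF T.vec_bundle_axioms E.vec_bundle_axioms], of f]
        smooth_map_compose[OF W.TS P E.TS smooth_external_ident[OF T.vec_bundle_axioms E.vec_bundle_axioms], of f] by auto
  qed
  then show ?thesis by (auto simp: Vect_aff_def TA.bundles_def vb_morphism_def)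
qed

lemma isomorphic_U:
  fixes A :: "('g tvec, 'e, 'x) abundle" and B :: "('g tvec, 'f, 'x) abundle"
  assumes "isomorphic (tangent_group G) X A B"
  shows "isomorphic G X (U_fun A) (U_fun B)"
proof -
  obtain E a F b where A: "A = (E, a)" "B = (F, b)" by (cases A, cases B) auto
  have z: "tangent_zero g \<in> carrier (tangent_group G)" if "g \<in> carrier G" for g
    using tangent_zero_carrier[OF atlas_G] that by (simp add: carrier_TG carrier_G del: tangent_bundle_simps)
  have "equivariant_morphism G X (E, \<lambda>g. a (tangent_zero g)) (F, \<lambda>g. b (tangent_zero g)) h"
    if "equivariant_morphism (tangent_group G) X (E, a) (F, b) h"
    for E :: "('e, 'x) vbundle" and F :: "('f, 'x) vbundle" and a b h
    using that z by (simp add: equivariant_morphism_def)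
  \<comment> \<open>The same restriction of equivariance with the two total space types exchanged,
    to be used for the inverse map.\<close>
  moreover have "equivariant_morphism G X (E, \<lambda>g. a (tangent_zero g)) (F, \<lambda>g. b (tangent_zero g)) h"
    if "equivariant_morphism (tangent_group G) X (E, a) (F, b) h"
    for E :: "('f, 'x) vbundle" and F :: "('e, 'x) vbundle" and a b h
    using that z by (simp add: equivariant_morphism_def)
  ultimately show ?thesis
    using assms unfolding A isomorphic_def U_fun_def prod.case fst_conv by metis
qed

lemma isomorphic_sigma:
  fixes A :: "('g, 'e, 'x) abundle" and B :: "('g, 'f, 'x) abundle"
  assumes "isomorphic G X A B"
  shows "isomorphic (tangent_group G) X (sigma_fun A) (sigma_fun B)"
proof -
  obtain E a F b where A: "A = (E, a)" "B = (F, b)" by (cases A, cases B) auto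
  have z: "fst v \<in> carrier G" if "v \<in> carrier (tangent_group G)" for v
    using fst_carrier_TG that by (simp add: carrier_TG)
  have "equivariant_morphism (tangent_group G) X (E, \<lambda>g. a (fst g)) (F, \<lambda>g. b (fst g)) h"
    if "equivariant_morphism G X (E, a) (F, b) h"
    for E :: "('e, 'x) vbundle" and F :: "('f, 'x) vbundle" and a b h
    using that z by (simp add: equivariant_morphism_def)
  moreover have "equivariant_morphism (tangent_group G) X (E, \<lambda>g. a (fst g)) (F, \<lambda>g. b (fst g)) h"
    if "equivariant_morphism G X (E, a) (F, b) h"
    for E :: "('f, 'x) vbundle" and F :: "('e, 'x) vbundle" and a b h
    using that z by (simp add: equivariant_morphism_def)
  ultimately show ?thesis
    using assms unfolding A isomorphic_def sigma_fun_def prod.case fst_conv by metis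
qed

section \<open>The functors U and sigma on objects, and the shear\<close>

context
  fixes X :: "'x atlas" and t
  assumes XX: "G_manifold G (X, t)"
begin

lemmas spG = GA_space[OF XX] and spT = TA_space[OF XX]

text \<open>Evaluated at zero vectors, where 0_g + 0_g = 0_g and c 0_g = 0_g, joint linearity
  becomes linearity of the action of a fixed g.\<close>

lemma U_in_bundles:
  assumes A: "A \<in> TA.bundles X t"
  shows "U_fun A \<in> GA.bundles X t"
proof -
  obtain E a where Ea: "A = (E, a)" "(E, a) \<in> TA.bundles X t" using A by (cases A) auto
  note E = TA.bundlesD[OF spT Ea(2)]
  interpret E: vec_bundle X E by (rule E(1))
  have z: "tangent_zero g \<in> carrier (tangent_group G)" if "g \<in> carrier G" for g
    using tangent_zero_carrier[OF atlas_G] that by (simp add: carrier_TG carrier_G del: tangent_bundle_simps)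
  have zadd: "vadd TG (tangent_zero g) (tangent_zero g) = tangent_zero g"
    and zscale: "vscale TG c (tangent_zero g) = tangent_zero g" and zproj: "vproj TG (tangent_zero g) = g" for g c
    using atlas_G by (simp_all add: tangent_add_zero) (simp add: tangent_zero_def)
  have "(E, \<lambda>g. a (tangent_zero g)) \<in> GA.bundles X t"
    unfolding GA.bundles_iff[OF spG]
  proof (intro conjI ballI allI impI)
    show "vec_bundle X E" ..
    have "tangent_zero \<one>\<^bsub>G\<^esub> = \<one>\<^bsub>tangent_group G\<^esub>" by (simp add: tangent_group_def)
    then show "left_action G (vcarrier E) (\<lambda>g. a (tangent_zero g))"
      using E(2) z by (auto simp: left_action_def simp flip: tangent_zero_mult)
    let ?L = "prod_atlas (atlas G) E.TS"
    have L: "smooth_atlas ?L" by (rule smooth_atlas_prod[OF atlas_G E.TS])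
    have "smooth_map ?L E.TS (\<lambda>p. a (tangent_zero (fst p)) (snd p))"
      by (rule TA.smooth_act[OF spT Ea(2) L smooth_map_compose[OF L atlas_G T.TS smooth_map_fst[OF atlas_G E.TS] smooth_tangent_zero[OF atlas_G]]
            smooth_map_snd[OF atlas_G E.TS]])
    then show "smooth_map ?L E.TS (\<lambda>(g, e). a (tangent_zero g) e)" by (simp add: case_prod_unfold)
  next
    fix g e assume "g \<in> carrier G" "e \<in> vcarrier E"
    then show "vproj E (a (tangent_zero g) e) = GA.base t g (vproj E e)"
      using E(5) z by (simp add: GA_base TA_base)
  next
    fix g e h e' assume "g \<in> carrier G" "e \<in> vcarrier E" "h \<in> carrier G" "e' \<in> vcarrier E"
      "vproj (rank_zero_bundle G) g = vproj (rank_zero_bundle G) h" "vproj E e = vproj E e'"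
    then show "a (tangent_zero (vadd (rank_zero_bundle G) g h)) (vadd E e e') =
        vadd E (a (tangent_zero g) e) (a (tangent_zero h) e')"
      using E(6)[of "tangent_zero g" e "tangent_zero g" e'] z[of g] by (simp add: rank_zero_bundle_def zadd del: tangent_bundle_simps)
  next
    fix c g e assume "g \<in> carrier G" "e \<in> vcarrier E"
    then show "a (tangent_zero (vscale (rank_zero_bundle G) c g)) (vscale E c e) = vscale E c (a (tangent_zero g) e)"
      using E(7)[of "tangent_zero g" e c] z[of g] by (simp add: rank_zero_bundle_def zscale del: tangent_bundle_simps)
  qed
  then show ?thesis by (simp add: Ea(1) U_fun_def)
qed

text \<open>The projection from \<open>TG\<close> to \<open>G\<close> is a smooth homomorphism and
  is constant on tangent spaces, so adding or scaling the acting vector has no effect and linearity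
  in the bundle gives joint linearity.\<close>

lemma sigma_in_bundles:
  assumes A: "A \<in> GA.bundles X t"
  shows "sigma_fun A \<in> TA.bundles X t"
proof -
  obtain E a where Ea: "A = (E, a)" "(E, a) \<in> GA.bundles X t" using A by (cases A) auto
  note E = GA.bundlesD[OF spG Ea(2)]
  interpret E: vec_bundle X E by (rule E(1))
  have z: "fst v \<in> carrier G" if "v \<in> carrier (tangent_group G)" for v
    using fst_carrier_TG that by (simp add: carrier_TG)
  have proj: "vproj TG = fst" and addf: "fst (vadd TG v w) = fst v" and scalef: "fst (vscale TG c v) = fst v" for v w c
    using atlas_G by (simp_all add: tangent_add_def)
  have "(E, \<lambda>v. a (fst v)) \<in> TA.bundles X t"
    unfolding TA.bundles_iff[OF spT]
  proof (intro conjI ballI allI impI)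
    show "vec_bundle X E" ..
    have "fst \<one>\<^bsub>tangent_group G\<^esub> = \<one>\<^bsub>G\<^esub>" by (simp add: tangent_group_def)
    then show "left_action (tangent_group G) (vcarrier E) (\<lambda>v. a (fst v))"
      using E(2) z by (simp add: left_action_def fst_tangent_mult)
    let ?L = "prod_atlas T.TS E.TS"
    have L: "smooth_atlas ?L" by (rule smooth_atlas_prod[OF T.TS E.TS])
    have "smooth_map ?L (atlas G) (\<lambda>p. fst (fst p))"
      using T.smooth_map_base[OF L smooth_map_fst[OF T.TS E.TS]] by (simp add: proj)
    from GA.smooth_act[OF spG Ea(2) L this smooth_map_snd[OF T.TS E.TS]]
    show "smooth_map ?L E.TS (\<lambda>(v, e). a (fst v) e)" by (simp add: case_prod_unfold)
  next
    fix v e assume "v \<in> carrier (tangent_group G)" "e \<in> vcarrier E"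
    then show "vproj E (a (fst v) e) = TA.base t v (vproj E e)"
      using E(5) z by (simp add: GA_base TA_base)
  next
    fix v e w e' assume *: "v \<in> carrier (tangent_group G)" "e \<in> vcarrier E" "w \<in> carrier (tangent_group G)" "e' \<in> vcarrier E"
      "vproj TG v = vproj TG w" "vproj E e = vproj E e'"
    have "a (fst v) (vadd E e e') = vadd E (a (fst v) e) (a (fst v) e')"
      using E(6)[of "fst v" e "fst v" e'] z[OF *(1)] * by (simp add: rank_zero_bundle_def)
    then show "a (fst (vadd TG v w)) (vadd E e e') = vadd E (a (fst v) e) (a (fst w) e')"
      using *(5) by (simp only: addf proj)
  next
    fix c v e assume *: "v \<in> carrier (tangent_group G)" "e \<in> vcarrier E"
    have "a (fst v) (vscale E c e) = vscale E c (a (fst v) e)"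
      using E(7)[of "fst v" e c] z[OF *(1)] * by (simp add: rank_zero_bundle_def)
    then show "a (fst (vscale TG c v)) (vscale E c e) = vscale E c (a (fst v) e)"
      by (simp only: scalef)
  qed
  then show ?thesis by (simp add: Ea(1) sigma_fun_def)
qed

text \<open>
  The shear \<open>(e, e') \<mapsto> (e, e' - e)\<close>: joint linearity gives \<open>v e' - v e = 0\<^sub>g (e' - e)\<close>, so that the translation
  part of the affine action disappears from the second summand.
\<close>

lemma isomorphic_shear:
  assumes A: "A \<in> TA.bundles X t"
  shows "isomorphic (tangent_group G) X (abundle_sum A A) (abundle_sum A (sigma_fun (U_fun A)))"
proof -
  obtain E a where Ea: "A = (E, a)" "(E, a) \<in> TA.bundles X t" using A by (cases A) auto
  note E = TA.bundlesD[OF spT Ea(2)]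
  interpret E: vec_bundle X E by (rule E(1))
  interpret W: vec_bundle X "whitney_sum E E" by (rule whitney_bundle[OF E(1) E(1)])
  have \<sigma>: "sigma_fun (U_fun A) = (E, \<lambda>v. a (tangent_zero (fst v)))"
    by (simp add: Ea(1) U_fun_def sigma_fun_def)
  have S: "(whitney_sum E E, \<lambda>k (e, e'). (a k e, a k e')) \<in> TA.bundles X t"
    "(whitney_sum E E, \<lambda>k (e, e'). (a k e, a (tangent_zero (fst k)) e')) \<in> TA.bundles X t"
    using TA.sum_in_bundles[OF spT A A] TA.sum_in_bundles[OF spT A sigma_in_bundles[OF U_in_bundles[OF A]]]
    by (simp_all only: \<sigma>, simp_all add: Ea(1) abundle_sum_simp)
  \<comment> \<open>\<open>sh c\<close> and \<open>sh (- c)\<close> are mutually inverse; the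
    isomorphism is \<open>sh (- 1)\<close> with inverse \<open>sh 1\<close>. Subtraction is
    expressed as addition of the multiple by -1, since the bundle structure provides only addition
    and scaling.\<close>
  define sh where "sh = (\<lambda>c p. (fst p, vadd E (snd p) (vscale E c (fst p))))"
  have cl: "vadd E e' (vscale E c e) \<in> vcarrier E" "vproj E (vadd E e' (vscale E c e)) = vproj E e'"
    if "e \<in> vcarrier E" "e' \<in> vcarrier E" "vproj E e = vproj E e'" for e e' c
    using that E.vadd_closed[of e' "vscale E c e"] E.vscale_closed[of e] by auto
  have \<phi>: "\<phi> (vadd E e' (vscale E c e)) = (\<lambda>i. \<phi> e' i + c * \<phi> e i)"
    if "(U, n, \<phi>) \<in> vtriv E" "e \<in> vcarrier E" "e' \<in> vcarrier E" "vproj E e = vproj E e'" "vproj E e' \<in> U" for U n \<phi> e e' c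
    using that E.triv_combine[of U n \<phi> e' "vscale E c e"] E.triv_combine(2)[of U n \<phi> e e c] E.vscale_closed[of e] by simp
  have smooth: "smooth_map W.TS W.TS (sh c)" for c
    unfolding sh_def
    by (intro smooth_whitney_pair[OF E(1) E(1) W.TS] E.smooth_map_linear[OF W.TS] smooth_whitney_fst[OF E(1) E(1)] smooth_whitney_snd[OF E(1) E(1)])
      (simp_all add: whitney_carrier cl)
  have inv: "sh c (sh (- c) p) = p" if p: "p \<in> vcarrier (whitney_sum E E)" for c p
  proof -
    have "vadd E (vadd E (snd p) (vscale E (- c) (fst p))) (vscale E c (fst p)) = snd p"
      by (rule E.fibre_eqI) (use p in \<open>simp_all add: whitney_carrier cl \<phi>\<close>)
    then show ?thesis by (simp add: sh_def)
  qed
  have "isomorphic (tangent_group G) X (whitney_sum E E, \<lambda>k (e, e'). (a k e, a k e'))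
      (whitney_sum E E, \<lambda>k (e, e'). (a k e, a (tangent_zero (fst k)) e'))"
  proof (rule TA.isomorphicI[OF spT S smooth[of "- 1"] smooth[of 1]])
    fix p assume p: "p \<in> vcarrier (whitney_sum E E)"
    then show "vproj (whitney_sum E E) (sh (- 1) p) = vproj (whitney_sum E E) p"
      by (simp add: sh_def whitney_proj)
    show "sh 1 (sh (- 1) p) = p" "sh (- 1) (sh 1 p) = p"
      using inv[OF p, of 1] inv[OF p, of "- 1"] by simp_all
    fix c
    have pc: "fst p \<in> vcarrier E" "snd p \<in> vcarrier E" "vproj E (fst p) = vproj E (snd p)" using p by (auto simp: whitney_carrier)
    have "vadd E (vscale E c (snd p)) (vscale E (- 1) (vscale E c (fst p))) =
        vscale E c (vadd E (snd p) (vscale E (- 1) (fst p)))"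
      by (rule E.fibre_eqI)
        (use pc in \<open>simp_all add: cl \<phi> E.vscale_closed E.triv_combine(2)[where e' = "vadd E (snd p) (vscale E (- 1) (fst p))"]
          E.triv_combine(2)[where e' = "snd p"] E.triv_combine(2)[where e' = "fst p"] algebra_simps\<close>)
    then show "sh (- 1) (vscale (whitney_sum E E) c p) = vscale (whitney_sum E E) c (sh (- 1) p)"
      by (cases p) (simp add: sh_def)
  next
    fix p q assume "p \<in> vcarrier (whitney_sum E E)" "q \<in> vcarrier (whitney_sum E E)"
      and "vproj (whitney_sum E E) p = vproj (whitney_sum E E) q"
    then have pc: "fst p \<in> vcarrier E" "snd p \<in> vcarrier E" "vproj E (fst p) = vproj E (snd p)"
      "fst q \<in> vcarrier E" "snd q \<in> vcarrier E" "vproj E (fst q) = vproj E (snd p)" "vproj E (snd q) = vproj E (snd p)"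
      by (auto simp: whitney_carrier whitney_proj)
    have "vadd E (vadd E (snd p) (snd q)) (vscale E (- 1) (vadd E (fst p) (fst q))) =
        vadd E (vadd E (snd p) (vscale E (- 1) (fst p))) (vadd E (snd q) (vscale E (- 1) (fst q)))"
      by (rule E.fibre_eqI)
        (use pc in \<open>simp_all add: cl \<phi> E.vadd_closed E.triv_combine(1) algebra_simps\<close>)
    then show "sh (- 1) (vadd (whitney_sum E E) p q) = vadd (whitney_sum E E) (sh (- 1) p) (sh (- 1) q)"
      by (cases p, cases q) (simp add: sh_def)
  next
    fix v p assume v: "v \<in> carrier (tangent_group G)" and p: "p \<in> vcarrier (whitney_sum E E)"
    \<comment> \<open>The zero vector 0_g at the base point of v, used to split v as v + 0_g while
      the second vector of the pair is split as the first plus the difference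
      \<open>d\<close>.\<close>
    define z where "z = tangent_zero (fst v)"
    have z: "z \<in> carrier (tangent_group G)" "vproj TG z = vproj TG v" "vadd TG v z = v"
      using tangent_zero_carrier[OF atlas_G] v fst_carrier_TG[of v] atlas_G
      by (simp_all add: z_def carrier_TG carrier_G tangent_add_zero)
    have pc: "fst p \<in> vcarrier E" "snd p \<in> vcarrier E" "vproj E (fst p) = vproj E (snd p)" using p by (auto simp: whitney_carrier)
    define d where "d = vadd E (snd p) (vscale E (- 1) (fst p))"
    have d: "d \<in> vcarrier E" "vproj E d = vproj E (snd p)" unfolding d_def using cl pc by auto
    have "snd p = vadd E (fst p) d"
      by (rule E.fibre_eqI) (use pc d in \<open>simp_all add: E.vadd_closed E.triv_combine(1)\<close>, simp add: d_def \<phi>)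
    then have split: "a v (snd p) = vadd E (a v (fst p)) (a z d)"
      using E(6)[OF v pc(1) z(1) d(1)] z(2,3) d(2) pc(3) by metis
    have cr: "a v (fst p) \<in> vcarrier E" "a z d \<in> vcarrier E" "vproj E (a z d) = vproj E (a v (fst p))"
      using E(4,5)[OF v pc(1)] E(4,5)[OF z(1) d(1)] d(2) pc(3) by (simp_all add: TA_base z_def)
    \<comment> \<open>Subtracting the image of the first vector leaves the action of 0_g on the
      difference, which is how v acts on the second summand of the target.\<close>
    have "vadd E (a v (snd p)) (vscale E (- 1) (a v (fst p))) = a z d"
      unfolding split
      by (rule E.fibre_eqI) (use cr in \<open>simp_all add: cl \<phi> E.vadd_closed E.triv_combine(1)\<close>)
    then show "sh (- 1) ((\<lambda>(e, e'). (a v e, a v e')) p) = (\<lambda>(e, e'). (a v e, a (tangent_zero (fst v)) e')) (sh (- 1) p)"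
      by (cases p) (simp add: sh_def z_def d_def)
  qed
  then show ?thesis unfolding \<sigma> unfolding Ea(1) abundle_sum_simp .
qed

end

end

section \<open>The isomorphism and its naturality\<close>

context lie
begin

lemma monoid_G_eq: "monoid_G G (X, t) = GA.monoid_of X t"
  by (simp add: monoid_G_def Vect_G_eq GA_base)

lemma monoid_aff_eq: "TA.space X t \<Longrightarrow> monoid_aff G (X, t) = TA.monoid_of X t"
  by (simp add: monoid_aff_def Vect_aff_eq TA_base)

lemma KO_eq: "KO G (X, t) = group_completion (GA.monoid_of X t)"
  by (simp add: KO_def monoid_G_eq)

lemma K_aff_eq: "TA.space X t \<Longrightarrow> K_aff G (X, t) = group_completion (TA.monoid_of X t)"
  by (simp add: K_aff_def monoid_aff_eq)

lemma K_U_eq: "K_U G (X, t) = K_map (GA.monoid_of X t) (GA.cl X t) U_fun"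
  by (simp add: K_U_def monoid_G_eq Vect_G_eq)

lemma K_sigma_eq: "TA.space X t \<Longrightarrow> K_sigma G (X, t) = K_map (TA.monoid_of X t) (TA.cl X t) sigma_fun"
  by (simp add: K_sigma_def monoid_aff_eq Vect_aff_eq)

lemma KO_pullback_eq:
  "KO_pullback G (X, t) f = K_map (GA.monoid_of X t) (GA.cl X t) (abundle_pullback X (GA.base t) f)"
  by (simp add: KO_pullback_def monoid_G_eq Vect_G_eq GA_base)

lemma K_aff_pullback_eq:
  "TA.space X t \<Longrightarrow>
    K_aff_pullback G (X, t) f = K_map (TA.monoid_of X t) (TA.cl X t) (abundle_pullback X (TA.base t) f)"
  by (simp add: K_aff_pullback_def monoid_aff_eq Vect_aff_eq TA_base)

abbreviation diff_G where
  "diff_G X t A B \<equiv> gc_diff (GA.monoid_of X t) (GA.cl X t A) (GA.cl X t B)"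

abbreviation diff_aff where
  "diff_aff X t A B \<equiv> gc_diff (TA.monoid_of X t) (TA.cl X t A) (TA.cl X t B)"

section \<open>The induced homomorphisms on Grothendieck groups\<close>

context
  fixes X :: "'x atlas" and t
  assumes XX: "G_manifold G (X, t)"
begin

lemma U_functor_sum:
  assumes "isomorphic (tangent_group G) X C (abundle_sum A B)"
  shows "isomorphic G X (U_fun C) (abundle_sum (U_fun A) (U_fun B))"
  using isomorphic_U[OF assms] by (simp add: U_fun_sum)

lemma sigma_functor_sum:
  assumes "isomorphic G X C (abundle_sum A B)"
  shows "isomorphic (tangent_group G) X (sigma_fun C) (abundle_sum (sigma_fun A) (sigma_fun B))"
  using isomorphic_sigma[OF assms] by (simp add: sigma_fun_sum)

lemma K_U_hom: "K_U G (X, t) \<in> hom (K_aff G (X, t)) (KO G (X, t))"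
  unfolding K_U_eq K_aff_eq[OF spT[OF XX]] KO_eq
  by (rule functor_K_map_hom[OF TA.acting_axioms GA.acting_axioms spT[OF XX] spG[OF XX]])
    (auto intro: U_in_bundles[OF XX] isomorphic_U U_functor_sum)

lemma K_sigma_hom: "K_sigma G (X, t) \<in> hom (KO G (X, t)) (K_aff G (X, t))"
  unfolding K_sigma_eq[OF spT[OF XX]] K_aff_eq[OF spT[OF XX]] KO_eq
  by (rule functor_K_map_hom[OF GA.acting_axioms TA.acting_axioms spG[OF XX] spT[OF XX]])
    (auto intro: sigma_in_bundles[OF XX] isomorphic_sigma sigma_functor_sum)

text \<open>\<open>K_U\<close> is computed on bundles of the fixed type. Passing to isomorphic
  representatives extends the formula to all types, which is needed for pullbacks, whose total
  spaces have a new type.\<close>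

lemma K_U_diff:
  assumes A: "A \<in> TA.bundles X t" and B: "B \<in> TA.bundles X t"
  shows "K_U G (X, t) (diff_aff X t A B) = diff_G X t (U_fun A) (U_fun B)"
proof -
  obtain A' where A': "A' \<in> TA.ubundles X t" "isomorphic (tangent_group G) X A A'" using TA.exists_rep[OF spT[OF XX] A] by blast
  obtain B' where B': "B' \<in> TA.ubundles X t" "isomorphic (tangent_group G) X B B'" using TA.exists_rep[OF spT[OF XX] B] by blast
  have "K_U G (X, t) (diff_aff X t A' B') = diff_G X t (U_fun A') (U_fun B')"
    unfolding K_U_eq
    by (rule functor_K_map[OF TA.acting_axioms GA.acting_axioms spT[OF XX] spG[OF XX] _ _ _ A'(1) B'(1)])
      (auto intro: U_in_bundles[OF XX] isomorphic_U U_functor_sum)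
  moreover have "TA.cl X t A = TA.cl X t A'" "TA.cl X t B = TA.cl X t B'"
    using TA.cl_eqI[OF spT[OF XX] A A'] TA.cl_eqI[OF spT[OF XX] B B'] by auto
  moreover have "GA.cl X t (U_fun A) = GA.cl X t (U_fun A')" "GA.cl X t (U_fun B) = GA.cl X t (U_fun B')"
    using GA.cl_eqI[OF spG[OF XX] U_in_bundles[OF XX A] U_in_bundles[OF XX A'(1)] isomorphic_U[OF A'(2)]]
      GA.cl_eqI[OF spG[OF XX] U_in_bundles[OF XX B] U_in_bundles[OF XX B'(1)] isomorphic_U[OF B'(2)]] by auto
  ultimately show ?thesis by simp
qed

lemma K_sigma_diff:
  assumes A: "A \<in> GA.bundles X t" and B: "B \<in> GA.bundles X t"
  shows "K_sigma G (X, t) (diff_G X t A B) = diff_aff X t (sigma_fun A) (sigma_fun B)"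
proof -
  obtain A' where A': "A' \<in> GA.ubundles X t" "isomorphic G X A A'" using GA.exists_rep[OF spG[OF XX] A] by blast
  obtain B' where B': "B' \<in> GA.ubundles X t" "isomorphic G X B B'" using GA.exists_rep[OF spG[OF XX] B] by blast
  have "K_sigma G (X, t) (diff_G X t A' B') = diff_aff X t (sigma_fun A') (sigma_fun B')"
    unfolding K_sigma_eq[OF spT[OF XX]]
    by (rule functor_K_map[OF GA.acting_axioms TA.acting_axioms spG[OF XX] spT[OF XX] _ _ _ A'(1) B'(1)])
      (auto intro: sigma_in_bundles[OF XX] isomorphic_sigma sigma_functor_sum)
  moreover have "GA.cl X t A = GA.cl X t A'" "GA.cl X t B = GA.cl X t B'"
    using GA.cl_eqI[OF spG[OF XX] A A'] GA.cl_eqI[OF spG[OF XX] B B'] by auto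
  moreover have "TA.cl X t (sigma_fun A) = TA.cl X t (sigma_fun A')" "TA.cl X t (sigma_fun B) = TA.cl X t (sigma_fun B')"
    using TA.cl_eqI[OF spT[OF XX] sigma_in_bundles[OF XX A] sigma_in_bundles[OF XX A'(1)] isomorphic_sigma[OF A'(2)]]
      TA.cl_eqI[OF spT[OF XX] sigma_in_bundles[OF XX B] sigma_in_bundles[OF XX B'(1)] isomorphic_sigma[OF B'(2)]] by auto
  ultimately show ?thesis by simp
qed

lemma K_aff_carrierE:
  assumes "z \<in> carrier (K_aff G (X, t))"
  obtains A B where "A \<in> TA.ubundles X t" "B \<in> TA.ubundles X t" "z = diff_aff X t A B"
  using TA.completion_carrierE[OF spT[OF XX]] assms unfolding K_aff_eq[OF spT[OF XX]] by blast

lemma KO_carrierE: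
  assumes "z \<in> carrier (KO G (X, t))"
  obtains A B where "A \<in> GA.ubundles X t" "B \<in> GA.ubundles X t" "z = diff_G X t A B"
  using GA.completion_carrierE[OF spG[OF XX]] assms unfolding KO_eq by blast

text \<open>The shear gives 2[C] = [C] + [sigma U C] for \<open>C = A\<close> and
  \<open>C = B\<close>. The monoid has no cancellation, but equality of formal differences only asks
  for equality after adding a common term.\<close>

lemma diff_aff_shear:
  assumes A: "A \<in> TA.bundles X t" and B: "B \<in> TA.bundles X t"
  shows "diff_aff X t (sigma_fun (U_fun A)) (sigma_fun (U_fun B)) = diff_aff X t A B"
proof -
  note sp = spT[OF XX]
  interpret M: comm_monoid "TA.monoid_of X t" by (rule TA.comm_monoid_bundles[OF sp])
  have \<sigma>: "sigma_fun (U_fun C) \<in> TA.bundles X t" if "C \<in> TA.bundles X t" for C :: "('g tvec, 'c, 'x) abundle"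
    using sigma_in_bundles[OF XX U_in_bundles[OF XX that]] .
  have sh: "TA.cl X t C \<otimes>\<^bsub>TA.monoid_of X t\<^esub> TA.cl X t C =
      TA.cl X t C \<otimes>\<^bsub>TA.monoid_of X t\<^esub> TA.cl X t (sigma_fun (U_fun C))" if C: "C \<in> TA.bundles X t" for C :: "('g tvec, 'c, 'x) abundle"
    unfolding TA.monoid_mult[OF sp C C] TA.monoid_mult[OF sp C \<sigma>[OF C]]
    by (rule TA.cl_eqI[OF sp TA.sum_in_bundles[OF sp C C] TA.sum_in_bundles[OF sp C \<sigma>[OF C]] isomorphic_shear[OF XX C]])
  define a b a' b' where "a = TA.cl X t A" "b = TA.cl X t B"
    "a' = TA.cl X t (sigma_fun (U_fun A))" "b' = TA.cl X t (sigma_fun (U_fun B))"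
  note defs = this
  have cr: "a \<in> carrier (TA.monoid_of X t)" "b \<in> carrier (TA.monoid_of X t)"
    "a' \<in> carrier (TA.monoid_of X t)" "b' \<in> carrier (TA.monoid_of X t)"
    unfolding defs by (intro TA.cl_carrier[OF sp] A B \<sigma>)+
  have eq: "a \<otimes>\<^bsub>TA.monoid_of X t\<^esub> a = a \<otimes>\<^bsub>TA.monoid_of X t\<^esub> a'" "b \<otimes>\<^bsub>TA.monoid_of X t\<^esub> b = b \<otimes>\<^bsub>TA.monoid_of X t\<^esub> b'"
    unfolding defs by (intro sh A B)+
  \<comment> \<open>The stabilizer is the product of \<open>a\<close> and \<open>b\<close>: its
    factor \<open>a\<close> lets \<open>a'\<close> be replaced by \<open>a\<close>, and its factor
    \<open>b\<close> lets one \<open>b\<close> be replaced by \<open>b'\<close>.\<close>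
  have "a' \<otimes>\<^bsub>TA.monoid_of X t\<^esub> b \<otimes>\<^bsub>TA.monoid_of X t\<^esub> (a \<otimes>\<^bsub>TA.monoid_of X t\<^esub> b) =
      (a \<otimes>\<^bsub>TA.monoid_of X t\<^esub> a') \<otimes>\<^bsub>TA.monoid_of X t\<^esub> (b \<otimes>\<^bsub>TA.monoid_of X t\<^esub> b)" using cr by (simp add: M.m_ac)
  also have "\<dots> = a \<otimes>\<^bsub>TA.monoid_of X t\<^esub> b' \<otimes>\<^bsub>TA.monoid_of X t\<^esub> (a \<otimes>\<^bsub>TA.monoid_of X t\<^esub> b)"
    unfolding eq(1)[symmetric] unfolding eq(2) using cr by (simp add: M.m_ac)
  finally show ?thesis
    unfolding defs[symmetric] using cr by (subst M.gc_diff_eq_iff) auto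
qed

lemma K_sigma_K_U: "z \<in> carrier (K_aff G (X, t)) \<Longrightarrow> K_sigma G (X, t) (K_U G (X, t) z) = z"
  by (elim K_aff_carrierE) (simp add: K_U_diff K_sigma_diff U_in_bundles[OF XX] diff_aff_shear)

lemma K_U_K_sigma: "z \<in> carrier (KO G (X, t)) \<Longrightarrow> K_U G (X, t) (K_sigma G (X, t) z) = z"
  by (elim KO_carrierE) (simp add: K_U_diff K_sigma_diff sigma_in_bundles[OF XX] U_sigma)

lemma comm_groups: "comm_group (K_aff G (X, t))" "comm_group (KO G (X, t))"
  unfolding K_aff_eq[OF spT[OF XX]] KO_eq
  by (intro comm_monoid.comm_group_completion TA.comm_monoid_bundles[OF spT[OF XX]] GA.comm_monoid_bundles[OF spG[OF XX]])+

lemma K_U_iso: "K_U G (X, t) \<in> iso (K_aff G (X, t)) (KO G (X, t))"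
  and K_sigma_iso: "K_sigma G (X, t) \<in> iso (KO G (X, t)) (K_aff G (X, t))"
proof -
  have *: "K_U G (X, t) ` carrier (K_aff G (X, t)) \<subseteq> carrier (KO G (X, t))"
    "K_sigma G (X, t) ` carrier (KO G (X, t)) \<subseteq> carrier (K_aff G (X, t))"
    using K_U_hom K_sigma_hom by (auto simp: hom_def)
  have "bij_betw (K_U G (X, t)) (carrier (K_aff G (X, t))) (carrier (KO G (X, t)))"
    using * K_sigma_K_U K_U_K_sigma by (intro bij_betw_byWitness[where f' = "K_sigma G (X, t)"]) auto
  then show "K_U G (X, t) \<in> iso (K_aff G (X, t)) (KO G (X, t))" using K_U_hom by (simp add: iso_def)
  have "bij_betw (K_sigma G (X, t)) (carrier (KO G (X, t))) (carrier (K_aff G (X, t)))"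
    using * K_sigma_K_U K_U_K_sigma by (intro bij_betw_byWitness[where f' = "K_U G (X, t)"]) auto
  then show "K_sigma G (X, t) \<in> iso (KO G (X, t)) (K_aff G (X, t))" using K_sigma_hom by (simp add: iso_def)
qed

end

lemma GA_action_map: "G_map G (X, t) (Y, s) f \<longleftrightarrow> GA.action_map X t Y s f"
  by (simp add: G_map_def GA.action_map_def GA_base)

lemma TA_action_map: "G_map G (X, t) (Y, s) f \<Longrightarrow> TA.action_map X t Y s f"
  using fst_carrier_TG by (simp add: G_map_def TA.action_map_def TA_base carrier_TG)

section \<open>Pullbacks and naturality\<close>

context
  fixes X :: "'x atlas" and t and Y :: "'y atlas" and s and f :: "'x \<Rightarrow> 'y"
  assumes XX: "G_manifold G (X, t)" and YY: "G_manifold G (Y, s)" and f: "G_map G (X, t) (Y, s) f"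
begin

lemmas fG = f[unfolded GA_action_map] and fT = TA_action_map[OF f]

lemma KO_pullback_hom: "KO_pullback G (X, t) f \<in> hom (KO G (Y, s)) (KO G (X, t))"
  unfolding KO_pullback_eq KO_eq by (rule GA.pullback_K_map_hom[OF spG[OF XX] spG[OF YY] fG])

lemma K_aff_pullback_hom: "K_aff_pullback G (X, t) f \<in> hom (K_aff G (Y, s)) (K_aff G (X, t))"
  unfolding K_aff_pullback_eq[OF spT[OF XX]] K_aff_eq[OF spT[OF XX]] K_aff_eq[OF spT[OF YY]]
  by (rule TA.pullback_K_map_hom[OF spT[OF XX] spT[OF YY] fT])

lemma KO_pullback_diff:
  assumes A: "A \<in> GA.bundles Y s" and B: "B \<in> GA.bundles Y s"
  shows "KO_pullback G (X, t) f (diff_G Y s A B) =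
    diff_G X t (abundle_pullback X (GA.base t) f A) (abundle_pullback X (GA.base t) f B)"
proof -
  note spX = spG[OF XX] and spY = spG[OF YY]
  note p = GA.pullback_in_bundles[OF spX spY fG]
  obtain A' where A': "A' \<in> GA.ubundles Y s" "isomorphic G Y A A'" using GA.exists_rep[OF spY A] by blast
  obtain B' where B': "B' \<in> GA.ubundles Y s" "isomorphic G Y B B'" using GA.exists_rep[OF spY B] by blast
  have "KO_pullback G (X, t) f (diff_G Y s A' B') =
    diff_G X t (abundle_pullback X (GA.base t) f A') (abundle_pullback X (GA.base t) f B')"
    unfolding KO_pullback_eq by (rule GA.pullback_K_map[OF spX spY fG A'(1) B'(1)])
  moreover have "GA.cl Y s A = GA.cl Y s A'" "GA.cl Y s B = GA.cl Y s B'"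
    using GA.cl_eqI[OF spY A A'] GA.cl_eqI[OF spY B B'] by auto
  moreover have "GA.cl X t (abundle_pullback X (GA.base t) f A) = GA.cl X t (abundle_pullback X (GA.base t) f A')"
    by (rule GA.cl_eqI[OF spX p[OF A] p[OF A'(1)] GA.isomorphic_pullback[OF spX spY fG A A']])
  moreover have "GA.cl X t (abundle_pullback X (GA.base t) f B) = GA.cl X t (abundle_pullback X (GA.base t) f B')"
    by (rule GA.cl_eqI[OF spX p[OF B] p[OF B'(1)] GA.isomorphic_pullback[OF spX spY fG B B']])
  ultimately show ?thesis by simp
qed

lemma K_aff_pullback_diff:
  assumes A: "A \<in> TA.bundles Y s" and B: "B \<in> TA.bundles Y s"
  shows "K_aff_pullback G (X, t) f (diff_aff Y s A B) =
    diff_aff X t (abundle_pullback X (TA.base t) f A) (abundle_pullback X (TA.base t) f B)"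
proof -
  note spX = spT[OF XX] and spY = spT[OF YY]
  note p = TA.pullback_in_bundles[OF spX spY fT]
  obtain A' where A': "A' \<in> TA.ubundles Y s" "isomorphic (tangent_group G) Y A A'" using TA.exists_rep[OF spY A] by blast
  obtain B' where B': "B' \<in> TA.ubundles Y s" "isomorphic (tangent_group G) Y B B'" using TA.exists_rep[OF spY B] by blast
  have "K_aff_pullback G (X, t) f (diff_aff Y s A' B') =
    diff_aff X t (abundle_pullback X (TA.base t) f A') (abundle_pullback X (TA.base t) f B')"
    unfolding K_aff_pullback_eq[OF spX] by (rule TA.pullback_K_map[OF spX spY fT A'(1) B'(1)])
  moreover have "TA.cl Y s A = TA.cl Y s A'" "TA.cl Y s B = TA.cl Y s B'"
    using TA.cl_eqI[OF spY A A'] TA.cl_eqI[OF spY B B'] by auto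
  moreover have "TA.cl X t (abundle_pullback X (TA.base t) f A) = TA.cl X t (abundle_pullback X (TA.base t) f A')"
    by (rule TA.cl_eqI[OF spX p[OF A] p[OF A'(1)] TA.isomorphic_pullback[OF spX spY fT A A']])
  moreover have "TA.cl X t (abundle_pullback X (TA.base t) f B) = TA.cl X t (abundle_pullback X (TA.base t) f B')"
    by (rule TA.cl_eqI[OF spX p[OF B] p[OF B'(1)] TA.isomorphic_pullback[OF spX spY fT B B']])
  ultimately show ?thesis by simp
qed

text \<open>Restriction along the zero section commutes with pullback on the nose, because the base
  action of \<open>TG\<close> passes through the projection and 0_g projects to g. No isomorphism
  has to be constructed.\<close>

lemma K_U_natural:
  assumes "z \<in> carrier (K_aff G (Y, s))"
  shows "K_U G (X, t) (K_aff_pullback G (X, t) f z) = KO_pullback G (X, t) f (K_U G (Y, s) z)"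
proof -
  obtain A B where z: "A \<in> TA.ubundles Y s" "B \<in> TA.ubundles Y s" "z = diff_aff Y s A B"
    using K_aff_carrierE[OF YY assms] by blast
  note p = TA.pullback_in_bundles[OF spT[OF XX] spT[OF YY] fT]
  show ?thesis
    unfolding z(3) K_aff_pullback_diff[OF z(1,2)] K_U_diff[OF XX p[OF z(1)] p[OF z(2)]] K_U_diff[OF YY z(1,2)]
      KO_pullback_diff[OF U_in_bundles[OF YY z(1)] U_in_bundles[OF YY z(2)]]
    by (simp add: TA_base GA_base U_fun_pullback)
qed

lemma K_sigma_natural:
  assumes "z \<in> carrier (KO G (Y, s))"
  shows "K_sigma G (X, t) (KO_pullback G (X, t) f z) = K_aff_pullback G (X, t) f (K_sigma G (Y, s) z)"
proof -
  obtain A B where z: "A \<in> GA.ubundles Y s" "B \<in> GA.ubundles Y s" "z = diff_G Y s A B"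
    using KO_carrierE[OF YY assms] by blast
  note p = GA.pullback_in_bundles[OF spG[OF XX] spG[OF YY] fG]
  show ?thesis
    unfolding z(3) KO_pullback_diff[OF z(1,2)] K_sigma_diff[OF XX p[OF z(1)] p[OF z(2)]] K_sigma_diff[OF YY z(1,2)]
      K_aff_pullback_diff[OF sigma_in_bundles[OF YY z(1)] sigma_in_bundles[OF YY z(2)]]
    by (simp add: TA_base GA_base sigma_fun_pullback)
qed

end

section \<open>Functoriality of the two pullbacks\<close>

lemma G_map_ident: "G_manifold G (X, t) \<Longrightarrow> G_map G (X, t) (X, t) (\<lambda>x. x)"
  using GA.action_map_ident[OF GA_space] by (simp add: GA_action_map)

lemma G_map_compose:
  assumes XX: "G_manifold G (X, t)" and YY: "G_manifold G (Y, s)" and ZZ: "G_manifold G (Z, r)"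
    and f: "G_map G (X, t) (Y, s) f" and h: "G_map G (Y, s) (Z, r) h"
  shows "G_map G (X, t) (Z, r) (h \<circ> f)"
proof -
  note X = GA.spaceD(1)[OF GA_space[OF XX]] and Y = GA.spaceD(1)[OF GA_space[OF YY]] and Z = GA.spaceD(1)[OF GA_space[OF ZZ]]
  have fs: "smooth_map X Y f" and hs: "smooth_map Y Z h" using f h by (auto simp: G_map_def)
  show ?thesis
    using f h smooth_map_compose[OF X Y Z fs hs] smooth_map_carrier[OF X Y fs] by (simp add: G_map_def o_def)
qed

lemma KO_pullback_ident:
  assumes XX: "G_manifold G (X, t)" and "z \<in> carrier (KO G (X, t))"
  shows "KO_pullback G (X, t) (\<lambda>x. x) z = z"
proof -
  obtain A B where z: "A \<in> GA.ubundles X t" "B \<in> GA.ubundles X t" "z = diff_G X t A B"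
    using KO_carrierE[OF assms] by blast
  note sp = spG[OF XX] and id = G_map_ident[OF XX]
  have "GA.cl X t C = GA.cl X t (abundle_pullback X (GA.base t) (\<lambda>x. x) C)" if C: "C \<in> GA.ubundles X t" for C
    by (rule GA.cl_eqI[OF sp C GA.pullback_in_bundles[OF sp sp GA.action_map_ident[OF sp] C] GA.isomorphic_pullback_ident[OF sp C]])
  then show ?thesis
    unfolding z(3) KO_pullback_diff[OF XX XX id z(1,2)] using z(1,2) by simp
qed

lemma K_aff_pullback_ident:
  assumes XX: "G_manifold G (X, t)" and "z \<in> carrier (K_aff G (X, t))"
  shows "K_aff_pullback G (X, t) (\<lambda>x. x) z = z"
proof -
  obtain A B where z: "A \<in> TA.ubundles X t" "B \<in> TA.ubundles X t" "z = diff_aff X t A B"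
    using K_aff_carrierE[OF assms] by blast
  note sp = spT[OF XX] and id = G_map_ident[OF XX]
  have "TA.cl X t C = TA.cl X t (abundle_pullback X (TA.base t) (\<lambda>x. x) C)" if C: "C \<in> TA.ubundles X t" for C
    by (rule TA.cl_eqI[OF sp C TA.pullback_in_bundles[OF sp sp TA.action_map_ident[OF sp] C] TA.isomorphic_pullback_ident[OF sp C]])
  then show ?thesis
    unfolding z(3) K_aff_pullback_diff[OF XX XX id z(1,2)] using z(1,2) by simp
qed

context
  fixes X :: "'x atlas" and t and Y :: "'y atlas" and s and Z :: "'z atlas" and r and f :: "'x \<Rightarrow> 'y" and h :: "'y \<Rightarrow> 'z"
  assumes XX: "G_manifold G (X, t)" and YY: "G_manifold G (Y, s)" and ZZ: "G_manifold G (Z, r)"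
    and f: "G_map G (X, t) (Y, s) f" and h: "G_map G (Y, s) (Z, r) h"
begin

lemma KO_pullback_comp:
  assumes "z \<in> carrier (KO G (Z, r))"
  shows "KO_pullback G (X, t) (h \<circ> f) z = KO_pullback G (X, t) f (KO_pullback G (Y, s) h z)"
proof -
  obtain A B where z: "A \<in> GA.ubundles Z r" "B \<in> GA.ubundles Z r" "z = diff_G Z r A B"
    using KO_carrierE[OF ZZ assms] by blast
  note spX = spG[OF XX] and spY = spG[OF YY] and spZ = spG[OF ZZ]
  note fG = f[unfolded GA_action_map] and hG = h[unfolded GA_action_map]
  note hf = G_map_compose[OF XX YY ZZ f h]
  note p = GA.pullback_in_bundles[OF spY spZ hG]
  have "GA.cl X t (abundle_pullback X (GA.base t) (h \<circ> f) C) =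
      GA.cl X t (abundle_pullback X (GA.base t) f (abundle_pullback Y (GA.base s) h C))" if C: "C \<in> GA.ubundles Z r" for C
    by (rule GA.cl_eqI[OF spX GA.pullback_in_bundles[OF spX spZ hf[unfolded GA_action_map] C]
          GA.pullback_in_bundles[OF spX spY fG p[OF C]] GA.isomorphic_pullback_comp[OF spX spY fG spZ hG C]])
  then show ?thesis
    unfolding z(3) KO_pullback_diff[OF XX ZZ hf z(1,2)] KO_pullback_diff[OF YY ZZ h z(1,2)]
      KO_pullback_diff[OF XX YY f p[OF z(1)] p[OF z(2)]]
    using z(1,2) by simp
qed

lemma K_aff_pullback_comp:
  assumes "z \<in> carrier (K_aff G (Z, r))"
  shows "K_aff_pullback G (X, t) (h \<circ> f) z = K_aff_pullback G (X, t) f (K_aff_pullback G (Y, s) h z)"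
proof -
  obtain A B where z: "A \<in> TA.ubundles Z r" "B \<in> TA.ubundles Z r" "z = diff_aff Z r A B"
    using K_aff_carrierE[OF ZZ assms] by blast
  note spX = spT[OF XX] and spY = spT[OF YY] and spZ = spT[OF ZZ]
  note fT = TA_action_map[OF f] and hT = TA_action_map[OF h]
  note hf = G_map_compose[OF XX YY ZZ f h]
  note p = TA.pullback_in_bundles[OF spY spZ hT]
  have "TA.cl X t (abundle_pullback X (TA.base t) (h \<circ> f) C) =
      TA.cl X t (abundle_pullback X (TA.base t) f (abundle_pullback Y (TA.base s) h C))" if C: "C \<in> TA.ubundles Z r" for C
    by (rule TA.cl_eqI[OF spX TA.pullback_in_bundles[OF spX spZ TA_action_map[OF hf] C]
          TA.pullback_in_bundles[OF spX spY fT p[OF C]] TA.isomorphic_pullback_comp[OF spX spY fT spZ hT C]])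
  then show ?thesis
    unfolding z(3) K_aff_pullback_diff[OF XX ZZ hf z(1,2)] K_aff_pullback_diff[OF YY ZZ h z(1,2)]
      K_aff_pullback_diff[OF XX YY f p[OF z(1)] p[OF z(2)]]
    using z(1,2) by simp
qed

end

end

text \<open>The identity and composition laws make both groups contravariant functors on
  G-manifolds, so that the naturality squares amount to an isomorphism of functors with inverse
  given by \<open>K_sigma\<close>.\<close>

theorem theoremC:
  fixes G :: "'g lie_grp" and X :: "('g, 'x) gspace"
  assumes "lie_group G" and "G_manifold G X"
  shows
    "comm_group (K_aff G X) \<and> comm_group (KO G X) \<and>
     K_U G X \<in> iso (K_aff G X) (KO G X) \<and>
     K_sigma G X \<in> iso (KO G X) (K_aff G X) \<and>
     (\<forall>z\<in>carrier (K_aff G X). K_sigma G X (K_U G X z) = z) \<and>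
     (\<forall>z\<in>carrier (KO G X). K_U G X (K_sigma G X z) = z) \<and>
     (\<forall>z\<in>carrier (K_aff G X). K_aff_pullback G X (\<lambda>x. x) z = z) \<and>
     (\<forall>z\<in>carrier (KO G X). KO_pullback G X (\<lambda>x. x) z = z) \<and>
     (\<forall>(Y :: ('g, 'y) gspace) f. G_manifold G Y \<and> G_map G X Y f \<longrightarrow>
        K_aff_pullback G X f \<in> hom (K_aff G Y) (K_aff G X) \<and>
        KO_pullback G X f \<in> hom (KO G Y) (KO G X) \<and>
        (\<forall>z\<in>carrier (K_aff G Y). K_U G X (K_aff_pullback G X f z) = KO_pullback G X f (K_U G Y z)) \<and>
        (\<forall>z\<in>carrier (KO G Y). K_sigma G X (KO_pullback G X f z) = K_aff_pullback G X f (K_sigma G Y z)) \<and>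
        (\<forall>(Z :: ('g, 'z) gspace) h. G_manifold G Z \<and> G_map G Y Z h \<longrightarrow>
           (\<forall>z\<in>carrier (K_aff G Z).
              K_aff_pullback G X (h \<circ> f) z = K_aff_pullback G X f (K_aff_pullback G Y h z)) \<and>
           (\<forall>z\<in>carrier (KO G Z).
              KO_pullback G X (h \<circ> f) z = KO_pullback G X f (KO_pullback G Y h z))))"
proof -
  interpret lie G by unfold_locales (rule assms(1))
  obtain M t where X: "X = (M, t)" by (cases X)
  note XX = assms(2)[unfolded X]
  show ?thesis
    unfolding X
  proof (intro conjI ballI allI impI; (elim conjE)?)
    show "comm_group (K_aff G (M, t))" "comm_group (KO G (M, t))" by (rule comm_groups[OF XX])+
    show "K_U G (M, t) \<in> iso (K_aff G (M, t)) (KO G (M, t))" by (rule K_U_iso[OF XX])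
    show "K_sigma G (M, t) \<in> iso (KO G (M, t)) (K_aff G (M, t))" by (rule K_sigma_iso[OF XX])
    show "K_sigma G (M, t) (K_U G (M, t) z) = z" "K_aff_pullback G (M, t) (\<lambda>x. x) z = z" if "z \<in> carrier (K_aff G (M, t))" for z
      by (rule K_sigma_K_U[OF XX that] K_aff_pullback_ident[OF XX that])+
    show "K_U G (M, t) (K_sigma G (M, t) z) = z" "KO_pullback G (M, t) (\<lambda>x. x) z = z" if "z \<in> carrier (KO G (M, t))" for z
      by (rule K_U_K_sigma[OF XX that] KO_pullback_ident[OF XX that])+
    fix Y :: "('g, 'y) gspace" and f
    assume Y: "G_manifold G Y" "G_map G (M, t) Y f"
    obtain N s where N: "Y = (N, s)" by (cases Y)
    note YY = Y(1)[unfolded N] and f = Y(2)[unfolded N]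
    show "K_aff_pullback G (M, t) f \<in> hom (K_aff G Y) (K_aff G (M, t))" unfolding N by (rule K_aff_pullback_hom[OF XX YY f])
    show "KO_pullback G (M, t) f \<in> hom (KO G Y) (KO G (M, t))" unfolding N by (rule KO_pullback_hom[OF XX YY f])
    show "K_U G (M, t) (K_aff_pullback G (M, t) f z) = KO_pullback G (M, t) f (K_U G Y z)" if "z \<in> carrier (K_aff G Y)" for z
      using that unfolding N by (rule K_U_natural[OF XX YY f])
    show "K_sigma G (M, t) (KO_pullback G (M, t) f z) = K_aff_pullback G (M, t) f (K_sigma G Y z)" if "z \<in> carrier (KO G Y)" for z
      using that unfolding N by (rule K_sigma_natural[OF XX YY f])
    fix Z :: "('g, 'z) gspace" and h
    assume Z: "G_manifold G Z" "G_map G Y Z h"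
    obtain P r where P: "Z = (P, r)" by (cases Z)
    note ZZ = Z(1)[unfolded P] and h = Z(2)[unfolded N P]
    show "K_aff_pullback G (M, t) (h \<circ> f) z = K_aff_pullback G (M, t) f (K_aff_pullback G Y h z)" if "z \<in> carrier (K_aff G Z)" for z
      using that unfolding N P by (rule K_aff_pullback_comp[OF XX YY ZZ f h])
    show "KO_pullback G (M, t) (h \<circ> f) z = KO_pullback G (M, t) f (KO_pullback G Y h z)" if "z \<in> carrier (KO G Z)" for z
      using that unfolding N P by (rule KO_pullback_comp[OF XX YY ZZ f h])
  qed
qed

end
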